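(* Let $\mathcal{X}_1,\mathcal{X}_2,\ldots$ be a sequence of $(\mathcal{H}^F,d_{\mathcal{H}^F})$-valued random variables such that ($\bar a$) almost surely, the paths of each $\mathcal{X}_m$ are noncrossing, and ($\bar b$) for a given deterministic countable dense set $\mathcal{D}\subset\mathbb{R}^2$, there exists for each $(x_j,t_j)\in\mathcal{D}$ a path $\theta_m^{x_j,t_j}$ in $\mathcal{X}_m$ such that the collection of semipaths $\mathcal{V}_m:=\{(\theta_m^{x_j,t_j}(t),\ t\ge t_j),\ (x_j,t_j)\in\mathcal{D}\}$ converges in distribution as $m\to\infty$ to coalescing Brownian motions (with unit diffusion constant) starting in $\mathcal{D}$. Then $\mathcal{X}_m$ converges in distribution as $m\to\infty$ to the full Brownian web (FBW).
   Context: Doubly infinite paths. Put $\Phi(x,t)=\tanh(x)/(1+|t|)$ and $\Psi(t)=\tanh(t)$ for $(x,t)\in[-\infty,\infty]^2$ (so $\Phi(x,\pm\infty)=0$). $\Pi^F$ is the set of functions $f:[-\infty,\infty]\to[-\infty,\infty]$ such that $t\mapsto\Phi(f(t),t)$ is continuous (functions differing only at $t=\pm\infty$ are identified), with metric $d^F(f_1,f_2)=\sup_{-\infty\le t\le\infty}|\Phi(f_1(t),t)-\Phi(f_2(t),t)|$. $\mathcal{H}^F$ is the set of compact subsets of $(\Pi^F,d^F)$, with the induced Hausdorff metric $d_{\mathcal{H}^F}$ and its Borel $\sigma$-algebra. Two paths cross if on their common time domain there are times $s,t$ at which their difference is strictly positive and strictly negative, respectively; a collection is noncrossing if no two of its paths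 cross. Semipaths. $\Pi$ is the set of pairs $(f,t_0)$, $t_0\in[-\infty,\infty]$, with $f:[t_0,\infty]\to[-\infty,\infty]$ such that $\Phi(f(t),t)$ is continuous, with metric $d((f_1,t_1),(f_2,t_2))=\sup_t|\Phi(\hat f_1(t),t)-\Phi(\hat f_2(t),t)|\vee|\Psi(t_1)-\Psi(t_2)|$, where $\hat f_i$ extends $f_i$ by the constant $f_i(t_i)$ to times before $t_i$. Convergence in distribution of the collection $\mathcal{V}_m$ is joint convergence in distribution of the semipaths indexed by $\mathcal{D}$, as random elements of the product space $\Pi^{\mathcal{D}}$. Coalescing Brownian motions (unit diffusion constant) are Brownian motions started at given space-time points, evolving independently until two of them meet, after which those two coincide forever; backward coalescing Brownian motions are the analogous objects run backward in time. Full Brownian web. For a deterministic countable dense $\mathcal{D}'=\{(y_1,s_1),(y_2,s_2),\ldots\}\subset\mathbb{R}^2$, the double Brownian web skeleton $\{\tilde W_1,\tilde W_1^b,\tilde W_2,\tilde W_2^b,\ldots\}$ is the family of coalescing/reflecting forward/backward Brownian motions starting at the points of $\mathcal{D}'$: $\tilde W_j$ (resp. $\tilde W_j^b$) is a forward (resp. backward) path from $(y_j,s_j)$, the forward paths are coalescing Brownian motions, the backward paths are backward coalescing Brownian motions, and almost surely no forward path crosses a backward path; these properties determine the joint law. Let $\tilde W_j^F(t)=\tilde W_j^b(t)$ for $t\le s_j$ and $\tilde W_j^F(t)=\tilde W_j(t)$ for $t\ge s_j$. The full Brownian web is the closure of $\{\tilde W_1^F,\tilde W_2^F,\ldots\}$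 in $(\Pi^F,d^F)$; it is an $\mathcal{H}^F$-valued random variable whose distribution does not depend on $\mathcal{D}'$ or its ordering. *)

theory Defs
  imports "HOL-Probability.Probability"
begin

section \<open>Doubly infinite paths\<close>

definition etanh :: "ereal \<Rightarrow> real" where
  "etanh x = (case x of ereal r \<Rightarrow> tanh r | PInfty \<Rightarrow> 1 | MInfty \<Rightarrow> -1)"

lemma etanh_simps [simp]:
  "etanh (ereal r) = tanh r" "etanh \<infinity> = 1" "etanh (-\<infinity>) = -1"
  by (simp_all add: etanh_def)

lemma etanh_0 [simp]: "etanh 0 = 0"
  by (simp add: zero_ereal_def)

definition Phi :: "ereal \<Rightarrow> ereal \<Rightarrow> real" where
  "Phi x t = (if \<bar>t\<bar> = \<infinity> then 0 else etanh x / (1 + \<bar>real_of_ereal t\<bar>))"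

definition Psi :: "ereal \<Rightarrow> real" where
  "Psi t = etanh t"

definition path_dist :: "(ereal \<Rightarrow> ereal) \<Rightarrow> (ereal \<Rightarrow> ereal) \<Rightarrow> real" where
  "path_dist f g = (SUP t. \<bar>Phi (f t) t - Phi (g t) t\<bar>)"

lemma etanh_bounds: "\<bar>etanh x\<bar> \<le> 1"
proof (cases x)
  case (real r)
  then show ?thesis using tanh_real_bounds[of r] by (simp add: abs_le_iff)
qed auto

lemma etanh_inj: "etanh x = etanh y \<longleftrightarrow> x = y"
proof -
  have "tanh r \<noteq> 1" "tanh r \<noteq> -1" "1 \<noteq> tanh r" "-1 \<noteq> tanh r" for r :: real
    using tanh_real_bounds[of r] by auto
  then show ?thesis by (cases x; cases y) auto
qed

lemma Phi_bounds: "\<bar>Phi x t\<bar> \<le> 1"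
proof -
  have "\<bar>etanh x / (1 + \<bar>r\<bar>)\<bar> \<le> 1" for r :: real
    using etanh_bounds[of x] unfolding abs_divide
    by (intro divide_le_eq[THEN iffD2]) auto
  from this[of "real_of_ereal t"] show ?thesis unfolding Phi_def by (auto simp only: abs_zero split: if_split)
qed

lemma path_dist_bdd: "bdd_above (range (\<lambda>t. \<bar>Phi (f t) t - Phi (g t) t\<bar>))"
proof (rule bdd_aboveI2)
  show "\<bar>Phi (f t) t - Phi (g t) t\<bar> \<le> 2" for t
    using Phi_bounds[of "f t" t] Phi_bounds[of "g t" t] by linarith
qed

lemma path_dist_upper: "\<bar>Phi (f t) t - Phi (g t) t\<bar> \<le> path_dist f g"
  unfolding path_dist_def by (rule cSUP_upper[OF UNIV_I path_dist_bdd])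

lemma path_dist_nonneg: "0 \<le> path_dist f g"
  using path_dist_upper[of f 0 g] by linarith

lemma path_dist_commute: "path_dist f g = path_dist g f"
  by (simp add: path_dist_def abs_minus_commute)

lemma path_dist_triangle: "path_dist f h \<le> path_dist f g + path_dist g h"
  unfolding path_dist_def[of f h]
proof (rule cSUP_least)
  show "\<bar>Phi (f t) t - Phi (h t) t\<bar> \<le> path_dist f g + path_dist g h" for t
    using path_dist_upper[of f t g] path_dist_upper[of g t h] by linarith
qed simp

lemma path_dist_eq_0:
  "path_dist f g = 0 \<longleftrightarrow> (\<forall>t. \<bar>t\<bar> \<noteq> \<infinity> \<longrightarrow> f t = g t)"
proof
  assume 0: "path_dist f g = 0"
  show "\<forall>t. \<bar>t\<bar> \<noteq> \<infinity> \<longrightarrow> f t = g t"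
  proof (intro allI impI)
    fix t :: ereal assume t: "\<bar>t\<bar> \<noteq> \<infinity>"
    have "Phi (f t) t = Phi (g t) t" using path_dist_upper[of f t g] 0 by simp
    moreover have "1 + \<bar>real_of_ereal t\<bar> \<noteq> 0" by linarith
    ultimately have "etanh (f t) = etanh (g t)" using t by (simp add: Phi_def)
    then show "f t = g t" by (simp add: etanh_inj)
  qed
next
  assume "\<forall>t. \<bar>t\<bar> \<noteq> \<infinity> \<longrightarrow> f t = g t"
  then have "\<bar>Phi (f t) t - Phi (g t) t\<bar> = 0" for t by (cases "\<bar>t\<bar> = \<infinity>") (auto simp: Phi_def)
  then show "path_dist f g = 0" by (simp add: path_dist_def)
qed

definition full_path_rel :: "(ereal \<Rightarrow> ereal) \<Rightarrow> (ereal \<Rightarrow> ereal) \<Rightarrow> bool" where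
  "full_path_rel f g \<longleftrightarrow>
     continuous_on UNIV (\<lambda>t. Phi (f t) t) \<and> continuous_on UNIV (\<lambda>t. Phi (g t) t) \<and>
     (\<forall>t. \<bar>t\<bar> \<noteq> \<infinity> \<longrightarrow> f t = g t)"

quotient_type full_path = "ereal \<Rightarrow> ereal" / partial: full_path_rel
proof (rule part_equivpI)
  have "full_path_rel (\<lambda>_. 0) (\<lambda>_. 0)"
    by (simp add: full_path_rel_def Phi_def cong: if_cong)
  then show "\<exists>f. full_path_rel f f" by blast
  show "symp full_path_rel"
    unfolding symp_def full_path_rel_def by metis
  show "transp full_path_rel"
    unfolding transp_def full_path_rel_def by metis
qed

instantiation full_path :: metric_space
begin

lift_definition dist_full_path :: "full_path \<Rightarrow> full_path \<Rightarrow> real" is path_dist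
proof -
  fix f f' g g' assume "full_path_rel f f'" "full_path_rel g g'"
  then have "path_dist f f' = 0" "path_dist g g' = 0"
    by (auto simp: full_path_rel_def path_dist_eq_0)
  then show "path_dist f g = path_dist f' g'"
    using path_dist_triangle[of f g f'] path_dist_triangle[of f' g g']
      path_dist_triangle[of f' g' f] path_dist_triangle[of f g' g]
    by (simp add: path_dist_commute)
qed

definition uniformity_full_path :: "(full_path \<times> full_path) filter" where
  "uniformity_full_path = (INF e\<in>{0<..}. principal {(x, y). dist x y < e})"

definition open_full_path :: "full_path set \<Rightarrow> bool" where
  "open_full_path U \<longleftrightarrow> (\<forall>x\<in>U. \<forall>\<^sub>F (x', y) in uniformity. x' = x \<longrightarrow> y \<in> U)"

instance
proof
  show "dist f g = 0 \<longleftrightarrow> f = g" for f g :: full_path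
    by transfer (auto simp: full_path_rel_def path_dist_eq_0)
  show "dist f g \<le> dist f h + dist g h" for f g h :: full_path
    by transfer (metis path_dist_triangle path_dist_commute)
qed (fact uniformity_full_path_def open_full_path_def)+

end

lift_definition path_at :: "full_path \<Rightarrow> real \<Rightarrow> ereal" is "\<lambda>f t. f (ereal t)"
  by (auto simp: full_path_rel_def)

(* For extended real values the strict inequalities express that the difference f - g is
   strictly positive, resp. negative, avoiding the library convention \<infinity> - \<infinity> = \<infinity>. *)
definition paths_cross :: "real set \<Rightarrow> (real \<Rightarrow> 'a::linorder) \<Rightarrow> (real \<Rightarrow> 'a) \<Rightarrow> bool" where
  "paths_cross T f g \<longleftrightarrow> (\<exists>s\<in>T. \<exists>t\<in>T. f s > g s \<and> f t < g t)"

(* Values at times \<plusminus>\<infinity> are identified away, so the common time domain of two elements of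
   full_path is the real line. *)
definition noncrossing :: "full_path set \<Rightarrow> bool" where
  "noncrossing K \<longleftrightarrow> (\<forall>f\<in>K. \<forall>g\<in>K. \<not> paths_cross UNIV (path_at f) (path_at g))"


section \<open>Compact sets of paths\<close>

definition hausdorff_dist :: "'a::metric_space set \<Rightarrow> 'a set \<Rightarrow> real" where
  "hausdorff_dist K L = max (SUP x\<in>K. infdist x L) (SUP y\<in>L. infdist y K)"

lemma hausdorff_dist_commute: "hausdorff_dist K L = hausdorff_dist L K"
  by (simp add: hausdorff_dist_def max.commute)

lemma bdd_above_infdist:
  assumes "compact K"
  shows "bdd_above ((\<lambda>x. infdist x L) ` K)"
proof -
  have "continuous_on K (\<lambda>x. infdist x L)" by (intro continuous_intros)
  then have "compact ((\<lambda>x. infdist x L) ` K)" using assms by (rule compact_continuous_image)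
  then show ?thesis by (intro bounded_imp_bdd_above compact_imp_bounded)
qed

lemma infdist_le_hausdorff_dist:
  assumes "compact K" "x \<in> K"
  shows "infdist x L \<le> hausdorff_dist K L"
  using cSUP_upper[OF assms(2) bdd_above_infdist[OF assms(1)], of L]
  by (simp add: hausdorff_dist_def)

lemma hausdorff_dist_eq_0:
  assumes K: "compact K" "K \<noteq> {}" and L: "compact L" "L \<noteq> {}"
  shows "hausdorff_dist K L = 0 \<longleftrightarrow> K = L"
proof
  have *: "A \<subseteq> B" if "hausdorff_dist A B = 0" "compact A" "compact B" "B \<noteq> {}"
    for A B :: "'a set"
  proof
    fix x assume "x \<in> A"
    then have "infdist x B \<le> 0" using infdist_le_hausdorff_dist[of A x B] that by simp
    then have "infdist x B = 0" using infdist_nonneg[of x B] by linarith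
    then show "x \<in> B"
      using in_closed_iff_infdist_zero[of B x] that compact_imp_closed by blast
  qed
  assume "hausdorff_dist K L = 0"
  then show "K = L" using * K L hausdorff_dist_commute by (metis subset_antisym)
next
  assume "K = L"
  moreover have "(SUP x\<in>L. infdist x L) = (SUP x\<in>L. 0)" by (rule SUP_cong) auto
  ultimately show "hausdorff_dist K L = 0" using L(2) by (simp add: hausdorff_dist_def)
qed

lemma hausdorff_dist_triangle:
  assumes K: "compact K" "K \<noteq> {}" and L: "compact L" "L \<noteq> {}" and H: "compact H" "H \<noteq> {}"
  shows "hausdorff_dist K L \<le> hausdorff_dist K H + hausdorff_dist H L"
proof -
  have *: "infdist x B \<le> hausdorff_dist A H + hausdorff_dist H B"
    if "compact A" "x \<in> A" "compact B" "B \<noteq> {}" for A B and x :: 'a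
  proof -
    have "continuous_on H (\<lambda>h. dist x h)" by (intro continuous_intros)
    then obtain h where h: "h \<in> H" "\<forall>y\<in>H. dist x h \<le> dist x y"
      using continuous_attains_inf[OF H] by blast
    have xH: "dist x h \<le> infdist x H"
      unfolding infdist_notempty[OF H(2)] using h(2) H(2) by (intro cINF_greatest) auto
    have "infdist x B \<le> infdist h B + dist x h" by (rule infdist_triangle)
    also have "\<dots> \<le> hausdorff_dist H B + hausdorff_dist A H"
      using infdist_le_hausdorff_dist[OF H(1) h(1), of B]
        infdist_le_hausdorff_dist[OF that(1,2), of H] xH by linarith
    finally show ?thesis by simp
  qed
  have "(SUP x\<in>K. infdist x L) \<le> hausdorff_dist K H + hausdorff_dist H L"
    using * K L by (intro cSUP_least) auto
  moreover have "(SUP x\<in>L. infdist x K) \<le> hausdorff_dist L H + hausdorff_dist H K"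
    using * K L by (intro cSUP_least) auto
  ultimately show ?thesis
    unfolding hausdorff_dist_def[of K L]
    by (simp add: hausdorff_dist_commute[of L H] hausdorff_dist_commute[of H K])
qed

(* The Hausdorff metric requires the compact sets to be nonempty. *)
typedef path_compact = "{K :: full_path set. compact K \<and> K \<noteq> {}}"
  morphisms paths_of Abs_path_compact
  by (rule exI[of _ "{undefined}"]) simp

setup_lifting type_definition_path_compact

instantiation path_compact :: metric_space
begin

lift_definition dist_path_compact :: "path_compact \<Rightarrow> path_compact \<Rightarrow> real" is hausdorff_dist .

definition uniformity_path_compact :: "(path_compact \<times> path_compact) filter" where
  "uniformity_path_compact = (INF e\<in>{0<..}. principal {(x, y). dist x y < e})"

definition open_path_compact :: "path_compact set \<Rightarrow> bool" where
  "open_path_compact U \<longleftrightarrow> (\<forall>x\<in>U. \<forall>\<^sub>F (x', y) in uniformity. x' = x \<longrightarrow> y \<in> U)"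

instance
proof
  show "dist K L = 0 \<longleftrightarrow> K = L" for K L :: path_compact
    by transfer (simp add: hausdorff_dist_eq_0)
  show "dist K L \<le> dist K H + dist L H" for K L H :: path_compact
    by transfer (metis hausdorff_dist_triangle hausdorff_dist_commute)
qed (fact uniformity_path_compact_def open_path_compact_def)+

end


section \<open>Semipaths\<close>

(* A semipath with starting time a is represented by a total function of which only the
   values at times in [a,\<infinity>] are used. *)
definition extend_back :: "(ereal \<Rightarrow> ereal) \<times> ereal \<Rightarrow> ereal \<Rightarrow> ereal" where
  "extend_back = (\<lambda>(f, a) t. f (max a t))"

definition semipath_dist ::
    "(ereal \<Rightarrow> ereal) \<times> ereal \<Rightarrow> (ereal \<Rightarrow> ereal) \<times> ereal \<Rightarrow> real" where
  "semipath_dist p q =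
     max (path_dist (extend_back p) (extend_back q)) \<bar>Psi (snd p) - Psi (snd q)\<bar>"

(* Semipaths at distance 0 are identified: they have the same starting time and agree on it and
   at all later times, except possibly for irrelevant values at times \<plusminus>\<infinity>. *)
definition semipath_rel ::
    "(ereal \<Rightarrow> ereal) \<times> ereal \<Rightarrow> (ereal \<Rightarrow> ereal) \<times> ereal \<Rightarrow> bool" where
  "semipath_rel p q \<longleftrightarrow>
     continuous_on {snd p..} (\<lambda>t. Phi (fst p t) t) \<and>
     continuous_on {snd q..} (\<lambda>t. Phi (fst q t) t) \<and>
     semipath_dist p q = 0"

lemma semipath_dist_nonneg: "0 \<le> semipath_dist p q"
  by (simp add: semipath_dist_def path_dist_nonneg)

lemma semipath_dist_commute: "semipath_dist p q = semipath_dist q p"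
  by (simp add: semipath_dist_def path_dist_commute abs_minus_commute)

lemma semipath_dist_triangle: "semipath_dist p q \<le> semipath_dist p r + semipath_dist r q"
  unfolding semipath_dist_def
  using path_dist_triangle[of "extend_back p" "extend_back q" "extend_back r"]
  by linarith

lemma semipath_dist_refl: "semipath_dist p p = 0"
  by (simp add: semipath_dist_def path_dist_eq_0[THEN iffD2])

quotient_type semipath = "(ereal \<Rightarrow> ereal) \<times> ereal" / partial: semipath_rel
proof (rule part_equivpI)
  have "semipath_rel (\<lambda>_. 0, 0) (\<lambda>_. 0, 0)"
    unfolding semipath_rel_def Phi_def
    by (simp add: semipath_dist_refl cong: if_cong)
  then show "\<exists>p. semipath_rel p p" ..
  show "symp semipath_rel"
    by (rule sympI) (simp add: semipath_rel_def semipath_dist_commute)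
  show "transp semipath_rel"
  proof (rule transpI)
    fix p q r assume "semipath_rel p q" "semipath_rel q r"
    then show "semipath_rel p r"
      using semipath_dist_triangle[of p r q] semipath_dist_nonneg[of p r]
      by (auto simp: semipath_rel_def)
  qed
qed

instantiation semipath :: metric_space
begin

lift_definition dist_semipath :: "semipath \<Rightarrow> semipath \<Rightarrow> real" is semipath_dist
proof -
  fix f f' g g' assume "semipath_rel f f'" "semipath_rel g g'"
  then have "semipath_dist f f' = 0" "semipath_dist g g' = 0"
    by (auto simp: semipath_rel_def)
  then show "semipath_dist f g = semipath_dist f' g'"
    using semipath_dist_triangle[of f g f'] semipath_dist_triangle[of f' g g']
      semipath_dist_triangle[of f' g' f] semipath_dist_triangle[of f g' g]
    by (simp add: semipath_dist_commute)
qed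

definition uniformity_semipath :: "(semipath \<times> semipath) filter" where
  "uniformity_semipath = (INF e\<in>{0<..}. principal {(x, y). dist x y < e})"

definition open_semipath :: "semipath set \<Rightarrow> bool" where
  "open_semipath U \<longleftrightarrow> (\<forall>x\<in>U. \<forall>\<^sub>F (x', y) in uniformity. x' = x \<longrightarrow> y \<in> U)"

instance
proof
  show "dist f g = 0 \<longleftrightarrow> f = g" for f g :: semipath
    by transfer (auto simp: semipath_rel_def)
  show "dist f g \<le> dist f h + dist g h" for f g h :: semipath
    by transfer (metis semipath_dist_triangle semipath_dist_commute)
qed (fact uniformity_semipath_def open_semipath_def)+

end

lift_definition semipath_from :: "real \<Rightarrow> full_path \<Rightarrow> semipath"
  is "\<lambda>a f. (f, ereal a)"
proof -
  fix a f g assume fg: "full_path_rel f g"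
  have "extend_back (f, ereal a) t = extend_back (g, ereal a) t" if "\<bar>t\<bar> \<noteq> \<infinity>" for t
    using fg that by (cases t) (auto simp: full_path_rel_def extend_back_def max_def)
  then have "path_dist (extend_back (f, ereal a)) (extend_back (g, ereal a)) = 0"
    by (simp add: path_dist_eq_0)
  then show "semipath_rel (f, ereal a) (g, ereal a)"
    using fg by (auto simp: full_path_rel_def semipath_rel_def semipath_dist_def
        intro: continuous_on_subset)
qed

(* Real-valued paths as elements of the two path spaces. The value 0 at times \<plusminus>\<infinity> is immaterial;
   the abstractions are meaningful when w is continuous on the relevant time domain. *)
definition time_extend :: "(real \<Rightarrow> real) \<Rightarrow> ereal \<Rightarrow> ereal" where
  "time_extend w t = (if \<bar>t\<bar> = \<infinity> then 0 else ereal (w (real_of_ereal t)))"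

definition full_path_of :: "(real \<Rightarrow> real) \<Rightarrow> full_path" where
  "full_path_of w = abs_full_path (time_extend w)"

definition semipath_of :: "real \<Rightarrow> (real \<Rightarrow> real) \<Rightarrow> semipath" where
  "semipath_of a w = abs_semipath (time_extend w, ereal a)"


lemma Phi_tendsto_infinite:
  assumes "\<bar>c\<bar> = (\<infinity>::ereal)"
  shows "((\<lambda>t. Phi (f t) t) \<longlongrightarrow> 0) (at c within S)"
proof (rule tendstoI)
  fix e :: real assume e: "0 < e"
  define b where "b = 1 / e"
  have b: "\<bar>etanh x / (1 + \<bar>r\<bar>)\<bar> < e" if "\<bar>r\<bar> > b" for x and r :: real
  proof -
    have "\<bar>etanh x / (1 + \<bar>r\<bar>)\<bar> \<le> 1 / (1 + \<bar>r\<bar>)"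
      using etanh_bounds[of x] unfolding abs_divide by (intro frac_le) auto
    also have "\<dots> < e" using that e by (simp add: b_def field_simps add_pos_nonneg)
    finally show ?thesis .
  qed
  have *: "dist (Phi (f t) t) 0 < e" if "t > ereal b \<or> t < ereal (-b)" for t
    using that b e by (cases t) (auto simp: Phi_def)
  have "eventually (\<lambda>t. t > ereal b \<or> t < ereal (-b)) (nhds c)"
  proof (cases c)
    case PInf
    then have "eventually (\<lambda>t. t > ereal b) (nhds c)" by (intro eventually_nhds_in_open[of "{ereal b<..}", simplified]) auto
    then show ?thesis by eventually_elim simp
  next
    case MInf
    then have "eventually (\<lambda>t. t < ereal (-b)) (nhds c)" by (intro eventually_nhds_in_open[of "{..<ereal (-b)}", simplified]) auto
    then show ?thesis by eventually_elim simp
  qed (use assms in auto)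
  then have "eventually (\<lambda>t. dist (Phi (f t) t) 0 < e) (nhds c)"
    by (rule eventually_mono) (rule *)
  then show "eventually (\<lambda>t. dist (Phi (f t) t) 0 < e) (at c within S)"
    by (auto simp: eventually_at_filter elim: eventually_mono)
qed

lemma Phi_time_extend:
  assumes "continuous_on {t. ereal t \<in> S} w"
  shows "continuous_on S (\<lambda>t. Phi (time_extend w t) t)"
  unfolding continuous_on_def
proof
  fix c assume c: "c \<in> S"
  show "((\<lambda>t. Phi (time_extend w t) t) \<longlongrightarrow> Phi (time_extend w c) c) (at c within S)"
  proof (cases "\<bar>c\<bar> = \<infinity>")
    case True then show ?thesis using Phi_tendsto_infinite[of c "time_extend w" S] by (simp add: Phi_def)
  next
    case False
    let ?R = "S \<inter> {t. \<bar>t\<bar> \<noteq> \<infinity>}"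
    have "continuous_on ((\<lambda>t. t) ` {t. ereal t \<in> S}) (\<lambda>r. tanh (w r) / (1 + \<bar>r\<bar>))"
      by (simp, intro continuous_intros assms) (auto simp: add_nonneg_eq_0_iff)
    then have "continuous_on (real_of_ereal ` ?R) (\<lambda>r. tanh (w r) / (1 + \<bar>r\<bar>))"
      by (rule continuous_on_subset) (auto simp: image_iff)
    moreover have "continuous_on ?R real_of_ereal"
      by (intro continuous_at_imp_continuous_on ballI continuous_at_of_ereal) auto
    ultimately have "continuous_on ?R (\<lambda>t. tanh (w (real_of_ereal t)) / (1 + \<bar>real_of_ereal t\<bar>))"
      using continuous_on_compose[unfolded o_def] by blast
    then have "continuous_on ?R (\<lambda>t. Phi (time_extend w t) t)"
      by (rule continuous_on_eq) (auto simp: Phi_def time_extend_def)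
    moreover have "at c within S = at c within ?R"
    proof (rule at_within_nhd)
      have "\<bar>t\<bar> \<noteq> \<infinity> \<longleftrightarrow> t \<in> {-\<infinity><..<\<infinity>}" for t :: ereal by (cases t) auto
      then have "{t. \<bar>t\<bar> \<noteq> (\<infinity>::ereal)} = {-\<infinity><..<\<infinity>}"
        by (intro set_eqI) (simp only: mem_Collect_eq)
      then show "open {t. \<bar>t\<bar> \<noteq> (\<infinity>::ereal)}" by simp
    qed (use False in auto)
    ultimately show ?thesis
      using c False by (simp add: continuous_on_def)
  qed
qed

lemma path_at_full_path_of:
  assumes "continuous_on UNIV w"
  shows "path_at (full_path_of w) t = ereal (w t)"
  using assms Phi_time_extend[of UNIV w]
  by (simp add: full_path_of_def path_at.abs_eq full_path_rel_def time_extend_def)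

lemma semipath_from_full_path_of:
  assumes "continuous_on UNIV w"
  shows "semipath_from a (full_path_of w) = semipath_of a w"
  using assms Phi_time_extend[of UNIV w]
  by (simp add: full_path_of_def semipath_of_def semipath_from.abs_eq full_path_rel_def)

lemma semipath_rel_time_extend:
  assumes "continuous_on {a..} w"
  shows "semipath_rel (time_extend w, ereal a) (time_extend w, ereal a)"
  using assms Phi_time_extend[of "{ereal a..}" w]
  by (auto simp: semipath_rel_def semipath_dist_refl atLeast_def)

section \<open>Convergence in distribution\<close>

definition borel_of :: "'a topology \<Rightarrow> 'a measure" where
  "borel_of T = sigma (topspace T) {U. openin T U}"

lemma borel_of_euclidean: "borel_of euclidean = borel"
  by (simp add: borel_of_def borel_def)

definition converges_in_distribution ::
    "'x topology \<Rightarrow> (nat \<Rightarrow> 'a measure) \<Rightarrow> (nat \<Rightarrow> 'a \<Rightarrow> 'x) \<Rightarrow> 'b measure \<Rightarrow> ('b \<Rightarrow> 'x) \<Rightarrow> bool"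
  where
  "converges_in_distribution T M X N Y \<longleftrightarrow>
     (\<forall>m. X m \<in> M m \<rightarrow>\<^sub>M borel_of T) \<and> Y \<in> N \<rightarrow>\<^sub>M borel_of T \<and>
     (\<forall>g. continuous_map T euclideanreal g \<and> bounded (g ` topspace T) \<longrightarrow>
        (\<lambda>m. \<integral>\<omega>. g (X m \<omega>) \<partial>M m) \<longlonglongrightarrow> (\<integral>\<omega>. g (Y \<omega>) \<partial>N))"


section \<open>Coalescing Brownian motions\<close>

(* Space-time points are pairs (x, t); families of paths are indexed by their starting points. *)

definition brownian_motion_from :: "'a measure \<Rightarrow> real \<times> real \<Rightarrow> ('a \<Rightarrow> real \<Rightarrow> real) \<Rightarrow> bool"
  where
  "brownian_motion_from M p B \<longleftrightarrow>
     (\<forall>t\<ge>snd p. (\<lambda>\<omega>. B \<omega> t) \<in> borel_measurable M) \<and>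
     (AE \<omega> in M. B \<omega> (snd p) = fst p \<and> continuous_on {snd p..} (B \<omega>)) \<and>
     (\<forall>u\<ge>snd p. \<forall>v>u.
        distributed M lborel (\<lambda>\<omega>. B \<omega> v - B \<omega> u) (normal_density 0 (sqrt (v - u)))) \<and>
     (\<forall>n (t :: nat \<Rightarrow> real). snd p \<le> t 0 \<and> strict_mono t \<longrightarrow>
        prob_space.indep_vars M (\<lambda>_. borel)
          (\<lambda>i \<omega>. B \<omega> (t (Suc i)) - B \<omega> (t i)) {..<n})"

definition independent_brownian_motions ::
    "'a measure \<Rightarrow> (real \<times> real) set \<Rightarrow> (real \<times> real \<Rightarrow> 'a \<Rightarrow> real \<Rightarrow> real) \<Rightarrow> bool"
  where
  "independent_brownian_motions M D B \<longleftrightarrow>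
     (\<forall>p\<in>D. brownian_motion_from M p (B p)) \<and>
     prob_space.indep_vars M (\<lambda>p. PiM {snd p..} (\<lambda>_. borel))
       (\<lambda>p \<omega>. \<lambda>t\<in>{snd p..}. B p \<omega> t) D"

definition random_paths ::
    "'a measure \<Rightarrow> (real \<times> real) set \<Rightarrow> (real \<times> real \<Rightarrow> 'a \<Rightarrow> real \<Rightarrow> real) \<Rightarrow> bool"
  where
  "random_paths M D W \<longleftrightarrow>
     (\<forall>p\<in>D. (\<forall>t\<ge>snd p. (\<lambda>\<omega>. W p \<omega> t) \<in> borel_measurable M) \<and>
        (AE \<omega> in M. W p \<omega> (snd p) = fst p \<and> continuous_on {snd p..} (W p \<omega>)))"

(* The paths w are obtained from the paths b by the coalescing rule with priorities r: each path
   w p follows b p until it meets a path of higher priority (lower rank), and two paths that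
   have met coincide from then on. For continuous w with w p starting at p, and r injective,
   this determines w from b. *)
definition coalesced ::
    "(real \<times> real) set \<Rightarrow> (real \<times> real \<Rightarrow> nat) \<Rightarrow>
     (real \<times> real \<Rightarrow> real \<Rightarrow> real) \<Rightarrow> (real \<times> real \<Rightarrow> real \<Rightarrow> real) \<Rightarrow> bool"
  where
  "coalesced D r b w \<longleftrightarrow>
     (\<forall>p\<in>D. \<forall>t\<ge>snd p.
        (\<forall>q\<in>D. r q < r p \<longrightarrow> (\<forall>u\<in>{max (snd p) (snd q)..t}. w q u \<noteq> w p u)) \<longrightarrow>
        w p t = b p t) \<and>
     (\<forall>p\<in>D. \<forall>q\<in>D. \<forall>u\<ge>max (snd p) (snd q). w p u = w q u \<longrightarrow> (\<forall>t\<ge>u. w p t = w q t))"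

definition path_law ::
    "'a measure \<Rightarrow> (real \<times> real) set \<Rightarrow> (real \<times> real \<Rightarrow> 'a \<Rightarrow> real \<Rightarrow> real) \<Rightarrow>
     ((real \<times> real) \<times> real \<Rightarrow> real) measure"
  where
  "path_law M D W =
     (let I = (SIGMA p:D. {snd p..})
      in distr M (PiM I (\<lambda>_. borel)) (\<lambda>\<omega>. \<lambda>(p, t)\<in>I. W p \<omega> t))"

(* The family W has the law of independent Brownian motions subjected to the coalescing rule. The
   driving Brownian motions live on an auxiliary probability space, since after a collision they
   involve randomness that is not a function of W. The type of that space is no restriction: the
   driving family is itself a random element of it. *)
definition coalescing_brownian_motions ::
    "'a measure \<Rightarrow> (real \<times> real) set \<Rightarrow> (real \<times> real \<Rightarrow> 'a \<Rightarrow> real \<Rightarrow> real) \<Rightarrow> bool"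
  where
  "coalescing_brownian_motions M D W \<longleftrightarrow>
     random_paths M D W \<and>
     (\<exists>(M' :: (real \<times> real \<Rightarrow> real \<Rightarrow> real) measure) B W' r.
        prob_space M' \<and> inj_on r D \<and> independent_brownian_motions M' D B \<and>
        random_paths M' D W' \<and>
        (AE \<omega> in M'. coalesced D r (\<lambda>p. B p \<omega>) (\<lambda>p. W' p \<omega>)) \<and>
        path_law M D W = path_law M' D W')"

definition backward_coalescing_brownian_motions ::
    "'a measure \<Rightarrow> (real \<times> real) set \<Rightarrow> (real \<times> real \<Rightarrow> 'a \<Rightarrow> real \<Rightarrow> real) \<Rightarrow> bool"
  where
  "backward_coalescing_brownian_motions M D Wb \<longleftrightarrow>
     coalescing_brownian_motions M ((\<lambda>(x, t). (x, - t)) ` D)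
       (\<lambda>(x, t) \<omega> u. Wb (x, - t) \<omega> (- u))"


section \<open>The full Brownian web\<close>

definition double_web_skeleton ::
    "'a measure \<Rightarrow> (real \<times> real) set \<Rightarrow> (real \<times> real \<Rightarrow> 'a \<Rightarrow> real \<Rightarrow> real) \<Rightarrow>
     (real \<times> real \<Rightarrow> 'a \<Rightarrow> real \<Rightarrow> real) \<Rightarrow> bool"
  where
  "double_web_skeleton M D W Wb \<longleftrightarrow>
     coalescing_brownian_motions M D W \<and>
     backward_coalescing_brownian_motions M D Wb \<and>
     (AE \<omega> in M. \<forall>p\<in>D. \<forall>q\<in>D. \<not> paths_cross {snd p..snd q} (W p \<omega>) (Wb q \<omega>))"

definition full_brownian_web :: "'a measure \<Rightarrow> ('a \<Rightarrow> path_compact) \<Rightarrow> bool" where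
  "full_brownian_web M Y \<longleftrightarrow>
     prob_space M \<and> Y \<in> borel_measurable M \<and>
     (\<exists>D W Wb. countable D \<and> closure D = UNIV \<and> double_web_skeleton M D W Wb \<and>
        (AE \<omega> in M. paths_of (Y \<omega>) =
           closure ((\<lambda>p. full_path_of (\<lambda>t. if t \<le> snd p then Wb p \<omega> t else W p \<omega> t)) ` D)))"

end

(* Convergence in distribution is proved by testing with continuous functions, without tightness or
   almost sure representations.

   A compact noncrossing set of paths K is determined, continuously, by the semipaths which it
   contains: if the semipaths of K started at a dense set D' coalesce and avoid the other points
   of D', and the semipaths in K_n started at D' converge to them, then K_n converges to K. Hence,
   for 0 <= g <= 1, the functions
     h_n u = sup {g K - n d(u', u) | K noncrossing with semipaths u' from D'}
   are continuous in the family of semipaths u, dominate g, and decrease to g at the families of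
   semipaths of the full Brownian web Y with skeleton on D'. The semipaths of X_m are controlled on D, not on D',
   but a coalescing Brownian motion started near a point of D', and slightly earlier, soon meets
   the one started at that point. So the limit of the semipaths from D determines those from D',
   which gives limsup E g(X_m) <= E g(Y). Apply this to g and to 1 - g.

   The comparison on D and D' needs the law of coalescing Brownian motions on the union of both, and
   that it does not depend on the priorities used in the coalescing rule. This is shown by exhibiting,
   for any new priorities, driving paths which are obtained by following at each time one of
   the old ones, selected from the past, so that they are again independent Brownian motions. *)

theory Submission
  imports Defs
begin

section \<open>Paths\<close>

definition tv :: "full_path \<Rightarrow> real \<Rightarrow> real" where
  "tv f t = etanh (path_at f t)"

lemma etanh_less_iff: "etanh x < etanh y \<longleftrightarrow> x < y"
proof -
  have *: "- 1 < tanh r" "tanh r < 1" for r :: real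
    using tanh_real_bounds[of r] by auto
  show ?thesis
    using * less_trans[OF *(1) *(2)] less_asym[OF *(1)] less_asym[OF *(2)]
    by (cases x; cases y) (auto simp: not_less less_imp_le)
qed

lemma paths_cross_tv:
  "paths_cross UNIV (path_at f) (path_at g) \<longleftrightarrow> (\<exists>s t. tv g s < tv f s \<and> tv f t < tv g t)"
  by (auto simp: paths_cross_def tv_def etanh_less_iff)

lemma noncrossing_le:
  assumes "noncrossing K" "f \<in> K" "g \<in> K" "tv f s < tv g s"
  shows "tv f t \<le> tv g t"
  using assms unfolding noncrossing_def paths_cross_tv by (meson not_less)

lemma full_path_repr:
  obtains r where "f = abs_full_path r" "full_path_rel r r"
  using Quotient_rep_abs_eq Quotient_full_path
  by (metis Quotient_abs_rep Quotient_rep_reflp)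

lemma full_path_rel_refl: "full_path_rel r r \<longleftrightarrow> continuous_on UNIV (\<lambda>t. Phi (r t) t)"
  by (auto simp: full_path_rel_def)

lemma tv_abs: "full_path_rel r r \<Longrightarrow> tv (abs_full_path r) t = etanh (r (ereal t))"
  by (simp add: tv_def path_at.abs_eq)

lemma Phi_ereal: "Phi x (ereal t) = etanh x / (1 + \<bar>t\<bar>)"
  by (simp add: Phi_def)

lemma tv_bounds: "\<bar>tv f t\<bar> \<le> 1"
  by (simp add: tv_def etanh_bounds)

lemma tv_dist: "\<bar>tv f t - tv g t\<bar> \<le> (1 + \<bar>t\<bar>) * dist f g"
proof -
  obtain r q where f: "f = abs_full_path r" "full_path_rel r r"
    and g: "g = abs_full_path q" "full_path_rel q q"
    using full_path_repr by metis
  have "\<bar>etanh (r (ereal t)) / (1 + \<bar>t\<bar>) - etanh (q (ereal t)) / (1 + \<bar>t\<bar>)\<bar> \<le> dist f g"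
    using path_dist_upper[of r "ereal t" q] f g by (simp add: Phi_ereal dist_full_path.abs_eq)
  then have "\<bar>etanh (r (ereal t)) - etanh (q (ereal t))\<bar> / (1 + \<bar>t\<bar>) \<le> dist f g"
    by (simp add: diff_divide_distrib[symmetric] abs_divide)
  then show ?thesis
    using f g by (simp add: tv_abs pos_divide_le_eq add_pos_nonneg mult.commute)
qed

lemma dist_le_tv:
  assumes "0 \<le> e" "2 \<le> e * (1 + T)" "\<And>t. \<bar>t\<bar> \<le> T \<Longrightarrow> \<bar>tv f t - tv g t\<bar> \<le> e"
  shows "dist f g \<le> e"
proof -
  obtain r q where f: "f = abs_full_path r" "full_path_rel r r"
    and g: "g = abs_full_path q" "full_path_rel q q"
    using full_path_repr by metis
  have "\<bar>Phi (r t) t - Phi (q t) t\<bar> \<le> e" for t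
  proof (cases "\<bar>t\<bar> = \<infinity>")
    case True
    then show ?thesis using assms(1) by (auto simp: Phi_def)
  next
    case False
    then obtain u where t: "t = ereal u" by auto
    have "\<bar>tv f u - tv g u\<bar> \<le> e * (1 + \<bar>u\<bar>)"
    proof (cases "\<bar>u\<bar> \<le> T")
      case True
      have "e * 1 \<le> e * (1 + \<bar>u\<bar>)" using assms(1) by (intro mult_left_mono) auto
      then show ?thesis using assms(3)[OF True] by simp
    next
      case False
      have "e * (1 + T) \<le> e * (1 + \<bar>u\<bar>)" using assms(1) False by (intro mult_left_mono) auto
      then show ?thesis
        using tv_bounds[of f u] tv_bounds[of g u] assms(2) by linarith
    qed
    then have "\<bar>tv f u - tv g u\<bar> / (1 + \<bar>u\<bar>) \<le> e"
      by (simp add: pos_divide_le_eq add_pos_nonneg)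
    then show ?thesis
      using f g by (simp add: t Phi_ereal tv_abs diff_divide_distrib abs_divide flip: diff_divide_distrib)
  qed
  then have "path_dist r q \<le> e" unfolding path_dist_def by (intro cSUP_least) auto
  then show ?thesis using f g by (simp add: dist_full_path.abs_eq)
qed

lemma continuous_tv: "continuous_on UNIV (tv f)"
proof -
  obtain r where f: "f = abs_full_path r" "full_path_rel r r" by (rule full_path_repr)
  then have c: "continuous_on UNIV (\<lambda>t. Phi (r t) t)" by (simp add: full_path_rel_refl)
  have "continuous_on UNIV (\<lambda>t::real. Phi (r (ereal t)) (ereal t))"
    by (rule continuous_on_compose2[OF c, of UNIV ereal]) (auto intro: continuous_intros)
  then have "continuous_on UNIV (\<lambda>t::real. Phi (r (ereal t)) (ereal t) * (1 + \<bar>t\<bar>))"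
    by (intro continuous_intros)
  moreover have "Phi (r (ereal t)) (ereal t) * (1 + \<bar>t\<bar>) = tv f t" for t
    using f add_pos_nonneg[of 1 "\<bar>t\<bar>"] by (simp add: Phi_ereal tv_abs)
  ultimately show ?thesis by simp
qed

lemma semipath_of_dist:
  assumes w: "continuous_on {a..} w" and t: "a \<le> t"
  shows "\<bar>tv f t - tanh (w t)\<bar> \<le> (1 + \<bar>t\<bar>) * dist (semipath_from a f) (semipath_of a w)"
proof -
  obtain r where f: "f = abs_full_path r" "full_path_rel r r" by (rule full_path_repr)
  have rel: "semipath_rel (r, ereal a) (r, ereal a)"
    using f(2) by (auto simp: full_path_rel_refl semipath_rel_def semipath_dist_refl intro: continuous_on_subset)
  have "dist (semipath_from a f) (semipath_of a w) = semipath_dist (r, ereal a) (time_extend w, ereal a)"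
    using f rel semipath_rel_time_extend[OF w]
    by (simp add: semipath_of_def semipath_from.abs_eq dist_semipath.abs_eq)
  also have "\<dots> \<ge> path_dist (extend_back (r, ereal a)) (extend_back (time_extend w, ereal a))"
    by (simp add: semipath_dist_def)
  also have "path_dist (extend_back (r, ereal a)) (extend_back (time_extend w, ereal a))
     \<ge> \<bar>Phi (extend_back (r, ereal a) (ereal t)) (ereal t) - Phi (extend_back (time_extend w, ereal a) (ereal t)) (ereal t)\<bar>"
    by (rule path_dist_upper)
  finally have "\<bar>etanh (r (ereal t)) / (1 + \<bar>t\<bar>) - tanh (w t) / (1 + \<bar>t\<bar>)\<bar>
      \<le> dist (semipath_from a f) (semipath_of a w)"
    using t by (simp add: extend_back_def max_absorb2 Phi_ereal time_extend_def)
  then have "\<bar>tv f t - tanh (w t)\<bar> / (1 + \<bar>t\<bar>) \<le> dist (semipath_from a f) (semipath_of a w)"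
    using f by (simp add: tv_abs diff_divide_distrib[symmetric] abs_divide)
  then show ?thesis by (simp add: pos_divide_le_eq add_pos_nonneg mult.commute)
qed

lemma semipath_from_eq_of:
  assumes w: "continuous_on {a..} w" and eq: "\<And>t. a \<le> t \<Longrightarrow> tv f t = tanh (w t)"
  shows "semipath_from a f = semipath_of a w"
proof -
  obtain r where f: "f = abs_full_path r" "full_path_rel r r" by (rule full_path_repr)
  have rel: "semipath_rel (r, ereal a) (r, ereal a)"
    using f(2) by (auto simp: full_path_rel_refl semipath_rel_def semipath_dist_refl intro: continuous_on_subset)
  have ext: "extend_back (r, ereal a) t = extend_back (time_extend w, ereal a) t" if fin: "\<bar>t\<bar> \<noteq> \<infinity>" for t
  proof -
    obtain v where v: "t = ereal v" using fin by (cases t) auto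
    obtain u where u: "max (ereal a) t = ereal u" "a \<le> u"
      by (rule that[of "max a v"]) (simp_all add: v)
    have "etanh (r (ereal u)) = etanh (ereal (w u))" using eq[OF u(2)] f by (simp add: tv_abs)
    then show ?thesis unfolding etanh_inj by (simp add: extend_back_def u time_extend_def)
  qed
  then have "semipath_dist (r, ereal a) (time_extend w, ereal a) = 0"
    using path_dist_eq_0[THEN iffD2, of "extend_back (r, ereal a)" "extend_back (time_extend w, ereal a)"] ext
    by (simp add: semipath_dist_def)
  then have "dist (semipath_from a f) (semipath_of a w) = 0"
    using f rel semipath_rel_time_extend[OF w]
    by (simp add: semipath_of_def semipath_from.abs_eq dist_semipath.abs_eq)
  then show ?thesis by simp
qed

section \<open>Noncrossing compact sets containing coalescing semipaths\<close>

lemma compact_tv_equicontinuous: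
  assumes "compact K" "0 < (e::real)"
  shows "\<exists>\<rho>>0. \<forall>f\<in>K. \<forall>s. \<bar>s - s0\<bar> < \<rho> \<longrightarrow> \<bar>tv f s - tv f s0\<bar> < e"
proof -
  define d where "d = e / (4 * (2 + \<bar>s0\<bar>))"
  have d: "0 < d" using assms by (simp add: d_def)
  then obtain k where k: "finite k" "k \<subseteq> K" "K \<subseteq> (\<Union>x\<in>k. ball x d)"
    using assms(1) compact_imp_seq_compact seq_compact_imp_totally_bounded by metis
  have "eventually (\<lambda>s. \<bar>tv f s - tv f s0\<bar> < e / 4) (nhds s0)" for f
  proof -
    have "isCont (tv f) s0" using continuous_tv by (simp add: continuous_on_eq_continuous_at)
    then have "(tv f \<longlongrightarrow> tv f s0) (nhds s0)" by (simp add: continuous_at tendsto_at_iff_tendsto_nhds)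
    then have "eventually (\<lambda>s. dist (tv f s) (tv f s0) < e / 4) (nhds s0)"
      using assms(2) by (intro tendstoD) auto
    then show ?thesis by (simp add: dist_real_def)
  qed
  then have "eventually (\<lambda>s. \<forall>f\<in>k. \<bar>tv f s - tv f s0\<bar> < e / 4) (nhds s0)"
    using k(1) by (simp add: eventually_ball_finite)
  then obtain r where r: "r > 0" "\<And>s f. dist s s0 < r \<Longrightarrow> f \<in> k \<Longrightarrow> \<bar>tv f s - tv f s0\<bar> < e / 4"
    unfolding eventually_nhds_metric by metis
  have "\<bar>tv f s - tv f s0\<bar> < e" if f: "f \<in> K" and s: "\<bar>s - s0\<bar> < min 1 r" for f s
  proof -
    obtain g where g: "g \<in> k" "dist g f < d" using k(3) f by (auto simp: subset_iff)
    have *: "\<bar>tv f u - tv g u\<bar> \<le> e / 4" if u: "\<bar>u - s0\<bar> < 1" for u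
    proof -
      have "(1 + \<bar>u\<bar>) * dist f g \<le> (2 + \<bar>s0\<bar>) * d"
        using g u by (intro mult_mono) (auto simp: dist_commute)
      also have "\<dots> = e / 4" by (simp add: d_def add_pos_nonneg field_simps)
      finally show ?thesis using tv_dist[of f u g] by linarith
    qed
    have "\<bar>tv g s - tv g s0\<bar> < e / 4" using r(2)[of s g] g s by (simp add: dist_real_def)
    then show ?thesis using *[of s] *[of s0] s assms(2) by linarith
  qed
  then show ?thesis using r(1) by (intro exI[of _ "min 1 r"]) auto
qed

lemma tanh_artanh_real:
  fixes y :: real
  assumes "-1 < y" "y < 1"
  shows "tanh (artanh y) = y"
proof -
  have "exp (- 2 * artanh y) = exp (ln ((1 - y) / (1 + y)))"
    using assms by (simp add: artanh_def ln_div)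
  also have "\<dots> = (1 - y) / (1 + y)" using assms by (intro exp_ln) auto
  finally have "exp (- 2 * artanh y) = (1 - y) / (1 + y)" .
  moreover have "(1 - (1 - y) / (1 + y)) / (1 + (1 - y) / (1 + y)) = y"
    using assms by (simp add: divide_simps)
  ultimately show ?thesis by (simp only: tanh_real_altdef)
qed

lemma dense_inter_open:
  fixes D :: "'a::topological_space set"
  assumes "closure D = UNIV" "open U" "x \<in> U"
  shows "\<exists>p\<in>D. p \<in> U"
  using assms by (metis IntE UNIV_I closure_iff_nhds_not_empty ex_in_conv open_contains_ball_eq subset_UNIV Int_iff inf_commute order_refl)

lemma finite_between:
  fixes A B :: "real set"
  assumes "finite A" "finite B" "\<And>a b. a \<in> A \<Longrightarrow> b \<in> B \<Longrightarrow> a < b"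
  shows "\<exists>x. (\<forall>a\<in>A. a < x) \<and> (\<forall>b\<in>B. x < b)"
proof (cases "A = {}")
  case True
  have "Min B - 1 < b" if "b \<in> B" for b using Min_le[OF assms(2) that] by linarith
  then show ?thesis using True by auto
next
  case A: False
  show ?thesis
  proof (cases "B = {}")
    case True
    have "a < Max A + 1" if "a \<in> A" for a using Max_ge[OF assms(1) that] by linarith
    then show ?thesis using True by auto
  next
    case False
    then have "Max A < Min B" using A assms by simp
    then have "a < (Max A + Min B) / 2" if "a \<in> A" for a using Max_ge[OF assms(1) that] by simp
    moreover have "(Max A + Min B) / 2 < b" if "b \<in> B" for b
      using Min_le[OF assms(2) that] \<open>Max A < Min B\<close> by simp
    ultimately show ?thesis by blast
  qed
qed

locale coalescing_family =
  fixes D :: "(real \<times> real) set" and w :: "real \<times> real \<Rightarrow> real \<Rightarrow> real"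
  assumes dense: "closure D = UNIV"
    and w_cont: "\<And>p. p \<in> D \<Longrightarrow> continuous_on {snd p..} (w p)"
    and w_start: "\<And>p. p \<in> D \<Longrightarrow> w p (snd p) = fst p"
    and w_coal: "\<And>p q u t. p \<in> D \<Longrightarrow> q \<in> D \<Longrightarrow> snd p \<le> u \<Longrightarrow> snd q \<le> u \<Longrightarrow>
      w p u = w q u \<Longrightarrow> u \<le> t \<Longrightarrow> w p t = w q t"
    and w_avoid: "\<And>p q. p \<in> D \<Longrightarrow> q \<in> D \<Longrightarrow> p \<noteq> q \<Longrightarrow> snd p \<le> snd q \<Longrightarrow> w p (snd q) \<noteq> fst q"
begin

lemma w_ext_cont: "p \<in> D \<Longrightarrow> continuous_on UNIV (\<lambda>t. w p (max (snd p) t))"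
  by (rule continuous_on_compose2[OF w_cont]) (auto intro!: continuous_intros)

lemma finite_grid:
  assumes K: "compact K" and th: "\<And>p. p \<in> D \<Longrightarrow> \<theta> p \<in> K"
    and tht: "\<And>p s. p \<in> D \<Longrightarrow> snd p \<le> s \<Longrightarrow> tv (\<theta> p) s = tanh (w p s)"
    and e: "0 < e"
  shows "\<exists>D0\<subseteq>D. finite D0 \<and> (\<forall>s\<in>{-T..T}. \<forall>a b. -1 \<le> a \<longrightarrow> b \<le> 1 \<longrightarrow> a + e < b \<longrightarrow>
     (\<exists>q\<in>D0. snd q < s \<and> a < tanh (w q s) \<and> tanh (w q s) < b))"
proof -
  define S where "S = {-T..T} \<times> {-1 + e/2..1 - e/2}"
  define U where "U q = {z. snd q < fst z \<and> \<bar>tanh (w q (max (snd q) (fst z))) - snd z\<bar> < e / 2}" for q :: "real \<times> real"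
  have "open (U q)" if "q \<in> D" for q
  proof -
    have "continuous_on UNIV (\<lambda>z::real \<times> real. w q (max (snd q) (fst z)))"
      by (rule continuous_on_compose2[OF w_ext_cont[OF that], of UNIV fst]) (auto intro: continuous_intros)
    then show ?thesis unfolding U_def
      by (intro open_Collect_conj open_Collect_less continuous_intros) auto
  qed
  moreover have "S \<subseteq> (\<Union>q\<in>D. U q)"
  proof
    fix z assume "z \<in> S"
    then obtain s0 y0 where z: "z = (s0, y0)" and y0: "-1 + e/2 \<le> y0" "y0 \<le> 1 - e/2"
      by (auto simp: S_def)
    have y1: "-1 < y0" "y0 < 1" using y0 e by auto
    obtain \<rho> where \<rho>: "\<rho> > 0" "\<And>f s. f \<in> K \<Longrightarrow> \<bar>s - s0\<bar> < \<rho> \<Longrightarrow> \<bar>tv f s - tv f s0\<bar> < e / 8"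
      using compact_tv_equicontinuous[OF K, of "e/8" s0] e by auto
    define V where "V = {p::real \<times> real. s0 - \<rho> < snd p \<and> snd p < s0 \<and> \<bar>tanh (fst p) - y0\<bar> < e / 8}"
    have "open V" unfolding V_def by (intro open_Collect_conj open_Collect_less continuous_intros) auto
    moreover have "(artanh y0, s0 - \<rho>/2) \<in> V" using y1 e \<rho> by (simp add: V_def tanh_artanh_real)
    ultimately obtain q where q: "q \<in> D" "q \<in> V" using dense_inter_open[OF dense] by blast
    then have "\<bar>tv (\<theta> q) (snd q) - tv (\<theta> q) s0\<bar> < e / 8" by (intro \<rho>(2) th) (auto simp: V_def)
    then have "\<bar>tanh (fst q) - tanh (w q s0)\<bar> < e / 8"
      using q tht[of q "snd q"] tht[of q s0] w_start[of q] by (simp add: V_def)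
    moreover have "\<bar>tanh (fst q) - y0\<bar> < e / 8" using q by (simp add: V_def)
    ultimately have "\<bar>tanh (w q s0) - y0\<bar> < e / 4" by linarith
    then have "z \<in> U q" using q e by (simp add: U_def z V_def max_absorb2)
    then show "z \<in> (\<Union>q\<in>D. U q)" using q by blast
  qed
  moreover have "compact S" unfolding S_def by (intro compact_Times) auto
  ultimately obtain D0 where D0: "D0 \<subseteq> D" "finite D0" "S \<subseteq> (\<Union>q\<in>D0. U q)"
    by (elim compactE_image[where C=D and f=U]) auto
  have "\<exists>q\<in>D0. snd q < s \<and> a < tanh (w q s) \<and> tanh (w q s) < b"
    if "s \<in> {-T..T}" "-1 \<le> a" "b \<le> 1" "a + e < b" for s a b
  proof -
    have "(s, (a + b) / 2) \<in> S" using that by (auto simp: S_def field_simps)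
    then obtain q where q: "q \<in> D0" "(s, (a+b)/2) \<in> U q" using D0 by blast
    then have "snd q < s" "\<bar>tanh (w q s) - (a + b) / 2\<bar> < e / 2" by (auto simp: U_def max_absorb2)
    then show ?thesis using q that by (intro bexI[of _ q]) (auto simp: field_simps abs_less_iff)
  qed
  then show ?thesis using D0 by blast
qed

text \<open>A path with the pattern \<open>A\<close> runs to the right of the paths in \<open>A\<close> and to the left of those in
  \<open>D0 - A\<close>. A start point \<open>p\<close> just before the first time \<open>U\<close> at which two of these meet yields a path with the
  same pattern, as far as paths starting before \<open>U\<close> are concerned; from \<open>U\<close> on both are pinched.\<close>

lemma pattern_point:
  assumes D0: "finite D0" "D0 \<subseteq> D" and A: "A \<subseteq> D0" and T: "\<And>q. q \<in> D0 \<Longrightarrow> snd q < T"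
    and ord: "\<And>a b s. a \<in> A \<Longrightarrow> b \<in> D0 - A \<Longrightarrow> snd a \<le> s \<Longrightarrow> snd b \<le> s \<Longrightarrow> w a s \<le> w b s"
  shows "\<exists>p\<in>D. \<exists>U\<le>T.
     (\<forall>a\<in>A. snd a < U \<longrightarrow> snd a \<le> snd p \<and> w a (snd p) < fst p) \<and>
     (\<forall>b\<in>D0 - A. snd b < U \<longrightarrow> snd b \<le> snd p \<and> fst p < w b (snd p)) \<and>
     (U = T \<or> (\<exists>a\<in>A. \<exists>b\<in>D0 - A. snd a < U \<and> snd b < U \<and> (\<forall>s\<ge>U. w a s = w b s)))"
proof -
  define M where "M a b = {s. max (snd a) (snd b) \<le> s \<and> s \<le> T \<and> w a s = w b s}" for a b
  define S where "S = (\<Union>a\<in>A. \<Union>b\<in>D0 - A. M a b)"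
  have fin: "finite A" "finite (D0 - A)" using D0 A finite_subset by auto
  have sub: "a \<in> D" if "a \<in> D0" for a using that D0 by auto
  have clM: "closed (M a b)" if "a \<in> D0" "b \<in> D0" for a b
  proof -
    have "M a b = {s. max (snd a) (snd b) \<le> s \<and> s \<le> T \<and> w a (max (snd a) s) = w b (max (snd b) s)}"
      by (auto simp: M_def max_absorb2)
    moreover have "closed \<dots>"
      by (intro closed_Collect_conj closed_Collect_le closed_Collect_eq continuous_intros w_ext_cont sub that)
    ultimately show ?thesis by simp
  qed
  have clS: "closed S" unfolding S_def
    by (intro closed_UN ballI clM fin) (use A in auto)
  obtain U where U: "U \<le> T" "\<And>u. u < U \<Longrightarrow> u \<notin> S"
      "U = T \<or> (\<exists>a\<in>A. \<exists>b\<in>D0 - A. snd a < U \<and> snd b < U \<and> (\<forall>s\<ge>U. w a s = w b s))"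
  proof (cases "S = {}")
    case True
    then show ?thesis using that[of T] by auto
  next
    case False
    have bdd: "bdd_below S"
    proof (rule bdd_belowI)
      fix x assume "x \<in> S"
      then obtain a b where "a \<in> A" "snd a \<le> x" by (auto simp: S_def M_def)
      then show "Min (snd ` A) \<le> x" using fin by (meson Min_le finite_imageI imageI order_trans)
    qed
    have "Inf S \<in> S" using closed_contains_Inf[OF False bdd clS] .
    then obtain a b where ab: "a \<in> A" "b \<in> D0 - A" "Inf S \<in> M a b" by (auto simp: S_def)
    have "a \<in> D" "b \<in> D" "a \<noteq> b" using ab A D0 by auto
    then have ne: "w a (snd b) \<noteq> w b (snd b)" if "snd a \<le> snd b"
      using w_avoid[of a b] w_start[of b] that by auto
    have ne': "w a (snd a) \<noteq> w b (snd a)" if "snd b \<le> snd a"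
      using w_avoid[of b a] w_start[of a] that \<open>a \<in> D\<close> \<open>b \<in> D\<close> \<open>a \<noteq> b\<close> by auto
    have m: "snd a \<le> Inf S" "snd b \<le> Inf S" "w a (Inf S) = w b (Inf S)"
      using ab(3) by (simp_all add: M_def)
    have "snd a \<noteq> Inf S"
    proof
      assume *: "snd a = Inf S"
      show False using ne'[unfolded *] m by simp
    qed
    moreover have "snd b \<noteq> Inf S"
    proof
      assume *: "snd b = Inf S"
      show False using ne[unfolded *] m by simp
    qed
    ultimately have lt: "snd a < Inf S" "snd b < Inf S" using m by (simp_all add: less_le)
    have eq: "w a s = w b s" if "Inf S \<le> s" for s
      using w_coal[OF \<open>a \<in> D\<close> \<open>b \<in> D\<close> m that] .
    have f1: "Inf S \<le> T" using ab(3) by (simp add: M_def)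
    have f2: "u \<notin> S" if "u < Inf S" for u using cInf_lower[OF _ bdd, of u] that by (meson not_less)
    have f3: "\<exists>a\<in>A. \<exists>b\<in>D0 - A. snd a < Inf S \<and> snd b < Inf S \<and> (\<forall>s\<ge>Inf S. w a s = w b s)"
      using ab(1,2) lt eq by blast
    show ?thesis by (rule that[OF f1 f2 disjI2[OF f3]])
  qed
  define L where "L = {q\<in>D0. snd q < U}"
  have finL: "finite L" using D0 by (simp add: L_def)
  have "\<exists>x. (\<forall>a\<in>snd ` L. a < x) \<and> (\<forall>b\<in>{U}. x < b)"
    by (rule finite_between) (use finL in \<open>auto simp: L_def\<close>)
  then obtain u0 where u0: "\<forall>a\<in>snd ` L. a < u0" "\<forall>b\<in>{U}. u0 < b" by blast
  have strict: "w a u0 < w b u0" if "a \<in> A \<inter> L" "b \<in> L - A" for a b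
  proof -
    have "u0 \<notin> M a b" using U(2)[of u0] u0 that by (auto simp: S_def L_def)
    moreover have lt: "snd a < u0" "snd b < u0" using u0 that by auto
    moreover have "w a u0 \<le> w b u0" using that lt by (intro ord) (auto simp: L_def)
    moreover have "u0 \<le> T" using u0 U(1) by auto
    ultimately show ?thesis by (auto simp: M_def)
  qed
  have "\<exists>x. (\<forall>a\<in>(\<lambda>a. w a u0) ` (A \<inter> L). a < x) \<and> (\<forall>b\<in>(\<lambda>b. w b u0) ` (L - A). x < b)"
    by (rule finite_between) (use finL strict in auto)
  then obtain x where x: "\<forall>a\<in>(\<lambda>a. w a u0) ` (A \<inter> L). a < x" "\<forall>b\<in>(\<lambda>b. w b u0) ` (L - A). x < b"
    by blast
  define V where "V = (\<Inter>q\<in>L. {p. snd q < snd p}) \<inter> (\<Inter>a\<in>A \<inter> L. {p. w a (max (snd a) (snd p)) < fst p})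
      \<inter> (\<Inter>b\<in>L - A. {p. fst p < w b (max (snd b) (snd p))})"
  have "open V"
  proof -
    have "continuous_on UNIV (\<lambda>p. w a (max (snd a) (snd p)))" if "a \<in> L" for a
      by (rule continuous_on_compose2[OF w_ext_cont, of a UNIV snd])
        (use that D0 in \<open>auto simp: L_def intro: continuous_intros\<close>)
    then show ?thesis unfolding V_def
      using finL by (intro open_Int open_INT finite_Int finite_Diff ballI open_Collect_less continuous_intros) auto
  qed
  moreover have "(x, u0) \<in> V" using x u0 by (auto simp: V_def max_absorb2 less_imp_le)
  ultimately obtain p where p: "p \<in> D" "p \<in> V" using dense_inter_open[OF dense] by blast
  have "snd a \<le> snd p \<and> w a (snd p) < fst p" if "a \<in> A" "snd a < U" for a
  proof -
    have "a \<in> A \<inter> L" using that A by (auto simp: L_def)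
    then have "snd a < snd p" "w a (max (snd a) (snd p)) < fst p" using p(2) unfolding V_def by blast+
    then show ?thesis by (simp add: max_absorb2)
  qed
  moreover have "snd b \<le> snd p \<and> fst p < w b (snd p)" if "b \<in> D0 - A" "snd b < U" for b
  proof -
    have "b \<in> L - A" using that A by (auto simp: L_def)
    then have "snd b < snd p" "fst p < w b (max (snd b) (snd p))" using p(2) unfolding V_def by blast+
    then show ?thesis by (simp add: max_absorb2)
  qed
  ultimately show ?thesis using p(1) U by blast
qed

definition approximates :: "(nat \<Rightarrow> real \<times> real \<Rightarrow> full_path) \<Rightarrow> bool" where
  "approximates \<theta> \<longleftrightarrow> (\<forall>q\<in>D. \<forall>T. \<forall>e>0. \<forall>\<^sub>F n in sequentially.
     \<forall>s\<in>{snd q..T}. \<bar>tv (\<theta> n q) s - tanh (w q s)\<bar> \<le> e)"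

lemma approximates_tendsto:
  assumes "approximates \<theta>" "q \<in> D" "snd q \<le> s"
  shows "(\<lambda>n. tv (\<theta> n q) s) \<longlonglongrightarrow> tanh (w q s)"
proof (rule tendstoI)
  fix e :: real assume e: "0 < e"
  have "\<forall>\<^sub>F n in sequentially. \<forall>s'\<in>{snd q..s}. \<bar>tv (\<theta> n q) s' - tanh (w q s')\<bar> \<le> e / 2"
    using assms(1,2) e half_gt_zero[OF e] unfolding approximates_def by blast
  then show "\<forall>\<^sub>F n in sequentially. dist (tv (\<theta> n q) s) (tanh (w q s)) < e"
  proof eventually_elim
    case (elim n)
    then have "\<bar>tv (\<theta> n q) s - tanh (w q s)\<bar> \<le> e / 2" using assms(3) by simp
    then show ?case using e unfolding dist_real_def by linarith
  qed
qed

lemma approximates_less: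
  assumes "approximates \<theta>" "q \<in> D" "q' \<in> D" "snd q \<le> s" "snd q' \<le> s" "w q s < w q' s"
  shows "\<forall>\<^sub>F n in sequentially. tv (\<theta> n q) s < tv (\<theta> n q') s"
proof -
  have "(\<lambda>n. tv (\<theta> n q') s - tv (\<theta> n q) s) \<longlonglongrightarrow> tanh (w q' s) - tanh (w q s)"
    by (intro tendsto_diff approximates_tendsto assms)
  then have "\<forall>\<^sub>F n in sequentially. 0 < tv (\<theta> n q') s - tv (\<theta> n q) s"
    by (rule order_tendstoD) (use assms(6) in simp)
  then show ?thesis by eventually_elim simp
qed

lemma one_sided_approximation:
  assumes K0: "compact K0" "\<And>p. p \<in> D \<Longrightarrow> \<theta>0 p \<in> K0"
    "\<And>p s. p \<in> D \<Longrightarrow> snd p \<le> s \<Longrightarrow> tv (\<theta>0 p) s = tanh (w p s)"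
    and nc: "\<And>n. noncrossing (K n)" "\<And>n. noncrossing (K' n)"
    and \<theta>: "\<And>n p. p \<in> D \<Longrightarrow> \<theta> n p \<in> K n" "\<And>n p. p \<in> D \<Longrightarrow> \<theta>' n p \<in> K' n"
    and appr: "approximates \<theta>" "approximates \<theta>'"
    and e: "0 < e"
  shows "\<forall>\<^sub>F n in sequentially. \<forall>f\<in>K n. \<exists>g\<in>K' n. dist f g \<le> e"
proof -
  define T0 where "T0 = 2 / e"
  define d where "d = e / 4"
  have d: "0 < d" using e by (simp add: d_def)
  have "\<exists>D0\<subseteq>D. finite D0 \<and> (\<forall>s\<in>{-T0..T0}. \<forall>a b. -1 \<le> a \<longrightarrow> b \<le> 1 \<longrightarrow>
      a + d < b \<longrightarrow> (\<exists>q\<in>D0. snd q < s \<and> a < tanh (w q s) \<and> tanh (w q s) < b))"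
    by (rule finite_grid[of K0 \<theta>0]) (fact K0 d)+
  then obtain D0 where D0: "D0 \<subseteq> D" "finite D0" and grid0: "\<forall>s\<in>{-T0..T0}. \<forall>a b. -1 \<le> a \<longrightarrow> b \<le> 1 \<longrightarrow>
      a + d < b \<longrightarrow> (\<exists>q\<in>D0. snd q < s \<and> a < tanh (w q s) \<and> tanh (w q s) < b)"
    by (elim exE conjE)
  note grid = grid0[rule_format]
  define T where "T = Max (insert T0 (snd ` D0)) + 1"
  have Tle: "x < T" if "x \<in> insert T0 (snd ` D0)" for x
    using Max_ge[OF _ that] D0(2) unfolding T_def by fastforce
  have T: "snd q < T" if "q \<in> D0" for q using that by (intro Tle) auto
  have T0: "T0 < T" by (intro Tle) auto
  define pat where "pat n f = {q\<in>D0. \<forall>s. tv (\<theta> n q) s \<le> tv f s}" for n f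
  have patD: "tv f s \<le> tv (\<theta> n q) s" if f: "f \<in> K n" "q \<in> D0 - pat n f" for n f q s
  proof -
    obtain s' where "tv f s' < tv (\<theta> n q) s'" using f by (auto simp: pat_def not_le)
    then show ?thesis using noncrossing_le[OF nc(1)] f \<theta>(1) D0(1) by blast
  qed
  have near: "\<forall>\<^sub>F n in sequentially. \<forall>q\<in>D0. \<forall>s\<in>{snd q..T}. \<bar>tv (\<theta>1 n q) s - tanh (w q s)\<bar> \<le> d"
    if "approximates \<theta>1" for \<theta>1
    using that D0 d unfolding approximates_def by (intro eventually_ball_finite) auto
  have ev: "\<forall>\<^sub>F n in sequentially. \<forall>f\<in>K n. pat n f = A \<longrightarrow> (\<exists>g\<in>K' n. dist f g \<le> e)" if A: "A \<subseteq> D0" for A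
  proof (cases "\<forall>a\<in>A. \<forall>b\<in>D0 - A. \<forall>s. snd a \<le> s \<longrightarrow> snd b \<le> s \<longrightarrow> w a s \<le> w b s")
    case False
    then obtain a b s where ab: "a \<in> A" "b \<in> D0 - A" "snd a \<le> s" "snd b \<le> s" "w b s < w a s"
      by (meson not_le)
    have "a \<in> D" "b \<in> D" using ab A D0 by auto
    then have "\<forall>\<^sub>F n in sequentially. tv (\<theta> n b) s < tv (\<theta> n a) s"
      using ab by (intro approximates_less appr)
    then show ?thesis
    proof eventually_elim
      case (elim n)
      have False if "f \<in> K n" "pat n f = A" for f
      proof -
        have "tv (\<theta> n a) s \<le> tv f s" using that ab(1) by (auto simp: pat_def)
        moreover have "tv f s \<le> tv (\<theta> n b) s" using patD[OF that(1)] that(2) ab(2) by blast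
        ultimately show False using elim by simp
      qed
      then show ?case by blast
    qed
  next
    case True
    have "\<exists>p\<in>D. \<exists>U\<le>T. (\<forall>a\<in>A. snd a < U \<longrightarrow> snd a \<le> snd p \<and> w a (snd p) < fst p) \<and>
        (\<forall>b\<in>D0 - A. snd b < U \<longrightarrow> snd b \<le> snd p \<and> fst p < w b (snd p)) \<and>
        (U = T \<or> (\<exists>a\<in>A. \<exists>b\<in>D0 - A. snd a < U \<and> snd b < U \<and> (\<forall>s\<ge>U. w a s = w b s)))"
      by (rule pattern_point[OF D0(2,1) A]) (use T True in auto)
    then obtain p U where p: "p \<in> D" "U \<le> T"
      and pA': "\<forall>a\<in>A. snd a < U \<longrightarrow> snd a \<le> snd p \<and> w a (snd p) < fst p"
      and pB': "\<forall>b\<in>D0 - A. snd b < U \<longrightarrow> snd b \<le> snd p \<and> fst p < w b (snd p)"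
      and U: "U = T \<or> (\<exists>a\<in>A. \<exists>b\<in>D0 - A. snd a < U \<and> snd b < U \<and> (\<forall>s\<ge>U. w a s = w b s))"
      by (elim bexE exE conjE)
    note pA = pA'[folded w_start[OF p(1)], rule_format] and pB = pB'[folded w_start[OF p(1)], rule_format]
    have "\<forall>\<^sub>F n in sequentially. \<forall>a\<in>A. snd a < U \<longrightarrow> tv (\<theta>' n a) (snd p) < tv (\<theta>' n p) (snd p)"
    proof (intro eventually_ball_finite ballI)
      fix a assume "a \<in> A"
      then have "\<forall>\<^sub>F n in sequentially. tv (\<theta>' n a) (snd p) < tv (\<theta>' n p) (snd p)" if "snd a < U"
        using A D0 p pA[OF _ that] by (intro approximates_less appr) auto
      then show "\<forall>\<^sub>F n in sequentially. snd a < U \<longrightarrow> tv (\<theta>' n a) (snd p) < tv (\<theta>' n p) (snd p)"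
        by (cases "snd a < U") auto
    qed (use A D0 finite_subset in auto)
    moreover have "\<forall>\<^sub>F n in sequentially. \<forall>b\<in>D0 - A. snd b < U \<longrightarrow> tv (\<theta>' n p) (snd p) < tv (\<theta>' n b) (snd p)"
    proof (intro eventually_ball_finite ballI)
      fix b assume "b \<in> D0 - A"
      then have "\<forall>\<^sub>F n in sequentially. tv (\<theta>' n p) (snd p) < tv (\<theta>' n b) (snd p)" if "snd b < U"
        using D0 p pB[OF _ that] by (intro approximates_less appr) auto
      then show "\<forall>\<^sub>F n in sequentially. snd b < U \<longrightarrow> tv (\<theta>' n p) (snd p) < tv (\<theta>' n b) (snd p)"
        by (cases "snd b < U") auto
    qed (use D0 in auto)
    ultimately show ?thesis
      using near[OF appr(1)] near[OF appr(2)]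
    proof eventually_elim
      case (elim n)
      note above = elim(1)[rule_format] and below = elim(2)[rule_format]
        and n1 = elim(3)[rule_format] and n2 = elim(4)[rule_format]
      have "dist f (\<theta>' n p) \<le> e" if f: "f \<in> K n" "pat n f = A" for f
      proof (rule dist_le_tv[of _ T0])
        let ?g = "\<theta>' n p"
        have fA: "tv (\<theta> n a) s \<le> tv f s" if "a \<in> A" for a s using f(2) that by (auto simp: pat_def)
        have fB: "tv f s \<le> tv (\<theta> n b) s" if "b \<in> D0 - A" for b s using patD[OF f(1)] f(2) that by blast
        have gA: "tv (\<theta>' n a) s \<le> tv ?g s" if "a \<in> A" "snd a < U" for a s
          using above[OF that] that A D0 p by (intro noncrossing_le[OF nc(2)[of n]] \<theta>(2)) auto
        have gB: "tv ?g s \<le> tv (\<theta>' n b) s" if "b \<in> D0 - A" "snd b < U" for b s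
          using below[OF that] that D0 p by (intro noncrossing_le[OF nc(2)[of n]] \<theta>(2)) auto
        fix s assume s: "\<bar>s\<bar> \<le> T0"
        show "\<bar>tv f s - tv ?g s\<bar> \<le> e"
        proof (cases "s < U")
          case True
          have "\<not> tv f s + 3 * d < tv ?g s"
          proof
            assume *: "tv f s + 3 * d < tv ?g s"
            have "\<exists>q\<in>D0. snd q < s \<and> tv f s + d < tanh (w q s) \<and> tanh (w q s) < tv ?g s - d"
              by (rule grid) (use * s tv_bounds[of f s] tv_bounds[of ?g s] d in \<open>simp_all add: abs_le_iff\<close>)
            then obtain q where q: "q \<in> D0" "snd q < s" "tv f s + d < tanh (w q s)" "tanh (w q s) < tv ?g s - d"
              by blast
            have "s \<in> {snd q..T}" using q s T0 by auto
            note n1[OF q(1) this] n2[OF q(1) this]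
            then have "tv f s < tv (\<theta> n q) s" "tv (\<theta>' n q) s < tv ?g s" using q by auto
            then have "q \<notin> A" "\<not> q \<in> D0 - A"
              using fA[of q s] gB[of q s] q True by auto
            then show False using q by blast
          qed
          moreover have "\<not> tv ?g s + 3 * d < tv f s"
          proof
            assume *: "tv ?g s + 3 * d < tv f s"
            have "\<exists>q\<in>D0. snd q < s \<and> tv ?g s + d < tanh (w q s) \<and> tanh (w q s) < tv f s - d"
              by (rule grid) (use * s tv_bounds[of f s] tv_bounds[of ?g s] d in \<open>simp_all add: abs_le_iff\<close>)
            then obtain q where q: "q \<in> D0" "snd q < s" "tv ?g s + d < tanh (w q s)" "tanh (w q s) < tv f s - d"
              by blast
            have "s \<in> {snd q..T}" using q s T0 by auto
            note n1[OF q(1) this] n2[OF q(1) this]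
            then have "tv (\<theta> n q) s < tv f s" "tv ?g s < tv (\<theta>' n q) s" using q by auto
            then have "\<not> q \<in> D0 - A" "q \<notin> A"
              using fB[of q s] gA[of q s] q True by auto
            then show False using q by blast
          qed
          ultimately show ?thesis using d by (simp add: d_def)
        next
          case False
          then obtain a b where ab: "a \<in> A" "b \<in> D0 - A" "snd a < U" "snd b < U" "w a s = w b s"
            using U s T0 by auto
          have "s \<in> {snd a..T}" "s \<in> {snd b..T}" "a \<in> D0" using ab False s T0 A by auto
          note n1[OF \<open>a \<in> D0\<close> this(1)] n2[OF \<open>a \<in> D0\<close> this(1)] n1[OF DiffD1[OF ab(2)] this(2)] n2[OF DiffD1[OF ab(2)] this(2)]
          then show ?thesis
            using fA[OF ab(1), of s] fB[OF ab(2), of s] gA[OF ab(1,3), of s] gB[OF ab(2,4), of s] d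
            unfolding ab(5) d_def by linarith
        qed
      qed (use e in \<open>auto simp: T0_def field_simps\<close>)
      then show ?case using \<theta>(2)[OF p(1)] by blast
    qed
  qed
  have "\<forall>\<^sub>F n in sequentially. \<forall>A\<in>Pow D0. \<forall>f\<in>K n. pat n f = A \<longrightarrow> (\<exists>g\<in>K' n. dist f g \<le> e)"
    using D0 ev by (intro eventually_ball_finite) auto
  then show ?thesis by eventually_elim (auto simp: pat_def)
qed

lemma approximatesI:
  assumes "\<And>q. q \<in> D \<Longrightarrow> (\<lambda>n. semipath_from (snd q) (\<theta> n q)) \<longlonglongrightarrow> semipath_of (snd q) (w q)"
  shows "approximates \<theta>"
  unfolding approximates_def
proof (intro ballI allI impI)
  fix q and T e :: real assume q: "q \<in> D" and e: "0 < e"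
  define c where "c = 1 + max \<bar>snd q\<bar> \<bar>T\<bar>"
  have c: "0 < c" by (simp add: c_def add_pos_nonneg)
  have "\<forall>\<^sub>F n in sequentially. dist (semipath_from (snd q) (\<theta> n q)) (semipath_of (snd q) (w q)) < e / c"
    using assms[OF q] e c by (intro tendstoD) auto
  then show "\<forall>\<^sub>F n in sequentially. \<forall>s\<in>{snd q..T}. \<bar>tv (\<theta> n q) s - tanh (w q s)\<bar> \<le> e"
  proof eventually_elim
    case (elim n)
    show ?case
    proof
      fix s assume s: "s \<in> {snd q..T}"
      have "(1 + \<bar>s\<bar>) * dist (semipath_from (snd q) (\<theta> n q)) (semipath_of (snd q) (w q)) \<le> c * (e / c)"
      proof (intro mult_mono)
        show "1 + \<bar>s\<bar> \<le> c" using s unfolding c_def atLeastAtMost_iff by linarith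
      qed (use elim c in auto)
      then show "\<bar>tv (\<theta> n q) s - tanh (w q s)\<bar> \<le> e"
        using semipath_of_dist[OF w_cont[OF q], of s "\<theta> n q"] s c by simp
    qed
  qed
qed

lemma hausdorff_dist_le:
  assumes "K \<noteq> {}" "L \<noteq> {}" "\<And>f. f \<in> K \<Longrightarrow> \<exists>g\<in>L. dist f g \<le> e" "\<And>f. f \<in> L \<Longrightarrow> \<exists>g\<in>K. dist f g \<le> e"
  shows "hausdorff_dist K L \<le> e"
proof -
  have "(SUP x\<in>K. infdist x L) \<le> e" using assms by (intro cSUP_least) (auto intro: infdist_le2)
  moreover have "(SUP x\<in>L. infdist x K) \<le> e" using assms by (intro cSUP_least) (auto intro: infdist_le2)
  ultimately show ?thesis by (simp add: hausdorff_dist_def)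
qed

theorem compatible_tendsto:
  assumes nc: "noncrossing (paths_of K0)" "\<And>n. noncrossing (paths_of (K n))"
    and K0: "\<And>p. p \<in> D \<Longrightarrow> \<exists>f\<in>paths_of K0. semipath_from (snd p) f = semipath_of (snd p) (w p)"
    and K: "\<And>n p. p \<in> D \<Longrightarrow> \<exists>f\<in>paths_of (K n). semipath_from (snd p) f = u n p"
    and u: "\<And>p. p \<in> D \<Longrightarrow> (\<lambda>n. u n p) \<longlonglongrightarrow> semipath_of (snd p) (w p)"
  shows "K \<longlonglongrightarrow> K0"
proof -
  obtain \<theta>0 where \<theta>0: "\<And>p. p \<in> D \<Longrightarrow> \<theta>0 p \<in> paths_of K0"
      "\<And>p. p \<in> D \<Longrightarrow> semipath_from (snd p) (\<theta>0 p) = semipath_of (snd p) (w p)"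
    using K0 by metis
  define \<theta> where "\<theta> n p = (SOME f. f \<in> paths_of (K n) \<and> semipath_from (snd p) f = u n p)" for n p
  have "\<theta> n p \<in> paths_of (K n) \<and> semipath_from (snd p) (\<theta> n p) = u n p" if "p \<in> D" for n p
    unfolding \<theta>_def by (rule someI_ex) (use K[OF that] in blast)
  then have \<theta>: "\<And>n p. p \<in> D \<Longrightarrow> \<theta> n p \<in> paths_of (K n)"
      "\<And>n p. p \<in> D \<Longrightarrow> semipath_from (snd p) (\<theta> n p) = u n p" by blast+
  have K0': "compact (paths_of K0)" "tv (\<theta>0 p) s = tanh (w p s)" if "p \<in> D" "snd p \<le> s" for p s
    using paths_of[of K0] semipath_of_dist[OF w_cont[OF that(1)] that(2), of "\<theta>0 p"] \<theta>0(2)[OF that(1)] by auto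
  have comp: "compact (paths_of K0)" and ne: "paths_of L \<noteq> {}" for L using paths_of[of K0] paths_of[of L] by auto
  have appr: "approximates (\<lambda>_. \<theta>0)" "approximates \<theta>"
    using u \<theta>0 \<theta> by (auto intro!: approximatesI)
  show ?thesis
  proof (rule tendstoI)
    fix e :: real assume "0 < e"
    then have "0 < e / 2" by simp
    have "\<forall>\<^sub>F n in sequentially. \<forall>f\<in>paths_of (K n). \<exists>g\<in>paths_of K0. dist f g \<le> e / 2"
      by (rule one_sided_approximation[of "paths_of K0" \<theta>0 _ _ \<theta> "\<lambda>_. \<theta>0"])
        (fact comp \<theta>0(1) \<theta>(1) K0'(2) nc appr \<open>0 < e / 2\<close>)+
    moreover have "\<forall>\<^sub>F n in sequentially. \<forall>f\<in>paths_of K0. \<exists>g\<in>paths_of (K n). dist f g \<le> e / 2"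
      by (rule one_sided_approximation[of "paths_of K0" \<theta>0 _ _ "\<lambda>_. \<theta>0" \<theta>])
        (fact comp \<theta>0(1) \<theta>(1) K0'(2) nc appr \<open>0 < e / 2\<close>)+
    ultimately
    show "\<forall>\<^sub>F n in sequentially. dist (K n) K0 < e"
    proof eventually_elim
      case (elim n)
      have "hausdorff_dist (paths_of (K n)) (paths_of K0) \<le> e / 2"
        using elim by (intro hausdorff_dist_le ne) auto
      then show ?case using \<open>0 < e\<close> by (simp add: dist_path_compact.rep_eq)
    qed
  qed
qed

end

section \<open>The coalescing rule\<close>

text \<open>Only countably many times are inspected, so that the coalescing construction below is measurable.\<close>

definition meets :: "real \<Rightarrow> real \<Rightarrow> (real \<Rightarrow> real) \<Rightarrow> (real \<Rightarrow> real) \<Rightarrow> bool" where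
  "meets a t f g \<longleftrightarrow> (\<forall>n::nat. \<exists>u\<in>{a..t} \<inter> insert t \<rat>. \<bar>f u - g u\<bar> < 1 / Suc n)"

lemma meets_iff:
  assumes f: "continuous_on {a..} f" and g: "continuous_on {a..} g"
  shows "meets a t f g \<longleftrightarrow> (\<exists>u\<in>{a..t}. f u = g u)"
proof
  assume m: "meets a t f g"
  then have at: "a \<le> t" by (auto simp: meets_def)
  have cont: "continuous_on {a..t} (\<lambda>u. \<bar>f u - g u\<bar>)"
    by (intro continuous_intros continuous_on_subset[OF f] continuous_on_subset[OF g]) auto
  obtain u where u: "u \<in> {a..t}" "\<And>v. v \<in> {a..t} \<Longrightarrow> \<bar>f u - g u\<bar> \<le> \<bar>f v - g v\<bar>"
    using continuous_attains_inf[OF _ _ cont] at by auto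
  have "f u = g u"
  proof (rule ccontr)
    assume "f u \<noteq> g u"
    then obtain n where n: "1 / Suc n < \<bar>f u - g u\<bar>" by (metis nat_approx_posE right_minus_eq zero_less_abs_iff)
    obtain v where "v \<in> {a..t}" "\<bar>f v - g v\<bar> < 1 / Suc n" using m unfolding meets_def by blast
    then show False using u(2)[of v] n by linarith
  qed
  then show "\<exists>u\<in>{a..t}. f u = g u" using u by blast
next
  assume "\<exists>u\<in>{a..t}. f u = g u"
  then obtain u where u: "a \<le> u" "u \<le> t" "f u = g u" by auto
  show "meets a t f g" unfolding meets_def
  proof
    fix n :: nat
    show "\<exists>v\<in>{a..t} \<inter> insert t \<rat>. \<bar>f v - g v\<bar> < 1 / Suc n"
    proof (cases "u = t")
      case True
      then show ?thesis using u by (intro bexI[of _ t]) auto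
    next
      case False
      have "continuous_on {a..} (\<lambda>u. f u - g u)" by (intro continuous_intros f g)
      then obtain d where d: "d > 0" "\<And>v. v \<in> {a..} \<Longrightarrow> dist v u < d \<Longrightarrow> dist (f v - g v) (f u - g u) < 1 / Suc n"
        unfolding continuous_on_iff using u(1) by (metis atLeast_iff of_nat_0_less_iff zero_less_Suc zero_less_divide_1_iff)
      have "u < min t (u + d)" using u False d by auto
      then obtain v where v: "v \<in> \<rat>" "u < v" "v < min t (u + d)" using Rats_dense_in_real by blast
      then have "dist (f v - g v) (f u - g u) < 1 / Suc n" using u by (intro d(2)) (auto simp: dist_real_def)
      then show ?thesis using u v by (intro bexI[of _ v]) (auto simp: dist_real_def)
    qed
  qed
qed

definition absorb :: "real \<Rightarrow> (real \<Rightarrow> real) \<Rightarrow> (real \<Rightarrow> real) \<Rightarrow> real \<Rightarrow> real" where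
  "absorb a f g t = (if meets a t f g then g t else f t)"

lemma first_meeting:
  fixes f g :: "real \<Rightarrow> real"
  assumes "continuous_on {a..} f" "continuous_on {a..} g" "a \<le> u" "f u = g u"
  obtains \<tau> where "a \<le> \<tau>" "f \<tau> = g \<tau>" "\<And>v. a \<le> v \<Longrightarrow> f v = g v \<Longrightarrow> \<tau> \<le> v"
proof -
  let ?S = "{a..} \<inter> (\<lambda>v. f v - g v) -` {0}"
  have "closed ?S" by (intro continuous_closed_preimage continuous_intros assms)
  moreover have "?S \<noteq> {}" using assms by auto
  moreover have bdd: "bdd_below ?S" by (intro bdd_belowI[of _ a]) auto
  ultimately have "Inf ?S \<in> ?S" by (intro closed_contains_Inf)
  moreover have "Inf ?S \<le> v" if "a \<le> v" "f v = g v" for v using that by (intro cInf_lower bdd) auto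
  ultimately show ?thesis using that[of "Inf ?S"] by auto
qed

lemma absorb_cases [consumes 2, case_names never at]:
  assumes "continuous_on {a..} f" "continuous_on {a..} g"
  obtains (never) "\<And>u. a \<le> u \<Longrightarrow> f u \<noteq> g u" "absorb a f g = f"
  | (at) \<tau> where "a \<le> \<tau>" "f \<tau> = g \<tau>" "\<And>u. a \<le> u \<Longrightarrow> u < \<tau> \<Longrightarrow> f u \<noteq> g u"
      "\<And>t. t \<le> \<tau> \<Longrightarrow> absorb a f g t = f t" "\<And>t. \<tau> \<le> t \<Longrightarrow> absorb a f g t = g t"
proof (cases "\<exists>u\<ge>a. f u = g u")
  case False
  then have "absorb a f g = f" by (auto simp: absorb_def meets_iff[OF assms])
  then show ?thesis using False by (intro never) auto
next
  case True
  then obtain \<tau> where \<tau>: "a \<le> \<tau>" "f \<tau> = g \<tau>" "\<And>v. a \<le> v \<Longrightarrow> f v = g v \<Longrightarrow> \<tau> \<le> v"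
    using first_meeting[OF assms] by metis
  show ?thesis
  proof (rule at[OF \<tau>(1,2)])
    show "f u \<noteq> g u" if "a \<le> u" "u < \<tau>" for u using \<tau>(3)[of u] that by auto
    show "absorb a f g t = g t" if "\<tau> \<le> t" for t
      using \<tau> that by (auto simp: absorb_def meets_iff[OF assms])
    show "absorb a f g t = f t" if "t \<le> \<tau>" for t
    proof (cases "t = \<tau>")
      case True
      then show ?thesis using \<tau> by (auto simp: absorb_def)
    next
      case False
      then have "\<not> (\<exists>u\<in>{a..t}. f u = g u)" using \<tau>(3) that by fastforce
      then show ?thesis by (simp add: absorb_def meets_iff[OF assms])
    qed
  qed
qed

lemma absorb_continuous:
  assumes f: "continuous_on {s..} f" and g: "continuous_on {c..} g"
  shows "continuous_on {s..} (absorb (max s c) f g)"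
proof -
  have f': "continuous_on {max s c..} f" and g': "continuous_on {max s c..} g"
    by (intro continuous_on_subset[OF f] continuous_on_subset[OF g]; auto)+
  show ?thesis
    using f' g'
  proof (cases rule: absorb_cases)
    case never
    then show ?thesis using f by simp
  next
    case (at \<tau>)
    have c: "continuous_on {s..} (\<lambda>t. if t \<le> \<tau> then f t else g t)"
      by (intro continuous_on_cases_le continuous_on_subset[OF f] continuous_on_subset[OF g] continuous_intros)
        (use at in auto)
    have eq: "(\<lambda>t. if t \<le> \<tau> then f t else g t) = absorb (max s c) f g" using at by auto
    show ?thesis using c unfolding eq .
  qed
qed

context
  fixes a :: "nat \<Rightarrow> real" and R :: "nat set" and b :: "nat \<Rightarrow> real \<Rightarrow> real"
begin

primrec absorb_upto :: "(nat \<Rightarrow> real \<Rightarrow> real) \<Rightarrow> nat \<Rightarrow> nat \<Rightarrow> real \<Rightarrow> real" where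
  "absorb_upto W k 0 = b k"
| "absorb_upto W k (Suc j) = (if j \<in> R then absorb (max (a k) (a j)) (absorb_upto W k j) (W j)
     else absorb_upto W k j)"

primrec sols :: "nat \<Rightarrow> nat \<Rightarrow> real \<Rightarrow> real" where
  "sols 0 = (\<lambda>_ _. 0)"
| "sols (Suc k) = (sols k)(k := absorb_upto (sols k) k k)"

definition sol :: "nat \<Rightarrow> real \<Rightarrow> real" where
  "sol k = sols (Suc k) k"

lemma sols_eq: "j < k \<Longrightarrow> sols k j = sol j"
  by (induction k) (auto simp: sol_def less_Suc_eq)

lemma absorb_upto_cong: "(\<And>j. j < i \<Longrightarrow> W j = W' j) \<Longrightarrow> absorb_upto W k i = absorb_upto W' k i"
  by (induction i) auto

lemma sol_rec: "sol k = absorb_upto sol k k"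
proof -
  have "sol k = absorb_upto (sols k) k k" by (simp add: sol_def)
  also have "\<dots> = absorb_upto sol k k" by (rule absorb_upto_cong) (simp add: sols_eq)
  finally show ?thesis .
qed

end

lemma absorb_upto_props:
  assumes b: "continuous_on {a k..} (b k)"
    and W: "\<And>j. j < i \<Longrightarrow> j \<in> R \<Longrightarrow> continuous_on {a j..} (W j)"
    and coal: "\<And>j j' u t. j < i \<Longrightarrow> j' < i \<Longrightarrow> j \<in> R \<Longrightarrow> j' \<in> R \<Longrightarrow> a j \<le> u \<Longrightarrow> a j' \<le> u \<Longrightarrow>
      W j u = W j' u \<Longrightarrow> u \<le> t \<Longrightarrow> W j t = W j' t"
  defines "f \<equiv> absorb_upto a R b W k"
  shows "continuous_on {a k..} (f i) \<and> f i (a k) = b k (a k) \<and>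
    (\<forall>j<i. j \<in> R \<longrightarrow> (\<forall>u t. a k \<le> u \<longrightarrow> a j \<le> u \<longrightarrow> W j u = f i u \<longrightarrow> u \<le> t \<longrightarrow> W j t = f i t)) \<and>
    (\<forall>t\<ge>a k. (\<forall>j<i. j \<in> R \<longrightarrow> (\<forall>u. a k \<le> u \<longrightarrow> a j \<le> u \<longrightarrow> u \<le> t \<longrightarrow> W j u \<noteq> f i u)) \<longrightarrow> f i t = b k t)"
  using W coal
proof (induction i)
  case 0
  then show ?case using b by (auto simp: f_def)
next
  case (Suc i)
  have IH: "continuous_on {a k..} (f i)" "f i (a k) = b k (a k)"
    "\<And>j u t. j < i \<Longrightarrow> j \<in> R \<Longrightarrow> a k \<le> u \<Longrightarrow> a j \<le> u \<Longrightarrow> W j u = f i u \<Longrightarrow> u \<le> t \<Longrightarrow> W j t = f i t"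
    "\<And>t. a k \<le> t \<Longrightarrow> (\<And>j u. j < i \<Longrightarrow> j \<in> R \<Longrightarrow> a k \<le> u \<Longrightarrow> a j \<le> u \<Longrightarrow> u \<le> t \<Longrightarrow> W j u \<noteq> f i u) \<Longrightarrow> f i t = b k t"
  proof -
    have *: "continuous_on {a k..} (f i) \<and> f i (a k) = b k (a k) \<and>
    (\<forall>j<i. j \<in> R \<longrightarrow> (\<forall>u t. a k \<le> u \<longrightarrow> a j \<le> u \<longrightarrow> W j u = f i u \<longrightarrow> u \<le> t \<longrightarrow> W j t = f i t)) \<and>
    (\<forall>t\<ge>a k. (\<forall>j<i. j \<in> R \<longrightarrow> (\<forall>u. a k \<le> u \<longrightarrow> a j \<le> u \<longrightarrow> u \<le> t \<longrightarrow> W j u \<noteq> f i u)) \<longrightarrow> f i t = b k t)"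
      by (rule Suc.IH; rule Suc.prems; simp)
    show "continuous_on {a k..} (f i)" "f i (a k) = b k (a k)" using * by blast+
    show "\<And>j u t. j < i \<Longrightarrow> j \<in> R \<Longrightarrow> a k \<le> u \<Longrightarrow> a j \<le> u \<Longrightarrow> W j u = f i u \<Longrightarrow> u \<le> t \<Longrightarrow> W j t = f i t"
      using * by blast
    show "\<And>t. a k \<le> t \<Longrightarrow> (\<And>j u. j < i \<Longrightarrow> j \<in> R \<Longrightarrow> a k \<le> u \<Longrightarrow> a j \<le> u \<Longrightarrow> u \<le> t \<Longrightarrow> W j u \<noteq> f i u) \<Longrightarrow> f i t = b k t"
      using * by blast
  qed
  show ?case
  proof (cases "i \<in> R")
    case False
    then have eq: "f (Suc i) = f i" by (simp add: f_def)
    have lt: "j < i" if "j < Suc i" "j \<in> R" for j using that False by (cases "j = i") auto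
    show ?thesis unfolding eq
      using IH(1,2) by (intro conjI allI impI) (auto intro: IH(3) lt simp: less_Suc_eq intro!: IH(4))
  next
    case True
    let ?c = "max (a k) (a i)"
    have f: "f (Suc i) = absorb ?c (f i) (W i)" using True by (simp add: f_def)
    have Wi: "continuous_on {a i..} (W i)" using Suc.prems True by simp
    have cf: "continuous_on {?c..} (f i)" "continuous_on {?c..} (W i)"
      by (intro continuous_on_subset[OF IH(1)] continuous_on_subset[OF Wi]; auto)+
    have cont: "continuous_on {a k..} (f (Suc i))" unfolding f by (intro absorb_continuous IH Wi)
    show ?thesis
      using cf
    proof (cases rule: absorb_cases)
      case never
      then have eq: "f (Suc i) = f i" by (simp add: f)
      have "W i u \<noteq> f i u" if "a k \<le> u" "a i \<le> u" for u using never(1)[of u] that by auto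
      then show ?thesis unfolding eq
        using IH(1,2) by (intro conjI allI impI) (auto intro: IH(3) simp: less_Suc_eq intro!: IH(4))
    next
      case (at \<tau>)
      have before: "f (Suc i) t = f i t" if "t \<le> \<tau>" for t using at that by (simp add: f)
      have after: "f (Suc i) t = W i t" if "\<tau> \<le> t" for t using at that by (simp add: f)
      have \<tau>: "a k \<le> \<tau>" "a i \<le> \<tau>" using at(1) by auto
      have start: "f (Suc i) (a k) = b k (a k)" using before[OF \<tau>(1)] IH(2) by simp
      have co: "W j t = f (Suc i) t"
        if j: "j < Suc i" "j \<in> R" and u: "a k \<le> u" "a j \<le> u" "W j u = f (Suc i) u" "u \<le> t" for j u t
      proof (cases "\<tau> \<le> u")
        case True
        then have "W j u = W i u" using u after by simp
        then have "W j t = W i t" using Suc.prems(2)[of j i u t] j \<open>i \<in> R\<close> u \<tau> True by simp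
        then show ?thesis using after[of t] True u by simp
      next
        case False
        then have ju: "W j u = f i u" using before[of u] u by simp
        then have "j \<noteq> i" using at(3)[of u] False u by auto
        then have "j < i" using j by simp
        note eq = IH(3)[OF this j(2) u(1,2) ju]
        show ?thesis
        proof (cases "t \<le> \<tau>")
          case True
          then show ?thesis using eq[OF u(4)] before by simp
        next
          case False
          have "W j \<tau> = W i \<tau>" using eq[of \<tau>] at(2) \<open>\<not> \<tau> \<le> u\<close> by simp
          then have "W j t = W i t" using Suc.prems(2)[of j i \<tau> t] j \<open>i \<in> R\<close> u \<tau> False \<open>\<not> \<tau> \<le> u\<close> by simp
          then show ?thesis using after[of t] False by simp
        qed
      qed
      have fol: "f (Suc i) t = b k t"
        if t: "a k \<le> t" and no: "\<And>j u. j < Suc i \<Longrightarrow> j \<in> R \<Longrightarrow> a k \<le> u \<Longrightarrow> a j \<le> u \<Longrightarrow> u \<le> t \<Longrightarrow> W j u \<noteq> f (Suc i) u" for t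
      proof -
        have "t < \<tau>" using no[of i \<tau>] after[of \<tau>] \<tau> \<open>i \<in> R\<close> by fastforce
        moreover have "f i t = b k t"
        proof (rule IH(4)[OF t])
          fix j u assume "j < i" "j \<in> R" "a k \<le> u" "a j \<le> u" "u \<le> t"
          then show "W j u \<noteq> f i u" using no[of j u] before[of u] \<open>t < \<tau>\<close> by simp
        qed
        ultimately show ?thesis using before[of t] by simp
      qed
      show ?thesis using cont start co fol by blast
    qed
  qed
qed

lemma sol_props:
  assumes b: "\<forall>k\<in>R. continuous_on {a k..} (b k)" and k: "k \<in> R"
  defines "W \<equiv> sol a R b"
  shows "continuous_on {a k..} (W k) \<and> W k (a k) = b k (a k) \<and>
    (\<forall>j<k. j \<in> R \<longrightarrow> (\<forall>u t. a k \<le> u \<longrightarrow> a j \<le> u \<longrightarrow> W j u = W k u \<longrightarrow> u \<le> t \<longrightarrow> W j t = W k t)) \<and>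
    (\<forall>t\<ge>a k. (\<forall>j<k. j \<in> R \<longrightarrow> (\<forall>u. a k \<le> u \<longrightarrow> a j \<le> u \<longrightarrow> u \<le> t \<longrightarrow> W j u \<noteq> W k u)) \<longrightarrow> W k t = b k t)"
  using k
proof (induction k rule: less_induct)
  case (less k)
  have W: "W k = absorb_upto a R b W k k" unfolding W_def by (rule sol_rec)
  have co: "W j t = W k' t" if "j < k'" "k' < k" "j \<in> R" "k' \<in> R" "a j \<le> u" "a k' \<le> u" "W j u = W k' u" "u \<le> t" for j k' u t
    using less.IH[OF that(2,4)] that by blast
  have co': "W j t = W j' t" if "j < k" "j' < k" "j \<in> R" "j' \<in> R" "a j \<le> u" "a j' \<le> u" "W j u = W j' u" "u \<le> t" for j j' u t
  proof (cases j j' rule: linorder_cases)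
    case less
    then show ?thesis using co that by blast
  next
    case greater
    then show ?thesis using co[of j' j u t] that by simp
  qed simp
  have c: "continuous_on {a j..} (W j)" if "j < k" "j \<in> R" for j using less.IH[OF that] by blast
  show ?case
    by (rule absorb_upto_props[where W = W and a = a and R = R and b = b and k = k and i = k, unfolded W[symmetric]])
      (fact bspec[OF b less.prems] c co')+
qed

lemma coalescedI:
  assumes "\<And>p t. p \<in> D \<Longrightarrow> snd p \<le> t \<Longrightarrow>
      (\<And>q u. q \<in> D \<Longrightarrow> r q < r p \<Longrightarrow> snd p \<le> u \<Longrightarrow> snd q \<le> u \<Longrightarrow> u \<le> t \<Longrightarrow> w q u \<noteq> w p u) \<Longrightarrow> w p t = b p t"
    and "\<And>p q u t. p \<in> D \<Longrightarrow> q \<in> D \<Longrightarrow> snd p \<le> u \<Longrightarrow> snd q \<le> u \<Longrightarrow> w p u = w q u \<Longrightarrow> u \<le> t \<Longrightarrow> w p t = w q t"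
  shows "coalesced D r b w"
  unfolding coalesced_def max.bounded_iff
proof (intro conjI ballI allI impI)
  fix p t assume p: "p \<in> D" "snd p \<le> t" and
    no: "\<forall>q\<in>D. r q < r p \<longrightarrow> (\<forall>u\<in>{max (snd p) (snd q)..t}. w q u \<noteq> w p u)"
  show "w p t = b p t"
  proof (rule assms(1)[OF p])
    fix q u assume "q \<in> D" "r q < r p" "snd p \<le> u" "snd q \<le> u" "u \<le> t"
    then show "w q u \<noteq> w p u" using no[THEN bspec, of q] by simp
  qed
next
  fix p q u t assume "p \<in> D" "q \<in> D" "snd p \<le> u \<and> snd q \<le> u" "w p u = w q u" "u \<le> t"
  then show "w p t = w q t" by (elim conjE) (rule assms(2))
qed

definition csol ::
    "(real \<times> real) set \<Rightarrow> (real \<times> real \<Rightarrow> nat) \<Rightarrow> (real \<times> real \<Rightarrow> real \<Rightarrow> real) \<Rightarrow> real \<times> real \<Rightarrow> real \<Rightarrow> real"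
  where
  "csol D r b p = sol (\<lambda>k. snd (inv_into D r k)) (r ` D) (\<lambda>k. b (inv_into D r k)) (r p)"

context
  fixes D :: "(real \<times> real) set" and r :: "real \<times> real \<Rightarrow> nat" and b :: "real \<times> real \<Rightarrow> real \<Rightarrow> real"
  assumes inj: "inj_on r D" and b: "\<And>p. p \<in> D \<Longrightarrow> continuous_on {snd p..} (b p)"
begin

lemma csol_props:
  assumes "p \<in> D"
  shows "continuous_on {snd p..} (csol D r b p)" "csol D r b p (snd p) = b p (snd p)"
    "\<And>q u t. q \<in> D \<Longrightarrow> r q < r p \<Longrightarrow> snd p \<le> u \<Longrightarrow> snd q \<le> u \<Longrightarrow> csol D r b q u = csol D r b p u \<Longrightarrow> u \<le> t \<Longrightarrow>
      csol D r b q t = csol D r b p t"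
    "\<And>t. snd p \<le> t \<Longrightarrow> (\<And>q u. q \<in> D \<Longrightarrow> r q < r p \<Longrightarrow> snd p \<le> u \<Longrightarrow> snd q \<le> u \<Longrightarrow> u \<le> t \<Longrightarrow>
      csol D r b q u \<noteq> csol D r b p u) \<Longrightarrow> csol D r b p t = b p t"
proof -
  let ?z = "inv_into D r"
  have z [simp]: "?z (r q) = q" if "q \<in> D" for q using inj that by simp
  have c: "\<forall>k\<in>r ` D. continuous_on {snd (?z k)..} (b (?z k))"
    by (intro ballI b inv_into_into)
  let ?a = "\<lambda>k. snd (?z k)" and ?b = "\<lambda>k. b (?z k)"
  let ?W = "sol ?a (r ` D) ?b"
  have rp: "r p \<in> r ` D" using assms by simp
  have W: "?W (r p) = csol D r b p" by (simp add: csol_def)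
  note * = sol_props[where a = ?a and R = "r ` D" and b = ?b, OF c rp, unfolded W z[OF assms]]
  show "continuous_on {snd p..} (csol D r b p)" "csol D r b p (snd p) = b p (snd p)"
    using *[THEN conjunct1] *[THEN conjunct2, THEN conjunct1] by simp_all
  note 3 = *[THEN conjunct2, THEN conjunct2, THEN conjunct1, rule_format]
    and 4 = *[THEN conjunct2, THEN conjunct2, THEN conjunct2, rule_format]
  show "csol D r b q t = csol D r b p t"
    if "q \<in> D" "r q < r p" "snd p \<le> u" "snd q \<le> u" "csol D r b q u = csol D r b p u" "u \<le> t" for q u t
    using 3[OF that(2), of u t] that unfolding csol_def by simp
  show "csol D r b p t = b p t"
    if t: "snd p \<le> t" and no: "\<And>q u. q \<in> D \<Longrightarrow> r q < r p \<Longrightarrow> snd p \<le> u \<Longrightarrow> snd q \<le> u \<Longrightarrow> u \<le> t \<Longrightarrow>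
      csol D r b q u \<noteq> csol D r b p u" for t
  proof (rule 4[OF t])
    fix j u assume j: "j < r p" "j \<in> r ` D" "snd p \<le> u" "snd (?z j) \<le> u" "u \<le> t"
    then have "?z j \<in> D" "r (?z j) = j" by (auto intro: inv_into_into f_inv_into_f)
    then show "?W j u \<noteq> csol D r b p u" using no[of "?z j" u] j by (simp add: csol_def)
  qed
qed

lemma csol_coalesced: "coalesced D r b (csol D r b)"
proof (rule coalescedI)
  show "csol D r b p t = csol D r b q t"
    if "p \<in> D" "q \<in> D" "snd p \<le> u" "snd q \<le> u" "csol D r b p u = csol D r b q u" "u \<le> t" for p q u t
  proof (cases "r p" "r q" rule: linorder_cases)
    case less
    show ?thesis by (rule csol_props(3)[OF that(2,1) less that(4,3,5,6)])
  next
    case equal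
    have "p = q" by (rule inj_onD[OF inj equal that(1,2)])
    then show ?thesis by (rule arg_cong)
  next
    case greater
    show ?thesis by (rule sym, rule csol_props(3)[OF that(1,2) greater that(3,4) that(5)[symmetric] that(6)])
  qed
qed (rule csol_props(4))

end

lemma coalesced_follow:
  assumes co: "coalesced D r b w" and p: "p \<in> D" and t: "snd p \<le> t"
    and no: "\<And>q u. q \<in> D \<Longrightarrow> r q < r p \<Longrightarrow> snd p \<le> u \<Longrightarrow> snd q \<le> u \<Longrightarrow> u \<le> t \<Longrightarrow> w q u \<noteq> w p u"
  shows "w p t = b p t"
proof (rule co[unfolded coalesced_def, THEN conjunct1, THEN bspec, OF p, THEN spec, THEN mp, OF t, THEN mp])
  show "\<forall>q\<in>D. r q < r p \<longrightarrow> (\<forall>u\<in>{max (snd p) (snd q)..t}. w q u \<noteq> w p u)"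
    by (intro ballI impI, rule no) simp_all
qed

lemma coalesced_meet:
  assumes co: "coalesced D r b w" and pq: "p \<in> D" "q \<in> D" and u: "snd p \<le> u" "snd q \<le> u"
    and "w p u = w q u" "u \<le> t"
  shows "w p t = w q t"
  using co[unfolded coalesced_def, THEN conjunct2, THEN bspec, OF pq(1), THEN bspec, OF pq(2), THEN spec, of u] u assms(6,7)
  by simp

lemma continuous_eq_at_right_endpoint:
  fixes f g :: "real \<Rightarrow> real"
  assumes "continuous_on {a..} f" "continuous_on {a..} g" "a < u" "\<And>s. a \<le> s \<Longrightarrow> s < u \<Longrightarrow> f s = g s"
  shows "f u = g u"
proof -
  have cl: "closure {a..<u} = {a..u}" using assms(3) by (rule closure_atLeastLessThan)
  have "continuous_on (closure {a..<u}) (\<lambda>s. f s - g s)" unfolding cl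
    by (intro continuous_intros continuous_on_subset[OF assms(1)] continuous_on_subset[OF assms(2)]) auto
  from continuous_constant_on_closure[OF this, of 0 u] show ?thesis
    using assms(3,4) by (simp add: cl)
qed

lemma coalesced_unique:
  assumes inj: "inj_on r D" and co: "coalesced D r b w" "coalesced D r b w'"
    and c: "\<And>p. p \<in> D \<Longrightarrow> continuous_on {snd p..} (w p)" "\<And>p. p \<in> D \<Longrightarrow> continuous_on {snd p..} (w' p)"
    and start: "\<And>p. p \<in> D \<Longrightarrow> w p (snd p) = w' p (snd p)"
  shows "p \<in> D \<Longrightarrow> snd p \<le> t \<Longrightarrow> w p t = w' p t"
proof (induction "r p" arbitrary: p t rule: less_induct)
  case less
  note p = less.prems(1)
  define Q where "Q = {q\<in>D. r q < r p}"
  define M where "M v q = {max (snd p) (snd q)..} \<inter> (\<lambda>u. v q u - v p u) -` {0}"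
    for v :: "real \<times> real \<Rightarrow> real \<Rightarrow> real" and q
  define N where "N = (\<Union>q\<in>Q. M w q \<union> M w' q)"
  have IH: "w q u = w' q u" if "q \<in> Q" "snd q \<le> u" for q u using less.hyps[of q u] that by (simp add: Q_def)
  have "inj_on r Q" using inj by (rule inj_on_subset) (auto simp: Q_def)
  moreover have "r ` Q \<subseteq> {..<r p}" by (auto simp: Q_def)
  ultimately have "finite Q" by (meson finite_imageD finite_lessThan finite_subset)
  moreover have "closed (M v q)" if "q \<in> Q" "v \<in> {w, w'}" for v q
  proof -
    have "q \<in> D" using that by (simp add: Q_def)
    then have "continuous_on {snd q..} (v q)" "continuous_on {snd p..} (v p)" using that(2) by (elim insertE; simp add: c p)+
    then show ?thesis unfolding M_def
      by (intro continuous_closed_preimage continuous_intros closed_atLeast closed_singleton;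
          elim continuous_on_subset; simp)
  qed
  ultimately have closed: "closed N" unfolding N_def by (intro closed_UN ballI closed_Un) auto
  have bdd: "bdd_below N" by (intro bdd_belowI[of _ "snd p"]) (auto simp: N_def M_def)
  have before: "w p t = w' p t" if t: "snd p \<le> t" and no: "\<And>u. u \<le> t \<Longrightarrow> u \<notin> N" for t
  proof -
    have *: "v q u \<noteq> v p u"
      if "q \<in> D" "r q < r p" "snd p \<le> u" "snd q \<le> u" "u \<le> t" "v \<in> {w, w'}" for q u v
    proof
      assume "v q u = v p u"
      then have "u \<in> M v q" "q \<in> Q" using that by (simp_all add: M_def Q_def)
      then have "u \<in> N" using that(6) unfolding N_def by blast
      then show False using no that(5) by blast
    qed
    have "w p t = b p t" by (rule coalesced_follow[OF co(1) p t]) (rule *; simp)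
    moreover have "w' p t = b p t" by (rule coalesced_follow[OF co(2) p t]) (rule *; simp)
    ultimately show ?thesis by simp
  qed
  show ?case
  proof (cases "\<exists>u\<le>t. u \<in> N")
    case False
    then show ?thesis using before less.prems(2) by blast
  next
    case True
    then obtain u' where u': "u' \<le> t" "u' \<in> N" by blast
    define u where "u = Inf N"
    have uN: "u \<in> N" unfolding u_def using u' by (intro closed_contains_Inf closed bdd) auto
    have le: "u \<le> v" if "v \<in> N" for v unfolding u_def using that by (rule cInf_lower[OF _ bdd])
    have ut: "u \<le> t" using le[OF u'(2)] u'(1) by simp
    have pu: "snd p \<le> u" using uN by (auto simp: N_def M_def)
    have eq: "w p u = w' p u"
    proof (cases "snd p = u")
      case True
      then show ?thesis using start[OF p] by simp
    next
      case False
      show ?thesis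
      proof (rule continuous_eq_at_right_endpoint[OF c(1)[OF p] c(2)[OF p]])
        fix s assume s: "snd p \<le> s" "s < u"
        then have "v \<notin> N" if "v \<le> s" for v using le[of v] that by fastforce
        then show "w p s = w' p s" using before s by blast
      qed (use False pu in simp)
    qed
    obtain q where q: "q \<in> Q" "snd q \<le> u" "w q u = w p u \<or> w' q u = w' p u"
      using uN by (auto simp: N_def M_def)
    have qD: "q \<in> D" using q by (simp add: Q_def)
    have qu: "w q u = w' q u" and qt: "w q t = w' q t" using IH[OF q(1)] q(2) ut by auto
    have 1: "w p u = w q u" and 2: "w' p u = w' q u" using q(3) qu eq by argo+
    have "w p t = w q t" by (rule coalesced_meet[OF co(1) p qD pu q(2) 1 ut])
    also have "\<dots> = w' p t" unfolding qt
      by (rule coalesced_meet[OF co(2) p qD pu q(2) 2 ut, symmetric])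
    finally show ?thesis .
  qed
qed

lemma pred_countable_Bex:
  assumes "countable X" "\<And>i. i \<in> X \<Longrightarrow> Measurable.pred M (P i)"
  shows "Measurable.pred M (\<lambda>x. \<exists>i\<in>X. P i x)"
  unfolding pred_def
  by (rule sets.sets_Collect_countable_Ex'[OF assms(2)[unfolded pred_def] assms(1)])

lemma pred_meets [measurable]:
  assumes "\<And>u. a \<le> u \<Longrightarrow> u \<le> t \<Longrightarrow> (\<lambda>\<omega>. f \<omega> u) \<in> borel_measurable M"
    "\<And>u. a \<le> u \<Longrightarrow> u \<le> t \<Longrightarrow> (\<lambda>\<omega>. g \<omega> u) \<in> borel_measurable M"
  shows "Measurable.pred M (\<lambda>\<omega>. meets a t (f \<omega>) (g \<omega>))"
  unfolding meets_def
proof (intro pred_intros_countable(1))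
  fix n :: nat
  show "Measurable.pred M (\<lambda>\<omega>. \<exists>u\<in>{a..t} \<inter> insert t \<rat>. \<bar>f \<omega> u - g \<omega> u\<bar> < 1 / real (Suc n))"
  proof (rule pred_countable_Bex)
    show "countable ({a..t} \<inter> insert t \<rat>)" by (intro countable_Int2) (simp add: countable_rat)
    fix u assume "u \<in> {a..t} \<inter> insert t \<rat>"
    then have [measurable]: "(\<lambda>\<omega>. f \<omega> u) \<in> borel_measurable M" "(\<lambda>\<omega>. g \<omega> u) \<in> borel_measurable M"
      using assms by auto
    show "Measurable.pred M (\<lambda>\<omega>. \<bar>f \<omega> u - g \<omega> u\<bar> < 1 / real (Suc n))" by measurable
  qed
qed

lemma measurable_sol:
  assumes "\<And>j u. j \<in> R \<Longrightarrow> j \<le> k \<Longrightarrow> a j \<le> u \<Longrightarrow> u \<le> t \<Longrightarrow> (\<lambda>\<omega>. b \<omega> j u) \<in> borel_measurable M"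
    and "k \<in> R" "a k \<le> s" "s \<le> t"
  shows "(\<lambda>\<omega>. sol a R (b \<omega>) k s) \<in> borel_measurable M"
  using assms
proof (induction k arbitrary: s rule: less_induct)
  case (less k)
  have "(\<lambda>\<omega>. absorb_upto a R (b \<omega>) (sol a R (b \<omega>)) k i s) \<in> borel_measurable M"
    if "i \<le> k" "a k \<le> s" "s \<le> t" for i s
    using that
  proof (induction i arbitrary: s)
    case 0
    then show ?case using less.prems(1)[of k s] less.prems(2) by simp
  next
    case (Suc i)
    show ?case
    proof (cases "i \<in> R")
      case True
      have W: "(\<lambda>\<omega>. sol a R (b \<omega>) i u) \<in> borel_measurable M" if "a i \<le> u" "u \<le> t" for u
      proof (rule less.IH)
        show "(\<lambda>\<omega>. b \<omega> j u) \<in> borel_measurable M" if "j \<in> R" "j \<le> i" "a j \<le> u" "u \<le> t" for j u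
          using that Suc.prems(1) by (intro less.prems(1)) auto
      qed (use True Suc.prems that in auto)
      have f: "(\<lambda>\<omega>. absorb_upto a R (b \<omega>) (sol a R (b \<omega>)) k i u) \<in> borel_measurable M" if "a k \<le> u" "u \<le> t" for u
        using Suc.IH[of u] Suc.prems that by simp
      have [measurable]: "Measurable.pred M (\<lambda>\<omega>. meets (max (a k) (a i)) s
          (absorb_upto a R (b \<omega>) (sol a R (b \<omega>)) k i) (sol a R (b \<omega>) i))"
        using Suc.prems by (intro pred_meets f W) auto
      show ?thesis
      proof (cases "a i \<le> s")
        case ai: True
        note [measurable] = W[OF ai \<open>s \<le> t\<close>] f[OF Suc.prems(2,3)]
        show ?thesis using True by (simp add: absorb_def)
      next
        case False
        then have "\<not> meets (max (a k) (a i)) s g h" for g h by (auto simp: meets_def)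
        then show ?thesis using True f[OF Suc.prems(2,3)] by (simp add: absorb_def)
      qed
    next
      case False
      then show ?thesis using Suc.IH[of s] Suc.prems by simp
    qed
  qed
  from this[of k s] less.prems show ?case by (subst sol_rec) simp
qed

lemma measurable_csol:
  assumes "inj_on r D" "p \<in> D" "snd p \<le> s" "s \<le> t"
    and "\<And>q u. q \<in> D \<Longrightarrow> r q \<le> r p \<Longrightarrow> snd q \<le> u \<Longrightarrow> u \<le> t \<Longrightarrow> (\<lambda>\<omega>. b \<omega> q u) \<in> borel_measurable M"
  shows "(\<lambda>\<omega>. csol D r (b \<omega>) p s) \<in> borel_measurable M"
  unfolding csol_def
proof (rule measurable_sol[where t = t])
  show "(\<lambda>\<omega>. b \<omega> (inv_into D r j) u) \<in> borel_measurable M"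
    if "j \<in> r ` D" "j \<le> r p" "snd (inv_into D r j) \<le> u" "u \<le> t" for j u
    using that by (intro assms(5) inv_into_into) (auto simp: f_inv_into_f)
qed (use assms in \<open>auto simp: inv_into_f_f\<close>)

section \<open>Laws of families of random variables\<close>

definition law :: "'a measure \<Rightarrow> 'i set \<Rightarrow> ('i \<Rightarrow> 'a \<Rightarrow> real) \<Rightarrow> ('i \<Rightarrow> real) measure" where
  "law M K X = distr M (PiM K (\<lambda>_. borel)) (\<lambda>\<omega>. \<lambda>i\<in>K. X i \<omega>)"

definition unit_continuous :: "('i \<Rightarrow> real \<Rightarrow> real) \<Rightarrow> bool" where
  "unit_continuous f \<longleftrightarrow> (\<forall>i. continuous_on UNIV (f i)) \<and> (\<forall>i x. 0 \<le> f i x \<and> f i x \<le> 1)"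

lemma unit_continuousD:
  assumes "unit_continuous f"
  shows "f i \<in> borel_measurable borel" "0 \<le> f i x" "f i x \<le> 1" "isCont (f i) x"
  using assms by (auto simp: unit_continuous_def continuous_on_eq_continuous_at intro: borel_measurable_continuous_onI)

lemma prod_unit_bounds:
  fixes g :: "'i \<Rightarrow> real"
  assumes "\<And>i. i \<in> J \<Longrightarrow> 0 \<le> g i \<and> g i \<le> 1"
  shows "0 \<le> (\<Prod>i\<in>J. g i)" "(\<Prod>i\<in>J. g i) \<le> 1" "\<bar>\<Prod>i\<in>J. g i\<bar> \<le> 1"
proof -
  show "0 \<le> (\<Prod>i\<in>J. g i)" "(\<Prod>i\<in>J. g i) \<le> 1"
    using assms by (auto intro!: prod_nonneg prod_le_1)
  then show "\<bar>\<Prod>i\<in>J. g i\<bar> \<le> 1" by simp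
qed

lemma measurable_law_map:
  "(\<And>i. i \<in> K \<Longrightarrow> X i \<in> borel_measurable M) \<Longrightarrow> (\<lambda>\<omega>. \<lambda>i\<in>K. X i \<omega>) \<in> M \<rightarrow>\<^sub>M PiM K (\<lambda>_. borel)"
  by (intro measurable_restrict) auto

lemma law_eqI:
  fixes X :: "'i \<Rightarrow> 'a \<Rightarrow> real" and Y :: "'i \<Rightarrow> 'b \<Rightarrow> real"
  assumes fin: "finite_measure M" "finite_measure N"
    and X: "\<And>i. i \<in> K \<Longrightarrow> X i \<in> borel_measurable M"
    and Y: "\<And>i. i \<in> K \<Longrightarrow> Y i \<in> borel_measurable N"
    and eq: "\<And>J f. finite J \<Longrightarrow> J \<subseteq> K \<Longrightarrow> unit_continuous f \<Longrightarrow>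
      (\<integral>\<omega>. (\<Prod>i\<in>J. f i (X i \<omega>)) \<partial>M) = (\<integral>\<omega>. (\<Prod>i\<in>J. f i (Y i \<omega>)) \<partial>N)"
  shows "law M K X = law N K Y"
proof -
  interpret M: finite_measure M by fact
  interpret N: finite_measure N by fact
  let ?\<Omega> = "\<Pi>\<^sub>E i\<in>K. (UNIV :: real set)"
  define P where "P = {{f\<in>?\<Omega>. \<forall>i\<in>j. f i \<in> A i} | A j. j \<in> {j. finite j \<and> j \<subseteq> K} \<and> A \<in> Pi j (\<lambda>_. {C. closed C})}"
  have sets: "sets (PiM K (\<lambda>_. borel :: real measure)) = sigma_sets ?\<Omega> P"
  proof -
    have "sets (PiM K (\<lambda>_. borel :: real measure)) = sets (PiM K (\<lambda>_. sigma UNIV {C::real set. closed C}))"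
      by (intro sets_PiM_cong) (simp_all add: borel_eq_closed)
    also have "\<dots> = sets (sigma ?\<Omega> P)" unfolding P_def
    proof (rule sets_PiM_sigma)
      show "\<exists>S\<subseteq>{C::real set. closed C}. countable S \<and> UNIV = \<Union>S" by (intro exI[of _ "{UNIV}"]) auto
      show "\<Union>{j. finite j \<and> j \<subseteq> K} = K" by (auto intro!: exI[of _ "{x}" for x])
    qed auto
    also have "\<dots> = sigma_sets ?\<Omega> P" by (intro sets_measure_of) (auto simp: P_def)
    finally show ?thesis .
  qed
  have stable: "Int_stable P"
  proof (rule Int_stableI)
    fix S T assume "S \<in> P" "T \<in> P"
    then obtain A j B k where S: "S = {f\<in>?\<Omega>. \<forall>i\<in>j. f i \<in> A i}" "finite j" "j \<subseteq> K" "\<And>i. i \<in> j \<Longrightarrow> closed (A i)"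
      and T: "T = {f\<in>?\<Omega>. \<forall>i\<in>k. f i \<in> B i}" "finite k" "k \<subseteq> K" "\<And>i. i \<in> k \<Longrightarrow> closed (B i)"
      by (auto simp: P_def Pi_iff)
    define C where "C i = (if i \<in> j then A i else UNIV) \<inter> (if i \<in> k then B i else UNIV)" for i
    have "S \<inter> T = {f\<in>?\<Omega>. \<forall>i\<in>j \<union> k. f i \<in> C i}" unfolding S T C_def by (auto split: if_splits)
    moreover have "closed (C i)" for i using S T by (auto simp: C_def)
    ultimately show "S \<inter> T \<in> P" unfolding P_def
      using S T by (auto intro!: exI[of _ C] exI[of _ "j \<union> k"])
  qed
  define h where "h n C x = (if C = {} then 0 else max 0 (1 - real n * infdist x C))" for n and C :: "real set" and x
  have uc: "unit_continuous (\<lambda>i. h n (A i))" for n and A :: "'i \<Rightarrow> real set"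
  proof -
    have "continuous_on UNIV (h n C)" for C
      by (cases "C = {}") (auto simp: h_def intro!: continuous_intros)
    then show ?thesis by (auto simp: unit_continuous_def h_def infdist_nonneg)
  qed
  have lim: "(\<lambda>n. h n C x) \<longlonglongrightarrow> indicat_real C x" if "closed C" for C x
  proof (cases "x \<in> C")
    case True
    then have "h n C x = 1" for n by (auto simp: h_def)
    then show ?thesis using True by simp
  next
    case False
    then have "eventually (\<lambda>n. h n C x = 0) sequentially"
    proof (cases "C = {}")
      case nonempty: False
      then have "0 < infdist x C" using False that in_closed_iff_infdist_zero[of C x] infdist_nonneg[of x C] by force
      then obtain n0 where n0: "1 < real n0 * infdist x C" using reals_Archimedean3 by blast
      have "h n C x = 0" if "n \<ge> n0" for n
      proof -
        have "real n0 * infdist x C \<le> real n * infdist x C" using that by (intro mult_right_mono) (auto simp: infdist_nonneg)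
        then show ?thesis using n0 by (simp add: h_def)
      qed
      then show ?thesis by (auto simp: eventually_sequentially)
    qed (simp add: h_def)
    then show ?thesis using False by (simp add: tendsto_eventually)
  qed
  have conv: "(\<lambda>n. \<integral>\<omega>. (\<Prod>i\<in>j. h n (A i) (Z i \<omega>)) \<partial>L) \<longlonglongrightarrow> measure L {\<omega>\<in>space L. \<forall>i\<in>j. Z i \<omega> \<in> A i}"
    if "finite_measure L" and j: "finite j" "j \<subseteq> K" and A: "\<And>i. i \<in> j \<Longrightarrow> closed (A i)"
      and [measurable]: "\<And>i. i \<in> K \<Longrightarrow> Z i \<in> borel_measurable L" for L :: "'c measure" and j A Z
  proof -
    interpret L: finite_measure L by fact
    have mj [measurable]: "Z i \<in> borel_measurable L" if "i \<in> j" for i using that j by auto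
    have [measurable]: "h n (A i) \<in> borel_measurable borel" for n i using unit_continuousD(1)[OF uc] .
    have [measurable]: "i \<in> j \<Longrightarrow> A i \<in> sets borel" for i using A by (simp add: borel_closed)
    let ?S = "{\<omega>\<in>space L. \<forall>i\<in>j. Z i \<omega> \<in> A i}"
    have S [measurable]: "?S \<in> sets L" using j(1) by measurable
    have "(\<lambda>n. \<integral>\<omega>. (\<Prod>i\<in>j. h n (A i) (Z i \<omega>)) \<partial>L) \<longlonglongrightarrow> (\<integral>\<omega>. indicat_real ?S \<omega> \<partial>L)"
    proof (rule integral_dominated_convergence[where w="\<lambda>_. 1"])
      show "AE \<omega> in L. (\<lambda>n. \<Prod>i\<in>j. h n (A i) (Z i \<omega>)) \<longlonglongrightarrow> indicat_real ?S \<omega>"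
      proof (rule AE_I2)
        fix \<omega> assume "\<omega> \<in> space L"
        have "(\<lambda>n. \<Prod>i\<in>j. h n (A i) (Z i \<omega>)) \<longlonglongrightarrow> (\<Prod>i\<in>j. indicat_real (A i) (Z i \<omega>))"
          by (intro tendsto_prod lim A)
        moreover have "(\<Prod>i\<in>j. indicat_real (A i) (Z i \<omega>)) = indicat_real ?S \<omega>"
          using j(1) \<open>\<omega> \<in> space L\<close> by (auto simp: indicator_def intro!: prod_zero)
        ultimately show "(\<lambda>n. \<Prod>i\<in>j. h n (A i) (Z i \<omega>)) \<longlonglongrightarrow> indicat_real ?S \<omega>" by simp
      qed
      show "AE \<omega> in L. norm (\<Prod>i\<in>j. h n (A i) (Z i \<omega>)) \<le> 1" for n
        using unit_continuousD(2,3)[OF uc] by (intro AE_I2) (auto intro!: prod_unit_bounds)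
      show "(\<lambda>\<omega>. \<Prod>i\<in>j. h n (A i) (Z i \<omega>)) \<in> borel_measurable L" for n
        by measurable
    qed auto
    then show ?thesis by (simp add: S)
  qed
  note mX = measurable_law_map[of K X M, OF X] and mY = measurable_law_map[of K Y N, OF Y]
  show ?thesis unfolding law_def
  proof (rule measure_eqI_generator_eq[OF stable, where \<Omega> = ?\<Omega> and A = "\<lambda>_. ?\<Omega>"])
    show "P \<subseteq> Pow ?\<Omega>" by (auto simp: P_def)
    fix S assume "S \<in> P"
    then obtain A j where S: "S = {f\<in>?\<Omega>. \<forall>i\<in>j. f i \<in> A i}" "finite j" "j \<subseteq> K" "\<And>i. i \<in> j \<Longrightarrow> closed (A i)"
      by (auto simp: P_def Pi_iff)
    have "S \<in> sets (PiM K (\<lambda>_. borel))" using \<open>S \<in> P\<close> unfolding sets by blast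
    moreover have "(\<lambda>\<omega>. \<lambda>i\<in>K. X i \<omega>) -` S \<inter> space M = {\<omega>\<in>space M. \<forall>i\<in>j. X i \<omega> \<in> A i}"
      "(\<lambda>\<omega>. \<lambda>i\<in>K. Y i \<omega>) -` S \<inter> space N = {\<omega>\<in>space N. \<forall>i\<in>j. Y i \<omega> \<in> A i}"
      using S by (auto simp: subset_iff)
    moreover have "measure M {\<omega>\<in>space M. \<forall>i\<in>j. X i \<omega> \<in> A i} = measure N {\<omega>\<in>space N. \<forall>i\<in>j. Y i \<omega> \<in> A i}"
    proof (rule LIMSEQ_unique)
      show "(\<lambda>n. \<integral>\<omega>. (\<Prod>i\<in>j. h n (A i) (X i \<omega>)) \<partial>M) \<longlonglongrightarrow> measure M {\<omega>\<in>space M. \<forall>i\<in>j. X i \<omega> \<in> A i}"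
        by (rule conv[OF fin(1) S(2,3,4) X])
      show "(\<lambda>n. \<integral>\<omega>. (\<Prod>i\<in>j. h n (A i) (X i \<omega>)) \<partial>M) \<longlonglongrightarrow> measure N {\<omega>\<in>space N. \<forall>i\<in>j. Y i \<omega> \<in> A i}"
        unfolding eq[OF S(2,3) uc] by (rule conv[OF fin(2) S(2,3,4) Y])
    qed
    ultimately show "emeasure (distr M (PiM K (\<lambda>_. borel)) (\<lambda>\<omega>. \<lambda>i\<in>K. X i \<omega>)) S =
        emeasure (distr N (PiM K (\<lambda>_. borel)) (\<lambda>\<omega>. \<lambda>i\<in>K. Y i \<omega>)) S"
      using mX mY by (simp add: emeasure_distr M.emeasure_eq_measure N.emeasure_eq_measure)
  next
    show "range (\<lambda>_. ?\<Omega>) \<subseteq> P" by (auto simp: P_def intro!: exI[of _ "{}"])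
    show "emeasure (distr M (PiM K (\<lambda>_. borel)) (\<lambda>\<omega>. \<lambda>i\<in>K. X i \<omega>)) ?\<Omega> \<noteq> \<infinity>"
      using finite_measure.emeasure_finite[OF M.finite_measure_distr[OF mX]] by simp
  qed (simp_all add: sets)
qed

lemma law_integral:
  assumes "law M K X = law N K Y" "\<And>i. i \<in> K \<Longrightarrow> X i \<in> borel_measurable M" "\<And>i. i \<in> K \<Longrightarrow> Y i \<in> borel_measurable N"
    and F: "F \<in> borel_measurable (PiM K (\<lambda>_. borel))"
  shows "(\<integral>\<omega>. F (\<lambda>i\<in>K. X i \<omega>) \<partial>M) = (\<integral>\<omega>. (F (\<lambda>i\<in>K. Y i \<omega>) :: real) \<partial>N)"
  using integral_distr[OF measurable_law_map[of K X M, OF assms(2)] F] integral_distr[OF measurable_law_map[of K Y N, OF assms(3)] F] assms(1)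
  by (simp add: law_def)

lemma law_AE:
  assumes "law M K X = law N K Y" "\<And>i. i \<in> K \<Longrightarrow> X i \<in> borel_measurable M" "\<And>i. i \<in> K \<Longrightarrow> Y i \<in> borel_measurable N"
    and F: "Measurable.pred (PiM K (\<lambda>_. borel)) F"
  shows "(AE \<omega> in M. F (\<lambda>i\<in>K. X i \<omega>)) \<longleftrightarrow> (AE \<omega> in N. F (\<lambda>i\<in>K. Y i \<omega>))"
proof -
  have F': "{x \<in> space (PiM K (\<lambda>_. borel)). F x} \<in> sets (PiM K (\<lambda>_. borel))" using F by simp
  have mX: "(\<lambda>\<omega>. \<lambda>i\<in>K. X i \<omega>) \<in> M \<rightarrow>\<^sub>M PiM K (\<lambda>_. borel)" by (rule measurable_law_map) (rule assms(2))
  have mY: "(\<lambda>\<omega>. \<lambda>i\<in>K. Y i \<omega>) \<in> N \<rightarrow>\<^sub>M PiM K (\<lambda>_. borel)" by (rule measurable_law_map) (rule assms(3))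
  show ?thesis
    using AE_distr_iff[OF mX F'] AE_distr_iff[OF mY F'] assms(1) unfolding law_def by metis
qed

lemma law_image:
  assumes "law M K X = law N K Y" "\<And>i. i \<in> K \<Longrightarrow> X i \<in> borel_measurable M" "\<And>i. i \<in> K \<Longrightarrow> Y i \<in> borel_measurable N"
    and G: "\<And>j. j \<in> J \<Longrightarrow> G j \<in> borel_measurable (PiM K (\<lambda>_. borel))"
  shows "law M J (\<lambda>j \<omega>. G j (\<lambda>i\<in>K. X i \<omega>)) = law N J (\<lambda>j \<omega>. G j (\<lambda>i\<in>K. Y i \<omega>))"
  using distr_distr[OF measurable_law_map[of J G, OF G] measurable_law_map[of K X M, OF assms(2)]]
    distr_distr[OF measurable_law_map[of J G, OF G] measurable_law_map[of K Y N, OF assms(3)]] assms(1)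
  by (simp add: law_def comp_def)

lemma law_subset:
  assumes "law M K X = law N K Y" "\<And>i. i \<in> K \<Longrightarrow> X i \<in> borel_measurable M" "\<And>i. i \<in> K \<Longrightarrow> Y i \<in> borel_measurable N"
    and "J \<subseteq> K"
  shows "law M J X = law N J Y"
proof -
  have "law M J (\<lambda>j \<omega>. (\<lambda>i\<in>K. X i \<omega>) j) = law N J (\<lambda>j \<omega>. (\<lambda>i\<in>K. Y i \<omega>) j)"
    using assms(4) by (intro law_image assms(1-3)) auto
  moreover have "law L J (\<lambda>j \<omega>. (\<lambda>i\<in>K. Z i \<omega>) j) = law L J Z" for L :: "'z measure" and Z
    unfolding law_def using assms(4) by (intro distr_cong refl restrict_ext) auto
  ultimately show ?thesis by metis
qed

lemma law_finite_subsets: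
  fixes X :: "'i \<Rightarrow> 'a \<Rightarrow> real" and Y :: "'i \<Rightarrow> 'b \<Rightarrow> real"
  assumes fin: "finite_measure M" "finite_measure N"
    and X: "\<And>i. i \<in> K \<Longrightarrow> X i \<in> borel_measurable M" and Y: "\<And>i. i \<in> K \<Longrightarrow> Y i \<in> borel_measurable N"
    and eq: "\<And>J. finite J \<Longrightarrow> J \<subseteq> K \<Longrightarrow> law M J X = law N J Y"
  shows "law M K X = law N K Y"
proof (rule law_eqI[OF fin X Y])
  fix J and f :: "'i \<Rightarrow> real \<Rightarrow> real" assume J: "finite J" "J \<subseteq> K" and f: "unit_continuous f"
  have [measurable]: "f i \<in> borel_measurable borel" for i by (rule unit_continuousD[OF f])
  have "(\<integral>\<omega>. (\<Prod>i\<in>J. f i ((\<lambda>i\<in>J. X i \<omega>) i)) \<partial>M) = (\<integral>\<omega>. (\<Prod>i\<in>J. f i ((\<lambda>i\<in>J. Y i \<omega>) i)) \<partial>N)"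
    by (rule law_integral[OF eq[OF J], where F = "\<lambda>x. \<Prod>i\<in>J. f i (x i)"]) (use J X Y in \<open>auto intro!: borel_measurable_prod\<close>)
  then show "(\<integral>\<omega>. (\<Prod>i\<in>J. f i (X i \<omega>)) \<partial>M) = (\<integral>\<omega>. (\<Prod>i\<in>J. f i (Y i \<omega>)) \<partial>N)" by simp
qed

lemma law_cong_AE:
  fixes X Y :: "'i \<Rightarrow> 'a \<Rightarrow> real"
  assumes fin: "finite_measure M"
    and X: "\<And>i. i \<in> K \<Longrightarrow> X i \<in> borel_measurable M" and Y: "\<And>i. i \<in> K \<Longrightarrow> Y i \<in> borel_measurable M"
    and eq: "\<And>i. i \<in> K \<Longrightarrow> AE \<omega> in M. X i \<omega> = Y i \<omega>"
  shows "law M K X = law M K Y"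
proof (rule law_eqI[OF fin fin X Y])
  fix J and f :: "'i \<Rightarrow> real \<Rightarrow> real" assume J: "finite J" "J \<subseteq> K" and f: "unit_continuous f"
  have [measurable]: "f i \<in> borel_measurable borel" for i by (rule unit_continuousD[OF f])
  have [measurable]: "i \<in> J \<Longrightarrow> X i \<in> borel_measurable M" "i \<in> J \<Longrightarrow> Y i \<in> borel_measurable M" for i using J X Y by auto
  have "AE \<omega> in M. \<forall>i\<in>J. X i \<omega> = Y i \<omega>" using J eq by (intro AE_finite_allI) auto
  then show "(\<integral>\<omega>. (\<Prod>i\<in>J. f i (X i \<omega>)) \<partial>M) = (\<integral>\<omega>. (\<Prod>i\<in>J. f i (Y i \<omega>)) \<partial>M)"
    by (intro integral_cong_AE) (auto elim!: eventually_mono intro!: prod.cong)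
qed

lemma law_limit:
  fixes X :: "'i \<Rightarrow> 'a \<Rightarrow> real" and Y :: "'i \<Rightarrow> 'b \<Rightarrow> real"
  assumes fin: "finite_measure M" "finite_measure N"
    and X: "\<And>i. i \<in> K \<Longrightarrow> X i \<in> borel_measurable M" and Y: "\<And>i. i \<in> K \<Longrightarrow> Y i \<in> borel_measurable N"
    and A: "\<And>n l. l \<in> \<Lambda> n \<Longrightarrow> A n l \<in> borel_measurable M" and B: "\<And>n l. l \<in> \<Lambda> n \<Longrightarrow> B n l \<in> borel_measurable N"
    and law: "\<And>n. law M (\<Lambda> n) (A n) = law N (\<Lambda> n) (B n)"
    and G: "\<And>n i. i \<in> K \<Longrightarrow> G n i \<in> borel_measurable (PiM (\<Lambda> n) (\<lambda>_. borel))"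
    and limX: "\<And>i. i \<in> K \<Longrightarrow> AE \<omega> in M. (\<lambda>n. G n i (\<lambda>l\<in>\<Lambda> n. A n l \<omega>)) \<longlonglongrightarrow> X i \<omega>"
    and limY: "\<And>i. i \<in> K \<Longrightarrow> AE \<omega> in N. (\<lambda>n. G n i (\<lambda>l\<in>\<Lambda> n. B n l \<omega>)) \<longlonglongrightarrow> Y i \<omega>"
  shows "law M K X = law N K Y"
proof (rule law_eqI[OF fin X Y])
  fix J and f :: "'i \<Rightarrow> real \<Rightarrow> real" assume J: "finite J" "J \<subseteq> K" and f: "unit_continuous f"
  have f' [measurable]: "f i \<in> borel_measurable borel" for i by (rule unit_continuousD[OF f])
  let ?F = "\<lambda>n x. \<Prod>i\<in>J. f i (G n i x)"
  have F: "?F n \<in> borel_measurable (PiM (\<Lambda> n) (\<lambda>_. borel))" for n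
    using J G by (intro borel_measurable_prod measurable_compose[OF _ f']) auto
  have lim: "(\<lambda>n. \<integral>\<omega>. ?F n (\<lambda>l\<in>\<Lambda> n. C n l \<omega>) \<partial>L) \<longlonglongrightarrow> (\<integral>\<omega>. (\<Prod>i\<in>J. f i (Z i \<omega>)) \<partial>L)"
    if L: "finite_measure L" and C: "\<And>n l. l \<in> \<Lambda> n \<Longrightarrow> C n l \<in> borel_measurable L"
      and Z: "\<And>i. i \<in> K \<Longrightarrow> Z i \<in> borel_measurable L"
      and c: "\<And>i. i \<in> K \<Longrightarrow> AE \<omega> in L. (\<lambda>n. G n i (\<lambda>l\<in>\<Lambda> n. C n l \<omega>)) \<longlonglongrightarrow> Z i \<omega>"
    for L :: "'z measure" and C Z
  proof (rule integral_dominated_convergence[where w="\<lambda>_. 1"])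
    interpret L: finite_measure L by fact
    show "integrable L (\<lambda>_. 1 :: real)" by simp
    show "(\<lambda>\<omega>. \<Prod>i\<in>J. f i (Z i \<omega>)) \<in> borel_measurable L"
      using J Z by (intro borel_measurable_prod measurable_compose[OF _ f']) auto
    show "(\<lambda>\<omega>. ?F n (\<lambda>l\<in>\<Lambda> n. C n l \<omega>)) \<in> borel_measurable L" for n
      by (rule measurable_compose[OF measurable_law_map F]) (rule C)
    have "AE \<omega> in L. \<forall>i\<in>J. (\<lambda>n. G n i (\<lambda>l\<in>\<Lambda> n. C n l \<omega>)) \<longlonglongrightarrow> Z i \<omega>"
      using J c by (intro AE_finite_allI) auto
    then show "AE \<omega> in L. (\<lambda>n. ?F n (\<lambda>l\<in>\<Lambda> n. C n l \<omega>)) \<longlonglongrightarrow> (\<Prod>i\<in>J. f i (Z i \<omega>))"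
    proof eventually_elim
      case (elim \<omega>)
      then show ?case
        by (intro tendsto_prod isCont_tendsto_compose[OF unit_continuousD(4)[OF f]]) auto
    qed
    show "AE \<omega> in L. norm (?F n (\<lambda>l\<in>\<Lambda> n. C n l \<omega>)) \<le> 1" for n
      using unit_continuousD(2,3)[OF f] by (intro AE_I2) (auto intro!: prod_unit_bounds)
  qed
  have "(\<integral>\<omega>. ?F n (\<lambda>l\<in>\<Lambda> n. A n l \<omega>) \<partial>M) = (\<integral>\<omega>. ?F n (\<lambda>l\<in>\<Lambda> n. B n l \<omega>) \<partial>N)" for n
    by (rule law_integral[OF law A B F])
  then show "(\<integral>\<omega>. (\<Prod>i\<in>J. f i (X i \<omega>)) \<partial>M) = (\<integral>\<omega>. (\<Prod>i\<in>J. f i (Y i \<omega>)) \<partial>N)"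
    using lim[OF fin(1) A X limX] lim[OF fin(2) B Y limY] by (simp add: LIMSEQ_unique)
qed

section \<open>Riemann sums of driving paths and independent Brownian motions\<close>

declare split_paired_All [simp del] split_paired_Ex [simp del]

definition grid :: "real \<Rightarrow> nat \<Rightarrow> nat \<Rightarrow> real" where
  "grid c n k = c + real k / real (Suc n)"

lemma strict_mono_grid: "strict_mono (grid c n)"
  by (rule strict_monoI) (simp add: grid_def divide_strict_right_mono)

definition grid_steps :: "real \<Rightarrow> nat \<Rightarrow> nat \<Rightarrow> real \<Rightarrow> real \<Rightarrow> nat set" where
  "grid_steps c L n a t = {k. k < L * Suc n \<and> a \<le> grid c n k \<and> grid c n (Suc k) \<le> t}"

text \<open>A path which follows finitely many driving paths one after the other is the limit of the sums of
  the increments of the current driver: at most one step per driver is affected by a change.\<close>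

lemma driver_sum_tendsto:
  fixes u :: "real \<Rightarrow> real" and B :: "'q \<Rightarrow> real \<Rightarrow> real" and m :: "real \<Rightarrow> 'q"
  assumes at: "c \<le> a" "a \<le> t" "t \<le> c + real L"
    and u: "continuous_on {a..t} u" and B: "\<And>q. q \<in> Q \<Longrightarrow> continuous_on {a..t} (B q)" and Q: "finite Q"
    and m: "\<And>s. a \<le> s \<Longrightarrow> s \<le> t \<Longrightarrow> m s \<in> Q"
    and follow: "\<And>s s'. a \<le> s \<Longrightarrow> s \<le> s' \<Longrightarrow> s' \<le> t \<Longrightarrow> m s = m s' \<Longrightarrow> u s' - u s = B (m s) s' - B (m s) s"
    and convex: "\<And>s s' s''. a \<le> s \<Longrightarrow> s \<le> s' \<Longrightarrow> s' \<le> s'' \<Longrightarrow> s'' \<le> t \<Longrightarrow> m s = m s'' \<Longrightarrow> m s' = m s"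
  shows "(\<lambda>n. \<Sum>k\<in>grid_steps c L n a t. B (m (grid c n k)) (grid c n (Suc k)) - B (m (grid c n k)) (grid c n k))
    \<longlonglongrightarrow> u t - u a"
proof -
  define h where "h = grid c"
  define S where "S n = grid_steps c L n a t" for n
  define k1 where "k1 n = nat \<lceil>(a - c) * real (Suc n)\<rceil>" for n
  define k2 where "k2 n = nat \<lfloor>(t - c) * real (Suc n)\<rfloor>" for n
  have h_ge: "a \<le> h n k \<longleftrightarrow> k1 n \<le> k" for n k
  proof -
    have "a \<le> h n k \<longleftrightarrow> (a - c) * real (Suc n) \<le> real k"
      by (simp add: h_def grid_def field_simps del: of_nat_Suc)
    also have "\<dots> \<longleftrightarrow> k1 n \<le> k" unfolding k1_def by (simp add: nat_le_iff ceiling_le_iff del: of_nat_Suc)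
    finally show ?thesis .
  qed
  have h_le: "h n k \<le> t \<longleftrightarrow> k \<le> k2 n" for n k
  proof -
    have nn: "0 \<le> (t - c) * real (Suc n)" using at by simp
    have "h n k \<le> t \<longleftrightarrow> real k \<le> (t - c) * real (Suc n)"
      by (simp add: h_def grid_def field_simps del: of_nat_Suc)
    also have "\<dots> \<longleftrightarrow> k \<le> k2 n" unfolding k2_def using nn by (simp add: le_nat_iff le_floor_iff del: of_nat_Suc)
    finally show ?thesis .
  qed
  have Sk: "S n = {k1 n..<k2 n}" for n
  proof -
    have "k < L * Suc n" if "h n (Suc k) \<le> t" for k
    proof -
      have "real (Suc k) / real (Suc n) \<le> real L" using that at by (simp add: h_def grid_def del: of_nat_Suc)
      then have "real (Suc k) \<le> real L * real (Suc n)" by (simp add: field_simps del: of_nat_Suc)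
      then show ?thesis by (metis Suc_le_eq of_nat_le_iff of_nat_mult)
    qed
    then show ?thesis unfolding S_def grid_steps_def h_def[symmetric] by (auto simp: h_ge h_le Suc_le_eq)
  qed
  define dl where "dl n = 1 / real (Suc n)" for n
  have dl: "0 < dl n" for n by (simp add: dl_def)
  have h0: "dl \<longlonglongrightarrow> 0" unfolding dl_def by (rule LIMSEQ_Suc) (rule lim_1_over_n)
  have hS: "h n (Suc k) = h n k + dl n" for n k by (simp add: h_def grid_def dl_def add_divide_distrib)
  have small: "\<forall>\<^sub>F n in sequentially. dl n < d" if "d > 0" for d
    using order_tendstoD(2)[OF h0 that] .
  show ?thesis
  proof (cases "a = t")
    case True
    have "S n = {}" for n
    proof -
      have "k \<notin> S n" for k
      proof
        assume "k \<in> S n"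
        then have "a \<le> h n k" "h n (Suc k) \<le> t" by (simp_all add: Sk h_ge h_le)
        then show False using True hS[of n k] dl[of n] by linarith
      qed
      then show ?thesis by auto
    qed
    then have "grid_steps c L n a t = {}" for n unfolding S_def .
    then show ?thesis using True by simp
  next
    case False
    then have lt: "a < t" using at by simp
    show ?thesis
    proof (rule LIMSEQ_I, unfold S_def[symmetric] h_def[symmetric])
      fix e :: real assume e: "0 < e"
      define e' where "e' = e / (2 * real (card Q) + 3)"
      have e': "0 < e'" unfolding e'_def using e by (intro divide_pos_pos) auto
      have uc: "\<forall>\<^sub>F n in sequentially. \<forall>x\<in>{a..t}. \<forall>y\<in>{a..t}. \<bar>x - y\<bar> \<le> dl n \<longrightarrow> \<bar>f x - f y\<bar> < e'"
        if "continuous_on {a..t} f" for f :: "real \<Rightarrow> real"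
      proof -
        have "uniformly_continuous_on {a..t} f" using that by (rule compact_uniformly_continuous) simp
        then obtain d where d: "d > 0" "\<And>x y. x \<in> {a..t} \<Longrightarrow> y \<in> {a..t} \<Longrightarrow> dist y x < d \<Longrightarrow> dist (f y) (f x) < e'"
          unfolding uniformly_continuous_on_def using e' by metis
        show ?thesis using small[OF d(1)]
          by eventually_elim (use d(2) in \<open>force simp: dist_real_def abs_minus_commute\<close>)
      qed
      have "\<forall>\<^sub>F n in sequentially. \<forall>q\<in>Q. \<forall>x\<in>{a..t}. \<forall>y\<in>{a..t}. \<bar>x - y\<bar> \<le> dl n \<longrightarrow> \<bar>B q x - B q y\<bar> < e'"
        by (intro eventually_ball_finite Q ballI uc B)
      moreover have "\<forall>\<^sub>F n in sequentially. dl n < (t - a) / 2" using lt by (intro small) simp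
      ultimately have "\<forall>\<^sub>F n in sequentially.
         \<bar>(\<Sum>k\<in>S n. B (m (h n k)) (h n (Suc k)) - B (m (h n k)) (h n k)) - (u t - u a)\<bar> < e"
        using uc[OF u]
      proof eventually_elim
        case (elim n)
        note Bn = elim(1)[rule_format] and un = elim(3)[rule_format]
        have ka: "a \<le> h n (k1 n)" and kt: "h n (k2 n) \<le> t" by (simp_all add: h_ge h_le)
        have ka': "h n (k1 n) \<le> a + dl n"
        proof (cases "k1 n")
          case 0
          then show ?thesis using at using dl[of n] by (simp add: h_def grid_def)
        next
          case (Suc j)
          then have "\<not> a \<le> h n j" by (simp add: h_ge)
          then show ?thesis using Suc by (simp add: hS)
        qed
        have "\<not> h n (Suc (k2 n)) \<le> t" by (simp add: h_le)
        then have kt': "t \<le> h n (k2 n) + dl n" by (simp add: hS)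
        have "a + dl n \<le> t - dl n" using elim(2) by (simp add: field_simps)
        moreover have "t - dl n \<le> h n (k2 n)" using kt' by simp
        ultimately have h12: "h n (k1 n) \<le> h n (k2 n)" using ka' by (meson order_trans)
        from h12 have k12: "k1 n \<le> k2 n" using strict_mono_less_eq[OF strict_mono_grid] by (simp add: h_def)
        define E where "E k = (B (m (h n k)) (h n (Suc k)) - B (m (h n k)) (h n k)) - (u (h n (Suc k)) - u (h n k))" for k
        define J where "J = {k\<in>S n. m (h n k) \<noteq> m (h n (Suc k))}"
        have finS: "finite (S n)" by (simp add: Sk)
        have inS: "a \<le> h n k" "h n k \<le> h n (Suc k)" "h n (Suc k) \<le> t" if "k \<in> S n" for k
          using that dl[of n] h_le[of n "Suc k"] by (auto simp: Sk h_ge hS less_imp_le)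
        have inj: "inj_on (\<lambda>k. m (h n k)) J"
        proof (rule linorder_inj_onI')
          fix k k' assume kk: "k < k'" "k \<in> J" "k' \<in> J"
          have "h n (Suc k) \<le> h n k'"
            using kk(1) strict_mono_less_eq[OF strict_mono_grid] by (simp add: h_def)
          then show "m (h n k) \<noteq> m (h n k')"
            using convex[of "h n k" "h n (Suc k)" "h n k'"] kk inS[of k] inS[of k'] by (auto simp: J_def)
        qed
        moreover have "(\<lambda>k. m (h n k)) ` J \<subseteq> Q"
        proof
          fix q assume "q \<in> (\<lambda>k. m (h n k)) ` J"
          then obtain k where k: "k \<in> S n" "q = m (h n k)" by (auto simp: J_def)
          show "q \<in> Q" unfolding k(2) using inS[OF k(1)] by (intro m) auto
        qed
        ultimately have cJ: "card J \<le> card Q" using Q by (rule card_inj_on_le)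
        have "E k = 0" if "k \<in> S n - J" for k
          using follow[of "h n k" "h n (Suc k)"] inS[of k] that by (simp add: E_def J_def)
        then have "sum E (S n) = sum E J" using finS by (intro sum.mono_neutral_right) (auto simp: J_def)
        moreover have "\<bar>E k\<bar> \<le> 2 * e'" if "k \<in> J" for k
        proof -
          have k: "k \<in> S n" using that by (simp add: J_def)
          note i = inS[OF k]
          have "m (h n k) \<in> Q" using i by (intro m) auto
          from Bn[OF this, of "h n (Suc k)" "h n k"] un[of "h n (Suc k)" "h n k"]
          show ?thesis using i by (simp add: E_def hS)
        qed
        then have "\<bar>sum E J\<bar> \<le> real (card J) * (2 * e')"
          by (intro order_trans[OF sum_abs] sum_bounded_above)
        ultimately have "\<bar>sum E (S n)\<bar> \<le> real (card Q) * (2 * e')"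
          using cJ e' by (smt (verit) mult_right_mono of_nat_le_iff)
        moreover have "(\<Sum>k\<in>S n. u (h n (Suc k)) - u (h n k)) = u (h n (k2 n)) - u (h n (k1 n))"
          unfolding Sk by (rule sum_Suc_diff'[OF k12])
        moreover have "\<bar>u (h n (k2 n)) - u t\<bar> < e'" "\<bar>u (h n (k1 n)) - u a\<bar> < e'"
          using un[of "h n (k2 n)" t] un[of "h n (k1 n)" a] ka ka' kt kt' h12 at
          by auto
        ultimately have "\<bar>(\<Sum>k\<in>S n. B (m (h n k)) (h n (Suc k)) - B (m (h n k)) (h n k)) - (u t - u a)\<bar>
            < real (card Q) * (2 * e') + 2 * e'"
          by (simp add: E_def sum_subtractf)
        also have "\<dots> < (2 * real (card Q) + 3) * e'" using e' by (simp add: algebra_simps)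
        also have "\<dots> = e" by (simp add: e'_def)
        finally show ?case .
      qed
      then show "\<exists>no. \<forall>n\<ge>no. norm ((\<Sum>k\<in>S n. B (m (h n k)) (h n (Suc k)) - B (m (h n k)) (h n k)) - (u t - u a)) < e"
        by (simp add: eventually_sequentially)
    qed
  qed
qed

definition gauss_mean :: "(real \<Rightarrow> real) \<Rightarrow> real \<Rightarrow> real" where
  "gauss_mean f v = (\<integral>x. normal_density 0 (sqrt v) x * f x \<partial>lborel)"

definition unit_measurable :: "('i \<Rightarrow> real \<Rightarrow> real) \<Rightarrow> bool" where
  "unit_measurable f \<longleftrightarrow> (\<forall>i. f i \<in> borel_measurable borel) \<and> (\<forall>i x. 0 \<le> f i x \<and> f i x \<le> 1)"

lemma unit_measurableD:
  assumes "unit_measurable f"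
  shows "f i \<in> borel_measurable borel" "0 \<le> f i x" "f i x \<le> 1"
  using assms by (auto simp: unit_measurable_def)

lemma unit_continuous_measurable: "unit_continuous f \<Longrightarrow> unit_measurable f"
  by (simp add: unit_measurable_def unit_continuousD)

lemma brownian_increments:
  fixes f :: "nat \<Rightarrow> real \<Rightarrow> real"
  assumes "prob_space M" and bm: "brownian_motion_from M p B" and h: "strict_mono h" and f: "unit_measurable f"
  shows "(\<integral>\<omega>. (\<Prod>k | k < n \<and> snd p \<le> h k. f k (B \<omega> (h (Suc k)) - B \<omega> (h k))) \<partial>M) =
    (\<Prod>k | k < n \<and> snd p \<le> h k. gauss_mean (f k) (h (Suc k) - h k))"
proof (cases "\<exists>k<n. snd p \<le> h k")
  case False
  then have "{k. k < n \<and> snd p \<le> h k} = {}" by auto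
  interpret prob_space M by fact
  show ?thesis unfolding \<open>{k. k < n \<and> snd p \<le> h k} = {}\<close> by (simp add: prob_space)
next
  case True
  interpret prob_space M by fact
  define j where "j = (LEAST k. snd p \<le> h k)"
  obtain k0 where k0: "k0 < n" "snd p \<le> h k0" using True by blast
  have j: "snd p \<le> h j" unfolding j_def by (rule LeastI[of "\<lambda>k. snd p \<le> h k", OF k0(2)])
  have le: "j \<le> k" if "snd p \<le> h k" for k unfolding j_def by (rule Least_le) (rule that)
  have jn: "j < n" using le[OF k0(2)] k0(1) by simp
  have iff: "snd p \<le> h k \<longleftrightarrow> j \<le> k" for k
  proof
    assume "j \<le> k"
    then have "h j \<le> h k" by (simp add: strict_mono_less_eq[OF h])
    then show "snd p \<le> h k" using j by simp
  qed (rule le)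
  have set: "{k. k < n \<and> snd p \<le> h k} = {0 + j..<(n - j) + j}"
    unfolding iff using jn by auto
  have hj: "strict_mono (\<lambda>i. h (i + j))" using h by (simp add: strict_mono_def)
  have ind: "indep_vars (\<lambda>_. borel) (\<lambda>i \<omega>. B \<omega> (h (Suc i + j)) - B \<omega> (h (i + j))) {..<n - j}"
    using bm[unfolded brownian_motion_from_def, THEN conjunct2, THEN conjunct2, THEN conjunct2, rule_format, of "\<lambda>i. h (i + j)" "n - j"]
      hj j by simp
  have [measurable]: "f i \<in> borel_measurable borel" for i by (rule unit_measurableD[OF f])
  have ind': "indep_vars (\<lambda>_. borel) (\<lambda>i \<omega>. f (i + j) (B \<omega> (h (Suc i + j)) - B \<omega> (h (i + j)))) {..<n - j}"
    by (rule indep_vars_compose2[OF ind]) simp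
  have rv: "(\<lambda>\<omega>. B \<omega> (h (Suc i + j)) - B \<omega> (h (i + j))) \<in> borel_measurable M" if "i < n - j" for i
    using ind that by (auto simp: indep_vars_def)
  have "(\<integral>\<omega>. (\<Prod>k\<in>{0 + j..<(n - j) + j}. f k (B \<omega> (h (Suc k)) - B \<omega> (h k))) \<partial>M) =
      (\<integral>\<omega>. (\<Prod>i<n - j. f (i + j) (B \<omega> (h (Suc i + j)) - B \<omega> (h (i + j)))) \<partial>M)"
    unfolding prod.shift_bounds_nat_ivl by (simp add: atLeast0LessThan)
  also have "\<dots> = (\<Prod>i<n - j. \<integral>\<omega>. f (i + j) (B \<omega> (h (Suc i + j)) - B \<omega> (h (i + j))) \<partial>M)"
  proof (rule indep_vars_lebesgue_integral[OF _ ind'])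
    show "integrable M (\<lambda>\<omega>. f (i + j) (B \<omega> (h (Suc i + j)) - B \<omega> (h (i + j))))" if "i \<in> {..<n - j}" for i
      using rv[of i] that unit_measurableD[OF f]
      by (intro integrable_const_bound[where B = 1] AE_I2) (auto intro!: measurable_compose[OF rv])
  qed simp
  also have "\<dots> = (\<Prod>i<n - j. gauss_mean (f (i + j)) (h (Suc (i + j)) - h (i + j)))"
  proof (intro prod.cong refl)
    fix i assume "i \<in> {..<n - j}"
    have "h j \<le> h (i + j)" "h (i + j) < h (Suc i + j)"
      using strict_mono_less_eq[OF h] strict_mono_less[OF h] by auto
    then have d: "distributed M lborel (\<lambda>\<omega>. B \<omega> (h (Suc i + j)) - B \<omega> (h (i + j)))
        (normal_density 0 (sqrt (h (Suc i + j) - h (i + j))))"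
      using bm[unfolded brownian_motion_from_def, THEN conjunct2, THEN conjunct2, THEN conjunct1, rule_format, of "h (i + j)" "h (Suc i + j)"] j
      by linarith
    show "(\<integral>\<omega>. f (i + j) (B \<omega> (h (Suc i + j)) - B \<omega> (h (i + j))) \<partial>M) = gauss_mean (f (i + j)) (h (Suc (i + j)) - h (i + j))"
      using distributed_integral[OF d, of "f (i + j)"] by (simp add: gauss_mean_def)
  qed
  also have "\<dots> = (\<Prod>k\<in>{0 + j..<(n - j) + j}. gauss_mean (f k) (h (Suc k) - h k))"
    unfolding prod.shift_bounds_nat_ivl by (simp add: atLeast0LessThan)
  finally show ?thesis unfolding set .
qed

definition steps :: "(real \<times> real) set \<Rightarrow> (nat \<Rightarrow> real) \<Rightarrow> nat \<Rightarrow> ((real \<times> real) \<times> nat) set" where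
  "steps A h n = (SIGMA z:A. {k. k < n \<and> snd z \<le> h k})"

definition increment :: "(real \<times> real \<Rightarrow> 'a \<Rightarrow> real \<Rightarrow> real) \<Rightarrow> (nat \<Rightarrow> real) \<Rightarrow> (real \<times> real) \<times> nat \<Rightarrow> 'a \<Rightarrow> real" where
  "increment X h i \<omega> = X (fst i) \<omega> (h (Suc (snd i))) - X (fst i) \<omega> (h (snd i))"

definition gaussian_increments :: "'a measure \<Rightarrow> (real \<times> real) set \<Rightarrow> (real \<times> real \<Rightarrow> 'a \<Rightarrow> real \<Rightarrow> real) \<Rightarrow> bool" where
  "gaussian_increments M A X \<longleftrightarrow> (\<forall>h n f. strict_mono h \<longrightarrow> unit_measurable f \<longrightarrow>
     (\<integral>\<omega>. (\<Prod>i\<in>steps A h n. f i (increment X h i \<omega>)) \<partial>M) =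
     (\<Prod>i\<in>steps A h n. gauss_mean (f i) (h (Suc (snd i)) - h (snd i))))"

lemma finite_steps: "finite A \<Longrightarrow> finite (steps A h n)"
  by (auto simp: steps_def)

lemma prod_steps: "finite A \<Longrightarrow> (\<Prod>i\<in>steps A h n. g i) = (\<Prod>z\<in>A. \<Prod>k | k < n \<and> snd z \<le> h k. (g (z, k) :: real))"
  unfolding steps_def by (subst prod.Sigma) (auto simp: split_beta)

lemma gaussian_incrementsI:
  assumes fin: "finite A" and M: "prob_space M"
    and bm: "\<And>z. z \<in> A \<Longrightarrow> brownian_motion_from M z (X z)"
    and ind: "\<And>G :: real \<times> real \<Rightarrow> 'a \<Rightarrow> real. \<And>h n f. strict_mono h \<Longrightarrow> unit_measurable f \<Longrightarrow>
        G = (\<lambda>z \<omega>. \<Prod>k | k < n \<and> snd z \<le> h k. f (z, k) (increment X h (z, k) \<omega>)) \<Longrightarrow>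
        prob_space.indep_vars M (\<lambda>_. borel) G A"
  shows "gaussian_increments M A X"
  unfolding gaussian_increments_def
proof (intro allI impI)
  interpret prob_space M by fact
  fix h :: "nat \<Rightarrow> real" and n and f :: "(real \<times> real) \<times> nat \<Rightarrow> real \<Rightarrow> real"
  assume h: "strict_mono h" and f: "unit_measurable f"
  define G where "G = (\<lambda>z \<omega>. \<Prod>k | k < n \<and> snd z \<le> h k. f (z, k) (increment X h (z, k) \<omega>))"
  have iv: "indep_vars (\<lambda>_. borel) G A" by (rule ind[OF h f G_def])
  have "(\<integral>\<omega>. (\<Prod>i\<in>steps A h n. f i (increment X h i \<omega>)) \<partial>M) = (\<integral>\<omega>. (\<Prod>z\<in>A. G z \<omega>) \<partial>M)"
    unfolding prod_steps[OF fin] G_def ..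
  also have "\<dots> = (\<Prod>z\<in>A. \<integral>\<omega>. G z \<omega> \<partial>M)"
  proof (rule indep_vars_lebesgue_integral[OF fin iv])
    fix z assume "z \<in> A"
    then have "G z \<in> borel_measurable M" using iv by (auto simp: indep_vars_def)
    then show "integrable M (G z)"
      by (intro integrable_const_bound[where B = 1] AE_I2)
        (auto simp: G_def intro!: prod_unit_bounds unit_measurableD(2,3)[OF f])
  qed
  also have "\<dots> = (\<Prod>z\<in>A. \<Prod>k | k < n \<and> snd z \<le> h k. gauss_mean (f (z, k)) (h (Suc k) - h k))"
  proof (intro prod.cong refl)
    fix z assume z: "z \<in> A"
    have "unit_measurable (\<lambda>k. f (z, k))" using f by (simp add: unit_measurable_def)
    from brownian_increments[OF M bm[OF z] h this, of n]
    show "(\<integral>\<omega>. G z \<omega> \<partial>M) = (\<Prod>k | k < n \<and> snd z \<le> h k. gauss_mean (f (z, k)) (h (Suc k) - h k))"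
      by (simp add: G_def increment_def)
  qed
  also have "\<dots> = (\<Prod>i\<in>steps A h n. gauss_mean (f i) (h (Suc (snd i)) - h (snd i)))"
    unfolding prod_steps[OF fin] by simp
  finally show "(\<integral>\<omega>. (\<Prod>i\<in>steps A h n. f i (increment X h i \<omega>)) \<partial>M) =
     (\<Prod>i\<in>steps A h n. gauss_mean (f i) (h (Suc (snd i)) - h (snd i)))" .
qed

lemma independent_brownian_motions_increments:
  assumes M: "prob_space M" and B: "independent_brownian_motions M D B" and A: "finite A" "A \<subseteq> D"
  shows "gaussian_increments M A B"
proof (rule gaussian_incrementsI[OF A(1) M])
  interpret prob_space M by fact
  show "brownian_motion_from M z (B z)" if "z \<in> A" for z
    using B A(2) that by (auto simp: independent_brownian_motions_def)
  fix G :: "real \<times> real \<Rightarrow> 'a \<Rightarrow> real" and h :: "nat \<Rightarrow> real" and n and f :: "(real \<times> real) \<times> nat \<Rightarrow> real \<Rightarrow> real"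
  assume h: "strict_mono h" and f: "unit_measurable f"
    and G: "G = (\<lambda>z \<omega>. \<Prod>k | k < n \<and> snd z \<le> h k. f (z, k) (increment B h (z, k) \<omega>))"
  have [measurable]: "f i \<in> borel_measurable borel" for i by (rule unit_measurableD[OF f])
  have "indep_vars (\<lambda>p. PiM {snd p..} (\<lambda>_. borel)) (\<lambda>p \<omega>. \<lambda>t\<in>{snd p..}. B p \<omega> t) A"
    using B A(2) by (auto simp: independent_brownian_motions_def intro: indep_vars_subset)
  then have "indep_vars (\<lambda>_. borel) (\<lambda>z \<omega>. (\<lambda>x. \<Prod>k | k < n \<and> snd z \<le> h k. f (z, k) (x (h (Suc k)) - x (h k)))
      (\<lambda>t\<in>{snd z..}. B z \<omega> t)) A"
  proof (rule indep_vars_compose2)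
    fix z :: "real \<times> real"
    have "snd z \<le> h (Suc k)" if "snd z \<le> h k" for k
      using that strict_mono_less[OF h, of k "Suc k"] by simp
    then show "(\<lambda>x. \<Prod>k | k < n \<and> snd z \<le> h k. f (z, k) (x (h (Suc k)) - x (h k)))
        \<in> borel_measurable (PiM {snd z..} (\<lambda>_. borel))"
      by (intro borel_measurable_prod measurable_compose[OF _ unit_measurableD(1)[OF f]] borel_measurable_diff
          measurable_component_singleton) auto
  qed
  moreover have "(\<lambda>z \<omega>. (\<lambda>x. \<Prod>k | k < n \<and> snd z \<le> h k. f (z, k) (x (h (Suc k)) - x (h k)))
      (\<lambda>t\<in>{snd z..}. B z \<omega> t)) = G"
    unfolding G
  proof (intro ext prod.cong refl)
    fix z :: "real \<times> real" and \<omega> k assume "k \<in> {k. k < n \<and> snd z \<le> h k}"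
    moreover then have "snd z \<le> h (Suc k)" using strict_mono_less[OF h, of k "Suc k"] by simp
    ultimately show "f (z, k) ((\<lambda>t\<in>{snd z..}. B z \<omega> t) (h (Suc k)) - (\<lambda>t\<in>{snd z..}. B z \<omega> t) (h k)) = f (z, k) (increment B h (z, k) \<omega>)"
      by (simp add: increment_def)
  qed
  ultimately show "indep_vars (\<lambda>_. borel) G A" by simp
qed

locale brownian_source =
  fixes M1 :: "'a measure" and p0 :: "real \<times> real" and B :: "'a \<Rightarrow> real \<Rightarrow> real"
  assumes prob_M1: "prob_space M1" and bm: "brownian_motion_from M1 p0 B"
begin

sublocale M1: prob_space M1 by (fact prob_M1)

definition bad :: "'a set" where
  "bad = (SOME N. N \<in> null_sets M1 \<and>
     {\<omega> \<in> space M1. \<not> (B \<omega> (snd p0) = fst p0 \<and> continuous_on {snd p0..} (B \<omega>))} \<subseteq> N)"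

lemma bad: "bad \<in> null_sets M1"
  "\<And>\<omega>. \<omega> \<in> space M1 - bad \<Longrightarrow> B \<omega> (snd p0) = fst p0 \<and> continuous_on {snd p0..} (B \<omega>)"
proof -
  have "AE \<omega> in M1. B \<omega> (snd p0) = fst p0 \<and> continuous_on {snd p0..} (B \<omega>)"
    using bm by (simp add: brownian_motion_from_def)
  then have "\<exists>N. N \<in> null_sets M1 \<and>
     {\<omega> \<in> space M1. \<not> (B \<omega> (snd p0) = fst p0 \<and> continuous_on {snd p0..} (B \<omega>))} \<subseteq> N"
    unfolding eventually_ae_filter by blast
  from someI_ex[OF this, folded bad_def]
  show "bad \<in> null_sets M1"
    "\<And>\<omega>. \<omega> \<in> space M1 - bad \<Longrightarrow> B \<omega> (snd p0) = fst p0 \<and> continuous_on {snd p0..} (B \<omega>)"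
    by blast+
qed

definition wiener :: "'a \<Rightarrow> real \<Rightarrow> real" where
  "wiener \<omega> t = (if \<omega> \<in> space M1 - bad then B \<omega> (snd p0 + max t 0) - fst p0 else 0)"

lemma wiener_start: "t \<le> 0 \<Longrightarrow> wiener \<omega> t = 0"
  using bad(2)[of \<omega>] by (simp add: wiener_def max_def)

lemma wiener_continuous: "continuous_on UNIV (wiener \<omega>)"
proof (cases "\<omega> \<in> space M1 - bad")
  case True
  then have B: "continuous_on {snd p0..} (B \<omega>)" using bad(2) by blast
  have "continuous_on UNIV (\<lambda>t. B \<omega> (snd p0 + max t 0))"
    by (rule continuous_on_compose2[OF B, of UNIV "\<lambda>t. snd p0 + max t 0"]) (auto intro!: continuous_intros)
  then have "continuous_on UNIV (\<lambda>t. B \<omega> (snd p0 + max t 0) - fst p0)"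
    by (rule continuous_on_diff) (rule continuous_on_const)
  moreover have "wiener \<omega> = (\<lambda>t. B \<omega> (snd p0 + max t 0) - fst p0)" using True by (intro ext) (simp add: wiener_def)
  ultimately show ?thesis by simp
next
  case False
  then have "wiener \<omega> = (\<lambda>_. 0)" by (auto simp: wiener_def)
  then show ?thesis by simp
qed

lemma measurable_wiener [measurable]: "(\<lambda>\<omega>. wiener \<omega> t) \<in> borel_measurable M1"
proof -
  have [measurable]: "(\<lambda>\<omega>. B \<omega> (snd p0 + max t 0)) \<in> borel_measurable M1"
    using bm by (auto simp: brownian_motion_from_def)
  have [measurable]: "bad \<in> sets M1" using bad(1) by auto
  show ?thesis unfolding wiener_def by measurable
qed

lemma wiener_AE: "AE \<omega> in M1. \<forall>t\<ge>0. wiener \<omega> t = B \<omega> (snd p0 + t) - fst p0"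
proof -
  have "AE \<omega> in M1. \<omega> \<notin> bad" by (rule AE_not_in[OF bad(1)])
  then show ?thesis by (rule AE_mp) (auto simp: wiener_def)
qed

definition \<Omega> :: "(real \<times> real \<Rightarrow> 'a) measure" where
  "\<Omega> = PiM UNIV (\<lambda>_. M1)"

sublocale P: product_prob_space "\<lambda>_. M1" "UNIV :: (real \<times> real) set" ..

sublocale \<Omega>: prob_space \<Omega> unfolding \<Omega>_def by (rule prob_space_PiM) (rule prob_M1)

definition \<beta> :: "real \<times> real \<Rightarrow> (real \<times> real \<Rightarrow> 'a) \<Rightarrow> real \<Rightarrow> real" where
  "\<beta> z \<omega> t = fst z + wiener (\<omega> z) (t - snd z)"

lemma measurable_component_\<Omega> [measurable]: "(\<lambda>\<omega>. \<omega> z) \<in> \<Omega> \<rightarrow>\<^sub>M M1"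
  unfolding \<Omega>_def by (rule measurable_component_singleton) simp

lemma measurable_\<beta> [measurable]: "(\<lambda>\<omega>. \<beta> z \<omega> t) \<in> borel_measurable \<Omega>"
  unfolding \<beta>_def by measurable

lemma \<beta>_continuous: "continuous_on S (\<beta> z \<omega>)"
  unfolding \<beta>_def
  by (intro continuous_intros continuous_on_compose2[OF wiener_continuous]) auto

lemma \<beta>_start: "t \<le> snd z \<Longrightarrow> \<beta> z \<omega> t = fst z"
  by (simp add: \<beta>_def wiener_start)

lemma distr_component: "distr \<Omega> M1 (\<lambda>\<omega>. \<omega> z) = M1"
  unfolding \<Omega>_def by (rule P.PiM_component) simp

lemma AE_component: "AE x in M1. Q x \<Longrightarrow> AE \<omega> in \<Omega>. Q (\<omega> z)"
  unfolding \<Omega>_def by (rule P.AE_component) auto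

lemma indep_components: "\<Omega>.indep_vars (\<lambda>_. M1) (\<lambda>z \<omega>. \<omega> z) UNIV"
proof (subst \<Omega>.indep_vars_iff_distr_eq_PiM')
  have "distr \<Omega> (PiM UNIV (\<lambda>_. M1)) (\<lambda>\<omega>. \<lambda>z\<in>UNIV. \<omega> z) = \<Omega>"
    unfolding \<Omega>_def by (simp add: restrict_UNIV distr_id2)
  moreover have "PiM UNIV (\<lambda>z. distr \<Omega> M1 (\<lambda>\<omega>. \<omega> z)) = \<Omega>"
    unfolding distr_component by (simp add: \<Omega>_def)
  ultimately show "distr \<Omega> (PiM UNIV (\<lambda>_. M1)) (\<lambda>\<omega>. \<lambda>z\<in>UNIV. \<omega> z) = PiM UNIV (\<lambda>z. distr \<Omega> M1 (\<lambda>\<omega>. \<omega> z))"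
    by simp
qed auto

lemma brownian_\<beta>: "brownian_motion_from \<Omega> z (\<beta> z)"
  unfolding brownian_motion_from_def
proof (intro conjI allI impI)
  have B [measurable]: "snd p0 \<le> t \<Longrightarrow> (\<lambda>\<omega>. B \<omega> t) \<in> borel_measurable M1" for t
    using bm by (auto simp: brownian_motion_from_def)
  have eq: "AE \<omega> in \<Omega>. \<forall>t\<ge>snd z. \<beta> z \<omega> t = fst z - fst p0 + B (\<omega> z) (snd p0 + (t - snd z))"
    using AE_component[OF wiener_AE, of z] by eventually_elim (simp add: \<beta>_def)
  show "(\<lambda>\<omega>. \<beta> z \<omega> t) \<in> borel_measurable \<Omega>" for t by measurable
  show "AE \<omega> in \<Omega>. \<beta> z \<omega> (snd z) = fst z \<and> continuous_on {snd z..} (\<beta> z \<omega>)"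
    by (intro AE_I2) (simp add: \<beta>_start \<beta>_continuous)
  show "distributed \<Omega> lborel (\<lambda>\<omega>. \<beta> z \<omega> v - \<beta> z \<omega> u) (normal_density 0 (sqrt (v - u)))"
    if uv: "snd z \<le> u" "u < v" for u v
  proof -
    let ?v = "snd p0 + (v - snd z)" and ?u = "snd p0 + (u - snd z)"
    have d: "distributed M1 lborel (\<lambda>x. B x ?v - B x ?u) (normal_density 0 (sqrt (v - u)))"
      using bm[unfolded brownian_motion_from_def, THEN conjunct2, THEN conjunct2, THEN conjunct1, rule_format, of ?u ?v] uv by simp
    have "distr \<Omega> lborel (\<lambda>\<omega>. \<beta> z \<omega> v - \<beta> z \<omega> u) = distr \<Omega> lborel (\<lambda>\<omega>. B (\<omega> z) ?v - B (\<omega> z) ?u)"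
      by (intro distr_cong_AE refl) (use eq uv in \<open>auto elim!: eventually_mono\<close>)
    also have "\<dots> = distr (distr \<Omega> M1 (\<lambda>\<omega>. \<omega> z)) lborel (\<lambda>x. B x ?v - B x ?u)"
      using uv by (subst distr_distr) (auto simp: comp_def)
    also have "\<dots> = density lborel (normal_density 0 (sqrt (v - u)))"
      using d by (simp add: distr_component distributed_def)
    finally show ?thesis using d by (simp add: distributed_def)
  qed
  show "\<Omega>.indep_vars (\<lambda>_. borel) (\<lambda>i \<omega>. \<beta> z \<omega> (t (Suc i)) - \<beta> z \<omega> (t i)) {..<n}"
    if t: "snd z \<le> t 0 \<and> strict_mono t" for n and t :: "nat \<Rightarrow> real"
  proof -
    define s where "s i = snd p0 + (t i - snd z)" for i
    have s: "snd p0 \<le> s 0" "strict_mono s" using t by (auto simp: s_def strict_mono_def)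
    have ti: "snd z \<le> t i" for i using t strict_mono_less_eq[of t 0 i] by auto
    have si: "snd p0 \<le> s i" for i using ti[of i] by (simp add: s_def)
    have ind: "M1.indep_vars (\<lambda>_. borel) (\<lambda>i x. B x (s (Suc i)) - B x (s i)) {..<n}"
      using bm[unfolded brownian_motion_from_def, THEN conjunct2, THEN conjunct2, THEN conjunct2, rule_format, of s n] s by simp
    show ?thesis
    proof (cases "n = 0")
      case True
      then show ?thesis unfolding \<Omega>.indep_vars_def by (simp add: \<Omega>.indep_sets_def)
    next
      case False
      have X: "(\<lambda>x. B x (s (Suc i)) - B x (s i)) \<in> borel_measurable M1" for i using si by measurable
      have ae: "AE \<omega> in \<Omega>. \<forall>i. \<beta> z \<omega> (t (Suc i)) - \<beta> z \<omega> (t i) = B (\<omega> z) (s (Suc i)) - B (\<omega> z) (s i)"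
        using eq by eventually_elim (simp add: ti s_def)
      have "distr \<Omega> (PiM {..<n} (\<lambda>_. borel)) (\<lambda>\<omega>. \<lambda>i\<in>{..<n}. \<beta> z \<omega> (t (Suc i)) - \<beta> z \<omega> (t i)) =
          distr \<Omega> (PiM {..<n} (\<lambda>_. borel)) (\<lambda>\<omega>. \<lambda>i\<in>{..<n}. B (\<omega> z) (s (Suc i)) - B (\<omega> z) (s i))"
      proof (intro distr_cong_AE refl)
        show "AE \<omega> in \<Omega>. (\<lambda>i\<in>{..<n}. \<beta> z \<omega> (t (Suc i)) - \<beta> z \<omega> (t i)) = (\<lambda>i\<in>{..<n}. B (\<omega> z) (s (Suc i)) - B (\<omega> z) (s i))"
          using ae by eventually_elim (rule restrict_ext, blast)
        show "(\<lambda>\<omega>. \<lambda>i\<in>{..<n}. B (\<omega> z) (s (Suc i)) - B (\<omega> z) (s i)) \<in> \<Omega> \<rightarrow>\<^sub>M PiM {..<n} (\<lambda>_. borel)"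
          by (rule measurable_compose[OF measurable_component_\<Omega>]) (intro measurable_restrict X)
      qed (intro measurable_restrict, measurable)
      also have "\<dots> = distr (distr \<Omega> M1 (\<lambda>\<omega>. \<omega> z)) (PiM {..<n} (\<lambda>_. borel)) (\<lambda>x. \<lambda>i\<in>{..<n}. B x (s (Suc i)) - B x (s i))"
        by (subst distr_distr) (auto simp: comp_def intro!: measurable_restrict X)
      also have "\<dots> = PiM {..<n} (\<lambda>i. distr M1 borel (\<lambda>x. B x (s (Suc i)) - B x (s i)))"
        unfolding distr_component
        using ind False by (subst (asm) M1.indep_vars_iff_distr_eq_PiM') (auto intro!: X)
      also have "\<dots> = PiM {..<n} (\<lambda>i. distr \<Omega> borel (\<lambda>\<omega>. \<beta> z \<omega> (t (Suc i)) - \<beta> z \<omega> (t i)))"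
      proof (intro PiM_cong refl)
        fix i
        have "distr M1 borel (\<lambda>x. B x (s (Suc i)) - B x (s i)) =
            distr \<Omega> borel (\<lambda>\<omega>. B (\<omega> z) (s (Suc i)) - B (\<omega> z) (s i))"
          by (subst distr_component[symmetric, of z], subst distr_distr) (auto simp: comp_def intro!: X)
        also have "\<dots> = distr \<Omega> borel (\<lambda>\<omega>. \<beta> z \<omega> (t (Suc i)) - \<beta> z \<omega> (t i))"
          by (intro distr_cong_AE refl measurable_compose[OF measurable_component_\<Omega> X])
            (use ae in \<open>auto elim!: eventually_mono\<close>)
        finally show "distr M1 borel (\<lambda>x. B x (s (Suc i)) - B x (s i)) =
            distr \<Omega> borel (\<lambda>\<omega>. \<beta> z \<omega> (t (Suc i)) - \<beta> z \<omega> (t i))" .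
      qed
      finally show ?thesis
        by (subst \<Omega>.indep_vars_iff_distr_eq_PiM') (use False in auto)
    qed
  qed
qed

lemma \<beta>_increments: "finite A \<Longrightarrow> gaussian_increments \<Omega> A \<beta>"
proof (rule gaussian_incrementsI)
  fix G :: "real \<times> real \<Rightarrow> (real \<times> real \<Rightarrow> 'a) \<Rightarrow> real" and h :: "nat \<Rightarrow> real" and n
    and f :: "(real \<times> real) \<times> nat \<Rightarrow> real \<Rightarrow> real"
  assume f: "unit_measurable f"
    and G: "G = (\<lambda>z \<omega>. \<Prod>k | k < n \<and> snd z \<le> h k. f (z, k) (increment \<beta> h (z, k) \<omega>))"
  have [measurable]: "f i \<in> borel_measurable borel" for i by (rule unit_measurableD[OF f])
  have "\<Omega>.indep_vars (\<lambda>_. M1) (\<lambda>z \<omega>. \<omega> z) A"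
    using indep_components by (rule \<Omega>.indep_vars_subset) simp
  then have "\<Omega>.indep_vars (\<lambda>_. borel) (\<lambda>z \<omega>. (\<lambda>x. \<Prod>k | k < n \<and> snd z \<le> h k. f (z, k)
     ((fst z + wiener x (h (Suc k) - snd z)) - (fst z + wiener x (h k - snd z)))) (\<omega> z)) A"
    by (rule \<Omega>.indep_vars_compose2) measurable
  then show "\<Omega>.indep_vars (\<lambda>_. borel) G A"
    unfolding G increment_def \<beta>_def by simp
qed (auto simp: brownian_\<beta> \<Omega>.prob_space_axioms)

end

lemma law_of_step_sums:
  fixes X :: "real \<times> real \<Rightarrow> 'a \<Rightarrow> real \<Rightarrow> real" and Y :: "real \<times> real \<Rightarrow> 'b \<Rightarrow> real \<Rightarrow> real"
  assumes fin: "finite_measure M" "finite_measure N" and A: "finite A"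
    and E: "\<And>n i. i \<in> steps A (grid c n) (L * Suc n) \<Longrightarrow> E n i \<in> borel_measurable M"
    and F: "\<And>n i. i \<in> steps A (grid c n) (L * Suc n) \<Longrightarrow> F n i \<in> borel_measurable N"
    and eq: "\<And>n f. unit_continuous f \<Longrightarrow> (\<integral>\<omega>. (\<Prod>i\<in>steps A (grid c n) (L * Suc n). f i (E n i \<omega>)) \<partial>M) =
      (\<integral>\<omega>. (\<Prod>i\<in>steps A (grid c n) (L * Suc n). f i (F n i \<omega>)) \<partial>N)"
    and X: "\<And>z t. z \<in> A \<Longrightarrow> snd z \<le> t \<Longrightarrow> t \<le> s \<Longrightarrow> (\<lambda>\<omega>. X z \<omega> t) \<in> borel_measurable M"
    and Y: "\<And>z t. z \<in> A \<Longrightarrow> snd z \<le> t \<Longrightarrow> t \<le> s \<Longrightarrow> (\<lambda>\<omega>. Y z \<omega> t) \<in> borel_measurable N"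
    and limX: "\<And>z t. z \<in> A \<Longrightarrow> snd z \<le> t \<Longrightarrow> t \<le> s \<Longrightarrow>
      AE \<omega> in M. (\<lambda>n. fst z + (\<Sum>k\<in>grid_steps c L n (snd z) t. E n (z, k) \<omega>)) \<longlonglongrightarrow> X z \<omega> t"
    and limY: "\<And>z t. z \<in> A \<Longrightarrow> snd z \<le> t \<Longrightarrow> t \<le> s \<Longrightarrow>
      AE \<omega> in N. (\<lambda>n. fst z + (\<Sum>k\<in>grid_steps c L n (snd z) t. F n (z, k) \<omega>)) \<longlonglongrightarrow> Y z \<omega> t"
  shows "law M (SIGMA z:A. {snd z..s}) (\<lambda>i \<omega>. X (fst i) \<omega> (snd i)) =
    law N (SIGMA z:A. {snd z..s}) (\<lambda>i \<omega>. Y (fst i) \<omega> (snd i))"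
proof -
  define G where "G n i v = fst (fst i) + (\<Sum>k\<in>grid_steps c L n (snd (fst i)) (snd i). v (fst i, k))"
    for n and i :: "(real \<times> real) \<times> real" and v :: "(real \<times> real) \<times> nat \<Rightarrow> real"
  have sub: "(z, k) \<in> steps A (grid c n) (L * Suc n)" if "z \<in> A" "k \<in> grid_steps c L n (snd z) t" for z k n t
    using that by (auto simp: steps_def grid_steps_def)
  show ?thesis
  proof (rule law_limit[OF fin, where \<Lambda> = "\<lambda>n. steps A (grid c n) (L * Suc n)" and A = E and B = F and G = G])
    fix n
    show "law M (steps A (grid c n) (L * Suc n)) (E n) = law N (steps A (grid c n) (L * Suc n)) (F n)"
    proof (rule law_eqI[OF fin])
      fix J and f :: "(real \<times> real) \<times> nat \<Rightarrow> real \<Rightarrow> real"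
      assume J: "finite J" "J \<subseteq> steps A (grid c n) (L * Suc n)" and f: "unit_continuous f"
      define f' where "f' i = (if i \<in> J then f i else (\<lambda>_. 1))" for i
      have f': "unit_continuous f'" using f by (simp add: unit_continuous_def f'_def)
      have "(\<Prod>i\<in>steps A (grid c n) (L * Suc n). f' i (e i)) = (\<Prod>i\<in>J. f i (e i))" for e
        using J finite_steps[OF A] by (intro prod.mono_neutral_cong_right) (auto simp: f'_def)
      then show "(\<integral>\<omega>. (\<Prod>i\<in>J. f i (E n i \<omega>)) \<partial>M) = (\<integral>\<omega>. (\<Prod>i\<in>J. f i (F n i \<omega>)) \<partial>N)"
        using eq[OF f', of n] by simp
    qed (auto intro: E F)
    fix i assume i: "i \<in> (SIGMA z:A. {snd z..s})"
    show "G n i \<in> borel_measurable (PiM (steps A (grid c n) (L * Suc n)) (\<lambda>_. borel))"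
      unfolding G_def using i sub[of "fst i" _ n "snd i"]
      by (intro borel_measurable_add borel_measurable_const borel_measurable_sum measurable_component_singleton) auto
  next
    fix i assume i: "i \<in> (SIGMA z:A. {snd z..s})"
    have *: "G n i (restrict h (steps A (grid c n) (L * Suc n))) =
       fst (fst i) + (\<Sum>k\<in>grid_steps c L n (snd (fst i)) (snd i). h (fst i, k))" for n h
    proof -
      have "fst i \<in> A" using i by auto
      then show ?thesis using sub[of "fst i" _ n "snd i"] unfolding G_def
        by (intro arg_cong2[where f = "(+)"] sum.cong refl) simp
    qed
    show "AE \<omega> in M. (\<lambda>n. G n i (\<lambda>l\<in>steps A (grid c n) (L * Suc n). E n l \<omega>)) \<longlonglongrightarrow> X (fst i) \<omega> (snd i)"
      unfolding * using i by (intro limX) auto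
    show "AE \<omega> in N. (\<lambda>n. G n i (\<lambda>l\<in>steps A (grid c n) (L * Suc n). F n l \<omega>)) \<longlonglongrightarrow> Y (fst i) \<omega> (snd i)"
      unfolding * using i by (intro limY) auto
  qed (auto intro: X Y E F)
qed

lemma increment_sum_tendsto:
  assumes "continuous_on {snd z..} (X z \<omega>)" "X z \<omega> (snd z) = fst z" "c \<le> snd z" "snd z \<le> t" "t \<le> c + real L"
  shows "(\<lambda>n. fst z + (\<Sum>k\<in>grid_steps c L n (snd z) t. increment X (grid c n) (z, k) \<omega>)) \<longlonglongrightarrow> X z \<omega> t"
proof -
  have "continuous_on {snd z..t} (X z \<omega>)" using assms(1) by (rule continuous_on_subset) auto
  then have "(\<lambda>n. \<Sum>k\<in>grid_steps c L n (snd z) t. X z \<omega> (grid c n (Suc k)) - X z \<omega> (grid c n k))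
     \<longlonglongrightarrow> X z \<omega> t - X z \<omega> (snd z)"
    by (intro driver_sum_tendsto[where B = "\<lambda>_::unit. X z \<omega>" and m = "\<lambda>_. ()" and Q = UNIV]) (use assms in auto)
  then show ?thesis using tendsto_add[OF tendsto_const, of _ _ _ "fst z"] assms(2) by (force simp: increment_def)
qed

lemma le_grid_Suc: "a \<le> grid c n k \<Longrightarrow> a \<le> grid c n (Suc k)"
  using strict_monoD[OF strict_mono_grid, of k "Suc k" c n] by simp

lemma law_gaussian_unique:
  fixes X :: "real \<times> real \<Rightarrow> 'a \<Rightarrow> real \<Rightarrow> real" and Y :: "real \<times> real \<Rightarrow> 'b \<Rightarrow> real \<Rightarrow> real"
  assumes fin: "finite_measure M" "finite_measure N"
    and g: "\<And>A. finite A \<Longrightarrow> A \<subseteq> D \<Longrightarrow> gaussian_increments M A X" "\<And>A. finite A \<Longrightarrow> A \<subseteq> D \<Longrightarrow> gaussian_increments N A Y"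
    and X: "\<And>z t. z \<in> D \<Longrightarrow> snd z \<le> t \<Longrightarrow> (\<lambda>\<omega>. X z \<omega> t) \<in> borel_measurable M"
    and Y: "\<And>z t. z \<in> D \<Longrightarrow> snd z \<le> t \<Longrightarrow> (\<lambda>\<omega>. Y z \<omega> t) \<in> borel_measurable N"
    and cX: "\<And>z. z \<in> D \<Longrightarrow> AE \<omega> in M. X z \<omega> (snd z) = fst z \<and> continuous_on {snd z..} (X z \<omega>)"
    and cY: "\<And>z. z \<in> D \<Longrightarrow> AE \<omega> in N. Y z \<omega> (snd z) = fst z \<and> continuous_on {snd z..} (Y z \<omega>)"
  shows "law M (SIGMA z:D. {snd z..}) (\<lambda>i \<omega>. X (fst i) \<omega> (snd i)) =
    law N (SIGMA z:D. {snd z..}) (\<lambda>i \<omega>. Y (fst i) \<omega> (snd i))"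
proof (rule law_finite_subsets[OF fin])
  fix J assume J: "finite J" "J \<subseteq> (SIGMA z:D. {snd z..})"
  define A where "A = fst ` J"
  have A: "finite A" "A \<subseteq> D" using J by (auto simp: A_def)
  have "bdd_above (snd ` J)" using J by (intro bdd_above_finite) auto
  then obtain s where s: "\<And>x. x \<in> snd ` J \<Longrightarrow> x \<le> s" by (auto simp: bdd_above_def)
  have "bdd_below (snd ` A)" using A by (intro bdd_below_finite) auto
  then obtain s' where s': "\<And>x. x \<in> snd ` A \<Longrightarrow> s' \<le> x" by (auto simp: bdd_below_def)
  obtain L where L: "s - s' \<le> real L" using real_arch_simple by blast
  define c where "c = s - real L"
  have c: "c \<le> snd z" if "z \<in> A" for z using s'[of "snd z"] that L by (simp add: c_def)
  have "law M (SIGMA z:A. {snd z..s}) (\<lambda>i \<omega>. X (fst i) \<omega> (snd i)) =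
    law N (SIGMA z:A. {snd z..s}) (\<lambda>i \<omega>. Y (fst i) \<omega> (snd i))"
  proof (rule law_of_step_sums[OF fin A(1), where c = c and L = L and E = "\<lambda>n. increment X (grid c n)" and F = "\<lambda>n. increment Y (grid c n)"])
    fix n f assume "unit_continuous (f :: (real \<times> real) \<times> nat \<Rightarrow> real \<Rightarrow> real)"
    then have "unit_measurable f" by (rule unit_continuous_measurable)
    then show "(\<integral>\<omega>. (\<Prod>i\<in>steps A (grid c n) (L * Suc n). f i (increment X (grid c n) i \<omega>)) \<partial>M) =
      (\<integral>\<omega>. (\<Prod>i\<in>steps A (grid c n) (L * Suc n). f i (increment Y (grid c n) i \<omega>)) \<partial>N)"
      using g[OF A] strict_mono_grid[of c n] unfolding gaussian_increments_def by simp
  next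
    fix z t assume z: "z \<in> A" "snd z \<le> t" "t \<le> s"
    then have zD: "z \<in> D" and t: "t \<le> c + real L" using A by (auto simp: c_def)
    show "AE \<omega> in M. (\<lambda>n. fst z + (\<Sum>k\<in>grid_steps c L n (snd z) t. increment X (grid c n) (z, k) \<omega>)) \<longlonglongrightarrow> X z \<omega> t"
      using cX[OF zD] by eventually_elim (intro increment_sum_tendsto c z t; simp)
    show "AE \<omega> in N. (\<lambda>n. fst z + (\<Sum>k\<in>grid_steps c L n (snd z) t. increment Y (grid c n) (z, k) \<omega>)) \<longlonglongrightarrow> Y z \<omega> t"
      using cY[OF zD] by eventually_elim (intro increment_sum_tendsto c z t; simp)
  next
    fix n i assume "i \<in> steps A (grid c n) (L * Suc n)"
    then have "fst i \<in> D" "snd (fst i) \<le> grid c n (snd i)" using A by (auto simp: steps_def)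
    then show "increment X (grid c n) i \<in> borel_measurable M" "increment Y (grid c n) i \<in> borel_measurable N"
      unfolding increment_def by (auto intro!: borel_measurable_diff X Y le_grid_Suc)
  qed (use A X Y in auto)
  then show "law M J (\<lambda>i \<omega>. X (fst i) \<omega> (snd i)) = law N J (\<lambda>i \<omega>. Y (fst i) \<omega> (snd i))"
  proof (rule law_subset)
    show "J \<subseteq> (SIGMA z:A. {snd z..s})"
    proof
      fix i assume i: "i \<in> J"
      then have "fst i \<in> A" "snd (fst i) \<le> snd i" "snd i \<le> s" using J(2) s by (auto simp: A_def)
      then show "i \<in> (SIGMA z:A. {snd z..s})" by (simp add: mem_Sigma_iff[of "fst i" "snd i", simplified])
    qed
  qed (use A X Y in auto)
qed (auto intro: X Y)

lemma gauss_mean_1: "0 < v \<Longrightarrow> gauss_mean (\<lambda>_. 1) v = 1"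
  by (simp add: gauss_mean_def integral_normal_density)

lemma gauss_mean_nonneg: "(\<And>x. 0 \<le> f x) \<Longrightarrow> 0 \<le> gauss_mean f v"
  unfolding gauss_mean_def by (intro integral_nonneg_AE AE_I2) simp

section \<open>Increments selected from the past\<close>

context brownian_source
begin

definition past :: "(real \<times> real) set \<Rightarrow> real \<Rightarrow> (real \<times> real \<Rightarrow> 'a) measure" where
  "past A s = vimage_algebra (space \<Omega>) (\<lambda>\<omega>. \<lambda>i\<in>(SIGMA z:A. {snd z..s}). \<beta> (fst i) \<omega> (snd i))
     (PiM (SIGMA z:A. {snd z..s}) (\<lambda>_. borel))"

lemma measurable_restrict_\<beta>:
  "(\<lambda>\<omega>. \<lambda>i\<in>K. \<beta> (fst i) \<omega> (snd i)) \<in> \<Omega> \<rightarrow>\<^sub>M PiM K (\<lambda>_. borel)"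
  by (intro measurable_law_map) measurable

lemma space_past [simp]: "space (past A s) = space \<Omega>"
  by (simp add: past_def)

lemma sets_past_subset: "sets (past A s) \<subseteq> sets \<Omega>"
  unfolding past_def by (intro sets_image_in_sets measurable_restrict_\<beta>) simp

lemma subalgebra_past: "subalgebra \<Omega> (past A s)"
  using sets_past_subset by (simp add: subalgebra_def)

lemma measurable_past_\<beta>:
  assumes "z \<in> A" "snd z \<le> t" "t \<le> s"
  shows "(\<lambda>\<omega>. \<beta> z \<omega> t) \<in> borel_measurable (past A s)"
proof -
  let ?K = "SIGMA z:A. {snd z..s}"
  have K: "(z, t) \<in> ?K" using assms by simp
  have "(\<lambda>\<omega>. \<lambda>i\<in>?K. \<beta> (fst i) \<omega> (snd i)) \<in> past A s \<rightarrow>\<^sub>M PiM ?K (\<lambda>_. borel)"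
    unfolding past_def
    by (rule measurable_vimage_algebra1) (use measurable_restrict_\<beta>[THEN measurable_space] in auto)
  then have "(\<lambda>\<omega>. (\<lambda>i\<in>?K. \<beta> (fst i) \<omega> (snd i)) (z, t)) \<in> borel_measurable (past A s)"
    by (rule measurable_compose[OF _ measurable_component_singleton]) (rule K)
  then show ?thesis using K by simp
qed

lemma past_mono:
  assumes "s \<le> t"
  shows "sets (past A s) \<subseteq> sets (past A t)"
proof -
  have "(\<lambda>\<omega>. \<lambda>i\<in>(SIGMA z:A. {snd z..s}). \<beta> (fst i) \<omega> (snd i)) \<in> past A t \<rightarrow>\<^sub>M PiM (SIGMA z:A. {snd z..s}) (\<lambda>_. borel)"
    using assms by (intro measurable_law_map measurable_past_\<beta>) auto
  then show ?thesis unfolding past_def[of A s] by (intro sets_image_in_sets) auto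
qed

lemma measurable_past_mono:
  "f \<in> borel_measurable (past A s) \<Longrightarrow> s \<le> t \<Longrightarrow> f \<in> borel_measurable (past A t)"
  by (rule measurable_from_subalg[of "past A t" "past A s"]) (simp_all add: subalgebra_def past_mono)

lemma measurable_increment_\<beta> [measurable]: "increment \<beta> h i \<in> borel_measurable \<Omega>"
  unfolding increment_def[abs_def] by measurable

lemma law_density_past:
  assumes A: "finite A" and A': "A' \<subseteq> A" "\<And>z. z \<in> A' \<Longrightarrow> snd z \<le> s" and s: "s < s'" and g: "unit_measurable g"
  defines "K \<equiv> SIGMA z:A. {snd z..s}"
  shows "law (density \<Omega> (\<lambda>\<omega>. ennreal (\<Prod>z\<in>A'. g z (\<beta> z \<omega> s' - \<beta> z \<omega> s)))) K (\<lambda>i \<omega>. \<beta> (fst i) \<omega> (snd i)) =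
    law (density \<Omega> (\<lambda>\<omega>. ennreal (\<Prod>z\<in>A'. gauss_mean (g z) (s' - s)))) K (\<lambda>i \<omega>. \<beta> (fst i) \<omega> (snd i))"
proof -
  have [measurable]: "g z \<in> borel_measurable borel" for z by (rule unit_measurableD[OF g])
  define Q where "Q \<omega> = (\<Prod>z\<in>A'. g z (\<beta> z \<omega> s' - \<beta> z \<omega> s))" for \<omega>
  define C where "C = (\<Prod>z\<in>A'. gauss_mean (g z) (s' - s))"
  have Q [measurable]: "Q \<in> borel_measurable \<Omega>" unfolding Q_def by measurable
  have Q01: "0 \<le> Q \<omega>" "Q \<omega> \<le> 1" for \<omega>
    unfolding Q_def using unit_measurableD(2,3)[OF g] by (auto intro!: prod_unit_bounds)
  have C0: "0 \<le> C" unfolding C_def by (intro prod_nonneg gauss_mean_nonneg ballI unit_measurableD[OF g])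
  have finQ: "finite_measure (density \<Omega> (\<lambda>\<omega>. ennreal (Q \<omega>)))"
  proof
    have "(\<integral>\<^sup>+\<omega>. ennreal (Q \<omega>) \<partial>\<Omega>) \<le> (\<integral>\<^sup>+\<omega>. 1 \<partial>\<Omega>)"
      using Q01 by (intro nn_integral_mono) (simp add: ennreal_le_1)
    also have "\<dots> < \<infinity>" by (simp add: \<Omega>.emeasure_space_1)
    finally show "emeasure (density \<Omega> (\<lambda>\<omega>. ennreal (Q \<omega>))) (space (density \<Omega> (\<lambda>\<omega>. ennreal (Q \<omega>)))) \<noteq> \<infinity>"
      by (simp add: emeasure_density)
  qed
  have finC: "finite_measure (density \<Omega> (\<lambda>\<omega>. ennreal C))"
    by standard (simp add: emeasure_density \<Omega>.emeasure_space_1)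
  have "bdd_below (snd ` A)" using A by (intro bdd_below_finite) auto
  then obtain b where b: "\<And>x. x \<in> snd ` A \<Longrightarrow> b \<le> x" by (auto simp: bdd_below_def)
  obtain L where L: "s - b \<le> real L" using real_arch_simple by blast
  define c where "c = s - real L"
  have c: "c \<le> snd z" if "z \<in> A" for z using b[of "snd z"] that L by (simp add: c_def)
  show ?thesis unfolding K_def Q_def[symmetric] C_def[symmetric]
  proof (rule law_of_step_sums[OF finQ finC A, where c = c and L = L and E = "\<lambda>n. increment \<beta> (grid c n)" and F = "\<lambda>n. increment \<beta> (grid c n)"])
    fix n f assume "unit_continuous (f :: (real \<times> real) \<times> nat \<Rightarrow> real \<Rightarrow> real)"
    then have f: "unit_measurable f" by (rule unit_continuous_measurable)
    have [measurable]: "f i \<in> borel_measurable borel" for i by (rule unit_measurableD[OF f])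
    define m where "m = L * Suc n"
    define h where "h k = (if k \<le> m then grid c n k else s' + (real k - real (Suc m)))" for k
    have gm: "grid c n m = s" by (simp add: grid_def m_def c_def field_simps)
    have "h k < h (Suc k)" for k
      using strict_monoD[OF strict_mono_grid, of k "Suc k" c n] gm s by (cases k m rule: linorder_cases) (auto simp: h_def)
    then have h: "strict_mono h" by (rule strict_mono_Suc_iff[THEN iffD2, rule_format])
    have hm: "h m = s" "h (Suc m) = s'" using gm by (simp_all add: h_def)
    define f' where "f' i = (if snd i < m then f i else if fst i \<in> A' then g (fst i) else (\<lambda>_. 1))" for i
    have f': "unit_measurable f'" using f g by (simp add: unit_measurable_def f'_def)
    have split: "steps A h (Suc m) = steps A (grid c n) m \<union> (\<lambda>z. (z, m)) ` {z\<in>A. snd z \<le> s}"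
      by (auto simp: steps_def h_def gm less_Suc_eq)
    have prod: "(\<Prod>i\<in>steps A h (Suc m). u i) = (\<Prod>i\<in>steps A (grid c n) m. u i) * (\<Prod>z | z \<in> A \<and> snd z \<le> s. u (z, m))"
      for u :: "_ \<Rightarrow> real"
    proof -
      have "(\<Prod>i\<in>(\<lambda>z. (z, m)) ` {z\<in>A. snd z \<le> s}. u i) = (\<Prod>z | z \<in> A \<and> snd z \<le> s. u (z, m))"
        by (subst prod.reindex) (auto simp: inj_on_def)
      then show ?thesis unfolding split
        by (subst prod.union_disjoint) (use A finite_steps[OF A] in \<open>auto simp: steps_def\<close>)
    qed
    have incr1: "(\<Prod>i\<in>steps A h (Suc m). f' i (increment \<beta> h i \<omega>)) =
       (\<Prod>i\<in>steps A (grid c n) m. f i (increment \<beta> (grid c n) i \<omega>)) * Q \<omega>" for \<omega>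
      unfolding prod
    proof (intro arg_cong2[where f = "(*)"] prod.cong refl)
      fix i assume "i \<in> steps A (grid c n) m"
      then have "snd i < m" by (auto simp: steps_def)
      then show "f' i (increment \<beta> h i \<omega>) = f i (increment \<beta> (grid c n) i \<omega>)"
        by (simp add: f'_def increment_def h_def)
    next
      have "(\<Prod>z | z \<in> A \<and> snd z \<le> s. f' (z, m) (increment \<beta> h (z, m) \<omega>)) = (\<Prod>z\<in>A'. f' (z, m) (increment \<beta> h (z, m) \<omega>))"
        using A A' by (intro prod.mono_neutral_right) (auto simp: f'_def)
      also have "\<dots> = Q \<omega>" unfolding Q_def by (intro prod.cong refl) (simp add: f'_def increment_def hm)
      finally show "(\<Prod>z | z \<in> A \<and> snd z \<le> s. f' (z, m) (increment \<beta> h (z, m) \<omega>)) = Q \<omega>" .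
    qed
    have incr2: "(\<Prod>i\<in>steps A h (Suc m). gauss_mean (f' i) (h (Suc (snd i)) - h (snd i))) =
       (\<Prod>i\<in>steps A (grid c n) m. gauss_mean (f i) (grid c n (Suc (snd i)) - grid c n (snd i))) * C"
      unfolding prod
    proof (intro arg_cong2[where f = "(*)"] prod.cong refl)
      fix i assume "i \<in> steps A (grid c n) m"
      then have "snd i < m" by (auto simp: steps_def)
      then show "gauss_mean (f' i) (h (Suc (snd i)) - h (snd i)) = gauss_mean (f i) (grid c n (Suc (snd i)) - grid c n (snd i))"
        by (simp add: f'_def h_def)
    next
      have "(\<Prod>z | z \<in> A \<and> snd z \<le> s. gauss_mean (f' (z, m)) (h (Suc (snd (z, m))) - h (snd (z, m)))) =
          (\<Prod>z\<in>A'. gauss_mean (f' (z, m)) (h (Suc (snd (z, m))) - h (snd (z, m))))"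
        using A A' s by (intro prod.mono_neutral_right) (auto simp: f'_def hm gauss_mean_1)
      also have "\<dots> = C" unfolding C_def by (intro prod.cong refl) (simp add: f'_def hm)
      finally show "(\<Prod>z | z \<in> A \<and> snd z \<le> s. gauss_mean (f' (z, m)) (h (Suc (snd (z, m))) - h (snd (z, m)))) = C" .
    qed
    define R where "R \<omega> = (\<Prod>i\<in>steps A (grid c n) m. f i (increment \<beta> (grid c n) i \<omega>))" for \<omega>
    have R [measurable]: "R \<in> borel_measurable \<Omega>" unfolding R_def increment_def by measurable
    have "(\<integral>\<omega>. R \<omega> \<partial>density \<Omega> (\<lambda>\<omega>. ennreal (Q \<omega>))) = (\<integral>\<omega>. R \<omega> * Q \<omega> \<partial>\<Omega>)"
      by (subst integral_density) (auto simp: Q01 mult.commute)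
    also have "\<dots> = (\<Prod>i\<in>steps A h (Suc m). gauss_mean (f' i) (h (Suc (snd i)) - h (snd i)))"
      using \<beta>_increments[OF A, unfolded gaussian_increments_def, rule_format, OF h f', of "Suc m"]
      unfolding incr1 R_def .
    also have "\<dots> = (\<integral>\<omega>. R \<omega> \<partial>\<Omega>) * C"
      using \<beta>_increments[OF A, unfolded gaussian_increments_def, rule_format, OF strict_mono_grid[of c n] f, of m]
      unfolding incr2 R_def by simp
    also have "\<dots> = (\<integral>\<omega>. R \<omega> \<partial>density \<Omega> (\<lambda>\<omega>. ennreal C))"
      by (subst integral_density) (auto simp: C0 mult.commute)
    finally show "(\<integral>\<omega>. (\<Prod>i\<in>steps A (grid c n) (L * Suc n). f i (increment \<beta> (grid c n) i \<omega>)) \<partial>density \<Omega> (\<lambda>\<omega>. ennreal (Q \<omega>))) =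
      (\<integral>\<omega>. (\<Prod>i\<in>steps A (grid c n) (L * Suc n). f i (increment \<beta> (grid c n) i \<omega>)) \<partial>density \<Omega> (\<lambda>\<omega>. ennreal C))"
      unfolding R_def m_def .
  next
    fix z t assume z: "z \<in> A" "snd z \<le> t" "t \<le> s"
    then have t: "t \<le> c + real L" by (simp add: c_def)
    show "AE \<omega> in density \<Omega> (\<lambda>\<omega>. ennreal (Q \<omega>)). (\<lambda>n. fst z + (\<Sum>k\<in>grid_steps c L n (snd z) t. increment \<beta> (grid c n) (z, k) \<omega>)) \<longlonglongrightarrow> \<beta> z \<omega> t"
      "AE \<omega> in density \<Omega> (\<lambda>\<omega>. ennreal C). (\<lambda>n. fst z + (\<Sum>k\<in>grid_steps c L n (snd z) t. increment \<beta> (grid c n) (z, k) \<omega>)) \<longlonglongrightarrow> \<beta> z \<omega> t"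
      by (intro AE_I2 increment_sum_tendsto c z t; simp add: \<beta>_start \<beta>_continuous)+
  qed simp_all
qed

lemma future_increments:
  assumes A: "finite A" and A': "A' \<subseteq> A" "\<And>z. z \<in> A' \<Longrightarrow> snd z \<le> s" and s: "s < s'" and g: "unit_measurable g"
    and Z: "Z \<in> borel_measurable (past A s)" "\<And>\<omega>. 0 \<le> Z \<omega> \<and> Z \<omega> \<le> 1"
  shows "(\<integral>\<omega>. Z \<omega> * (\<Prod>z\<in>A'. g z (\<beta> z \<omega> s' - \<beta> z \<omega> s)) \<partial>\<Omega>) = (\<integral>\<omega>. Z \<omega> \<partial>\<Omega>) * (\<Prod>z\<in>A'. gauss_mean (g z) (s' - s))"
proof -
  have [measurable]: "g z \<in> borel_measurable borel" for z by (rule unit_measurableD[OF g])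
  define Q where "Q \<omega> = (\<Prod>z\<in>A'. g z (\<beta> z \<omega> s' - \<beta> z \<omega> s))" for \<omega>
  define C where "C = (\<Prod>z\<in>A'. gauss_mean (g z) (s' - s))"
  have Q [measurable]: "Q \<in> borel_measurable \<Omega>" unfolding Q_def by measurable
  have Q01: "0 \<le> Q \<omega>" "Q \<omega> \<le> 1" for \<omega>
    unfolding Q_def using unit_measurableD(2,3)[OF g] by (auto intro!: prod_unit_bounds)
  have C0: "0 \<le> C" unfolding C_def by (intro prod_nonneg gauss_mean_nonneg ballI unit_measurableD[OF g])
  define M where "M = density \<Omega> (\<lambda>\<omega>. ennreal (Q \<omega>))"
  define N where "N = density \<Omega> (\<lambda>\<omega>. ennreal C)"
  let ?K = "SIGMA z:A. {snd z..s}"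
  let ?X = "\<lambda>\<omega>. \<lambda>i\<in>?K. \<beta> (fst i) \<omega> (snd i)"
  have sM [simp]: "sets M = sets \<Omega>" "sets N = sets \<Omega>" "space M = space \<Omega>" "space N = space \<Omega>"
    by (simp_all add: M_def N_def)
  have law: "distr M (PiM ?K (\<lambda>_. borel)) ?X = distr N (PiM ?K (\<lambda>_. borel)) ?X"
    using law_density_past[OF A A' s g] unfolding law_def M_def N_def Q_def C_def .
  have sub: "subalgebra M (past A s)" "subalgebra N (past A s)"
    using subalgebra_past by (simp_all add: subalgebra_def)
  have X: "?X \<in> M \<rightarrow>\<^sub>M PiM ?K (\<lambda>_. borel)" "?X \<in> N \<rightarrow>\<^sub>M PiM ?K (\<lambda>_. borel)"
    using measurable_restrict_\<beta>[of ?K] by (simp_all cong: measurable_cong_sets)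
  have "restr_to_subalg M (past A s) = restr_to_subalg N (past A s)"
  proof (rule measure_eqI)
    fix S assume "S \<in> sets (restr_to_subalg M (past A s))"
    then have S: "S \<in> sets (past A s)" using sub by (simp add: sets_restr_to_subalg)
    then obtain T where T: "T \<in> sets (PiM ?K (\<lambda>_. borel))" "S = ?X -` T \<inter> space \<Omega>"
      unfolding past_def by (auto simp: sets_vimage_algebra2[OF measurable_restrict_\<beta>[THEN measurable_space, THEN funcsetI]])
    have "emeasure M S = emeasure N S"
      using emeasure_distr[OF X(1) T(1)] emeasure_distr[OF X(2) T(1)] law T(2) by simp
    then show "emeasure (restr_to_subalg M (past A s)) S = emeasure (restr_to_subalg N (past A s)) S"
      using sub S by (simp add: emeasure_restr_to_subalg)
  qed (use sub in \<open>simp add: sets_restr_to_subalg\<close>)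
  then have "(\<integral>\<omega>. Z \<omega> \<partial>M) = (\<integral>\<omega>. Z \<omega> \<partial>N)"
    using integral_subalgebra2[OF sub(1) Z(1)] integral_subalgebra2[OF sub(2) Z(1)] by simp
  moreover have [measurable]: "Z \<in> borel_measurable \<Omega>" by (rule measurable_from_subalg[OF subalgebra_past Z(1)])
  have "(\<integral>\<omega>. Z \<omega> \<partial>M) = (\<integral>\<omega>. Z \<omega> * Q \<omega> \<partial>\<Omega>)"
    unfolding M_def by (subst integral_density) (auto simp: Q01 mult.commute)
  moreover have "(\<integral>\<omega>. Z \<omega> \<partial>N) = (\<integral>\<omega>. Z \<omega> \<partial>\<Omega>) * C"
    unfolding N_def by (subst integral_density) (auto simp: C0 mult.commute)
  ultimately show ?thesis by (simp add: Q_def C_def)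
qed

lemma prod_steps_by_time:
  assumes "finite J"
  shows "(\<Prod>i\<in>steps J h n. u i) = (\<Prod>k<n. \<Prod>p | p \<in> J \<and> snd p \<le> h k. (u (p, k) :: real))"
proof -
  have "(\<Prod>k<n. \<Prod>p | p \<in> J \<and> snd p \<le> h k. u (p, k)) = (\<Prod>(k, p)\<in>(SIGMA k:{..<n}. {p. p \<in> J \<and> snd p \<le> h k}). u (p, k))"
    using assms by (subst prod.Sigma) auto
  also have "\<dots> = (\<Prod>i\<in>steps J h n. u i)"
    by (rule prod.reindex_bij_witness[of _ "\<lambda>(p, k). (k, p)" "\<lambda>(k, p). (p, k)"]) (auto simp: steps_def)
  finally show ?thesis by simp
qed

text \<open>Choosing at each time step, on the basis of the past, distinct drivers for the members of \<open>J\<close> does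
  not change the law of the increments.\<close>

lemma predictable_increments:
  fixes \<pi> :: "nat \<Rightarrow> real \<times> real \<Rightarrow> (real \<times> real \<Rightarrow> 'a) \<Rightarrow> real \<times> real"
  assumes A: "finite A" and J: "finite J" and h: "strict_mono h" and f: "unit_measurable f"
    and \<pi>: "\<And>k p \<omega>. p \<in> J \<Longrightarrow> snd p \<le> h k \<Longrightarrow> \<pi> k p \<omega> \<in> A \<and> snd (\<pi> k p \<omega>) \<le> h k"
    and inj: "\<And>k p q \<omega>. p \<in> J \<Longrightarrow> q \<in> J \<Longrightarrow> snd p \<le> h k \<Longrightarrow> snd q \<le> h k \<Longrightarrow> p \<noteq> q \<Longrightarrow> \<pi> k p \<omega> \<noteq> \<pi> k q \<omega>"
    and meas: "\<And>k p z. p \<in> J \<Longrightarrow> snd p \<le> h k \<Longrightarrow> Measurable.pred (past A (h k)) (\<lambda>\<omega>. \<pi> k p \<omega> = z)"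
  shows "(\<integral>\<omega>. (\<Prod>i\<in>steps J h n. f i (increment \<beta> h (\<pi> (snd i) (fst i) \<omega>, snd i) \<omega>)) \<partial>\<Omega>) =
    (\<Prod>i\<in>steps J h n. gauss_mean (f i) (h (Suc (snd i)) - h (snd i)))"
proof -
  have [measurable]: "f i \<in> borel_measurable borel" for i by (rule unit_measurableD[OF f])
  define Jk where "Jk k = {p\<in>J. snd p \<le> h k}" for k
  define T where "T k \<omega> = (\<Prod>p\<in>Jk k. f (p, k) (increment \<beta> h (\<pi> k p \<omega>, k) \<omega>))" for k \<omega>
  have finJk [simp]: "finite (Jk k)" for k using J by (simp add: Jk_def)
  have T01: "0 \<le> T k \<omega>" "T k \<omega> \<le> 1" for k \<omega>
    unfolding T_def using unit_measurableD(2,3)[OF f] by (auto intro!: prod_unit_bounds)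
  define \<Sigma> where "\<Sigma> k = PiE (Jk k) (\<lambda>_. A)" for k
  have fin\<Sigma> [simp]: "finite (\<Sigma> k)" for k unfolding \<Sigma>_def using A by (intro finite_PiE) auto
  define I where "I k \<sigma> \<omega> = (if \<forall>p\<in>Jk k. \<pi> k p \<omega> = \<sigma> p then 1 else 0 :: real)" for k \<sigma> \<omega>
  define H where "H k \<sigma> \<omega> = (\<Prod>p\<in>Jk k. f (p, k) (increment \<beta> h (\<sigma> p, k) \<omega>))" for k \<sigma> \<omega>
  have hh: "h k < h (Suc k)" for k using strict_monoD[OF h, of k "Suc k"] by simp
  have decomp: "T k \<omega> = (\<Sum>\<sigma>\<in>\<Sigma> k. I k \<sigma> \<omega> * H k \<sigma> \<omega>)" for k \<omega>
  proof -
    define \<sigma>0 where "\<sigma>0 = (\<lambda>p\<in>Jk k. \<pi> k p \<omega>)"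
    have s0: "\<sigma>0 \<in> \<Sigma> k" using \<pi> by (auto simp: \<sigma>0_def \<Sigma>_def Jk_def)
    have "(\<Sum>\<sigma>\<in>\<Sigma> k. I k \<sigma> \<omega> * H k \<sigma> \<omega>) = (\<Sum>\<sigma>\<in>{\<sigma>0}. I k \<sigma> \<omega> * H k \<sigma> \<omega>)"
    proof (intro sum.mono_neutral_right ballI)
      fix \<sigma> assume \<sigma>: "\<sigma> \<in> \<Sigma> k - {\<sigma>0}"
      have "\<not> (\<forall>p\<in>Jk k. \<pi> k p \<omega> = \<sigma> p)"
      proof
        assume "\<forall>p\<in>Jk k. \<pi> k p \<omega> = \<sigma> p"
        then have "\<sigma> = \<sigma>0" using \<sigma> s0 unfolding \<Sigma>_def by (intro PiE_ext[of \<sigma> "Jk k" "\<lambda>_. A"]) (auto simp: \<sigma>0_def)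
        then show False using \<sigma> by simp
      qed
      then show "I k \<sigma> \<omega> * H k \<sigma> \<omega> = 0" by (auto simp: I_def)
    qed (use s0 in auto)
    also have "\<dots> = T k \<omega>" by (simp add: I_def H_def T_def \<sigma>0_def)
    finally show ?thesis ..
  qed
  have I_meas: "I k \<sigma> \<in> borel_measurable (past A (h k))" for k \<sigma>
  proof -
    have [measurable]: "Measurable.pred (past A (h k)) (\<lambda>\<omega>. \<forall>p\<in>Jk k. \<pi> k p \<omega> = \<sigma> p)"
      by (intro pred_intros_finite meas) (auto simp: Jk_def J)
    show ?thesis unfolding I_def by measurable
  qed
  have H_meas: "H k \<sigma> \<in> borel_measurable (past A (h (Suc k)))" if "\<sigma> \<in> \<Sigma> k" "\<And>p. p \<in> Jk k \<Longrightarrow> snd (\<sigma> p) \<le> h k" for k \<sigma>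
    unfolding H_def increment_def fst_conv snd_conv
  proof (intro borel_measurable_prod measurable_compose[OF _ unit_measurableD(1)[OF f]] borel_measurable_diff measurable_past_\<beta>)
    fix p assume p: "p \<in> Jk k"
    show "\<sigma> p \<in> A" using that(1) p by (auto simp: \<Sigma>_def)
    show "snd (\<sigma> p) \<le> h k" by (rule that(2)[OF p])
    show "snd (\<sigma> p) \<le> h (Suc k)" using that(2)[OF p] hh[of k] by linarith
  qed (use hh[of k] that(1) in \<open>auto simp: \<Sigma>_def\<close>)
  have IH_meas: "(\<lambda>\<omega>. I k \<sigma> \<omega> * H k \<sigma> \<omega>) \<in> borel_measurable (past A (h (Suc k)))" if "\<sigma> \<in> \<Sigma> k" for k \<sigma>
  proof (cases "\<forall>p\<in>Jk k. snd (\<sigma> p) \<le> h k")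
    case True
    then show ?thesis
      using that by (intro borel_measurable_times H_meas measurable_past_mono[OF I_meas]) (auto simp: hh less_imp_le)
  next
    case False
    then obtain p where p: "p \<in> Jk k" "\<not> snd (\<sigma> p) \<le> h k" by blast
    have "I k \<sigma> \<omega> = 0" for \<omega>
    proof -
      have "snd (\<pi> k p \<omega>) \<le> h k" using \<pi>[of p k \<omega>] p(1) by (simp add: Jk_def)
      then have "\<pi> k p \<omega> \<noteq> \<sigma> p" using p(2) by auto
      then show ?thesis using p(1) by (auto simp only: I_def split: if_splits)
    qed
    then show ?thesis by simp
  qed
  have T_meas: "T k \<in> borel_measurable (past A (h (Suc k)))" for k
    unfolding decomp[abs_def] by (intro borel_measurable_sum IH_meas)
  have Z_meas: "(\<lambda>\<omega>. \<Prod>k<n. T k \<omega>) \<in> borel_measurable (past A (h n))" for n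
    by (intro borel_measurable_prod measurable_past_mono[OF T_meas]) (simp add: strict_mono_less_eq[OF h])
  define C where "C k = (\<Prod>p\<in>Jk k. gauss_mean (f (p, k)) (h (Suc k) - h k))" for k
  have summand: "(\<integral>\<omega>. (\<Prod>k<n. T k \<omega>) * (I n \<sigma> \<omega> * H n \<sigma> \<omega>) \<partial>\<Omega>) = (\<integral>\<omega>. (\<Prod>k<n. T k \<omega>) * I n \<sigma> \<omega> \<partial>\<Omega>) * C n"
    if \<sigma>: "\<sigma> \<in> \<Sigma> n" for n \<sigma>
  proof (cases "\<exists>\<omega>. I n \<sigma> \<omega> \<noteq> 0")
    case False
    then have "I n \<sigma> \<omega> = 0" for \<omega> by blast
    then show ?thesis by simp
  next
    case True
    then obtain \<omega>0 where \<omega>0: "\<forall>p\<in>Jk n. \<pi> n p \<omega>0 = \<sigma> p" by (auto simp: I_def split: if_splits)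
    have inj\<sigma>: "inj_on \<sigma> (Jk n)"
    proof (rule inj_onI)
      fix p q assume "p \<in> Jk n" "q \<in> Jk n" "\<sigma> p = \<sigma> q"
      then show "p = q" using inj[of p q n \<omega>0] \<omega>0 by (auto simp: Jk_def)
    qed
    have start: "snd (\<sigma> p) \<le> h n" if "p \<in> Jk n" for p using \<pi>[of p n \<omega>0] \<omega>0 that by (auto simp: Jk_def)
    define g where "g z = f (inv_into (Jk n) \<sigma> z, n)" for z
    have g: "unit_measurable g" using f by (simp add: unit_measurable_def g_def)
    have gs: "g (\<sigma> p) = f (p, n)" if "p \<in> Jk n" for p using inj\<sigma> that by (simp add: g_def)
    have H: "H n \<sigma> \<omega> = (\<Prod>z\<in>\<sigma> ` Jk n. g z (\<beta> z \<omega> (h (Suc n)) - \<beta> z \<omega> (h n)))" for \<omega>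
      unfolding prod.reindex[OF inj\<sigma>] comp_def H_def by (intro prod.cong refl) (simp add: gs increment_def)
    have "(\<integral>\<omega>. ((\<Prod>k<n. T k \<omega>) * I n \<sigma> \<omega>) * (\<Prod>z\<in>\<sigma> ` Jk n. g z (\<beta> z \<omega> (h (Suc n)) - \<beta> z \<omega> (h n))) \<partial>\<Omega>) =
       (\<integral>\<omega>. (\<Prod>k<n. T k \<omega>) * I n \<sigma> \<omega> \<partial>\<Omega>) * (\<Prod>z\<in>\<sigma> ` Jk n. gauss_mean (g z) (h (Suc n) - h n))"
    proof (rule future_increments[OF A])
      show "\<sigma> ` Jk n \<subseteq> A" using \<sigma> by (auto simp: \<Sigma>_def)
      show "(\<lambda>\<omega>. (\<Prod>k<n. T k \<omega>) * I n \<sigma> \<omega>) \<in> borel_measurable (past A (h n))"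
        by (intro borel_measurable_times Z_meas I_meas)
      show "0 \<le> (\<Prod>k<n. T k \<omega>) * I n \<sigma> \<omega> \<and> (\<Prod>k<n. T k \<omega>) * I n \<sigma> \<omega> \<le> 1" for \<omega>
        using prod_unit_bounds[of "{..<n}" "\<lambda>k. T k \<omega>"] T01 by (auto simp: I_def)
    qed (use start hh g in auto)
    also have "(\<Prod>z\<in>\<sigma> ` Jk n. gauss_mean (g z) (h (Suc n) - h n)) = C n"
      unfolding prod.reindex[OF inj\<sigma>] comp_def C_def by (intro prod.cong refl) (simp add: gs)
    finally show ?thesis unfolding H by (simp add: mult.assoc)
  qed
  have int: "integrable \<Omega> (\<lambda>\<omega>. (\<Prod>k<n. T k \<omega>) * U \<omega>)"
    if "U \<in> borel_measurable (past A (h (Suc n)))" "\<And>\<omega>. \<bar>U \<omega>\<bar> \<le> 1" for n U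
  proof (rule \<Omega>.integrable_const_bound[where B = 1])
    show "(\<lambda>\<omega>. (\<Prod>k<n. T k \<omega>) * U \<omega>) \<in> borel_measurable \<Omega>"
      by (intro borel_measurable_times measurable_from_subalg[OF subalgebra_past that(1)] measurable_from_subalg[OF subalgebra_past Z_meas])
    show "AE \<omega> in \<Omega>. norm ((\<Prod>k<n. T k \<omega>) * U \<omega>) \<le> 1"
    proof (rule AE_I2)
      fix \<omega>
      have "\<bar>\<Prod>k<n. T k \<omega>\<bar> * \<bar>U \<omega>\<bar> \<le> 1 * 1"
        using T01 that(2) by (intro mult_mono prod_unit_bounds) auto
      then show "norm ((\<Prod>k<n. T k \<omega>) * U \<omega>) \<le> 1" by (simp add: abs_mult)
    qed
  qed
  have I1: "\<bar>I n \<sigma> \<omega>\<bar> \<le> 1" for n \<sigma> \<omega> by (simp add: I_def)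
  have H1: "\<bar>H n \<sigma> \<omega>\<bar> \<le> 1" for n \<sigma> \<omega>
    unfolding H_def using unit_measurableD(2,3)[OF f] by (intro prod_unit_bounds) auto
  have "(\<integral>\<omega>. (\<Prod>k<n. T k \<omega>) \<partial>\<Omega>) = (\<Prod>k<n. C k)" for n
  proof (induction n)
    case 0
    then show ?case by (simp add: \<Omega>.prob_space)
  next
    case (Suc n)
    have "(\<integral>\<omega>. (\<Prod>k<Suc n. T k \<omega>) \<partial>\<Omega>) = (\<integral>\<omega>. (\<Sum>\<sigma>\<in>\<Sigma> n. (\<Prod>k<n. T k \<omega>) * (I n \<sigma> \<omega> * H n \<sigma> \<omega>)) \<partial>\<Omega>)"
      by (simp add: decomp[of n] sum_distrib_left)
    also have "\<dots> = (\<Sum>\<sigma>\<in>\<Sigma> n. \<integral>\<omega>. (\<Prod>k<n. T k \<omega>) * (I n \<sigma> \<omega> * H n \<sigma> \<omega>) \<partial>\<Omega>)"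
    proof (intro Bochner_Integration.integral_sum int IH_meas)
      show "\<bar>I n \<sigma> \<omega> * H n \<sigma> \<omega>\<bar> \<le> 1" for \<sigma> \<omega>
        using mult_mono[OF I1[of n \<sigma> \<omega>] H1[of n \<sigma> \<omega>]] by (simp add: abs_mult)
    qed
    also have "\<dots> = (\<Sum>\<sigma>\<in>\<Sigma> n. \<integral>\<omega>. (\<Prod>k<n. T k \<omega>) * I n \<sigma> \<omega> \<partial>\<Omega>) * C n"
      unfolding sum_distrib_right by (intro sum.cong refl summand)
    also have "(\<Sum>\<sigma>\<in>\<Sigma> n. \<integral>\<omega>. (\<Prod>k<n. T k \<omega>) * I n \<sigma> \<omega> \<partial>\<Omega>) = (\<integral>\<omega>. (\<Sum>\<sigma>\<in>\<Sigma> n. (\<Prod>k<n. T k \<omega>) * I n \<sigma> \<omega>) \<partial>\<Omega>)"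
      by (intro Bochner_Integration.integral_sum[symmetric] int I1 measurable_past_mono[OF I_meas] less_imp_le hh)
    also have "\<dots> = (\<integral>\<omega>. (\<Prod>k<n. T k \<omega>) \<partial>\<Omega>)"
    proof -
      have "(\<Sum>\<sigma>\<in>\<Sigma> n. I n \<sigma> \<omega>) = 1" for \<omega>
      proof -
        define \<sigma>0 where "\<sigma>0 = (\<lambda>p\<in>Jk n. \<pi> n p \<omega>)"
        have s0: "\<sigma>0 \<in> \<Sigma> n" using \<pi> by (auto simp: \<sigma>0_def \<Sigma>_def Jk_def)
        have "I n \<sigma> \<omega> = (if \<sigma> = \<sigma>0 then 1 else 0)" if "\<sigma> \<in> \<Sigma> n" for \<sigma>
        proof (cases "\<forall>p\<in>Jk n. \<pi> n p \<omega> = \<sigma> p")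
          case True
          then have "\<sigma> = \<sigma>0" using that s0 unfolding \<Sigma>_def by (intro PiE_ext[of \<sigma> "Jk n" "\<lambda>_. A"]) (auto simp: \<sigma>0_def)
          then show ?thesis using True by (simp add: I_def)
        next
          case False
          then have "\<sigma> \<noteq> \<sigma>0" by (auto simp: \<sigma>0_def)
          then show ?thesis using False by (auto simp: I_def)
        qed
        then have "(\<Sum>\<sigma>\<in>\<Sigma> n. I n \<sigma> \<omega>) = (\<Sum>\<sigma>\<in>\<Sigma> n. if \<sigma> = \<sigma>0 then 1 else 0)" by (intro sum.cong) auto
        then show ?thesis using s0 by simp
      qed
      then show ?thesis by (simp add: sum_distrib_left[symmetric])
    qed
    finally show ?case using Suc by simp
  qed
  then show ?thesis unfolding prod_steps_by_time[OF J] T_def C_def Jk_def by simp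
qed

end

section \<open>Independence of the priorities\<close>

definition clamp_paths :: "(real \<times> real \<Rightarrow> real \<Rightarrow> real) \<Rightarrow> real \<times> real \<Rightarrow> real \<Rightarrow> real" where
  "clamp_paths b q u = b q (max (snd q) u)"

lemma csol_unique:
  assumes inj: "inj_on r D" and co: "coalesced D r b w"
    and b: "\<And>p. p \<in> D \<Longrightarrow> continuous_on {snd p..} (b p)"
    and w: "\<And>p. p \<in> D \<Longrightarrow> continuous_on {snd p..} (w p)"
    and start: "\<And>p. p \<in> D \<Longrightarrow> w p (snd p) = b p (snd p)"
    and p: "p \<in> D" "snd p \<le> t"
  shows "w p t = csol D r (clamp_paths b) p t"
proof (rule coalesced_unique[OF inj, where b = "clamp_paths b" and w = w, OF _ _ w _ _ p])
  have cb: "continuous_on {snd p..} (clamp_paths b p)" if "p \<in> D" for p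
    using b[OF that] by (rule continuous_on_eq) (simp add: clamp_paths_def max_absorb2)
  show "coalesced D r (clamp_paths b) w"
  proof (rule coalescedI)
    show "w p t = clamp_paths b p t"
      if "p \<in> D" "snd p \<le> t" "\<And>q u. q \<in> D \<Longrightarrow> r q < r p \<Longrightarrow> snd p \<le> u \<Longrightarrow> snd q \<le> u \<Longrightarrow> u \<le> t \<Longrightarrow> w q u \<noteq> w p u" for p t
      using coalesced_follow[OF co that] that(2) by (simp add: clamp_paths_def max_absorb2)
  qed (rule coalesced_meet[OF co])
  show "coalesced D r (clamp_paths b) (csol D r (clamp_paths b))" by (rule csol_coalesced[OF inj cb])
  show "continuous_on {snd p..} (csol D r (clamp_paths b) p)" if "p \<in> D" for p
    by (rule csol_props[OF inj cb that])
  show "w p (snd p) = csol D r (clamp_paths b) p (snd p)" if "p \<in> D" for p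
    using csol_props(2)[OF inj cb that] start[OF that] by (simp add: clamp_paths_def)
qed

definition csol_map ::
    "(real \<times> real) set \<Rightarrow> (real \<times> real \<Rightarrow> nat) \<Rightarrow> ((real \<times> real) \<times> real \<Rightarrow> real) \<Rightarrow> (real \<times> real) \<times> real \<Rightarrow> real"
  where
  "csol_map D r x i = csol D r (clamp_paths (\<lambda>q u. x (q, u))) (fst i) (snd i)"

lemma measurable_csol_map:
  assumes "inj_on r D" "fst i \<in> D" "snd (fst i) \<le> snd i"
  shows "(\<lambda>x. csol_map D r x i) \<in> borel_measurable (PiM (SIGMA q:D. {snd q..}) (\<lambda>_. borel))"
  unfolding csol_map_def
  by (rule measurable_csol[OF assms order_refl]) (auto simp: clamp_paths_def intro!: measurable_component_singleton)

lemma sol_cong: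
  assumes "\<And>k. k \<in> R \<Longrightarrow> c k = c' k"
  shows "k \<in> R \<Longrightarrow> sol a R c k = sol a R c' k"
proof (induction k rule: less_induct)
  case (less k)
  have "absorb_upto a R c W k i = absorb_upto a R c' W k i" for W i
    using assms[OF less.prems] by (induction i) auto
  moreover have "absorb_upto a R c' (sol a R c) k i = absorb_upto a R c' (sol a R c') k i" if "i \<le> k" for i
    using that less.IH by (induction i) auto
  ultimately show ?case by (metis order_refl sol_rec)
qed

lemma csol_cong:
  assumes "\<And>q u. q \<in> D \<Longrightarrow> b q u = b' q u" "p \<in> D"
  shows "csol D r b p = csol D r b' p"
  unfolding csol_def
proof (rule sol_cong)
  show "b (inv_into D r k) = b' (inv_into D r k)" if "k \<in> r ` D" for k
    using assms(1)[OF inv_into_into[OF that]] by (intro ext)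
qed (use assms(2) in simp)

lemma csol_map_law:
  assumes inj: "inj_on r D" and co: "coalesced D r b w"
    and b: "\<And>p. p \<in> D \<Longrightarrow> continuous_on {snd p..} (b p)"
    and w: "\<And>p. p \<in> D \<Longrightarrow> continuous_on {snd p..} (w p)"
    and start: "\<And>p. p \<in> D \<Longrightarrow> w p (snd p) = b p (snd p)"
    and p: "p \<in> D" "snd p \<le> t"
  shows "csol_map D r (\<lambda>i\<in>(SIGMA q:D. {snd q..}). b (fst i) (snd i)) (p, t) = w p t"
proof -
  have "csol D r (clamp_paths (\<lambda>q u. (\<lambda>i\<in>(SIGMA q:D. {snd q..}). b (fst i) (snd i)) (q, u))) p =
      csol D r (clamp_paths b) p"
    by (rule csol_cong[OF _ p(1)]) (simp add: clamp_paths_def)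
  then show ?thesis using csol_unique[OF assms] by (simp add: csol_map_def)
qed

lemma law_all_times:
  fixes X :: "real \<times> real \<Rightarrow> 'a \<Rightarrow> real \<Rightarrow> real" and Y :: "real \<times> real \<Rightarrow> 'b \<Rightarrow> real \<Rightarrow> real"
  assumes fin: "finite_measure M" "finite_measure N"
    and X: "\<And>z t. z \<in> A \<Longrightarrow> snd z \<le> t \<Longrightarrow> (\<lambda>\<omega>. X z \<omega> t) \<in> borel_measurable M"
    and Y: "\<And>z t. z \<in> A \<Longrightarrow> snd z \<le> t \<Longrightarrow> (\<lambda>\<omega>. Y z \<omega> t) \<in> borel_measurable N"
    and eq: "\<And>s. law M (SIGMA z:A. {snd z..s}) (\<lambda>i \<omega>. X (fst i) \<omega> (snd i)) =
      law N (SIGMA z:A. {snd z..s}) (\<lambda>i \<omega>. Y (fst i) \<omega> (snd i))"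
  shows "law M (SIGMA z:A. {snd z..}) (\<lambda>i \<omega>. X (fst i) \<omega> (snd i)) =
    law N (SIGMA z:A. {snd z..}) (\<lambda>i \<omega>. Y (fst i) \<omega> (snd i))"
proof (rule law_finite_subsets[OF fin])
  fix J assume J: "finite J" "J \<subseteq> (SIGMA z:A. {snd z..})"
  have "bdd_above (snd ` J)" using J by (intro bdd_above_finite) auto
  then obtain s where s: "\<And>x. x \<in> snd ` J \<Longrightarrow> x \<le> s" by (auto simp: bdd_above_def)
  show "law M J (\<lambda>i \<omega>. X (fst i) \<omega> (snd i)) = law N J (\<lambda>i \<omega>. Y (fst i) \<omega> (snd i))"
  proof (rule law_subset[OF eq[of s]])
    show "J \<subseteq> (SIGMA z:A. {snd z..s})"
    proof
      fix i assume i: "i \<in> J"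
      then have "fst i \<in> A" "snd (fst i) \<le> snd i" "snd i \<le> s" using J(2) s by auto
      then show "i \<in> (SIGMA z:A. {snd z..s})" by (simp add: mem_Sigma_iff[of "fst i" "snd i", simplified])
    qed
  qed (auto intro: X Y)
qed (auto intro: X Y)

context brownian_source
begin

definition web :: "(real \<times> real) set \<Rightarrow> (real \<times> real \<Rightarrow> nat) \<Rightarrow> real \<times> real \<Rightarrow> (real \<times> real \<Rightarrow> 'a) \<Rightarrow> real \<Rightarrow> real" where
  "web D r p \<omega> = csol D r (\<lambda>q. \<beta> q \<omega>) p"

context
  fixes D :: "(real \<times> real) set" and r :: "real \<times> real \<Rightarrow> nat"
  assumes inj: "inj_on r D"
begin

lemma web_continuous: "p \<in> D \<Longrightarrow> continuous_on {snd p..} (web D r p \<omega>)"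
  unfolding web_def by (rule csol_props[OF inj \<beta>_continuous])

lemma web_start: "p \<in> D \<Longrightarrow> web D r p \<omega> (snd p) = fst p"
  unfolding web_def by (subst csol_props(2)[OF inj \<beta>_continuous]) (simp_all add: \<beta>_start)

lemma web_coalesced: "coalesced D r (\<lambda>q. \<beta> q \<omega>) (\<lambda>p. web D r p \<omega>)"
  unfolding web_def by (rule csol_coalesced[OF inj \<beta>_continuous])

lemma measurable_web: "p \<in> D \<Longrightarrow> snd p \<le> t \<Longrightarrow> (\<lambda>\<omega>. web D r p \<omega> t) \<in> borel_measurable \<Omega>"
  unfolding web_def by (rule measurable_csol[OF inj _ _ order_refl]) auto

lemma measurable_web_past:
  "p \<in> D \<Longrightarrow> snd p \<le> t \<Longrightarrow> t \<le> s \<Longrightarrow> {q\<in>D. r q \<le> r p} \<subseteq> A \<Longrightarrow>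
    (\<lambda>\<omega>. web D r p \<omega> t) \<in> borel_measurable (past A s)"
  unfolding web_def by (rule measurable_csol[OF inj, where t = s]) (auto intro: measurable_past_\<beta>)

end

lemma web_meet:
  assumes "inj_on r D" "p \<in> D" "q \<in> D" "snd p \<le> u" "snd q \<le> u" "web D r p \<omega> u = web D r q \<omega> u" "u \<le> t"
  shows "web D r p \<omega> t = web D r q \<omega> t"
  using coalesced_meet[OF web_coalesced[OF assms(1)] assms(2-)] .

text \<open>Changing the priorities: a member \<open>p\<close> of \<open>J\<close> is driven by the leader of its cluster until it meets a member
  of \<open>J\<close> of higher new priority, and from then on by a fresh Brownian motion. The paths \<open>tilted p\<close>
  obtained in this way are again independent Brownian motions, and \<open>web D r\<close>, restricted to \<open>J\<close>, is
  coalesced from them with respect to the new priorities.\<close>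

context
  fixes D J A0 A :: "(real \<times> real) set" and r r' :: "real \<times> real \<Rightarrow> nat" and \<phi> :: "real \<times> real \<Rightarrow> real \<times> real"
  assumes inj: "inj_on r D" and J: "finite J" "J \<subseteq> D" and inj': "inj_on r' J"
    and A0: "finite A0" "J \<subseteq> A0" "A0 \<subseteq> D" "\<And>p q. p \<in> A0 \<Longrightarrow> q \<in> D \<Longrightarrow> r q \<le> r p \<Longrightarrow> q \<in> A0"
    and \<phi>: "inj_on \<phi> J" "\<And>p. p \<in> J \<Longrightarrow> snd (\<phi> p) = snd p" "\<And>p. p \<in> J \<Longrightarrow> \<phi> p \<notin> A0"
    and A: "A = A0 \<union> \<phi> ` J"
begin

definition is_leader :: "real \<times> real \<Rightarrow> real \<times> real \<Rightarrow> real \<Rightarrow> (real \<times> real \<Rightarrow> 'a) \<Rightarrow> bool" where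
  "is_leader z p s \<omega> \<longleftrightarrow> z \<in> A0 \<and> snd z \<le> s \<and> web D r z \<omega> s = web D r p \<omega> s \<and>
     (\<forall>q\<in>A0. snd q \<le> s \<longrightarrow> web D r q \<omega> s = web D r p \<omega> s \<longrightarrow> r z \<le> r q)"

definition leader :: "real \<times> real \<Rightarrow> real \<Rightarrow> (real \<times> real \<Rightarrow> 'a) \<Rightarrow> real \<times> real" where
  "leader p s \<omega> = (SOME z. is_leader z p s \<omega>)"

definition dead :: "real \<times> real \<Rightarrow> real \<Rightarrow> (real \<times> real \<Rightarrow> 'a) \<Rightarrow> bool" where
  "dead p s \<omega> \<longleftrightarrow> (\<exists>q\<in>J. r' q < r' p \<and> snd q \<le> s \<and> web D r q \<omega> s = web D r p \<omega> s)"

definition driver :: "real \<times> real \<Rightarrow> real \<Rightarrow> (real \<times> real \<Rightarrow> 'a) \<Rightarrow> real \<times> real" where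
  "driver p s \<omega> = (if dead p s \<omega> then \<phi> p else leader p s \<omega>)"

definition death :: "real \<times> real \<Rightarrow> (real \<times> real \<Rightarrow> 'a) \<Rightarrow> real" where
  "death p \<omega> = Inf {s. snd p \<le> s \<and> dead p s \<omega>}"

definition tilted :: "real \<times> real \<Rightarrow> (real \<times> real \<Rightarrow> 'a) \<Rightarrow> real \<Rightarrow> real" where
  "tilted p \<omega> t = (if dead p t \<omega> then web D r p \<omega> (death p \<omega>) + \<beta> (\<phi> p) \<omega> t - \<beta> (\<phi> p) \<omega> (death p \<omega>)
     else web D r p \<omega> t)"

lemma is_leader_unique:
  assumes "is_leader z p s \<omega>" "is_leader z' p s \<omega>"
  shows "z = z'"
proof -
  have "r z = r z'" using assms unfolding is_leader_def by (intro antisym) blast+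
  then show ?thesis using assms A0(3) inj_onD[OF inj] unfolding is_leader_def by blast
qed

lemma leader:
  assumes p: "p \<in> J" "snd p \<le> s"
  shows "is_leader (leader p s \<omega>) p s \<omega>"
proof -
  define C where "C = {q\<in>A0. snd q \<le> s \<and> web D r q \<omega> s = web D r p \<omega> s}"
  have C: "finite C" "p \<in> C" using p A0 by (auto simp: C_def)
  then have "arg_min_on r C \<in> C" "\<And>q. q \<in> C \<Longrightarrow> r (arg_min_on r C) \<le> r q"
    by (auto intro!: arg_min_if_finite arg_min_least)
  then have "is_leader (arg_min_on r C) p s \<omega>" by (simp add: is_leader_def C_def)
  then show ?thesis unfolding leader_def by (rule someI)
qed

lemma leader_eq_iff: "p \<in> J \<Longrightarrow> snd p \<le> s \<Longrightarrow> leader p s \<omega> = z \<longleftrightarrow> is_leader z p s \<omega>"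
  using leader is_leader_unique by metis

lemma web_leader:
  assumes p: "p \<in> J" "snd p \<le> s"
  shows "web D r p \<omega> s = \<beta> (leader p s \<omega>) \<omega> s"
proof -
  let ?z = "leader p s \<omega>"
  have z: "?z \<in> A0" "snd ?z \<le> s" "web D r ?z \<omega> s = web D r p \<omega> s"
    "\<And>q. q \<in> A0 \<Longrightarrow> snd q \<le> s \<Longrightarrow> web D r q \<omega> s = web D r p \<omega> s \<Longrightarrow> r ?z \<le> r q"
    using leader[OF p, of \<omega>] by (auto simp: is_leader_def)
  have "?z \<in> D" using z(1) A0(3) by auto
  have "web D r ?z \<omega> s = \<beta> ?z \<omega> s"
  proof (rule coalesced_follow[OF web_coalesced[OF inj] \<open>?z \<in> D\<close> z(2)])
    fix q u assume q: "q \<in> D" "r q < r ?z" "snd ?z \<le> u" "snd q \<le> u" "u \<le> s"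
    show "web D r q \<omega> u \<noteq> web D r ?z \<omega> u"
    proof
      assume "web D r q \<omega> u = web D r ?z \<omega> u"
      then have "web D r q \<omega> s = web D r ?z \<omega> s" by (rule web_meet[OF inj q(1) \<open>?z \<in> D\<close> q(4,3) _ q(5)])
      then have "web D r q \<omega> s = web D r p \<omega> s" using z(3) by simp
      moreover have "q \<in> A0" using A0(4)[OF z(1) q(1)] q(2) by simp
      ultimately have "r ?z \<le> r q" using z(4)[of q] q(4,5) by simp
      then show False using q(2) by simp
    qed
  qed
  then show ?thesis using z(3) by simp
qed

lemma dead_mono:
  assumes p: "p \<in> J" "snd p \<le> s" and "dead p s \<omega>" "s \<le> t"
  shows "dead p t \<omega>"
proof -
  obtain q where q: "q \<in> J" "r' q < r' p" "snd q \<le> s" "web D r q \<omega> s = web D r p \<omega> s"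
    using assms(3) unfolding dead_def by blast
  have "web D r q \<omega> t = web D r p \<omega> t"
    using web_meet[OF inj _ _ q(3) p(2) q(4) assms(4)] q(1) p(1) J(2) by auto
  then show ?thesis using q assms(4) unfolding dead_def by (intro bexI[of _ q]) auto
qed

lemma dead_iff:
  assumes p: "p \<in> J" and ex: "snd p \<le> s0" "dead p s0 \<omega>" and t: "snd p \<le> t"
  shows "dead p t \<omega> \<longleftrightarrow> death p \<omega> \<le> t" "snd p \<le> death p \<omega>"
proof -
  let ?S = "{s. snd p \<le> s \<and> dead p s \<omega>}"
  have pD: "p \<in> D" using p J by auto
  have S: "?S = (\<Union>q\<in>{q\<in>J. r' q < r' p}. {max (snd p) (snd q)..} \<inter> (\<lambda>s. web D r q \<omega> s - web D r p \<omega> s) -` {0})"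
    unfolding dead_def by (intro set_eqI iffI) (auto simp: max_def split: if_splits)
  have "closed ?S" unfolding S
  proof (intro closed_UN ballI)
    fix q assume "q \<in> {q\<in>J. r' q < r' p}"
    then have "q \<in> D" using J by auto
    note c = web_continuous[OF inj this, of \<omega>] web_continuous[OF inj pD, of \<omega>]
    show "closed ({max (snd p) (snd q)..} \<inter> (\<lambda>s. web D r q \<omega> s - web D r p \<omega> s) -` {0})"
      by (intro continuous_closed_preimage continuous_intros continuous_on_subset[OF c(1)] continuous_on_subset[OF c(2)]) auto
  qed (use J in auto)
  moreover have bdd: "bdd_below ?S" by (intro bdd_belowI[of _ "snd p"]) auto
  ultimately have D: "snd p \<le> death p \<omega>" "dead p (death p \<omega>) \<omega>"
    using closed_contains_Inf[of ?S] ex unfolding death_def by auto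
  show "snd p \<le> death p \<omega>" by fact
  show "dead p t \<omega> \<longleftrightarrow> death p \<omega> \<le> t"
  proof
    assume "dead p t \<omega>"
    then show "death p \<omega> \<le> t" unfolding death_def using t by (intro cInf_lower bdd) simp
  qed (rule dead_mono[OF p D])
qed

lemma tilted_continuous:
  assumes p: "p \<in> J"
  shows "continuous_on {snd p..} (tilted p \<omega>)"
proof -
  have c: "continuous_on {snd p..} (web D r p \<omega>)" by (rule web_continuous[OF inj]) (use p J(2) in blast)
  show ?thesis
  proof (cases "\<exists>s\<ge>snd p. dead p s \<omega>")
    case False
    then show ?thesis by (intro continuous_on_eq[OF c]) (auto simp: tilted_def)
  next
    case True
    then obtain s0 where s0: "snd p \<le> s0" "dead p s0 \<omega>" by blast
    let ?d = "death p \<omega>"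
    have "continuous_on {snd p..} (\<lambda>t. if t \<le> ?d then web D r p \<omega> t else web D r p \<omega> ?d + \<beta> (\<phi> p) \<omega> t - \<beta> (\<phi> p) \<omega> ?d)"
      by (intro continuous_on_cases_le continuous_on_subset[OF c] continuous_intros \<beta>_continuous) auto
    then show ?thesis
      by (rule continuous_on_eq) (auto simp: tilted_def dead_iff[OF p s0])
  qed
qed

lemma tilted_start:
  assumes p: "p \<in> J"
  shows "tilted p \<omega> (snd p) = fst p"
proof -
  have st: "web D r p \<omega> (snd p) = fst p" by (rule web_start[OF inj]) (use p J(2) in blast)
  have "death p \<omega> = snd p" if "dead p (snd p) \<omega>" using dead_iff[OF p order_refl that order_refl] that by simp
  then show ?thesis using st by (simp add: tilted_def)
qed

lemma driver_in:
  assumes "p \<in> J" "snd p \<le> s"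
  shows "driver p s \<omega> \<in> A" "snd (driver p s \<omega>) \<le> s"
  using leader[OF assms, of \<omega>] assms \<phi>(2) by (auto simp: driver_def is_leader_def A)

lemma driver_dead_iff:
  assumes "p \<in> J" "snd p \<le> s" "q \<in> J"
  shows "driver p s \<omega> = \<phi> q \<longleftrightarrow> dead p s \<omega> \<and> p = q"
proof -
  have "leader p s \<omega> \<noteq> \<phi> q" using leader[OF assms(1,2), of \<omega>] \<phi>(3)[OF assms(3)] by (auto simp: is_leader_def)
  moreover have "\<phi> p = \<phi> q \<longleftrightarrow> p = q" using inj_on_eq_iff[OF \<phi>(1) assms(1,3)] .
  ultimately show ?thesis by (simp add: driver_def)
qed

lemma driver_inj:
  assumes p: "p \<in> J" "snd p \<le> s" and q: "q \<in> J" "snd q \<le> s" and ne: "p \<noteq> q"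
  shows "driver p s \<omega> \<noteq> driver q s \<omega>"
proof
  assume eq: "driver p s \<omega> = driver q s \<omega>"
  have "\<not> dead p s \<omega>" using eq driver_dead_iff[OF q p(1), of \<omega>] ne by (auto simp: driver_def split: if_splits)
  moreover have "\<not> dead q s \<omega>" using eq driver_dead_iff[OF p q(1), of \<omega>] ne by (auto simp: driver_def split: if_splits)
  ultimately have "leader p s \<omega> = leader q s \<omega>" using eq by (simp add: driver_def)
  then have w: "web D r p \<omega> s = web D r q \<omega> s" using web_leader[OF p, of \<omega>] web_leader[OF q, of \<omega>] by simp
  have "r' p \<noteq> r' q" using inj_onD[OF inj' _ p(1) q(1)] ne by blast
  then have "dead p s \<omega> \<or> dead q s \<omega>"
  proof (cases "r' p < r' q")
    case True
    then have "dead q s \<omega>" unfolding dead_def using w p by blast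
    then show ?thesis ..
  next
    case False
    then have "r' q < r' p" using \<open>r' p \<noteq> r' q\<close> by simp
    then have "dead p s \<omega>" unfolding dead_def using w[symmetric] q by blast
    then show ?thesis ..
  qed
  then show False using \<open>\<not> dead p s \<omega>\<close> \<open>\<not> dead q s \<omega>\<close> by blast
qed

lemma driver_follow:
  assumes p: "p \<in> J" and s: "snd p \<le> s" "s \<le> s'" and eq: "driver p s \<omega> = driver p s' \<omega>"
  shows "tilted p \<omega> s' - tilted p \<omega> s = \<beta> (driver p s \<omega>) \<omega> s' - \<beta> (driver p s \<omega>) \<omega> s"
proof (cases "dead p s \<omega>")
  case True
  then have "dead p s' \<omega>" by (rule dead_mono[OF p s(1) _ s(2)])
  then show ?thesis using True by (simp add: tilted_def driver_def)
next
  case False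
  have s': "snd p \<le> s'" using s by simp
  have "\<not> dead p s' \<omega>" using driver_dead_iff[OF p s(1) p, of \<omega>] driver_dead_iff[OF p s' p, of \<omega>] eq False by auto
  then show ?thesis
    using False eq web_leader[OF p s(1), of \<omega>] web_leader[OF p s', of \<omega>] by (simp add: tilted_def driver_def)
qed

lemma driver_convex:
  assumes p: "p \<in> J" and s: "snd p \<le> s" "s \<le> s'" "s' \<le> s''" and eq: "driver p s \<omega> = driver p s'' \<omega>"
  shows "driver p s' \<omega> = driver p s \<omega>"
proof (cases "dead p s \<omega>")
  case True
  then have "dead p s' \<omega>" by (rule dead_mono[OF p s(1) _ s(2)])
  then show ?thesis using True by (simp add: driver_def)
next
  case False
  have ps': "snd p \<le> s'" and ps'': "snd p \<le> s''" using s by auto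
  have d2: "\<not> dead p s'' \<omega>" using driver_dead_iff[OF p s(1) p, of \<omega>] driver_dead_iff[OF p ps'' p, of \<omega>] eq False by auto
  then have d1: "\<not> dead p s' \<omega>" using dead_mono[OF p ps' _ s(3)] by blast
  have l: "leader p s \<omega> = leader p s'' \<omega>" using eq False d2 by (simp add: driver_def)
  let ?z = "leader p s \<omega>" and ?y = "leader p s' \<omega>"
  have z: "?z \<in> A0" "snd ?z \<le> s" "web D r ?z \<omega> s = web D r p \<omega> s"
    using leader[OF p s(1), of \<omega>] by (auto simp: is_leader_def)
  have z'': "\<And>q. q \<in> A0 \<Longrightarrow> snd q \<le> s'' \<Longrightarrow> web D r q \<omega> s'' = web D r p \<omega> s'' \<Longrightarrow> r ?z \<le> r q"
    using leader[OF p ps'', of \<omega>] unfolding l by (auto simp: is_leader_def)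
  have y: "?y \<in> A0" "snd ?y \<le> s'" "web D r ?y \<omega> s' = web D r p \<omega> s'"
    "\<And>q. q \<in> A0 \<Longrightarrow> snd q \<le> s' \<Longrightarrow> web D r q \<omega> s' = web D r p \<omega> s' \<Longrightarrow> r ?y \<le> r q"
    using leader[OF p ps', of \<omega>] by (auto simp: is_leader_def)
  have D: "?z \<in> D" "?y \<in> D" "p \<in> D" using z y A0 p J by auto
  have "web D r ?z \<omega> s' = web D r p \<omega> s'" by (rule web_meet[OF inj D(1,3) z(2) s(1) z(3) s(2)])
  then have 1: "r ?y \<le> r ?z" using y(4)[OF z(1)] z(2) s(2) by simp
  have "web D r ?y \<omega> s'' = web D r p \<omega> s''" by (rule web_meet[OF inj D(2,3) y(2) ps' y(3) s(3)])
  then have 2: "r ?z \<le> r ?y" using z''[OF y(1)] y(2) s(3) by simp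
  have "?y = ?z" using inj_onD[OF inj antisym[OF 1 2] D(2,1)] .
  then show ?thesis using False d1 by (simp add: driver_def)
qed

lemma finite_A: "finite A"
  using A0 J by (simp add: A)

lemma measurable_driver:
  assumes p: "p \<in> J" "snd p \<le> s"
  shows "Measurable.pred (past A s) (\<lambda>\<omega>. driver p s \<omega> = z)"
proof -
  have w: "(\<lambda>\<omega>. web D r q \<omega> s) \<in> borel_measurable (past A s)" if "q \<in> A0" "snd q \<le> s" for q
  proof (rule measurable_web_past[OF inj _ that(2) order_refl])
    show "q \<in> D" using that A0(3) by blast
    show "{q'\<in>D. r q' \<le> r q} \<subseteq> A"
    proof
      fix q' assume "q' \<in> {q'\<in>D. r q' \<le> r q}"
      then have "q' \<in> A0" by (intro A0(4)[OF that(1)]) simp_all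
      then show "q' \<in> A" unfolding A by simp
    qed
  qed
  have pA: "p \<in> A0" using p(1) A0(2) by (rule subsetD[rotated])
  have const: "Measurable.pred N (\<lambda>_. c)" for N :: "'b measure" and c by simp
  have eqs: "Measurable.pred (past A s) (\<lambda>\<omega>. web D r q \<omega> s = web D r p \<omega> s)" if "q \<in> A0" "snd q \<le> s" for q
    unfolding pred_def by (rule borel_measurable_eq[OF w[OF that] w[OF pA p(2)]])
  have eq: "Measurable.pred (past A s) (\<lambda>\<omega>. snd q \<le> s \<and> web D r q \<omega> s = web D r p \<omega> s)" if "q \<in> A0" for q
    by (intro pred_intros_conj1' eqs that)
  have dead: "Measurable.pred (past A s) (\<lambda>\<omega>. dead p s \<omega>)"
    unfolding dead_def
  proof (intro pred_intros_finite J pred_intros_conj1')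
    fix q assume "q \<in> J" "snd q \<le> s"
    then show "Measurable.pred (past A s) (\<lambda>\<omega>. web D r q \<omega> s = web D r p \<omega> s)"
      using A0(2) by (intro eqs) (rule subsetD)
  qed
  have leader: "Measurable.pred (past A s) (\<lambda>\<omega>. leader p s \<omega> = z)"
  proof (cases "z \<in> A0")
    case True
    have iffl: "leader p s \<omega> = z \<longleftrightarrow> (snd z \<le> s \<and> web D r z \<omega> s = web D r p \<omega> s) \<and>
        (\<forall>q\<in>A0. (snd q \<le> s \<and> web D r q \<omega> s = web D r p \<omega> s) \<longrightarrow> r z \<le> r q)" for \<omega>
      unfolding leader_eq_iff[OF p] is_leader_def by (simp only: True simp_thms conj_assoc imp_conjL)
    show ?thesis unfolding iffl
      by (rule pred_intros_logic(3)[OF eq[OF True]])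
        (intro pred_intros_finite A0(1) pred_intros_logic(4) eq const)
  next
    case False
    then have iffl: "leader p s \<omega> = z \<longleftrightarrow> False" for \<omega>
      unfolding leader_eq_iff[OF p] is_leader_def by (simp only: simp_thms)
    show ?thesis unfolding iffl by (rule const)
  qed
  have iff: "driver p s \<omega> = z \<longleftrightarrow> (dead p s \<omega> \<and> \<phi> p = z) \<or> (\<not> dead p s \<omega> \<and> leader p s \<omega> = z)" for \<omega>
    by (simp add: driver_def)
  show ?thesis unfolding iff
    by (intro pred_intros_logic(2,3,5) dead leader const)
qed

lemma tilted_limit:
  assumes p: "p \<in> J" and t: "c \<le> snd p" "snd p \<le> t" "t \<le> c + real L"
  shows "(\<lambda>n. fst p + (\<Sum>k\<in>grid_steps c L n (snd p) t. increment \<beta> (grid c n) (driver p (grid c n k) \<omega>, k) \<omega>))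
    \<longlonglongrightarrow> tilted p \<omega> t"
proof -
  have "(\<lambda>n. \<Sum>k\<in>grid_steps c L n (snd p) t. \<beta> (driver p (grid c n k) \<omega>) \<omega> (grid c n (Suc k)) -
      \<beta> (driver p (grid c n k) \<omega>) \<omega> (grid c n k)) \<longlonglongrightarrow> tilted p \<omega> t - tilted p \<omega> (snd p)"
  proof (rule driver_sum_tendsto[where B = "\<lambda>q. \<beta> q \<omega>" and m = "\<lambda>s. driver p s \<omega>", OF t])
    show "continuous_on {snd p..t} (tilted p \<omega>)"
      by (rule continuous_on_subset[OF tilted_continuous[OF p]]) auto
    show "finite A" by (rule finite_A)
    show "driver p s \<omega> \<in> A" if "snd p \<le> s" for s by (rule driver_in[OF p that])
    show "tilted p \<omega> s' - tilted p \<omega> s = \<beta> (driver p s \<omega>) \<omega> s' - \<beta> (driver p s \<omega>) \<omega> s"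
      if "snd p \<le> s" "s \<le> s'" "driver p s \<omega> = driver p s' \<omega>" for s s' by (rule driver_follow[OF p that])
    show "driver p s' \<omega> = driver p s \<omega>"
      if "snd p \<le> s" "s \<le> s'" "s' \<le> s''" "driver p s \<omega> = driver p s'' \<omega>" for s s' s'' by (rule driver_convex[OF p that])
  qed (rule \<beta>_continuous)
  from tendsto_add[OF tendsto_const[of "fst p"] this] show ?thesis
    by (simp add: increment_def tilted_start[OF p])
qed

lemma measurable_driven_increment:
  assumes "p \<in> J" "snd p \<le> h k"
  shows "(\<lambda>\<omega>. increment \<beta> h (driver p (h k) \<omega>, k) \<omega>) \<in> borel_measurable \<Omega>"
proof (rule measurable_compose_countable'[where f = "\<lambda>z \<omega>. increment \<beta> h (z, k) \<omega>" and I = A])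
  show "driver p (h k) \<in> \<Omega> \<rightarrow>\<^sub>M count_space A"
    unfolding measurable_count_space_eq2[OF finite_A]
  proof (intro conjI ballI)
    show "driver p (h k) \<in> space \<Omega> \<rightarrow> A" using driver_in(1)[OF assms] by blast
    fix z
    have "{\<omega> \<in> space (past A (h k)). driver p (h k) \<omega> = z} \<in> sets (past A (h k))"
      using measurable_driver[OF assms, of z] unfolding pred_def .
    then have "{\<omega> \<in> space \<Omega>. driver p (h k) \<omega> = z} \<in> sets \<Omega>" using sets_past_subset by auto
    moreover have "driver p (h k) -` {z} \<inter> space \<Omega> = {\<omega> \<in> space \<Omega>. driver p (h k) \<omega> = z}" by blast
    ultimately show "driver p (h k) -` {z} \<inter> space \<Omega> \<in> sets \<Omega>" by simp
  qed
  show "countable A" using finite_A by (rule countable_finite)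
qed (rule measurable_increment_\<beta>)

lemma measurable_tilted:
  assumes p: "p \<in> J" and t: "snd p \<le> t"
  shows "(\<lambda>\<omega>. tilted p \<omega> t) \<in> borel_measurable \<Omega>"
proof -
  obtain L where L: "t - snd p \<le> real L" using real_arch_simple by blast
  show ?thesis
  proof (rule borel_measurable_LIMSEQ_real)
    show "(\<lambda>n. fst p + (\<Sum>k\<in>grid_steps (snd p) L n (snd p) t.
        increment \<beta> (grid (snd p) n) (driver p (grid (snd p) n k) \<omega>, k) \<omega>)) \<longlonglongrightarrow> tilted p \<omega> t" for \<omega>
      by (rule tilted_limit[OF p order_refl t]) (use L in simp)
    show "(\<lambda>\<omega>. fst p + (\<Sum>k\<in>grid_steps (snd p) L n (snd p) t.
        increment \<beta> (grid (snd p) n) (driver p (grid (snd p) n k) \<omega>, k) \<omega>)) \<in> borel_measurable \<Omega>" for n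
      by (intro borel_measurable_add borel_measurable_const borel_measurable_sum measurable_driven_increment p)
        (simp add: grid_steps_def)
  qed
qed

lemma law_tilted:
  "law \<Omega> (SIGMA z:J. {snd z..}) (\<lambda>i \<omega>. tilted (fst i) \<omega> (snd i)) = law \<Omega> (SIGMA z:J. {snd z..}) (\<lambda>i \<omega>. \<beta> (fst i) \<omega> (snd i))"
proof (rule law_all_times[OF \<Omega>.finite_measure_axioms \<Omega>.finite_measure_axioms])
  fix s
  have "bdd_below (snd ` J)" using J by (intro bdd_below_finite) auto
  then obtain b where b: "\<And>x. x \<in> snd ` J \<Longrightarrow> b \<le> x" by (auto simp: bdd_below_def)
  obtain L where L: "s - b \<le> real L" using real_arch_simple by blast
  define c where "c = s - real L"
  have c: "c \<le> snd z" if "z \<in> J" for z using b[of "snd z"] that L by (simp add: c_def)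
  define E where "E n i \<omega> = increment \<beta> (grid c n) (driver (fst i) (grid c n (snd i)) \<omega>, snd i) \<omega>" for n and i :: "(real \<times> real) \<times> nat" and \<omega>
  show "law \<Omega> (SIGMA z:J. {snd z..s}) (\<lambda>i \<omega>. tilted (fst i) \<omega> (snd i)) =
      law \<Omega> (SIGMA z:J. {snd z..s}) (\<lambda>i \<omega>. \<beta> (fst i) \<omega> (snd i))"
  proof (rule law_of_step_sums[OF \<Omega>.finite_measure_axioms \<Omega>.finite_measure_axioms J(1), where c = c and L = L and E = E and F = "\<lambda>n. increment \<beta> (grid c n)"])
    fix n f assume "unit_continuous (f :: (real \<times> real) \<times> nat \<Rightarrow> real \<Rightarrow> real)"
    then have f: "unit_measurable f" by (rule unit_continuous_measurable)
    have "(\<integral>\<omega>. (\<Prod>i\<in>steps J (grid c n) (L * Suc n). f i (E n i \<omega>)) \<partial>\<Omega>) =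
      (\<Prod>i\<in>steps J (grid c n) (L * Suc n). gauss_mean (f i) (grid c n (Suc (snd i)) - grid c n (snd i)))"
      unfolding E_def
      by (rule predictable_increments[where \<pi> = "\<lambda>k p. driver p (grid c n k)", OF finite_A J(1) strict_mono_grid f])
        (blast intro: driver_in driver_inj[THEN notE] measurable_driver)+
    also have "\<dots> = (\<integral>\<omega>. (\<Prod>i\<in>steps J (grid c n) (L * Suc n). f i (increment \<beta> (grid c n) i \<omega>)) \<partial>\<Omega>)"
      using \<beta>_increments[OF J(1), unfolded gaussian_increments_def, rule_format, OF strict_mono_grid[of c n] f, of "L * Suc n"] by simp
    finally show "(\<integral>\<omega>. (\<Prod>i\<in>steps J (grid c n) (L * Suc n). f i (E n i \<omega>)) \<partial>\<Omega>) =
      (\<integral>\<omega>. (\<Prod>i\<in>steps J (grid c n) (L * Suc n). f i (increment \<beta> (grid c n) i \<omega>)) \<partial>\<Omega>)" .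
  next
    fix n i assume "i \<in> steps J (grid c n) (L * Suc n)"
    then show "E n i \<in> borel_measurable \<Omega>"
      unfolding E_def[abs_def] by (intro measurable_driven_increment) (auto simp: steps_def)
  next
    fix z t assume z: "z \<in> J" "snd z \<le> t" "t \<le> s"
    then have t: "t \<le> c + real L" by (simp add: c_def)
    show "AE \<omega> in \<Omega>. (\<lambda>n. fst z + (\<Sum>k\<in>grid_steps c L n (snd z) t. E n (z, k) \<omega>)) \<longlonglongrightarrow> tilted z \<omega> t"
      unfolding E_def fst_conv snd_conv by (intro AE_I2 tilted_limit c z t)
    show "AE \<omega> in \<Omega>. (\<lambda>n. fst z + (\<Sum>k\<in>grid_steps c L n (snd z) t. increment \<beta> (grid c n) (z, k) \<omega>)) \<longlonglongrightarrow> \<beta> z \<omega> t"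
      by (intro AE_I2 increment_sum_tendsto c z t; simp add: \<beta>_start \<beta>_continuous)
  qed (use measurable_tilted in auto)
qed (use measurable_tilted in auto)

lemma web_eq_csol_tilted:
  assumes p: "p \<in> J" "snd p \<le> t"
  shows "csol_map J r' (\<lambda>i\<in>(SIGMA q:J. {snd q..}). tilted (fst i) \<omega> (snd i)) (p, t) = web D r p \<omega> t"
proof (rule csol_map_law[OF inj' _ _ _ _ p])
  have D: "q \<in> D" if "q \<in> J" for q using that J(2) by blast
  show "coalesced J r' (\<lambda>q. tilted q \<omega>) (\<lambda>q. web D r q \<omega>)"
  proof (rule coalescedI)
    fix p t assume p: "p \<in> J" "snd p \<le> t" and no: "\<And>q u. q \<in> J \<Longrightarrow> r' q < r' p \<Longrightarrow> snd p \<le> u \<Longrightarrow> snd q \<le> u \<Longrightarrow> u \<le> t \<Longrightarrow>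
      web D r q \<omega> u \<noteq> web D r p \<omega> u"
    have "\<not> dead p t \<omega>"
    proof
      assume "dead p t \<omega>"
      then obtain q where "q \<in> J" "r' q < r' p" "snd q \<le> t" "web D r q \<omega> t = web D r p \<omega> t"
        unfolding dead_def by blast
      then show False using no[of q t] p(2) by simp
    qed
    then show "web D r p \<omega> t = tilted p \<omega> t" by (simp add: tilted_def)
  next
    fix p q u t assume "p \<in> J" "q \<in> J" "snd p \<le> u" "snd q \<le> u" "web D r p \<omega> u = web D r q \<omega> u" "u \<le> t"
    then show "web D r p \<omega> t = web D r q \<omega> t" by (rule web_meet[OF inj D D])
  qed
  show "continuous_on {snd q..} (tilted q \<omega>)" if "q \<in> J" for q by (rule tilted_continuous[OF that])
  show "continuous_on {snd q..} (web D r q \<omega>)" if "q \<in> J" for q by (rule web_continuous[OF inj D[OF that]])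
  show "web D r q \<omega> (snd q) = tilted q \<omega> (snd q)" if "q \<in> J" for q
    using tilted_start[OF that] web_start[OF inj D[OF that]] by simp
qed

lemma law_web_restrict:
  "law \<Omega> (SIGMA z:J. {snd z..}) (\<lambda>i \<omega>. web D r (fst i) \<omega> (snd i)) =
   law \<Omega> (SIGMA z:J. {snd z..}) (\<lambda>i \<omega>. csol_map J r' (\<lambda>i\<in>(SIGMA q:J. {snd q..}). \<beta> (fst i) \<omega> (snd i)) i)"
proof -
  have mt: "(\<lambda>\<omega>. tilted (fst i) \<omega> (snd i)) \<in> borel_measurable \<Omega>" if "i \<in> (SIGMA z:J. {snd z..})" for i
    using that by (intro measurable_tilted) auto
  have "law \<Omega> (SIGMA z:J. {snd z..}) (\<lambda>i \<omega>. web D r (fst i) \<omega> (snd i)) =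
    law \<Omega> (SIGMA z:J. {snd z..}) (\<lambda>i \<omega>. csol_map J r' (\<lambda>i\<in>(SIGMA q:J. {snd q..}). tilted (fst i) \<omega> (snd i)) i)"
    unfolding law_def
  proof (intro distr_cong refl restrict_ext)
    fix \<omega> i assume i: "i \<in> (SIGMA z:J. {snd z..})"
    then have "fst i \<in> J" "snd (fst i) \<le> snd i" by auto
    from web_eq_csol_tilted[OF this, of \<omega>, unfolded prod.collapse]
    show "web D r (fst i) \<omega> (snd i) = csol_map J r' (\<lambda>i\<in>(SIGMA q:J. {snd q..}). tilted (fst i) \<omega> (snd i)) i" by (rule sym)
  qed
  also have "\<dots> = law \<Omega> (SIGMA z:J. {snd z..}) (\<lambda>i \<omega>. csol_map J r' (\<lambda>i\<in>(SIGMA q:J. {snd q..}). \<beta> (fst i) \<omega> (snd i)) i)"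
  proof (rule law_image[OF law_tilted])
    fix i assume "i \<in> (SIGMA z:J. {snd z..})"
    then show "(\<lambda>x. csol_map J r' x i) \<in> borel_measurable (PiM (SIGMA q:J. {snd q..}) (\<lambda>_. borel))"
      by (intro measurable_csol_map inj') auto
  qed (simp_all only: mt measurable_\<beta>)
  finally show ?thesis .
qed

end

theorem web_consistency:
  assumes inj: "inj_on r D" and J: "finite J" "J \<subseteq> D" and inj': "inj_on r' J"
  shows "law \<Omega> (SIGMA z:J. {snd z..}) (\<lambda>i \<omega>. web D r (fst i) \<omega> (snd i)) =
   law \<Omega> (SIGMA z:J. {snd z..}) (\<lambda>i \<omega>. csol_map J r' (\<lambda>i\<in>(SIGMA q:J. {snd q..}). \<beta> (fst i) \<omega> (snd i)) i)"
proof -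
  define A0 where "A0 = {q\<in>D. \<exists>p\<in>J. r q \<le> r p}"
  have "r ` A0 \<subseteq> {..Max (r ` J)}"
  proof
    fix k assume "k \<in> r ` A0"
    then obtain q p where "k = r q" "p \<in> J" "r q \<le> r p" unfolding A0_def by blast
    moreover have "r p \<le> Max (r ` J)" using J(1) \<open>p \<in> J\<close> by (intro Max_ge) auto
    ultimately show "k \<in> {..Max (r ` J)}" by simp
  qed
  moreover have "inj_on r A0" using inj by (rule inj_on_subset) (auto simp: A0_def)
  ultimately have fin: "finite A0" by (meson finite_imageD finite_atMost finite_subset)
  have sub: "J \<subseteq> A0" "A0 \<subseteq> D" using J by (auto simp: A0_def)
  have down: "q \<in> A0" if "p \<in> A0" "q \<in> D" "r q \<le> r p" for p q
    using that unfolding A0_def by (blast intro: order_trans)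
  have "bdd_above ((\<lambda>q. \<bar>fst q\<bar>) ` A0)" using fin by (intro bdd_above_finite) auto
  then obtain b where b: "\<And>q. q \<in> A0 \<Longrightarrow> \<bar>fst q\<bar> \<le> b" unfolding bdd_above_def by blast
  define \<phi> where "\<phi> p = (fst p + (2 * b + 1), snd p)" for p :: "real \<times> real"
  have "inj_on \<phi> J" unfolding \<phi>_def by (intro inj_onI prod_eqI) auto
  moreover have "snd (\<phi> p) = snd p" for p by (simp add: \<phi>_def)
  moreover have "\<phi> p \<notin> A0" if "p \<in> J" for p
  proof
    assume "\<phi> p \<in> A0"
    then have "\<bar>fst (\<phi> p)\<bar> \<le> b" "\<bar>fst p\<bar> \<le> b" using b sub(1) that by blast+
    then show False by (simp add: \<phi>_def)
  qed
  ultimately show ?thesis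
    by (intro law_web_restrict[OF inj J inj' fin sub, of \<phi>]) (use down in auto)
qed

end

section \<open>The law of coalescing Brownian motions\<close>

lemma path_law_eq_law:
  "path_law M D W = law M (SIGMA p:D. {snd p..}) (\<lambda>i \<omega>. W (fst i) \<omega> (snd i))"
  unfolding path_law_def law_def Let_def by (simp add: case_prod_unfold)

context brownian_source
begin

lemma web_law_unique:
  assumes r: "inj_on r D" "inj_on r' D'" and sub: "K \<subseteq> D" "K \<subseteq> D'"
  shows "law \<Omega> (SIGMA z:K. {snd z..}) (\<lambda>i \<omega>. web D r (fst i) \<omega> (snd i)) =
    law \<Omega> (SIGMA z:K. {snd z..}) (\<lambda>i \<omega>. web D' r' (fst i) \<omega> (snd i))"
proof (rule law_finite_subsets[OF \<Omega>.finite_measure_axioms \<Omega>.finite_measure_axioms])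
  have m: "(\<lambda>\<omega>. web C k (fst i) \<omega> (snd i)) \<in> borel_measurable \<Omega>"
    if "i \<in> (SIGMA z:K. {snd z..})" "inj_on k C" "K \<subseteq> C" for C k i
    by (rule measurable_web[OF that(2)]) (use that in auto)
  show "(\<lambda>\<omega>. web D r (fst i) \<omega> (snd i)) \<in> borel_measurable \<Omega>"
    "(\<lambda>\<omega>. web D' r' (fst i) \<omega> (snd i)) \<in> borel_measurable \<Omega>" if "i \<in> (SIGMA z:K. {snd z..})" for i
    using m[OF that r(1) sub(1)] m[OF that r(2) sub(2)] .
  fix I assume I: "finite I" "I \<subseteq> (SIGMA z:K. {snd z..})"
  define J where "J = fst ` I"
  have J: "finite J" "J \<subseteq> K" using I by (auto simp: J_def)
  have IJ: "I \<subseteq> (SIGMA z:J. {snd z..})"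
  proof
    fix i assume i: "i \<in> I"
    then have "fst i \<in> J" "snd (fst i) \<le> snd i" using I(2) by (auto simp: J_def)
    then show "i \<in> (SIGMA z:J. {snd z..})" by (simp add: mem_Sigma_iff[of "fst i" "snd i", simplified])
  qed
  have JD: "J \<subseteq> D" "J \<subseteq> D'" using J sub by auto
  have inj: "inj_on r J" using r(1) JD(1) by (rule inj_on_subset)
  have "law \<Omega> (SIGMA z:J. {snd z..}) (\<lambda>i \<omega>. web D r (fst i) \<omega> (snd i)) =
    law \<Omega> (SIGMA z:J. {snd z..}) (\<lambda>i \<omega>. web D' r' (fst i) \<omega> (snd i))"
    unfolding web_consistency[OF r(1) J(1) JD(1) inj] web_consistency[OF r(2) J(1) JD(2) inj] ..
  then show "law \<Omega> I (\<lambda>i \<omega>. web D r (fst i) \<omega> (snd i)) = law \<Omega> I (\<lambda>i \<omega>. web D' r' (fst i) \<omega> (snd i))"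
  proof (rule law_subset[OF _ _ _ IJ])
    fix i assume "i \<in> (SIGMA z:J. {snd z..})"
    then have "i \<in> (SIGMA z:K. {snd z..})" using J(2) by auto
    then show "(\<lambda>\<omega>. web D r (fst i) \<omega> (snd i)) \<in> borel_measurable \<Omega>" "(\<lambda>\<omega>. web D' r' (fst i) \<omega> (snd i)) \<in> borel_measurable \<Omega>"
      using m r sub by blast+
  qed
qed

theorem coalescing_law:
  fixes N :: "'n measure"
  assumes N: "prob_space N" and W: "coalescing_brownian_motions N D W" and r': "inj_on r' D'" and sub: "D \<subseteq> D'"
  shows "law N (SIGMA z:D. {snd z..}) (\<lambda>i \<omega>. W (fst i) \<omega> (snd i)) =
    law \<Omega> (SIGMA z:D. {snd z..}) (\<lambda>i \<omega>. web D' r' (fst i) \<omega> (snd i))"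
proof -
  let ?K = "SIGMA z:D. {snd z..}"
  obtain M' :: "(real \<times> real \<Rightarrow> real \<Rightarrow> real) measure" and B' W' r where M': "prob_space M'" and r: "inj_on r D"
    and B': "independent_brownian_motions M' D B'" and W': "random_paths M' D W'"
    and co: "AE \<omega> in M'. coalesced D r (\<lambda>p. B' p \<omega>) (\<lambda>p. W' p \<omega>)" and eq: "path_law N D W = path_law M' D W'"
    using W unfolding coalescing_brownian_motions_def by blast
  interpret M': prob_space M' by fact
  have cD: "countable D" using r by (rule countableI)
  have bm': "brownian_motion_from M' p (B' p)" if "p \<in> D" for p
    using B' that by (simp add: independent_brownian_motions_def)
  have mB: "(\<lambda>\<omega>. B' p \<omega> t) \<in> borel_measurable M'" if "p \<in> D" "snd p \<le> t" for p t
    using bm'[OF that(1)] that(2) by (simp add: brownian_motion_from_def)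
  have mW: "(\<lambda>\<omega>. W' p \<omega> t) \<in> borel_measurable M'" if "p \<in> D" "snd p \<le> t" for p t
    using W' that by (simp add: random_paths_def)
  have cB: "AE \<omega> in M'. B' p \<omega> (snd p) = fst p \<and> continuous_on {snd p..} (B' p \<omega>)" if "p \<in> D" for p
    using bm'[OF that] by (simp add: brownian_motion_from_def)
  have cW: "AE \<omega> in M'. W' p \<omega> (snd p) = fst p \<and> continuous_on {snd p..} (W' p \<omega>)" if "p \<in> D" for p
    using W' that by (simp add: random_paths_def)
  define X where "X i \<omega> = csol_map D r (\<lambda>j\<in>?K. B' (fst j) \<omega> (snd j)) i" for i \<omega>
  have mX: "X i \<in> borel_measurable M'" if "i \<in> ?K" for i
    unfolding X_def
  proof (rule measurable_compose[OF measurable_law_map])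
    show "(\<lambda>x. csol_map D r x i) \<in> borel_measurable (PiM ?K (\<lambda>_. borel))"
      using that by (intro measurable_csol_map r) auto
    show "(\<lambda>\<omega>. B' (fst i) \<omega> (snd i)) \<in> borel_measurable M'" if "i \<in> ?K" for i
      using that by (intro mB) auto
  qed
  have X: "AE \<omega> in M'. \<forall>i\<in>?K. X i \<omega> = W' (fst i) \<omega> (snd i)"
  proof -
    have "AE \<omega> in M'. \<forall>p\<in>D. (B' p \<omega> (snd p) = fst p \<and> continuous_on {snd p..} (B' p \<omega>)) \<and>
        (W' p \<omega> (snd p) = fst p \<and> continuous_on {snd p..} (W' p \<omega>))"
      using cB cW by (subst AE_ball_countable[OF cD]) (simp add: AE_conj_iff)
    then show ?thesis using co
    proof eventually_elim
      case (elim \<omega>)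
      show ?case
      proof
        fix i assume i: "i \<in> ?K"
        then have "fst i \<in> D" "snd (fst i) \<le> snd i" by auto
        from csol_map_law[OF r elim(2) _ _ _ this] elim(1)
        show "X i \<omega> = W' (fst i) \<omega> (snd i)" unfolding X_def by simp
      qed
    qed
  qed
  have mW': "(\<lambda>\<omega>. W' (fst i) \<omega> (snd i)) \<in> borel_measurable M'" if "i \<in> ?K" for i
    using that by (intro mW) auto
  have 1: "law M' ?K (\<lambda>i \<omega>. W' (fst i) \<omega> (snd i)) = law M' ?K X"
    by (rule law_cong_AE[OF M'.finite_measure_axioms mW' mX])
      (use X in \<open>auto elim!: eventually_mono\<close>)
  have 2: "law M' ?K (\<lambda>i \<omega>. B' (fst i) \<omega> (snd i)) = law \<Omega> ?K (\<lambda>i \<omega>. \<beta> (fst i) \<omega> (snd i))"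
  proof (rule law_gaussian_unique[OF M'.finite_measure_axioms \<Omega>.finite_measure_axioms])
    show "gaussian_increments M' A B'" if "finite A" "A \<subseteq> D" for A
      by (rule independent_brownian_motions_increments[OF M' B' that])
    show "gaussian_increments \<Omega> A \<beta>" if "finite A" for A by (rule \<beta>_increments[OF that])
    show "AE \<omega> in \<Omega>. \<beta> z \<omega> (snd z) = fst z \<and> continuous_on {snd z..} (\<beta> z \<omega>)" for z
      by (intro AE_I2) (simp add: \<beta>_start \<beta>_continuous)
  qed (simp_all only: mB cB measurable_\<beta>)
  have 3: "law M' ?K X = law \<Omega> ?K (\<lambda>i \<omega>. csol_map D r (\<lambda>j\<in>?K. \<beta> (fst j) \<omega> (snd j)) i)"
    unfolding X_def
  proof (rule law_image[OF 2])
    show "(\<lambda>x. csol_map D r x i) \<in> borel_measurable (PiM ?K (\<lambda>_. borel))" if "i \<in> ?K" for i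
      using that by (intro measurable_csol_map r) auto
    show "(\<lambda>\<omega>. B' (fst i) \<omega> (snd i)) \<in> borel_measurable M'" if "i \<in> ?K" for i
      using that by (intro mB) auto
  qed (rule measurable_\<beta>)
  have 4: "law \<Omega> ?K (\<lambda>i \<omega>. csol_map D r (\<lambda>j\<in>?K. \<beta> (fst j) \<omega> (snd j)) i) = law \<Omega> ?K (\<lambda>i \<omega>. web D r (fst i) \<omega> (snd i))"
    unfolding law_def
  proof (intro distr_cong refl restrict_ext)
    fix \<omega> i assume "i \<in> ?K"
    then have i: "fst i \<in> D" "snd (fst i) \<le> snd i" by auto
    have "csol_map D r (\<lambda>j\<in>?K. \<beta> (fst j) \<omega> (snd j)) (fst i, snd i) = web D r (fst i) \<omega> (snd i)"
      by (rule csol_map_law[OF r web_coalesced[OF r] _ _ _ i])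
        (simp_all add: \<beta>_continuous web_continuous[OF r] web_start[OF r] \<beta>_start)
    then show "csol_map D r (\<lambda>j\<in>?K. \<beta> (fst j) \<omega> (snd j)) i = web D r (fst i) \<omega> (snd i)" by simp
  qed
  have "law N ?K (\<lambda>i \<omega>. W (fst i) \<omega> (snd i)) = law M' ?K (\<lambda>i \<omega>. W' (fst i) \<omega> (snd i))"
    using eq unfolding path_law_eq_law .
  also note 1
  also note 3
  also note 4
  also have "law \<Omega> ?K (\<lambda>i \<omega>. web D r (fst i) \<omega> (snd i)) = law \<Omega> ?K (\<lambda>i \<omega>. web D' r' (fst i) \<omega> (snd i))"
    by (rule web_law_unique[OF r r' order_refl sub])
  finally show ?thesis .
qed

lemma measurable_random_path:
  assumes "coalescing_brownian_motions N D W" "i \<in> (SIGMA z:D. {snd z..})"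
  shows "(\<lambda>\<omega>. W (fst i) \<omega> (snd i)) \<in> borel_measurable N"
  using assms by (auto simp: coalescing_brownian_motions_def random_paths_def)

lemma coalescing_AE_continuous:
  assumes "coalescing_brownian_motions N D W" "countable D"
  shows "AE \<omega> in N. \<forall>p\<in>D. W p \<omega> (snd p) = fst p \<and> continuous_on {snd p..} (W p \<omega>)"
  using assms by (subst AE_ball_countable) (auto simp: coalescing_brownian_motions_def random_paths_def)

text \<open>For continuous paths, this is coalescence after each meeting; only rational times are inspected.\<close>

definition coalesces :: "((real \<times> real) \<times> real \<Rightarrow> real) \<Rightarrow> real \<times> real \<Rightarrow> real \<times> real \<Rightarrow> bool" where
  "coalesces x p q \<longleftrightarrow> (\<forall>t\<in>\<rat>. max (snd p) (snd q) \<le> t \<longrightarrow> meets (max (snd p) (snd q)) t (\<lambda>u. x (p, u)) (\<lambda>u. x (q, u)) \<longrightarrow>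
     x (p, t) = x (q, t))"

lemma coalesces_iff:
  assumes "continuous_on {snd p..} (w p)" "continuous_on {snd q..} (w q)" and D: "p \<in> D" "q \<in> D"
  shows "coalesces (\<lambda>i\<in>(SIGMA z:D. {snd z..}). w (fst i) (snd i)) p q \<longleftrightarrow>
    (\<forall>u t. snd p \<le> u \<longrightarrow> snd q \<le> u \<longrightarrow> w p u = w q u \<longrightarrow> u \<le> t \<longrightarrow> w p t = w q t)"
proof -
  let ?a = "max (snd p) (snd q)" and ?x = "\<lambda>i\<in>(SIGMA z:D. {snd z..}). w (fst i) (snd i)"
  have c: "continuous_on {?a..} (w p)" "continuous_on {?a..} (w q)"
    by (rule continuous_on_subset[OF assms(1)], auto, rule continuous_on_subset[OF assms(2)], auto)
  have m: "meets ?a t (\<lambda>u. ?x (p, u)) (\<lambda>u. ?x (q, u)) \<longleftrightarrow> meets ?a t (w p) (w q)" for t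
    unfolding meets_def using D by (intro all_cong1 bex_cong refl) auto
  have co: "coalesces ?x p q \<longleftrightarrow> (\<forall>t\<in>\<rat>. ?a \<le> t \<longrightarrow> (\<exists>u\<in>{?a..t}. w p u = w q u) \<longrightarrow> w p t = w q t)"
    unfolding coalesces_def m meets_iff[OF c] using D by (intro ball_cong refl imp_cong) auto
  show ?thesis unfolding co
  proof (intro iffI allI impI)
    fix u t assume *: "\<forall>t\<in>\<rat>. ?a \<le> t \<longrightarrow> (\<exists>u\<in>{?a..t}. w p u = w q u) \<longrightarrow> w p t = w q t"
      and u: "snd p \<le> u" "snd q \<le> u" "w p u = w q u" "u \<le> t"
    show "w p t = w q t"
    proof (cases "u = t")
      case True
      then show ?thesis using u by simp
    next
      case False
      have cl: "closure ({u<..<t} \<inter> \<rat>) \<subseteq> {u..t}" by (rule closure_minimal) auto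
      have tcl: "t \<in> closure ({u<..<t} \<inter> \<rat>)"
        unfolding closure_approachable
      proof (intro allI impI)
        fix e :: real assume "0 < e"
        then have "max u (t - e) < t" using False u by auto
        then obtain s where "s \<in> \<rat>" "max u (t - e) < s" "s < t" using Rats_dense_in_real by blast
        then show "\<exists>s\<in>{u<..<t} \<inter> \<rat>. dist s t < e" by (intro bexI[of _ s]) (auto simp: dist_real_def)
      qed
      have cont: "continuous_on (closure ({u<..<t} \<inter> \<rat>)) (\<lambda>s. w p s - w q s)"
        by (rule continuous_on_subset[OF _ cl])
          (use u in \<open>auto intro!: continuous_intros continuous_on_subset[OF c(1)] continuous_on_subset[OF c(2)]\<close>)
      have "w p s - w q s = 0" if "s \<in> {u<..<t} \<inter> \<rat>" for s
        using *[THEN bspec, of s] that u by auto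
      from continuous_constant_on_closure[OF cont this tcl] show ?thesis by simp
    qed
  next
    assume "\<forall>u t. snd p \<le> u \<longrightarrow> snd q \<le> u \<longrightarrow> w p u = w q u \<longrightarrow> u \<le> t \<longrightarrow> w p t = w q t"
    then show "\<forall>t\<in>\<rat>. ?a \<le> t \<longrightarrow> (\<exists>u\<in>{?a..t}. w p u = w q u) \<longrightarrow> w p t = w q t" by auto
  qed
qed

lemma pred_countable_Ball:
  assumes "countable X" "\<And>i. i \<in> X \<Longrightarrow> Measurable.pred M (P i)"
  shows "Measurable.pred M (\<lambda>x. \<forall>i\<in>X. P i x)"
proof -
  have "Measurable.pred M (\<lambda>x. \<not> (\<exists>i\<in>X. \<not> P i x))"
    by (intro pred_intros_logic(2) pred_countable_Bex assms)
  then show ?thesis by simp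
qed

lemma measurable_coalesces:
  assumes "p \<in> D" "q \<in> D"
  shows "Measurable.pred (PiM (SIGMA z:D. {snd z..}) (\<lambda>_. borel)) (\<lambda>x. coalesces x p q)"
  unfolding coalesces_def
proof (intro pred_countable_Ball countable_rat pred_intros_imp')
  fix t :: real assume t: "max (snd p) (snd q) \<le> t"
  have c: "(\<lambda>x. x (z, u)) \<in> borel_measurable (PiM (SIGMA z:D. {snd z..}) (\<lambda>_. borel))"
    if "z \<in> {p, q}" "max (snd p) (snd q) \<le> u" for z u
    using that assms by (intro measurable_component_singleton) auto
  show "Measurable.pred (PiM (SIGMA z:D. {snd z..}) (\<lambda>_. borel)) (\<lambda>x.
      meets (max (snd p) (snd q)) t (\<lambda>u. x (p, u)) (\<lambda>u. x (q, u)) \<longrightarrow> x (p, t) = (x (q, t) :: real))"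
  proof (rule pred_intros_logic(4)[OF pred_meets])
    show "Measurable.pred (PiM (SIGMA z:D. {snd z..}) (\<lambda>_. borel)) (\<lambda>x. x (p, t) = (x (q, t) :: real))"
      unfolding pred_def by (intro borel_measurable_eq c t) auto
  qed (auto intro!: c)
qed

lemma coalescing_AE_meet:
  fixes N :: "'n measure"
  assumes N: "prob_space N" and W: "coalescing_brownian_motions N D W" and D: "countable D"
  shows "AE \<omega> in N. \<forall>p\<in>D. \<forall>q\<in>D. \<forall>u t. snd p \<le> u \<longrightarrow> snd q \<le> u \<longrightarrow> W p \<omega> u = W q \<omega> u \<longrightarrow> u \<le> t \<longrightarrow> W p \<omega> t = W q \<omega> t"
proof -
  let ?K = "SIGMA z:D. {snd z..}"
  obtain r :: "real \<times> real \<Rightarrow> nat" where r: "inj_on r D" using D unfolding countable_def by blast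
  have "AE \<omega> in N. coalesces (\<lambda>i\<in>?K. W (fst i) \<omega> (snd i)) p q" if p: "p \<in> D" "q \<in> D" for p q
  proof (subst law_AE[OF coalescing_law[OF N W r order_refl]])
    show "AE \<omega> in \<Omega>. coalesces (\<lambda>i\<in>?K. web D r (fst i) \<omega> (snd i)) p q"
      by (intro AE_I2) (subst coalesces_iff[OF web_continuous[OF r p(1)] web_continuous[OF r p(2)] p], blast intro: web_meet[OF r p])
    show "(\<lambda>\<omega>. web D r (fst i) \<omega> (snd i)) \<in> borel_measurable \<Omega>" if "i \<in> ?K" for i
      using that by (intro measurable_web r) auto
  qed (use p W in \<open>auto intro: measurable_random_path measurable_coalesces\<close>)
  then have "AE \<omega> in N. \<forall>p\<in>D. \<forall>q\<in>D. coalesces (\<lambda>i\<in>?K. W (fst i) \<omega> (snd i)) p q"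
    by (subst AE_ball_countable[OF D], intro ballI, subst AE_ball_countable[OF D]) blast
  then show ?thesis using coalescing_AE_continuous[OF W D]
  proof eventually_elim
    case (elim \<omega>)
    show ?case
    proof (intro ballI)
      fix p q assume p: "p \<in> D" "q \<in> D"
      have c: "continuous_on {snd p..} (W p \<omega>)" "continuous_on {snd q..} (W q \<omega>)" using elim(2) p by blast+
      show "\<forall>u t. snd p \<le> u \<longrightarrow> snd q \<le> u \<longrightarrow> W p \<omega> u = W q \<omega> u \<longrightarrow> u \<le> t \<longrightarrow> W p \<omega> t = W q \<omega> t"
        using elim(1) p coalesces_iff[of p "\<lambda>p. W p \<omega>" q D, OF c p] by blast
    qed
  qed
qed

lemma web_top: "inj_on r D \<Longrightarrow> p \<in> D \<Longrightarrow> snd p \<le> t \<Longrightarrow> (\<And>q. q \<in> D \<Longrightarrow> \<not> r q < r p) \<Longrightarrow> web D r p \<omega> t = \<beta> p \<omega> t"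
  by (rule coalesced_follow[OF web_coalesced]) auto

lemma law_single_path:
  assumes r: "inj_on r D" and p: "p \<in> D"
  shows "law \<Omega> (SIGMA z:{p}. {snd z..}) (\<lambda>i \<omega>. web D r (fst i) \<omega> (snd i)) =
    law \<Omega> (SIGMA z:{p}. {snd z..}) (\<lambda>i \<omega>. \<beta> (fst i) \<omega> (snd i))"
proof -
  have "law \<Omega> (SIGMA z:{p}. {snd z..}) (\<lambda>i \<omega>. web D r (fst i) \<omega> (snd i)) =
      law \<Omega> (SIGMA z:{p}. {snd z..}) (\<lambda>i \<omega>. web {p} (\<lambda>_. 0) (fst i) \<omega> (snd i))"
    by (rule web_law_unique[OF r]) (use p in auto)
  also have "\<dots> = law \<Omega> (SIGMA z:{p}. {snd z..}) (\<lambda>i \<omega>. \<beta> (fst i) \<omega> (snd i))"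
    unfolding law_def by (intro distr_cong refl restrict_ext web_top) auto
  finally show ?thesis .
qed

lemma coalescing_AE_avoid:
  fixes N :: "'n measure"
  assumes N: "prob_space N" and W: "coalescing_brownian_motions N D W" and D: "countable D" and p: "p \<in> D" "snd p < t"
  shows "AE \<omega> in N. W p \<omega> t \<noteq> x"
proof -
  let ?K = "SIGMA z:D. {snd z..}" and ?S = "SIGMA z:{p}. {snd z..}"
  obtain r :: "real \<times> real \<Rightarrow> nat" where r: "inj_on r D" using D unfolding countable_def by blast
  have mW: "(\<lambda>\<omega>. W (fst i) \<omega> (snd i)) \<in> borel_measurable N" if "i \<in> ?K" for i by (rule measurable_random_path[OF W that])
  have mw: "(\<lambda>\<omega>. web D r (fst i) \<omega> (snd i)) \<in> borel_measurable \<Omega>" if "i \<in> ?K" for i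
    using that by (intro measurable_web r) auto
  have sub: "?S \<subseteq> ?K" using p by auto
  have pt: "(p, t) \<in> ?S" using p by auto
  have "law N ?S (\<lambda>i \<omega>. W (fst i) \<omega> (snd i)) = law \<Omega> ?S (\<lambda>i \<omega>. web D r (fst i) \<omega> (snd i))"
    by (rule law_subset[OF coalescing_law[OF N W r order_refl] mW mw sub])
  also note law_single_path[OF r p(1)]
  finally have eq: "law N ?S (\<lambda>i \<omega>. W (fst i) \<omega> (snd i)) = law \<Omega> ?S (\<lambda>i \<omega>. \<beta> (fst i) \<omega> (snd i))" .
  have m: "Measurable.pred (PiM ?S (\<lambda>_. borel)) (\<lambda>v. v (p, t) \<noteq> x)"
    unfolding pred_def by (intro borel_measurable_neq measurable_component_singleton[OF pt] borel_measurable_const)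
  have "(AE \<omega> in N. (\<lambda>i\<in>?S. W (fst i) \<omega> (snd i)) (p, t) \<noteq> x) \<longleftrightarrow> (AE \<omega> in \<Omega>. (\<lambda>i\<in>?S. \<beta> (fst i) \<omega> (snd i)) (p, t) \<noteq> x)"
    by (rule law_AE[OF eq _ measurable_\<beta> m]) (use sub mW in blast)
  moreover have "AE \<omega> in \<Omega>. \<beta> p \<omega> t \<noteq> x"
  proof -
    have d: "distributed \<Omega> lborel (\<lambda>\<omega>. \<beta> p \<omega> t - \<beta> p \<omega> (snd p)) (normal_density 0 (sqrt (t - snd p)))"
      using brownian_\<beta>[of p, unfolded brownian_motion_from_def, THEN conjunct2, THEN conjunct2, THEN conjunct1, rule_format, OF order_refl p(2)] .
    have ae: "AE y in lborel. y \<noteq> x - fst p" by (rule AE_lborel_singleton)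
    have "AE y in distr \<Omega> lborel (\<lambda>\<omega>. \<beta> p \<omega> t - \<beta> p \<omega> (snd p)). y \<noteq> x - fst p"
      unfolding distributed_distr_eq_density[OF d] by (subst AE_density) (use ae in \<open>auto elim: eventually_mono\<close>)
    then have "AE \<omega> in \<Omega>. \<beta> p \<omega> t - \<beta> p \<omega> (snd p) \<noteq> x - fst p"
      by (rule AE_distrD[rotated]) measurable
    then show ?thesis by eventually_elim (auto simp: \<beta>_start)
  qed
  ultimately show ?thesis using pt by simp
qed

end

lemma coalescing_source:
  assumes "coalescing_brownian_motions N D W" "D \<noteq> {}"
  obtains M1 :: "(real \<times> real \<Rightarrow> real \<Rightarrow> real) measure" and p0 B where "brownian_source M1 p0 B"
proof -
  obtain M' :: "(real \<times> real \<Rightarrow> real \<Rightarrow> real) measure" and B where "prob_space M'" "independent_brownian_motions M' D B"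
    using assms(1) unfolding coalescing_brownian_motions_def by blast
  then show ?thesis using that assms(2) unfolding independent_brownian_motions_def brownian_source_def by blast
qed

section \<open>Nearby Brownian motions meet soon\<close>

lemma gauss_mean_scale:
  assumes "0 < v"
  shows "gauss_mean f v = gauss_mean (\<lambda>y. f (sqrt v * y)) 1"
proof -
  have s: "0 < sqrt v" using assms by simp
  have "gauss_mean f v = \<bar>sqrt v\<bar> *\<^sub>R (\<integral>y. normal_density 0 (sqrt v) (0 + sqrt v * y) * f (0 + sqrt v * y) \<partial>lborel)"
    unfolding gauss_mean_def by (rule lborel_integral_real_affine) (use s in simp)
  also have "\<dots> = (\<integral>y. sqrt v * (normal_density 0 (sqrt v) (sqrt v * y) * f (sqrt v * y)) \<partial>lborel)"
    using s by simp
  also have "\<dots> = gauss_mean (\<lambda>y. f (sqrt v * y)) 1"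
    unfolding gauss_mean_def
  proof (intro Bochner_Integration.integral_cong refl)
    fix y
    have "sqrt v * normal_density 0 (sqrt v) (sqrt v * y) = normal_density 0 1 y"
      using assms s by (simp add: normal_density_def power_mult_distrib real_sqrt_mult)
    then show "sqrt v * (normal_density 0 (sqrt v) (sqrt v * y) * f (sqrt v * y)) = normal_density 0 (sqrt 1) y * f (sqrt v * y)"
      by (simp add: mult.assoc[symmetric])
  qed
  finally show ?thesis .
qed

lemma integrable_gauss:
  assumes "f \<in> borel_measurable borel" "\<And>x. \<bar>f x\<bar> \<le> 1"
  shows "integrable lborel (\<lambda>x. normal_density 0 1 x * f x)"
proof (rule Bochner_Integration.integrable_bound[where f = "normal_density 0 1"])
  show "AE x in lborel. norm (normal_density 0 1 x * f x) \<le> norm (normal_density 0 1 x)"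
    using assms(2) by (intro AE_I2) (simp add: abs_mult mult_left_le)
qed (use assms(1) in auto)

lemma gauss_mean_interval_pos:
  assumes "a < b" "{a..b} \<subseteq> S" "S \<in> sets borel"
  shows "0 < gauss_mean (indicat_real S) 1"
proof -
  define m where "m = max \<bar>a\<bar> \<bar>b\<bar>"
  have "0 < normal_density 0 1 m * (b - a)" using assms by (intro mult_pos_pos normal_density_pos) auto
  also have "\<dots> = (\<integral>x. normal_density 0 1 m * indicat_real {a..b} x \<partial>lborel)" using assms by simp
  also have "\<dots> \<le> (\<integral>x. normal_density 0 1 x * indicat_real S x \<partial>lborel)"
  proof (rule integral_mono)
    show "integrable lborel (\<lambda>x. normal_density 0 1 m * indicat_real {a..b} x)"
      using assms(1) by (intro integrable_mult_right integrable_real_indicator) (auto simp: emeasure_lborel_Icc)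
    show "integrable lborel (\<lambda>x. normal_density 0 1 x * indicat_real S x)"
      using assms(3) by (intro integrable_gauss) (auto simp: indicator_def)
    fix x
    show "normal_density 0 1 m * indicat_real {a..b} x \<le> normal_density 0 1 x * indicat_real S x"
    proof (cases "x \<in> {a..b}")
      case True
      then have "\<bar>x\<bar> \<le> m" by (auto simp: m_def)
      then have "x\<^sup>2 \<le> m\<^sup>2" using abs_le_square_iff[of x m] by (simp add: m_def)
      then have "normal_density 0 1 m \<le> normal_density 0 1 x" by (simp add: normal_density_def divide_right_mono)
      then show ?thesis using True assms(2) by auto
    qed simp
  qed
  finally show ?thesis by (simp add: gauss_mean_def)
qed

lemma gauss_mean_le_1: "S \<in> sets borel \<Longrightarrow> gauss_mean (indicat_real S) 1 \<le> 1"
proof -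
  assume S: "S \<in> sets borel"
  have "gauss_mean (indicat_real S) 1 \<le> (\<integral>x. normal_density 0 1 x \<partial>lborel)"
    unfolding gauss_mean_def
    by (rule integral_mono) (use S in \<open>auto simp: indicator_def intro!: integrable_gauss\<close>)
  then show ?thesis by (simp add: integral_normal_density)
qed

lemma gauss_tail:
  assumes "0 < e"
  shows "\<exists>m\<ge>1. gauss_mean (indicat_real {y. m < \<bar>y\<bar>}) 1 < e"
proof -
  have "(\<lambda>n. \<integral>x. normal_density 0 1 x * indicat_real {y. real n < \<bar>y\<bar>} x \<partial>lborel) \<longlonglongrightarrow> (\<integral>x. 0 \<partial>(lborel :: real measure))"
  proof (rule integral_dominated_convergence[where w = "normal_density 0 1"])
    show "AE x in lborel. (\<lambda>n. normal_density 0 1 x * indicat_real {y. real n < \<bar>y\<bar>} x) \<longlonglongrightarrow> 0"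
    proof (rule AE_I2)
      fix x :: real
      obtain n0 where "\<bar>x\<bar> \<le> real n0" using real_arch_simple by blast
      then have "\<forall>n\<ge>n0. normal_density 0 1 x * indicat_real {y. real n < \<bar>y\<bar>} x = 0" by auto
      then show "(\<lambda>n. normal_density 0 1 x * indicat_real {y. real n < \<bar>y\<bar>} x) \<longlonglongrightarrow> 0"
        by (intro tendsto_eventually) (auto simp: eventually_sequentially)
    qed
  qed (auto simp: indicator_def)
  then have "\<forall>\<^sub>F n in sequentially. (\<integral>x. normal_density 0 1 x * indicat_real {y. real n < \<bar>y\<bar>} x \<partial>lborel) < e"
    using assms by (intro order_tendstoD) auto
  then obtain n where "(\<integral>x. normal_density 0 1 x * indicat_real {y. real n < \<bar>y\<bar>} x \<partial>lborel) < e" "1 \<le> n"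
    by (metis (no_types, lifting) eventually_sequentially nle_le)
  then show ?thesis by (intro exI[of _ "real n"]) (simp add: gauss_mean_def)
qed

context brownian_source
begin

lemma small_modulus:
  assumes "0 < e"
  shows "\<exists>\<delta>>0. \<delta> \<le> e \<and> measure M1 {\<omega>\<in>space M1. \<exists>h\<in>{0..\<delta>} \<inter> \<rat>. e < \<bar>wiener \<omega> h\<bar>} \<le> e"
proof -
  define S where "S n = {\<omega>\<in>space M1. \<exists>h\<in>{0..1 / real (Suc n)} \<inter> \<rat>. e < \<bar>wiener \<omega> h\<bar>}" for n
  have m: "S n \<in> sets M1" for n
  proof -
    have "Measurable.pred M1 (\<lambda>\<omega>. \<exists>h\<in>{0..1 / real (Suc n)} \<inter> \<rat>. e < \<bar>wiener \<omega> h\<bar>)"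
      by (intro pred_countable_Bex) (auto simp: countable_rat)
    then show ?thesis unfolding S_def pred_def .
  qed
  have dec: "decseq S"
  proof (rule decseq_SucI)
    fix n
    have "1 / real (Suc (Suc n)) \<le> 1 / real (Suc n)" by (intro divide_left_mono) auto
    then show "S (Suc n) \<subseteq> S n" unfolding S_def by fastforce
  qed
  have "(\<Inter>n. S n) = {}"
  proof (rule ccontr)
    assume "(\<Inter>n. S n) \<noteq> {}"
    then obtain \<omega> where w: "\<And>n. \<omega> \<in> S n" by blast
    have "isCont (wiener \<omega>) 0" using wiener_continuous[of \<omega>] by (simp add: continuous_on_eq_continuous_at)
    then obtain d where d: "d > 0" "\<And>h. \<bar>h\<bar> < d \<Longrightarrow> \<bar>wiener \<omega> h\<bar> < e"
      using assms unfolding continuous_at_eps_delta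
      by (auto simp: dist_real_def wiener_start[of 0])
    obtain n where n: "1 / real (Suc n) < d" using d(1) nat_approx_posE by blast
    obtain h where "h \<in> {0..1 / real (Suc n)}" "e < \<bar>wiener \<omega> h\<bar>" using w[of n] unfolding S_def by blast
    then show False using d(2)[of h] n by auto
  qed
  then have "(\<lambda>n. measure M1 (S n)) \<longlonglongrightarrow> 0"
    using M1.finite_Lim_measure_decseq[of S] m dec by (auto simp: image_subset_iff)
  then have ev: "\<forall>\<^sub>F n in sequentially. measure M1 (S n) < e" using assms by (rule order_tendstoD)
  have "(\<lambda>n. 1 / real (Suc n)) \<longlonglongrightarrow> 0" by (rule LIMSEQ_Suc) (rule lim_1_over_n)
  then have "\<forall>\<^sub>F n in sequentially. 1 / real (Suc n) < e" using assms by (rule order_tendstoD)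
  with ev have "\<forall>\<^sub>F n in sequentially. measure M1 (S n) < e \<and> 1 / real (Suc n) < e" by eventually_elim simp
  then obtain n where "measure M1 (S n) < e" "1 / real (Suc n) < e"
    unfolding eventually_sequentially by blast
  then show ?thesis unfolding S_def by (intro exI[of _ "1 / real (Suc n)"]) auto
qed

lemma rational_modulus:
  fixes f :: "real \<Rightarrow> real"
  assumes "continuous_on UNIV f" "0 < \<delta>" "\<And>h. h \<in> {0..\<delta>} \<inter> \<rat> \<Longrightarrow> \<bar>f h\<bar> \<le> e" "0 \<le> h" "h \<le> \<delta>"
  shows "\<bar>f h\<bar> \<le> e"
proof (rule ccontr)
  assume "\<not> \<bar>f h\<bar> \<le> e"
  moreover have "isCont (\<lambda>x. \<bar>f x\<bar>) h"
    using assms(1) by (intro continuous_intros) (simp add: continuous_on_eq_continuous_at)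
  ultimately obtain d where d: "d > 0" "\<And>x. \<bar>x - h\<bar> < d \<Longrightarrow> \<bar>\<bar>f x\<bar> - \<bar>f h\<bar>\<bar> < \<bar>f h\<bar> - e"
    unfolding continuous_at_eps_delta dist_real_def by (metis diff_gt_0_iff_gt not_le)
  have "max 0 (h - d) < min \<delta> (h + d)" using assms d(1) by auto
  then obtain x where "x \<in> \<rat>" "max 0 (h - d) < x" "x < min \<delta> (h + d)" using Rats_dense_in_real by blast
  then have x: "x \<in> {0..\<delta>} \<inter> \<rat>" "\<bar>x - h\<bar> < d" using assms(4,5) by (simp, auto)
  from d(2)[OF x(2)] assms(3)[OF x(1)] show False by linarith
qed

lemma measure_component:
  assumes "S \<in> sets M1"
  shows "measure \<Omega> {\<omega>\<in>space \<Omega>. \<omega> z \<in> S} = measure M1 S" "{\<omega>\<in>space \<Omega>. \<omega> z \<in> S} \<in> sets \<Omega>"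
proof -
  have eq: "{\<omega>\<in>space \<Omega>. \<omega> z \<in> S} = (\<lambda>\<omega>. \<omega> z) -` S \<inter> space \<Omega>" by auto
  show "{\<omega>\<in>space \<Omega>. \<omega> z \<in> S} \<in> sets \<Omega>" unfolding eq using assms by measurable
  show "measure \<Omega> {\<omega>\<in>space \<Omega>. \<omega> z \<in> S} = measure M1 S" unfolding eq
    using measure_distr[OF measurable_component_\<Omega> assms, of z] by (simp add: distr_component)
qed

text \<open>Two Brownian motions run over geometrically decreasing scales; on each scale the difference makes a
  large negative move with a fixed probability, which dominates everything that happened on the
  smaller scales.\<close>

lemma difference_dips:
  assumes e: "0 < e"
  shows "\<exists>\<eta>>0. \<forall>p q t. p \<noteq> q \<longrightarrow> snd p \<le> t \<longrightarrow> snd q \<le> t \<longrightarrow> (\<exists>N\<in>sets \<Omega>. measure \<Omega> N \<le> e \<and>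
    (\<forall>\<omega>\<in>space \<Omega> - N. \<exists>u\<in>{0..e}. (\<beta> p \<omega> (t + u) - \<beta> p \<omega> t) - (\<beta> q \<omega> (t + u) - \<beta> q \<omega> t) < - \<eta>))"
proof -
  define \<kappa> where "\<kappa> = gauss_mean (indicat_real {..< -1}) 1"
  define \<kappa>' where "\<kappa>' = gauss_mean (indicat_real {1 <..}) 1"
  have k: "0 < \<kappa>" "\<kappa> \<le> 1" "0 < \<kappa>'" "\<kappa>' \<le> 1" unfolding \<kappa>_def \<kappa>'_def
       apply (rule gauss_mean_interval_pos[of "-3" "-2"]; force)
      apply (rule gauss_mean_le_1; simp)
     apply (rule gauss_mean_interval_pos[of 2 3]; force)
    by (rule gauss_mean_le_1) simp
  have kk: "0 < \<kappa> * \<kappa>'" "\<kappa> * \<kappa>' \<le> 1" using k by (auto intro: mult_le_one)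
  have "(\<lambda>n. (1 - \<kappa> * \<kappa>') ^ n) \<longlonglongrightarrow> 0" using kk by (intro LIMSEQ_power_zero) auto
  then have "\<forall>\<^sub>F n in sequentially. (1 - \<kappa> * \<kappa>') ^ n < e / 2" by (rule order_tendstoD) (use e in simp)
  then obtain J where J: "(1 - \<kappa> * \<kappa>') ^ J < e / 2" unfolding eventually_sequentially by blast
  obtain m where m: "1 \<le> m" "gauss_mean (indicat_real {y. m < \<bar>y\<bar>}) 1 < e / (4 * (real J + 1))"
    using gauss_tail[of "e / (4 * (real J + 1))"] e by auto
  define c where "c = 1 / (4 * m)"
  have c: "0 < c" "c \<le> 1 / 4" "m * c = 1 / 4" using m by (auto simp: c_def field_simps)
  define d where "d k = e * (c\<^sup>2) ^ (J - k)" for k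
  have d_pos: "0 < d k" for k using e c by (simp add: d_def)
  have d_Suc: "d k = c\<^sup>2 * d (Suc k)" if "k < J" for k
  proof -
    have "J - k = Suc (J - Suc k)" using that by simp
    then show ?thesis by (simp add: d_def)
  qed
  have c2: "c\<^sup>2 \<le> 1 / 16" using power_mono[OF c(2), of 2] c(1) by (simp add: power2_eq_square)
  have d_less: "d k < d (Suc k)" if "k < J" for k
    using d_Suc[OF that] d_pos[of "Suc k"] c2 mult_strict_right_mono[of "c\<^sup>2" 1 "d (Suc k)"] by simp
  have d_e: "d k \<le> e" for k
    unfolding d_def using e c c2 by (intro mult_left_le power_le_one) auto
  define \<eta> where "\<eta> = sqrt (d 0) / 2"
  have eta: "0 < \<eta>" using d_pos by (simp add: \<eta>_def)
  have main: "\<exists>N\<in>sets \<Omega>. measure \<Omega> N \<le> e \<and>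
    (\<forall>\<omega>\<in>space \<Omega> - N. \<exists>u\<in>{0..e}. (\<beta> p \<omega> (t + u) - \<beta> p \<omega> t) - (\<beta> q \<omega> (t + u) - \<beta> q \<omega> t) < - \<eta>)"
    if pq: "p \<noteq> q" and pt: "snd p \<le> t" "snd q \<le> t" for p q t
  proof -
    define g where "g k = t + d k" for k
    define v where "v k = d (Suc k) - d k" for k
    have v: "0 < v k" if "k < J" for k using d_less[OF that] by (simp add: v_def)
    have gt: "t \<le> g k" for k using d_pos[of k] by (simp add: g_def)
    have gS: "g k < g (Suc k)" "g (Suc k) - g k = v k" if "k < J" for k using d_less[OF that] by (auto simp: g_def v_def)
    define a where "a k \<omega> = indicat_real {..< - sqrt (v k)} (\<beta> p \<omega> (g (Suc k)) - \<beta> p \<omega> (g k)) *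
        indicat_real {sqrt (v k) <..} (\<beta> q \<omega> (g (Suc k)) - \<beta> q \<omega> (g k))" for k \<omega>
    have a01: "0 \<le> a k \<omega>" "a k \<omega> \<le> 1" for k \<omega> by (auto simp: a_def indicator_def)
    have mb: "(\<lambda>\<omega>. \<beta> z \<omega> s) \<in> borel_measurable (past {p, q} s')" if "z \<in> {p, q}" "t \<le> s" "s \<le> s'" for z s s'
      using that pt by (intro measurable_past_\<beta>) auto
    have ma: "a k \<in> borel_measurable (past {p, q} s')" if "g (Suc k) \<le> s'" "k < J" for k s'
    proof -
      have "g k \<le> s'" using gS[OF that(2)] that(1) by simp
      have 1: "(\<lambda>\<omega>. \<beta> p \<omega> (g (Suc k)) - \<beta> p \<omega> (g k)) \<in> borel_measurable (past {p, q} s')"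
        "(\<lambda>\<omega>. \<beta> q \<omega> (g (Suc k)) - \<beta> q \<omega> (g k)) \<in> borel_measurable (past {p, q} s')"
        using that(1) \<open>g k \<le> s'\<close> gt by (auto intro!: borel_measurable_diff mb)
      show ?thesis unfolding a_def
        by (intro borel_measurable_times measurable_compose[OF 1(1)] measurable_compose[OF 1(2)]) auto
    qed
    define Z where "Z n \<omega> = (\<Prod>k<n. 1 - a k \<omega>)" for n \<omega>
    have Z01: "0 \<le> Z n \<omega>" "Z n \<omega> \<le> 1" for n \<omega>
      unfolding Z_def using a01 by (auto intro!: prod_nonneg prod_le_1)
    have gmono: "g (Suc k) \<le> g n" if "k < n" "n \<le> J" for k n
      using that
    proof (induction n)
      case (Suc n)
      then show ?case using gS(1)[of n] by (cases "k = n") auto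
    qed simp
    have mZ: "Z n \<in> borel_measurable (past {p, q} (g n))" if "n \<le> J" for n
      unfolding Z_def[abs_def] using that
      by (intro borel_measurable_prod borel_measurable_diff borel_measurable_const ma gmono) auto
    have mO: "f \<in> borel_measurable \<Omega>" if "f \<in> borel_measurable (past {p, q} s)" for f :: "_ \<Rightarrow> real" and s
      by (rule measurable_from_subalg[OF subalgebra_past that])
    have EZ: "(\<integral>\<omega>. Z n \<omega> \<partial>\<Omega>) = (1 - \<kappa> * \<kappa>') ^ n" if "n \<le> J" for n
      using that
    proof (induction n)
      case 0
      then show ?case by (simp add: Z_def \<Omega>.prob_space)
    next
      case (Suc n)
      then have n: "n < J" "n \<le> J" by auto
      define f where "f z = (if z = p then indicat_real {..< - sqrt (v n)} else indicat_real {sqrt (v n) <..})" for z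
      have f: "unit_measurable f" by (auto simp: unit_measurable_def f_def)
      have "(\<integral>\<omega>. Z n \<omega> * (\<Prod>z\<in>{p, q}. f z (\<beta> z \<omega> (g (Suc n)) - \<beta> z \<omega> (g n))) \<partial>\<Omega>) =
          (\<integral>\<omega>. Z n \<omega> \<partial>\<Omega>) * (\<Prod>z\<in>{p, q}. gauss_mean (f z) (g (Suc n) - g n))"
        by (rule future_increments[OF _ order_refl _ _ f mZ[OF n(2)]]) (use pt gt[of n] gS[OF n(1)] Z01 in auto)
      moreover have "(\<Prod>z\<in>{p, q}. f z (\<beta> z \<omega> (g (Suc n)) - \<beta> z \<omega> (g n))) = a n \<omega>" for \<omega>
        using pq by (simp add: f_def a_def)
      moreover have "(\<Prod>z\<in>{p, q}. gauss_mean (f z) (g (Suc n) - g n)) = \<kappa> * \<kappa>'"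
      proof -
        have s: "0 < sqrt (v n)" using v[OF n(1)] by simp
        have "sqrt (v n) * y < - sqrt (v n) \<longleftrightarrow> y < - 1" "sqrt (v n) < sqrt (v n) * y \<longleftrightarrow> 1 < y" for y
          using s mult_less_cancel_left_pos[OF s, of y "-1"] mult_less_cancel_left_pos[OF s, of 1 y] by auto
        then have "gauss_mean (indicat_real {..< - sqrt (v n)}) (v n) = \<kappa>" "gauss_mean (indicat_real {sqrt (v n) <..}) (v n) = \<kappa>'"
          unfolding \<kappa>_def \<kappa>'_def
          by (auto simp: gauss_mean_scale[OF v[OF n(1)]] indicator_def intro!: arg_cong[where f = "\<lambda>f. gauss_mean f 1"])
        then show ?thesis using pq gS(2)[OF n(1)] by (simp add: f_def)
      qed
      ultimately have "(\<integral>\<omega>. Z n \<omega> * a n \<omega> \<partial>\<Omega>) = (1 - \<kappa> * \<kappa>') ^ n * (\<kappa> * \<kappa>')" using Suc n by simp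
      moreover have "(\<integral>\<omega>. Z (Suc n) \<omega> \<partial>\<Omega>) = (\<integral>\<omega>. Z n \<omega> - Z n \<omega> * a n \<omega> \<partial>\<Omega>)"
        by (simp add: Z_def algebra_simps)
      moreover have "\<dots> = (\<integral>\<omega>. Z n \<omega> \<partial>\<Omega>) - (\<integral>\<omega>. Z n \<omega> * a n \<omega> \<partial>\<Omega>)"
      proof (rule Bochner_Integration.integral_diff)
        show "integrable \<Omega> (Z n)"
          by (rule \<Omega>.integrable_const_bound[where B = 1]) (use Z01 mO[OF mZ[OF n(2)]] in auto)
        show "integrable \<Omega> (\<lambda>\<omega>. Z n \<omega> * a n \<omega>)"
          by (rule \<Omega>.integrable_const_bound[where B = 1])
            (use Z01 a01 in \<open>auto intro!: borel_measurable_times mO[OF mZ[OF n(2)]] mO[OF ma[OF order_refl n(1)]] mult_le_one simp: abs_mult\<close>)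
      qed
      ultimately show ?case using Suc n by (simp add: algebra_simps)
    qed
    define N0 where "N0 = {\<omega>\<in>space \<Omega>. Z J \<omega> = 1}"
    have "Z J \<omega> = 0 \<or> Z J \<omega> = 1" for \<omega>
    proof (cases "\<exists>k<J. a k \<omega> = 1")
      case True
      then show ?thesis unfolding Z_def by (intro disjI1 prod_zero) auto
    next
      case False
      moreover have "a k \<omega> = 0 \<or> a k \<omega> = 1" for k by (auto simp: a_def indicator_def)
      ultimately have "Z J \<omega> = (\<Prod>k<J. 1)" unfolding Z_def by (intro prod.cong) force+
      then show ?thesis by simp
    qed
    then have Zind: "Z J \<omega> = indicat_real N0 \<omega>" if "\<omega> \<in> space \<Omega>" for \<omega> using that by (auto simp: N0_def indicator_def)
    have N0 [measurable]: "N0 \<in> sets \<Omega>" unfolding N0_def using mO[OF mZ[OF order_refl]] by measurable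
    have "measure \<Omega> N0 = (\<integral>\<omega>. Z J \<omega> \<partial>\<Omega>)" using Zind by (subst Bochner_Integration.integral_cong[OF refl Zind]) simp_all
    then have PN0: "measure \<Omega> N0 < e / 2" using EZ[OF order_refl] J by simp
    define T where "T z k = {\<omega>\<in>space \<Omega>. m * sqrt (d k) < \<bar>\<beta> z \<omega> (g k) - \<beta> z \<omega> t\<bar>}" for z k
    have T [measurable]: "T z k \<in> sets \<Omega>" for z k unfolding T_def by measurable
    have PT: "measure \<Omega> (T z k) < e / (4 * (real J + 1))" if "z \<in> {p, q}" for z k
    proof -
      define f where "f = (\<lambda>_::real \<times> real. indicat_real {y. m * sqrt (d k) < \<bar>y\<bar>})"
      have f: "unit_measurable f" by (auto simp: unit_measurable_def f_def)
      have "(\<integral>\<omega>. 1 * (\<Prod>z\<in>{z}. f z (\<beta> z \<omega> (g k) - \<beta> z \<omega> t)) \<partial>\<Omega>) = (\<integral>\<omega>. 1 \<partial>\<Omega>) * (\<Prod>z\<in>{z}. gauss_mean (f z) (g k - t))"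
        by (rule future_increments[where A = "{z}", OF _ order_refl _ _ f]) (use that pt d_pos[of k] in \<open>auto simp: g_def\<close>)
      then have "(\<integral>\<omega>. f z (\<beta> z \<omega> (g k) - \<beta> z \<omega> t) \<partial>\<Omega>) = gauss_mean (f z) (d k)"
        by (simp add: \<Omega>.prob_space g_def)
      moreover have "(\<integral>\<omega>. f z (\<beta> z \<omega> (g k) - \<beta> z \<omega> t) \<partial>\<Omega>) = measure \<Omega> (T z k)"
        by (subst Bochner_Integration.integral_cong[OF refl, where g = "indicat_real (T z k)"]) (auto simp: f_def T_def indicator_def)
      moreover have "gauss_mean (f z) (d k) = gauss_mean (indicat_real {y. m < \<bar>y\<bar>}) 1"
      proof -
        have s: "0 < sqrt (d k)" using d_pos[of k] by simp
        have "m * sqrt (d k) < \<bar>sqrt (d k) * y\<bar> \<longleftrightarrow> m < \<bar>y\<bar>" for y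
          using s mult_less_cancel_left_pos[OF s, of m "\<bar>y\<bar>"] by (simp add: abs_mult mult.commute)
        then show ?thesis by (auto simp: gauss_mean_scale[OF d_pos[of k]] f_def indicator_def intro!: arg_cong[where f = "\<lambda>f. gauss_mean f 1"])
      qed
      ultimately show ?thesis using m(2) by simp
    qed
    define N where "N = N0 \<union> (\<Union>k\<in>{..<J}. T p k \<union> T q k)"
    have N: "N \<in> sets \<Omega>" unfolding N_def by measurable
    have "measure \<Omega> (\<Union>k\<in>{..<J}. T p k \<union> T q k) \<le> (\<Sum>k<J. measure \<Omega> (T p k \<union> T q k))"
      by (intro \<Omega>.finite_measure_subadditive_finite) auto
    also have "\<dots> \<le> (\<Sum>k<J. e / (4 * (real J + 1)) + e / (4 * (real J + 1)))"
    proof (intro sum_mono)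
      fix k
      have "measure \<Omega> (T p k \<union> T q k) \<le> measure \<Omega> (T p k) + measure \<Omega> (T q k)"
        by (intro measure_Un_le) auto
      then show "measure \<Omega> (T p k \<union> T q k) \<le> e / (4 * (real J + 1)) + e / (4 * (real J + 1))"
        using PT[of p k] PT[of q k] by simp
    qed
    also have "\<dots> = real J * (e / (2 * (real J + 1)))"
    proof -
      have "e / (4 * y) + e / (4 * y) = e / (2 * y)" for y by (cases "y = 0") (auto simp: field_simps)
      from this[of "real J + 1"] show ?thesis by simp
    qed
    also have "\<dots> \<le> e / 2" using e by (simp add: field_simps)
    finally have "measure \<Omega> (\<Union>k\<in>{..<J}. T p k \<union> T q k) \<le> e / 2" .
    moreover have "measure \<Omega> N \<le> measure \<Omega> N0 + measure \<Omega> (\<Union>k\<in>{..<J}. T p k \<union> T q k)"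
      unfolding N_def by (intro measure_Un_le) auto
    ultimately have PN: "measure \<Omega> N \<le> e" using PN0 by linarith
    have "\<exists>u\<in>{0..e}. (\<beta> p \<omega> (t + u) - \<beta> p \<omega> t) - (\<beta> q \<omega> (t + u) - \<beta> q \<omega> t) < - \<eta>" if w: "\<omega> \<in> space \<Omega> - N" for \<omega>
    proof -
      have "Z J \<omega> \<noteq> 1" using w by (auto simp: N_def N0_def)
      then have "\<exists>k<J. a k \<omega> \<noteq> 0" unfolding Z_def by (metis (mono_tags, lifting) diff_zero lessThan_iff prod.neutral)
      then obtain k where k: "k < J" "a k \<omega> \<noteq> 0" by blast
      then have inc: "\<beta> p \<omega> (g (Suc k)) - \<beta> p \<omega> (g k) < - sqrt (v k)" "sqrt (v k) < \<beta> q \<omega> (g (Suc k)) - \<beta> q \<omega> (g k)"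
        by (auto simp: a_def indicator_def split: if_splits)
      have sm: "\<bar>\<beta> p \<omega> (g k) - \<beta> p \<omega> t\<bar> \<le> m * sqrt (d k)" "\<bar>\<beta> q \<omega> (g k) - \<beta> q \<omega> t\<bar> \<le> m * sqrt (d k)"
        using w k(1) by (force simp: N_def T_def)+
      define D where "D = sqrt (d (Suc k))"
      have D: "0 < D" using d_pos by (simp add: D_def)
      have "sqrt (d k) = c * D" using d_Suc[OF k(1)] c(1) by (simp add: real_sqrt_mult D_def)
      then have md: "m * sqrt (d k) = D / 4" using c(3) by (metis mult.assoc mult.commute times_divide_eq_right mult_1)
      have "(3 / 4 * D)\<^sup>2 \<le> v k"
      proof -
        have DD: "D\<^sup>2 = d (Suc k)" using d_pos[of "Suc k"] by (simp add: D_def)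
        have "d k \<le> 1 / 16 * d (Suc k)" unfolding d_Suc[OF k(1)] using c2 d_pos[of "Suc k"] by (intro mult_right_mono) auto
        then have "9 / 16 * d (Suc k) \<le> v k" using d_pos[of "Suc k"] by (simp add: v_def)
        then show ?thesis by (simp add: power_mult_distrib power_divide DD)
      qed
      then have "3 / 4 * D \<le> sqrt (v k)" by (rule real_le_rsqrt)
      moreover have "sqrt (d 0) \<le> D"
      proof -
        have "d 0 \<le> d (Suc k)" unfolding d_def using e c c2 k(1)
          by (intro mult_left_mono power_decreasing) auto
        then show ?thesis by (simp add: D_def)
      qed
      ultimately have "(\<beta> p \<omega> (g (Suc k)) - \<beta> p \<omega> t) - (\<beta> q \<omega> (g (Suc k)) - \<beta> q \<omega> t) < - \<eta>"
        using inc sm D unfolding md \<eta>_def by linarith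
      then show ?thesis using d_pos[of "Suc k"] d_e[of "Suc k"] by (intro bexI[of _ "d (Suc k)"]) (auto simp: g_def)
    qed
    then show ?thesis using N PN by blast
  qed
  show ?thesis using eta main by blast
qed

end

lemma measure_law:
  assumes X: "\<And>i. i \<in> K \<Longrightarrow> X i \<in> borel_measurable M" and F: "Measurable.pred (PiM K (\<lambda>_. borel)) F"
  shows "measure M {\<omega>\<in>space M. F (\<lambda>i\<in>K. X i \<omega>)} = measure (law M K X) {x \<in> space (PiM K (\<lambda>_. borel)). F x}"
proof -
  note m = measurable_law_map[of K X M, OF X]
  have S: "{x \<in> space (PiM K (\<lambda>_. borel)). F x} \<in> sets (PiM K (\<lambda>_. borel))" using F by simp
  have "(\<lambda>\<omega>. \<lambda>i\<in>K. X i \<omega>) -` {x \<in> space (PiM K (\<lambda>_. borel)). F x} \<inter> space M = {\<omega>\<in>space M. F (\<lambda>i\<in>K. X i \<omega>)}"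
    using measurable_space[OF m] by auto
  then show ?thesis unfolding law_def by (subst measure_distr[OF m S]) simp_all
qed

lemma law_measure:
  assumes "law M K X = law N K Y" "\<And>i. i \<in> K \<Longrightarrow> X i \<in> borel_measurable M" "\<And>i. i \<in> K \<Longrightarrow> Y i \<in> borel_measurable N"
    and F: "Measurable.pred (PiM K (\<lambda>_. borel)) F"
  shows "measure M {\<omega>\<in>space M. F (\<lambda>i\<in>K. X i \<omega>)} = measure N {\<omega>\<in>space N. F (\<lambda>i\<in>K. Y i \<omega>)}"
  by (rule trans[OF measure_law trans[OF arg_cong[where f = "\<lambda>L. measure L _", OF assms(1)] measure_law[symmetric]]])
    (fact assms)+

context brownian_source
begin

lemma Rats_modulus_sets: "{\<omega>\<in>space M1. \<exists>h\<in>{0..\<delta>} \<inter> \<rat>. e < \<bar>wiener \<omega> h\<bar>} \<in> sets M1"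
proof -
  have "Measurable.pred M1 (\<lambda>\<omega>. \<exists>h\<in>{0..\<delta>} \<inter> \<rat>. e < \<bar>wiener \<omega> h\<bar>)"
    by (intro pred_countable_Bex) (auto simp: countable_rat)
  then show ?thesis unfolding pred_def .
qed

lemma starting_modulus:
  assumes "0 < e"
  shows "\<exists>\<delta>>0. \<delta> \<le> e \<and> (\<forall>p. \<exists>N\<in>sets \<Omega>. measure \<Omega> N \<le> e \<and> (\<forall>\<omega>\<in>space \<Omega> - N. \<forall>u\<in>{snd p..snd p + \<delta>}. \<bar>\<beta> p \<omega> u - fst p\<bar> \<le> e))"
proof -
  obtain \<delta> where d: "0 < \<delta>" "\<delta> \<le> e" "measure M1 {\<omega>\<in>space M1. \<exists>h\<in>{0..\<delta>} \<inter> \<rat>. e < \<bar>wiener \<omega> h\<bar>} \<le> e"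
    using small_modulus[OF assms] by blast
  define S where "S = {\<omega>\<in>space M1. \<exists>h\<in>{0..\<delta>} \<inter> \<rat>. e < \<bar>wiener \<omega> h\<bar>}"
  have S: "S \<in> sets M1" unfolding S_def by (rule Rats_modulus_sets)
  have "\<exists>N\<in>sets \<Omega>. measure \<Omega> N \<le> e \<and> (\<forall>\<omega>\<in>space \<Omega> - N. \<forall>u\<in>{snd p..snd p + \<delta>}. \<bar>\<beta> p \<omega> u - fst p\<bar> \<le> e)" for p
  proof (rule bexI[OF conjI measure_component(2)[OF S, of p]])
    show "measure \<Omega> {\<omega>\<in>space \<Omega>. \<omega> p \<in> S} \<le> e" unfolding measure_component(1)[OF S] using d(3) by (simp only: S_def)
    show "\<forall>\<omega>\<in>space \<Omega> - {\<omega>\<in>space \<Omega>. \<omega> p \<in> S}. \<forall>u\<in>{snd p..snd p + \<delta>}. \<bar>\<beta> p \<omega> u - fst p\<bar> \<le> e"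
    proof (intro ballI)
      fix \<omega> u assume w: "\<omega> \<in> space \<Omega> - {\<omega>\<in>space \<Omega>. \<omega> p \<in> S}" and u: "u \<in> {snd p..snd p + \<delta>}"
      have "\<omega> \<in> space \<Omega>" using w by blast
      then have sp: "\<omega> p \<in> space M1" by (rule measurable_space[OF measurable_component_\<Omega>])
      have "\<bar>wiener (\<omega> p) h\<bar> \<le> e" if h: "h \<in> {0..\<delta>} \<inter> \<rat>" for h
      proof (rule ccontr)
        assume "\<not> \<bar>wiener (\<omega> p) h\<bar> \<le> e"
        then have "e < \<bar>wiener (\<omega> p) h\<bar>" by simp
        then have "\<omega> p \<in> S" unfolding S_def using sp h by (intro CollectI conjI bexI[of _ h])
        then show False using w by blast
      qed
      then have "\<bar>wiener (\<omega> p) (u - snd p)\<bar> \<le> e"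
        by (rule rational_modulus[OF wiener_continuous d(1)]) (use u in auto)
      then show "\<bar>\<beta> p \<omega> u - fst p\<bar> \<le> e" by (simp add: \<beta>_def)
    qed
  qed
  then have "\<forall>p. \<exists>N\<in>sets \<Omega>. measure \<Omega> N \<le> e \<and> (\<forall>\<omega>\<in>space \<Omega> - N. \<forall>u\<in>{snd p..snd p + \<delta>}. \<bar>\<beta> p \<omega> u - fst p\<bar> \<le> e)" by (rule allI)
  with d(1,2) show ?thesis by (intro exI[of _ \<delta>] conjI)
qed

lemma meet_soon:
  assumes "0 < e"
  shows "\<exists>\<rho>>0. \<rho> \<le> e \<and> (\<forall>p q. p \<noteq> q \<longrightarrow> \<bar>fst p - fst q\<bar> < \<rho> \<longrightarrow> snd p \<le> snd q \<longrightarrow> snd q < snd p + \<rho> \<longrightarrow>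
    (\<exists>N\<in>sets \<Omega>. measure \<Omega> N \<le> e \<and> (\<forall>\<omega>\<in>space \<Omega> - N. \<exists>u\<in>{snd q..snd q + e}. \<beta> p \<omega> u = \<beta> q \<omega> u)))"
proof -
  have e3: "0 < e / 3" using assms by simp
  obtain \<eta> where eta: "0 < \<eta>" and dips: "\<forall>p q t. p \<noteq> q \<longrightarrow> snd p \<le> t \<longrightarrow> snd q \<le> t \<longrightarrow> (\<exists>N\<in>sets \<Omega>. measure \<Omega> N \<le> e / 3 \<and>
    (\<forall>\<omega>\<in>space \<Omega> - N. \<exists>u\<in>{0..e / 3}. (\<beta> p \<omega> (t + u) - \<beta> p \<omega> t) - (\<beta> q \<omega> (t + u) - \<beta> q \<omega> t) < - \<eta>))"
    using difference_dips[OF e3] by blast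
  obtain \<delta> where d: "0 < \<delta>" "\<delta> \<le> min (e / 3) (\<eta> / 2)"
    and mod: "\<forall>p. \<exists>N\<in>sets \<Omega>. measure \<Omega> N \<le> min (e / 3) (\<eta> / 2) \<and> (\<forall>\<omega>\<in>space \<Omega> - N. \<forall>u\<in>{snd p..snd p + \<delta>}. \<bar>\<beta> p \<omega> u - fst p\<bar> \<le> min (e / 3) (\<eta> / 2))"
    using starting_modulus[of "min (e / 3) (\<eta> / 2)"] assms eta by auto
  have "\<exists>N\<in>sets \<Omega>. measure \<Omega> N \<le> e \<and> (\<forall>\<omega>\<in>space \<Omega> - N. \<exists>u\<in>{snd q..snd q + e}. \<beta> p \<omega> u = \<beta> q \<omega> u)"
    if pq: "p \<noteq> q" "\<bar>fst p - fst q\<bar> < \<delta>" "snd p \<le> snd q" "snd q < snd p + \<delta>" for p q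
  proof -
    obtain N1 where N1: "N1 \<in> sets \<Omega>" "measure \<Omega> N1 \<le> e / 3"
      "\<forall>\<omega>\<in>space \<Omega> - N1. \<forall>u\<in>{snd p..snd p + \<delta>}. \<bar>\<beta> p \<omega> u - fst p\<bar> \<le> \<eta> / 2"
      using mod by (metis (no_types, lifting) min.boundedE)
    obtain N2 where N2: "N2 \<in> sets \<Omega>" "measure \<Omega> N2 \<le> e / 3"
      "\<forall>\<omega>\<in>space \<Omega> - N2. \<exists>u\<in>{0..e / 3}. (\<beta> p \<omega> (snd q + u) - \<beta> p \<omega> (snd q)) - (\<beta> q \<omega> (snd q + u) - \<beta> q \<omega> (snd q)) < - \<eta>"
      using mp[OF mp[OF mp[OF dips[THEN spec, THEN spec, THEN spec, of p q "snd q"] pq(1)] pq(3)] order_refl] by blast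
    obtain N3 where N3: "N3 \<in> sets \<Omega>" "measure \<Omega> N3 \<le> e / 3"
      "\<forall>\<omega>\<in>space \<Omega> - N3. \<exists>u\<in>{0..e / 3}. (\<beta> q \<omega> (snd q + u) - \<beta> q \<omega> (snd q)) - (\<beta> p \<omega> (snd q + u) - \<beta> p \<omega> (snd q)) < - \<eta>"
      using mp[OF mp[OF mp[OF dips[THEN spec, THEN spec, THEN spec, of q p "snd q"] pq(1)[symmetric]] order_refl] pq(3)] by blast
    have "measure \<Omega> (N1 \<union> N2 \<union> N3) \<le> e"
      using measure_Un_le[of "N1 \<union> N2" \<Omega> N3] measure_Un_le[of N1 \<Omega> N2] N1 N2 N3 by auto
    moreover have "\<exists>u\<in>{snd q..snd q + e}. \<beta> p \<omega> u = \<beta> q \<omega> u" if w: "\<omega> \<in> space \<Omega> - (N1 \<union> N2 \<union> N3)" for \<omega>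
    proof -
      have b: "\<bar>\<beta> p \<omega> (snd q) - fst p\<bar> \<le> \<eta> / 2" using N1(3) w pq by auto
      have bq: "\<beta> q \<omega> (snd q) = fst q" by (simp add: \<beta>_start)
      obtain u1 where u1: "u1 \<in> {0..e / 3}" "(\<beta> p \<omega> (snd q + u1) - \<beta> p \<omega> (snd q)) - (\<beta> q \<omega> (snd q + u1) - \<beta> q \<omega> (snd q)) < - \<eta>"
        using N2(3) w by blast
      obtain u2 where u2: "u2 \<in> {0..e / 3}" "(\<beta> q \<omega> (snd q + u2) - \<beta> q \<omega> (snd q)) - (\<beta> p \<omega> (snd q + u2) - \<beta> p \<omega> (snd q)) < - \<eta>"
        using N3(3) w by blast
      let ?f = "\<lambda>u. \<beta> p \<omega> u - \<beta> q \<omega> u"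
      have s: "snd q + u1 \<in> {snd q..snd q + e}" "snd q + u2 \<in> {snd q..snd q + e}" using u1(1) u2(1) assms by auto
      have f: "?f (snd q + u1) \<le> 0" "0 \<le> ?f (snd q + u2)" using u1(2) u2(2) b bq pq(2) d(2) eta by linarith+
      have c: "connected (?f ` {snd q..snd q + e})"
        by (intro connected_continuous_image continuous_intros continuous_on_subset[OF \<beta>_continuous]) auto
      have "0 \<in> ?f ` {snd q..snd q + e}"
        by (rule connectedD_interval[OF c imageI[OF s(1)] imageI[OF s(2)] f])
      then show ?thesis by auto
    qed
    ultimately show ?thesis using N1(1) N2(1) N3(1) by (intro bexI[of _ "N1 \<union> N2 \<union> N3"]) auto
  qed
  then show ?thesis using d assms by (intro exI[of _ \<delta>]) auto
qed

definition apart :: "real \<Rightarrow> real \<times> real \<Rightarrow> real \<times> real \<Rightarrow> ((real \<times> real) \<times> real \<Rightarrow> real) \<Rightarrow> bool" where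
  "apart e p q x \<longleftrightarrow> (\<exists>h\<in>\<rat> \<inter> {0..}. e < \<bar>x (p, snd q + h) - x (q, snd q + h)\<bar>)"

lemma measurable_apart:
  assumes "p \<in> K" "q \<in> K" "snd p \<le> snd q"
  shows "Measurable.pred (PiM (SIGMA z:K. {snd z..}) (\<lambda>_. borel)) (apart e p q)"
  unfolding apart_def
proof (intro pred_countable_Bex)
  fix h :: real assume h: "h \<in> \<rat> \<inter> {0..}"
  have "(\<lambda>x. x (p, snd q + h)) \<in> borel_measurable (PiM (SIGMA z:K. {snd z..}) (\<lambda>_. borel))"
    by (rule measurable_component_singleton) (use assms h in auto)
  moreover have "(\<lambda>x. x (q, snd q + h)) \<in> borel_measurable (PiM (SIGMA z:K. {snd z..}) (\<lambda>_. borel))"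
    by (rule measurable_component_singleton) (use assms h in auto)
  ultimately have "(\<lambda>x. \<bar>x (p, snd q + h) - x (q, snd q + h)\<bar> :: real) \<in> borel_measurable (PiM (SIGMA z:K. {snd z..}) (\<lambda>_. borel))"
    by (rule borel_measurable_abs[OF borel_measurable_diff])
  then show "Measurable.pred (PiM (SIGMA z:K. {snd z..}) (\<lambda>_. borel)) (\<lambda>x. e < \<bar>x (p, snd q + h) - x (q, snd q + h)\<bar>)"
    unfolding pred_def by (intro borel_measurable_less borel_measurable_const)
qed (auto simp: countable_rat)

text \<open>By independence of the priorities, the path from the later point may be assumed to follow its driving
  Brownian motion, and the other one to follow its own until they meet.\<close>

lemma web_close:
  assumes "0 < e"
  shows "\<exists>\<rho>>0. \<forall>p q D r. inj_on r D \<longrightarrow> p \<in> D \<longrightarrow> q \<in> D \<longrightarrow> p \<noteq> q \<longrightarrow> \<bar>fst p - fst q\<bar> < \<rho> \<longrightarrow> snd p \<le> snd q \<longrightarrow> snd q < snd p + \<rho> \<longrightarrow>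
    measure \<Omega> {\<omega>\<in>space \<Omega>. apart e p q (\<lambda>i\<in>(SIGMA z:{p, q}. {snd z..}). web D r (fst i) \<omega> (snd i))} \<le> e"
proof -
  have e3: "0 < e / 3" using assms by simp
  obtain \<delta> where d: "0 < \<delta>" "\<delta> \<le> e / 3"
    and mod: "\<forall>p. \<exists>N\<in>sets \<Omega>. measure \<Omega> N \<le> e / 3 \<and> (\<forall>\<omega>\<in>space \<Omega> - N. \<forall>u\<in>{snd p..snd p + \<delta>}. \<bar>\<beta> p \<omega> u - fst p\<bar> \<le> e / 3)"
    using starting_modulus[OF e3] by blast
  have d2: "0 < \<delta> / 2" using d by simp
  obtain \<rho> where rho: "0 < \<rho>" "\<rho> \<le> \<delta> / 2"
    and meet: "\<forall>p q. p \<noteq> q \<longrightarrow> \<bar>fst p - fst q\<bar> < \<rho> \<longrightarrow> snd p \<le> snd q \<longrightarrow> snd q < snd p + \<rho> \<longrightarrow>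
    (\<exists>N\<in>sets \<Omega>. measure \<Omega> N \<le> \<delta> / 2 \<and> (\<forall>\<omega>\<in>space \<Omega> - N. \<exists>u\<in>{snd q..snd q + \<delta> / 2}. \<beta> p \<omega> u = \<beta> q \<omega> u))"
    using meet_soon[OF d2] by blast
  have "measure \<Omega> {\<omega>\<in>space \<Omega>. apart e p q (\<lambda>i\<in>(SIGMA z:{p, q}. {snd z..}). web D r (fst i) \<omega> (snd i))} \<le> e"
    if r: "inj_on r D" and pD: "p \<in> D" "q \<in> D" and pq: "p \<noteq> q" "\<bar>fst p - fst q\<bar> < \<rho>" "snd p \<le> snd q" "snd q < snd p + \<rho>" for p q D r
  proof -
    define J where "J = {p, q}"
    define r' :: "real \<times> real \<Rightarrow> nat" where "r' z = (if z = q then 0 else 1)" for z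
    have r': "inj_on r' J" using pq by (auto simp: inj_on_def r'_def J_def)
    let ?K = "SIGMA z:{p, q}. {snd z..}"
    have mw: "(\<lambda>\<omega>. web C k (fst i) \<omega> (snd i)) \<in> borel_measurable \<Omega>"
      if "i \<in> ?K" "inj_on k C" "{p, q} \<subseteq> C" for C k i
      by (rule measurable_web[OF that(2)]) (use that in auto)
    have "measure \<Omega> {\<omega>\<in>space \<Omega>. apart e p q (\<lambda>i\<in>?K. web D r (fst i) \<omega> (snd i))} =
        measure \<Omega> {\<omega>\<in>space \<Omega>. apart e p q (\<lambda>i\<in>?K. web J r' (fst i) \<omega> (snd i))}"
    proof (rule law_measure[OF web_law_unique[OF r r']])
      show "Measurable.pred (PiM ?K (\<lambda>_. borel)) (apart e p q)"
        using pq by (intro measurable_apart) auto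
    qed (use pD r r' in \<open>auto simp: J_def intro!: mw\<close>)
    moreover have "measure \<Omega> {\<omega>\<in>space \<Omega>. apart e p q (\<lambda>i\<in>?K. web J r' (fst i) \<omega> (snd i))} \<le> e"
    proof -
      obtain N1 where N1: "N1 \<in> sets \<Omega>" "measure \<Omega> N1 \<le> e / 3" "\<forall>\<omega>\<in>space \<Omega> - N1. \<forall>u\<in>{snd p..snd p + \<delta>}. \<bar>\<beta> p \<omega> u - fst p\<bar> \<le> e / 3"
        using mod by blast
      obtain N2 where N2: "N2 \<in> sets \<Omega>" "measure \<Omega> N2 \<le> e / 3" "\<forall>\<omega>\<in>space \<Omega> - N2. \<forall>u\<in>{snd q..snd q + \<delta>}. \<bar>\<beta> q \<omega> u - fst q\<bar> \<le> e / 3"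
        using mod by blast
      obtain N3 where N3: "N3 \<in> sets \<Omega>" "measure \<Omega> N3 \<le> \<delta> / 2" "\<forall>\<omega>\<in>space \<Omega> - N3. \<exists>u\<in>{snd q..snd q + \<delta> / 2}. \<beta> p \<omega> u = \<beta> q \<omega> u"
        using meet pq by blast
      have "measure \<Omega> (N1 \<union> N2 \<union> N3) \<le> e"
        using measure_Un_le[of "N1 \<union> N2" \<Omega> N3] measure_Un_le[of N1 \<Omega> N2] N1 N2 N3 d by auto
      moreover have "{\<omega>\<in>space \<Omega>. apart e p q (\<lambda>i\<in>?K. web J r' (fst i) \<omega> (snd i))} \<subseteq> N1 \<union> N2 \<union> N3"
      proof (rule subsetI, rule ccontr)
        fix \<omega> assume "\<omega> \<in> {\<omega>\<in>space \<Omega>. apart e p q (\<lambda>i\<in>?K. web J r' (fst i) \<omega> (snd i))}" and nN: "\<omega> \<notin> N1 \<union> N2 \<union> N3"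
        then have w: "\<omega> \<in> space \<Omega>" and a: "apart e p q (\<lambda>i\<in>?K. web J r' (fst i) \<omega> (snd i))" by auto
        let ?w = "\<lambda>z. web J r' z \<omega>"
        obtain h where h: "0 \<le> h" "e < \<bar>?w p (snd q + h) - ?w q (snd q + h)\<bar>"
          using a pq(3) unfolding apart_def by auto
        define s where "s = snd q + h"
        have s: "snd q \<le> s" "snd p \<le> s" "?w p s \<noteq> ?w q s" "e < \<bar>?w p s - ?w q s\<bar>" using h assms pq by (auto simp: s_def)
        have J: "p \<in> J" "q \<in> J" by (auto simp: J_def)
        have wq: "?w q t = \<beta> q \<omega> t" if "snd q \<le> t" for t
          by (rule web_top[OF r' J(2) that]) (simp add: r'_def)
        have no: "?w q t \<noteq> ?w p t" if "snd q \<le> t" "t \<le> s" for t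
          using web_meet[OF r' J(2,1) that(1) _ _ that(2), of \<omega>] pq(3) that s(3) by auto
        have wp: "?w p t = \<beta> p \<omega> t" if "snd p \<le> t" "t \<le> s" for t
        proof (rule coalesced_follow[OF web_coalesced[OF r'] J(1) that(1)])
          fix z u assume "z \<in> J" "r' z < r' p" "snd p \<le> u" "snd z \<le> u" "u \<le> t"
          then show "?w z u \<noteq> ?w p u" using no[of u] that(2) by (auto simp: J_def)
        qed
        obtain u where u: "u \<in> {snd q..snd q + \<delta> / 2}" "\<beta> p \<omega> u = \<beta> q \<omega> u" using N3(3) w nN by blast
        have "s < u" using no[of u] wq[of u] wp[of u] u pq(3) by force
        then have "\<bar>\<beta> p \<omega> s - fst p\<bar> \<le> e / 3" "\<bar>\<beta> q \<omega> s - fst q\<bar> \<le> e / 3"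
          using N1(3) N2(3) w nN u(1) s pq rho by auto
        then show False using s(4) wp[OF s(2) order_refl] wq[OF s(1)] pq(2) rho d by linarith
      qed
      ultimately show ?thesis using N1(1) N2(1) N3(1)
        by (meson \<Omega>.finite_measure_mono order_trans sets.Un)
    qed
    ultimately show ?thesis by simp
  qed
  then show ?thesis using rho(1) by (intro exI[of _ \<rho>] conjI allI impI)
qed

end

lemma dist_semipath_of_le:
  assumes c: "continuous_on {a..} w" "continuous_on {a..} w'"
    and a: "\<bar>tanh (w a) - tanh (w' a)\<bar> \<le> e"
    and le: "\<And>s. a \<le> s \<Longrightarrow> \<bar>tanh (w s) - tanh (w' s)\<bar> \<le> e \<or> 2 \<le> e * (1 + \<bar>s\<bar>)"
  shows "dist (semipath_of a w) (semipath_of a w') \<le> e"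
proof -
  have e: "0 \<le> e" using a by linarith
  have "\<bar>Phi (extend_back (time_extend w, ereal a) t) t - Phi (extend_back (time_extend w', ereal a) t) t\<bar> \<le> e" for t
  proof (cases "\<bar>t\<bar> = \<infinity>")
    case True
    then show ?thesis using e by (auto simp: Phi_def)
  next
    case False
    then obtain u where t: "t = ereal u" by auto
    have "\<bar>tanh (w (max a u)) - tanh (w' (max a u))\<bar> \<le> e * (1 + \<bar>u\<bar>)"
    proof (cases "\<bar>tanh (w (max a u)) - tanh (w' (max a u))\<bar> \<le> e")
      case True
      have "e * 1 \<le> e * (1 + \<bar>u\<bar>)" using e by (intro mult_left_mono) auto
      then show ?thesis using True by simp
    next
      case False
      then have "a \<le> u" "2 \<le> e * (1 + \<bar>u\<bar>)" using a le[of u] le[of a] by (auto simp: max_def split: if_splits)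
      moreover have "\<bar>tanh x\<bar> \<le> 1" for x :: real using tanh_real_bounds[of x] by auto
      ultimately show ?thesis by (smt (verit))
    qed
    then have "\<bar>tanh (w (max a u)) - tanh (w' (max a u))\<bar> / (1 + \<bar>u\<bar>) \<le> e"
      by (simp add: pos_divide_le_eq add_pos_nonneg)
    then show ?thesis
      by (simp add: t Phi_ereal extend_back_def time_extend_def abs_divide ereal_max[symmetric] del: ereal_max flip: diff_divide_distrib)
  qed
  then have "path_dist (extend_back (time_extend w, ereal a)) (extend_back (time_extend w', ereal a)) \<le> e"
    unfolding path_dist_def by (intro cSUP_least) auto
  then have "semipath_dist (time_extend w, ereal a) (time_extend w', ereal a) \<le> e"
    using e by (simp add: semipath_dist_def)
  then show ?thesis
    using semipath_rel_time_extend[OF c(1)] semipath_rel_time_extend[OF c(2)]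
    by (simp add: semipath_of_def dist_semipath.abs_eq)
qed

lemma tanh_diff_le: "\<bar>tanh x - tanh y\<bar> \<le> \<bar>x - y :: real\<bar>"
proof -
  have "norm (tanh x - tanh y) \<le> 1 * norm (x - y)"
  proof (rule field_differentiable_bound[of UNIV tanh "\<lambda>x. 1 - tanh x ^ 2"])
    show "(tanh has_field_derivative 1 - (tanh z)\<^sup>2) (at z within UNIV)" for z :: real
      by (auto intro!: derivative_eq_intros simp: cosh_real_nonzero)
    show "norm (1 - (tanh z)\<^sup>2) \<le> 1" for z :: real
      using tanh_real_bounds[of z] by (auto simp: abs_le_iff power_le_one_iff abs_square_le_1)
  qed auto
  then show ?thesis by simp
qed

context brownian_source
begin

theorem approximants:
  assumes D: "closure D = UNIV" and D': "countable D'" and sub: "D \<subseteq> D''" "D' \<subseteq> D''" and r: "inj_on r D''"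
  shows "\<exists>ap. (\<forall>n. \<forall>q\<in>D'. ap n q \<in> D \<and> snd (ap n q) \<le> snd q) \<and>
    (AE \<omega> in \<Omega>. \<forall>q\<in>D'. (\<lambda>n. semipath_of (snd q) (web D'' r (ap n q) \<omega>)) \<longlonglongrightarrow> semipath_of (snd q) (web D'' r q \<omega>))"
proof -
  have "\<forall>n. \<exists>\<rho>>0. \<forall>p q D r. inj_on r D \<longrightarrow> p \<in> D \<longrightarrow> q \<in> D \<longrightarrow> p \<noteq> q \<longrightarrow> \<bar>fst p - fst q\<bar> < \<rho> \<longrightarrow> snd p \<le> snd q \<longrightarrow> snd q < snd p + \<rho> \<longrightarrow>
    measure \<Omega> {\<omega>\<in>space \<Omega>. apart ((1/2)^n) p q (\<lambda>i\<in>(SIGMA z:{p, q}. {snd z..}). web D r (fst i) \<omega> (snd i))} \<le> (1/2)^n"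
    by (intro allI web_close) simp
  then obtain \<rho> where rho0: "\<forall>n. 0 < \<rho> n \<and> (\<forall>p q D r. inj_on r D \<longrightarrow> p \<in> D \<longrightarrow> q \<in> D \<longrightarrow> p \<noteq> q \<longrightarrow> \<bar>fst p - fst q\<bar> < \<rho> n \<longrightarrow> snd p \<le> snd q \<longrightarrow> snd q < snd p + \<rho> n \<longrightarrow>
    measure \<Omega> {\<omega>\<in>space \<Omega>. apart ((1/2)^n) p q (\<lambda>i\<in>(SIGMA z:{p, q}. {snd z..}). web D r (fst i) \<omega> (snd i))} \<le> (1/2)^n)"
    unfolding choice_iff by (rule exE)
  have rho: "0 < \<rho> n" for n using rho0 by (rule allE[of _ n]) (erule conjunct1)
  have close: "measure \<Omega> {\<omega>\<in>space \<Omega>. apart ((1/2)^n) p q (\<lambda>i\<in>(SIGMA z:{p, q}. {snd z..}). web D r (fst i) \<omega> (snd i))} \<le> (1/2)^n"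
    if "inj_on r D" "p \<in> D" "q \<in> D" "p \<noteq> q" "\<bar>fst p - fst q\<bar> < \<rho> n" "snd p \<le> snd q" "snd q < snd p + \<rho> n" for n p q D r
    by (rule rho0[THEN spec, THEN conjunct2, THEN spec, THEN spec, THEN spec, THEN spec, THEN mp, THEN mp, THEN mp, THEN mp, THEN mp, THEN mp, THEN mp, OF that])
  have "\<exists>p\<in>D. p \<noteq> q \<and> \<bar>fst p - fst q\<bar> < \<rho> n \<and> snd p \<le> snd q \<and> snd q < snd p + \<rho> n" for n and q :: "real \<times> real"
  proof -
    have "open ({fst q - \<rho> n <..< fst q + \<rho> n} \<times> {snd q - \<rho> n <..< snd q})" by (intro open_Times) auto
    moreover have "(fst q, snd q - \<rho> n / 2) \<in> {fst q - \<rho> n <..< fst q + \<rho> n} \<times> {snd q - \<rho> n <..< snd q}" using rho[of n] by simp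
    ultimately obtain p where "p \<in> D" "p \<in> {fst q - \<rho> n <..< fst q + \<rho> n} \<times> {snd q - \<rho> n <..< snd q}"
      using dense_inter_open[OF D] by blast
    then show ?thesis by (intro bexI[of _ p]) (auto simp: abs_less_iff mem_Times_iff)
  qed
  then have "\<forall>n q. \<exists>p. p \<in> D \<and> p \<noteq> q \<and> \<bar>fst p - fst q\<bar> < \<rho> n \<and> snd p \<le> snd q \<and> snd q < snd p + \<rho> n" by blast
  then obtain ap where ap0: "\<forall>n q. ap n q \<in> D \<and> ap n q \<noteq> q \<and> \<bar>fst (ap n q) - fst q\<bar> < \<rho> n \<and> snd (ap n q) \<le> snd q \<and> snd q < snd (ap n q) + \<rho> n"
    unfolding choice_iff by (elim exE)
  have ap: "ap n q \<in> D" "ap n q \<noteq> q" "\<bar>fst (ap n q) - fst q\<bar> < \<rho> n" "snd (ap n q) \<le> snd q" "snd q < snd (ap n q) + \<rho> n" for n q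
    using ap0[THEN spec, THEN spec, of n q] by blast+
  have "AE \<omega> in \<Omega>. (\<lambda>n. semipath_of (snd q) (web D'' r (ap n q) \<omega>)) \<longlonglongrightarrow> semipath_of (snd q) (web D'' r q \<omega>)" if q: "q \<in> D'" for q
  proof -
    define A where "A n = {\<omega>\<in>space \<Omega>. apart ((1/2)^n) (ap n q) q (\<lambda>i\<in>(SIGMA z:{ap n q, q}. {snd z..}). web D'' r (fst i) \<omega> (snd i))}" for n
    have inD: "ap n q \<in> D''" "q \<in> D''" for n by (rule subsetD[OF sub(1) ap(1)], rule subsetD[OF sub(2) q])
    have mA: "A n \<in> sets \<Omega>" for n
    proof -
      have 1: "(\<lambda>\<omega>. \<lambda>i\<in>(SIGMA z:{ap n q, q}. {snd z..}). web D'' r (fst i) \<omega> (snd i)) \<in> \<Omega> \<rightarrow>\<^sub>M PiM (SIGMA z:{ap n q, q}. {snd z..}) (\<lambda>_. borel)"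
      proof (rule measurable_law_map)
        fix i assume i: "i \<in> (SIGMA z:{ap n q, q}. {snd z..})"
        have "fst i \<in> D''" "snd (fst i) \<le> snd i" using i inD(1)[of n] inD(2) ap(4)[of n q] by auto
        then show "(\<lambda>\<omega>. web D'' r (fst i) \<omega> (snd i)) \<in> borel_measurable \<Omega>" by (rule measurable_web[OF r])
      qed
      have "Measurable.pred \<Omega> (\<lambda>\<omega>. apart ((1/2)^n) (ap n q) q (\<lambda>i\<in>(SIGMA z:{ap n q, q}. {snd z..}). web D'' r (fst i) \<omega> (snd i)))"
        by (rule measurable_compose[OF 1 measurable_apart]) (use ap(4)[of n q] in auto)
      then show ?thesis unfolding A_def pred_def .
    qed
    have PA: "measure \<Omega> (A n) \<le> (1/2)^n" for n
      unfolding A_def by (rule close[OF r inD ap(2-5)])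
    have "AE \<omega> in \<Omega>. eventually (\<lambda>n. \<omega> \<in> space \<Omega> - A n) sequentially"
    proof (rule borel_cantelli_AE1)
      show "summable (\<lambda>n. measure \<Omega> (A n))"
        by (rule summable_comparison_test'[where g = "\<lambda>n. (1/2)^n" and N = 0]) (use PA in \<open>auto intro: summable_geometric\<close>)
    qed (use mA in \<open>auto simp: less_top[symmetric]\<close>)
    then show ?thesis
    proof eventually_elim
      case (elim \<omega>)
      have c: "continuous_on {snd q..} (web D'' r (ap n q) \<omega>)" "continuous_on {snd q..} (web D'' r q \<omega>)" for n
        using continuous_on_subset[OF web_continuous[OF r inD(1)[of n]], of "{snd q..}"] web_continuous[OF r inD(2)] ap(4)[of n q]
        by auto
      have le: "dist (semipath_of (snd q) (web D'' r (ap n q) \<omega>)) (semipath_of (snd q) (web D'' r q \<omega>)) \<le> (1/2)^n"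
        if w: "\<omega> \<in> space \<Omega> - A n" for n
      proof -
        let ?f = "\<lambda>s. \<bar>web D'' r (ap n q) \<omega> s - web D'' r q \<omega> s\<bar>"
        have rat: "?f (snd q + h) \<le> (1/2)^n" if "h \<in> \<rat> \<inter> {0..}" for h
          using w that ap(4)[of n q] by (auto simp: A_def apart_def not_less)
        have le: "?f s \<le> (1/2)^n" if "snd q \<le> s" for s
        proof -
          let ?g = "\<lambda>h. web D'' r (ap n q) \<omega> (snd q + max 0 h) - web D'' r q \<omega> (snd q + max 0 h)"
          have "\<bar>?g (s - snd q)\<bar> \<le> (1/2)^n"
          proof (rule rational_modulus[where \<delta> = "s - snd q + 1" and f = ?g])
            show "continuous_on UNIV ?g"
              by (intro continuous_intros continuous_on_compose2[OF c(1)] continuous_on_compose2[OF c(2)]) auto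
            show "\<bar>?g h\<bar> \<le> (1/2)^n" if "h \<in> {0..s - snd q + 1} \<inter> \<rat>" for h
              using rat[of h] that by auto
          qed (use that in auto)
          then show "?f s \<le> (1/2)^n" using that by simp
        qed
        have "\<bar>tanh (web D'' r (ap n q) \<omega> s) - tanh (web D'' r q \<omega> s)\<bar> \<le> (1/2)^n" if "snd q \<le> s" for s
          using le[OF that] tanh_diff_le[of "web D'' r (ap n q) \<omega> s" "web D'' r q \<omega> s"] by linarith
        then show ?thesis
          by (intro dist_semipath_of_le[OF c]) auto
      qed
      have "\<forall>\<^sub>F n in sequentially. norm (dist (semipath_of (snd q) (web D'' r (ap n q) \<omega>)) (semipath_of (snd q) (web D'' r q \<omega>))) \<le> (1/2)^n"
        using elim by eventually_elim (simp only: real_norm_def abs_of_nonneg[OF zero_le_dist] le)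
      moreover have "(\<lambda>n. (1/2)^n :: real) \<longlonglongrightarrow> 0" by (rule LIMSEQ_power_zero) simp
      ultimately show ?case
        unfolding tendsto_dist_iff[of _ "semipath_of (snd q) (web D'' r q \<omega>)"] by (rule Lim_null_comparison)
    qed
  qed
  then have "AE \<omega> in \<Omega>. \<forall>q\<in>D'. (\<lambda>n. semipath_of (snd q) (web D'' r (ap n q) \<omega>)) \<longlonglongrightarrow> semipath_of (snd q) (web D'' r q \<omega>)"
    unfolding AE_ball_countable[OF D'] ..
  then show ?thesis using ap(1,4) by (intro exI[of _ ap] conjI allI ballI)
qed

end

section \<open>Functionals of semipaths\<close>

lemma continuous_Phi:
  assumes "continuous_on UNIV (\<lambda>r. etanh (F (ereal r)))"
  shows "continuous_on UNIV (\<lambda>t. Phi (F t) t)"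
  unfolding continuous_on_def
proof
  fix c :: ereal
  show "((\<lambda>t. Phi (F t) t) \<longlongrightarrow> Phi (F c) c) (at c within UNIV)"
  proof (cases "\<bar>c\<bar> = \<infinity>")
    case True then show ?thesis using Phi_tendsto_infinite[of c F UNIV] by (simp add: Phi_def)
  next
    case False
    let ?R = "{t :: ereal. \<bar>t\<bar> \<noteq> \<infinity>}"
    have "continuous_on UNIV (\<lambda>r. etanh (F (ereal r)) / (1 + \<bar>r\<bar>))"
      by (intro continuous_intros assms) (auto simp: add_nonneg_eq_0_iff)
    moreover have "continuous_on ?R real_of_ereal"
      by (intro continuous_at_imp_continuous_on ballI continuous_at_of_ereal) auto
    ultimately have "continuous_on ?R (\<lambda>t. etanh (F (ereal (real_of_ereal t))) / (1 + \<bar>real_of_ereal t\<bar>))"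
      by (rule continuous_on_compose2) simp
    then have "continuous_on ?R (\<lambda>t. Phi (F t) t)"
      by (rule continuous_on_eq) (auto simp: Phi_def ereal_real)
    moreover have "open ?R"
    proof -
      have "\<bar>t\<bar> \<noteq> \<infinity> \<longleftrightarrow> t \<in> {-\<infinity><..<\<infinity>}" for t :: ereal by (cases t) auto
      then have "?R = {-\<infinity><..<\<infinity>}" by (intro set_eqI) (simp only: mem_Collect_eq)
      then show ?thesis by simp
    qed
    ultimately have "isCont (\<lambda>t. Phi (F t) t) c" using False by (simp add: continuous_on_eq_continuous_at)
    then show ?thesis by (simp add: isCont_def)
  qed
qed

lemma continuous_extend_back:
  assumes f: "continuous_on {a..} (\<lambda>t. Phi (f t) t)"
  shows "continuous_on UNIV (\<lambda>t. Phi (extend_back (f, a) t) t)"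
proof (rule continuous_Phi)
  define G where "G r = Phi (f (ereal r)) (ereal r) * (1 + \<bar>r\<bar>)" for r
  have G: "etanh (f (ereal r)) = G r" for r by (simp add: G_def Phi_ereal add_nonneg_eq_0_iff)
  have cG: "continuous_on {r. a \<le> ereal r} G" unfolding G_def
    by (intro continuous_intros continuous_on_compose2[OF f, of _ ereal]) auto
  show "continuous_on UNIV (\<lambda>r. etanh (extend_back (f, a) (ereal r)))"
  proof (cases a)
    case (real b)
    have "continuous_on UNIV (\<lambda>r. G (max b r))"
      by (rule continuous_on_compose2[OF cG]) (auto intro!: continuous_intros simp: real)
    then show ?thesis by (simp add: extend_back_def real G[symmetric])
  next
    case PInf
    then show ?thesis by (simp add: extend_back_def max_def)
  next
    case MInf
    then have "extend_back (f, a) (ereal r) = f (ereal r)" for r by (simp add: extend_back_def max_def)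
    then show ?thesis using cG MInf by (simp add: G)
  qed
qed

lemma extend_back_restrict_dist:
  "path_dist (extend_back (extend_back p, ereal t)) (extend_back (extend_back q, ereal t))
     \<le> (1 + \<bar>t\<bar>) * path_dist (extend_back p) (extend_back q)"
  unfolding path_dist_def[of "extend_back (extend_back p, ereal t)"]
proof (intro cSUP_least)
  fix s :: ereal
  let ?F = "extend_back p" and ?G = "extend_back q" and ?d = "path_dist (extend_back p) (extend_back q)"
  have d: "0 \<le> ?d" by (rule path_dist_nonneg)
  have t: "\<bar>etanh (?F (ereal u)) - etanh (?G (ereal u))\<bar> \<le> (1 + \<bar>u\<bar>) * ?d" for u
  proof -
    have "\<bar>etanh (?F (ereal u)) - etanh (?G (ereal u))\<bar> / (1 + \<bar>u\<bar>) \<le> ?d"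
      using path_dist_upper[of ?F "ereal u" ?G] by (simp add: Phi_ereal abs_divide flip: diff_divide_distrib)
    then show ?thesis by (simp add: pos_divide_le_eq add_pos_nonneg mult.commute)
  qed
  show "\<bar>Phi (extend_back (?F, ereal t) s) s - Phi (extend_back (?G, ereal t) s) s\<bar> \<le> (1 + \<bar>t\<bar>) * ?d"
  proof (cases "\<bar>s\<bar> = \<infinity>")
    case True
    then show ?thesis using d by (auto simp: Phi_def)
  next
    case False
    then obtain u where s: "s = ereal u" by auto
    have "\<bar>etanh (?F (ereal (max t u))) - etanh (?G (ereal (max t u)))\<bar> \<le> (1 + \<bar>max t u\<bar>) * ?d" by (rule t)
    also have "\<dots> \<le> ((1 + \<bar>t\<bar>) * (1 + \<bar>u\<bar>)) * ?d"
    proof (intro mult_right_mono d)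
      have "0 \<le> \<bar>t\<bar> * \<bar>u\<bar>" by simp
      then show "1 + \<bar>max t u\<bar> \<le> (1 + \<bar>t\<bar>) * (1 + \<bar>u\<bar>)" by (simp add: algebra_simps max_def)
    qed
    finally have "\<bar>etanh (?F (ereal (max t u))) - etanh (?G (ereal (max t u)))\<bar> / (1 + \<bar>u\<bar>) \<le> (1 + \<bar>t\<bar>) * ?d"
      by (simp add: pos_divide_le_eq add_pos_nonneg mult_ac)
    moreover have "extend_back (H, ereal t) s = H (ereal (max t u))" for H by (simp add: s extend_back_def)
    ultimately show ?thesis by (simp add: s Phi_ereal abs_divide flip: diff_divide_distrib)
  qed
qed simp

text \<open>For starting times after \<open>t\<close> the path is extended back by a constant, which makes the map total and Lipschitz.\<close>

lift_definition semipath_restrict :: "real \<Rightarrow> semipath \<Rightarrow> semipath"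
  is "\<lambda>t p. (extend_back p, ereal t)"
proof -
  fix t and p q :: "(ereal \<Rightarrow> ereal) \<times> ereal" assume pq: "semipath_rel p q"
  have "continuous_on {ereal t..} (\<lambda>s. Phi (extend_back p s) s)" "continuous_on {ereal t..} (\<lambda>s. Phi (extend_back q s) s)"
    using pq continuous_on_subset[OF continuous_extend_back[of "snd p" "fst p"]] continuous_on_subset[OF continuous_extend_back[of "snd q" "fst q"]]
    by (auto simp: semipath_rel_def)
  moreover have "path_dist (extend_back p) (extend_back q) = 0"
    using pq path_dist_nonneg[of "extend_back p" "extend_back q"] by (auto simp: semipath_rel_def semipath_dist_def max_def split: if_splits)
  then have "path_dist (extend_back (extend_back p, ereal t)) (extend_back (extend_back q, ereal t)) = 0"
    using extend_back_restrict_dist[of p t q] path_dist_nonneg[of "extend_back (extend_back p, ereal t)" "extend_back (extend_back q, ereal t)"] by simp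
  ultimately show "semipath_rel (extend_back p, ereal t) (extend_back q, ereal t)"
    by (simp add: semipath_rel_def semipath_dist_def)
qed

lemma dist_semipath_restrict: "dist (semipath_restrict t u) (semipath_restrict t v) \<le> (1 + \<bar>t\<bar>) * dist u v"
proof (transfer fixing: t)
  fix p q :: "(ereal \<Rightarrow> ereal) \<times> ereal"
  have "semipath_dist (extend_back p, ereal t) (extend_back q, ereal t) = path_dist (extend_back (extend_back p, ereal t)) (extend_back (extend_back q, ereal t))"
    using path_dist_nonneg[of "extend_back (extend_back p, ereal t)" "extend_back (extend_back q, ereal t)"] by (simp add: semipath_dist_def)
  also have "\<dots> \<le> (1 + \<bar>t\<bar>) * path_dist (extend_back p) (extend_back q)" by (rule extend_back_restrict_dist)
  also have "\<dots> \<le> (1 + \<bar>t\<bar>) * semipath_dist p q" by (intro mult_left_mono) (auto simp: semipath_dist_def)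
  finally show "semipath_dist (extend_back p, ereal t) (extend_back q, ereal t) \<le> (1 + \<bar>t\<bar>) * semipath_dist p q" .
qed

lemma continuous_semipath_restrict: "continuous_on UNIV (semipath_restrict t)"
proof (rule lipschitz_on_continuous_on)
  show "(1 + \<bar>t\<bar>)-lipschitz_on UNIV (semipath_restrict t)"
    by (rule lipschitz_onI) (auto intro: dist_semipath_restrict)
qed

lemma extend_back_extend_back:
  "a \<le> t \<Longrightarrow> extend_back (extend_back (f, ereal a), ereal t) s = extend_back (f, ereal t) s"
  by (simp add: extend_back_def max.absorb2 flip: max.assoc)

lemma semipath_restrict_from: "a \<le> t \<Longrightarrow> semipath_restrict t (semipath_from a f) = semipath_from t f"
proof -
  assume at: "a \<le> t"
  obtain r where f: "f = abs_full_path r" "full_path_rel r r" by (rule full_path_repr)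
  have rel: "semipath_rel (r, ereal b) (r, ereal b)" for b
    using f(2) by (auto simp: full_path_rel_refl semipath_rel_def semipath_dist_refl intro: continuous_on_subset)
  have "semipath_rel (extend_back (r, ereal a), ereal t) (extend_back (r, ereal a), ereal t)"
    using continuous_on_subset[OF continuous_extend_back[of "ereal a" r], of "{ereal t..}"] rel[of a]
    unfolding semipath_rel_def fst_conv snd_conv by (intro conjI semipath_dist_refl) simp_all
  moreover have "semipath_dist (extend_back (r, ereal a), ereal t) (r, ereal t) = 0"
    using at by (simp add: semipath_dist_def path_dist_eq_0[THEN iffD2] extend_back_extend_back)
  ultimately have "semipath_rel (extend_back (r, ereal a), ereal t) (r, ereal t)"
    using rel[of t] by (simp add: semipath_rel_def)
  then have "abs_semipath (extend_back (r, ereal a), ereal t) = abs_semipath (r, ereal t)"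
    by (rule Quotient_rel_abs[OF Quotient_semipath])
  then show ?thesis
    unfolding f(1) semipath_from.abs_eq[OF f(2)] semipath_restrict.abs_eq[OF rel] .
qed

lemma semipath_restrict_of:
  assumes "a \<le> t" and w: "continuous_on {a..} w"
  shows "semipath_restrict t (semipath_of a w) = semipath_of t w"
proof -
  have w': "continuous_on {t..} w" using w assms(1) by (auto intro: continuous_on_subset)
  note rel = semipath_rel_time_extend[OF w] semipath_rel_time_extend[OF w']
  have "semipath_rel (extend_back (time_extend w, ereal a), ereal t) (extend_back (time_extend w, ereal a), ereal t)"
    using continuous_on_subset[OF continuous_extend_back[of "ereal a" "time_extend w"], of "{ereal t..}"] rel(1)
    unfolding semipath_rel_def fst_conv snd_conv by (intro conjI semipath_dist_refl) simp_all
  moreover have "semipath_dist (extend_back (time_extend w, ereal a), ereal t) (time_extend w, ereal t) = 0"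
    using assms(1) by (simp add: semipath_dist_def path_dist_eq_0[THEN iffD2] extend_back_extend_back)
  ultimately have "semipath_rel (extend_back (time_extend w, ereal a), ereal t) (time_extend w, ereal t)"
    using rel(2) by (simp add: semipath_rel_def)
  then have "abs_semipath (extend_back (time_extend w, ereal a), ereal t) = abs_semipath (time_extend w, ereal t)"
    by (rule Quotient_rel_abs[OF Quotient_semipath])
  then show ?thesis
    unfolding semipath_of_def semipath_restrict.abs_eq[OF rel(1)] .
qed

lemma tent_sum:
  fixes x :: real
  assumes "0 \<le> x"
  shows "(\<Sum>k\<le>N. max 0 (1 - \<bar>x - real k\<bar>)) = max 0 (min 1 (real N + 1 - x))"
proof (induction N)
  case 0
  then show ?case using assms by (auto simp: max_def min_def)
next
  case (Suc N)
  have "max 0 (min 1 (real N + 1 - x)) + max 0 (1 - \<bar>x - real (Suc N)\<bar>) = max 0 (min 1 (real (Suc N) + 1 - x))"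
    by (smt (verit) of_nat_Suc)
  then show ?case using Suc by simp
qed

definition node :: "real \<Rightarrow> nat \<Rightarrow> nat \<Rightarrow> real" where
  "node a n k = a + real k / real (Suc n)"

definition interpolate :: "real \<Rightarrow> nat \<Rightarrow> (nat \<Rightarrow> real) \<Rightarrow> real \<Rightarrow> real" where
  "interpolate a n v s = (\<Sum>k\<le>(Suc n)\<^sup>2. v k * max 0 (1 - \<bar>real (Suc n) * (s - a) - real k\<bar>))"

lemma continuous_interpolate: "continuous_on S (interpolate a n v)"
  unfolding interpolate_def[abs_def] by (intro continuous_intros)

lemma interpolate_close:
  assumes "a \<le> s" "s \<le> a + real n" "\<And>k. \<bar>node a n k - s\<bar> < 1 / real (Suc n) \<Longrightarrow> \<bar>v k - y\<bar> \<le> e" "0 \<le> e"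
  shows "\<bar>interpolate a n v s - y\<bar> \<le> e"
proof -
  let ?x = "real (Suc n) * (s - a)" and ?t = "\<lambda>k. max 0 (1 - \<bar>real (Suc n) * (s - a) - real k\<bar>)"
  have "?x \<le> real (Suc n) * real (Suc n)" using assms(2) by (intro mult_left_mono) auto
  then have x: "0 \<le> ?x" "?x \<le> real ((Suc n)\<^sup>2)"
    using assms(1) by (simp_all only: power2_eq_square of_nat_mult zero_le_mult_iff) auto
  have one: "(\<Sum>k\<le>(Suc n)\<^sup>2. ?t k) = 1" unfolding tent_sum[OF x(1)] using x(2) by (simp add: max_def min_def)
  have "\<bar>interpolate a n v s - y\<bar> = \<bar>\<Sum>k\<le>(Suc n)\<^sup>2. (v k - y) * ?t k\<bar>"
    using one by (simp add: interpolate_def left_diff_distrib sum_subtractf flip: sum_distrib_left)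
  also have "\<dots> \<le> (\<Sum>k\<le>(Suc n)\<^sup>2. \<bar>(v k - y) * ?t k\<bar>)" by (rule sum_abs)
  also have "\<dots> \<le> (\<Sum>k\<le>(Suc n)\<^sup>2. e * ?t k)"
  proof (intro sum_mono)
    fix k
    show "\<bar>(v k - y) * ?t k\<bar> \<le> e * ?t k"
    proof (cases "\<bar>?x - real k\<bar> < 1")
      case True
      have "node a n k - s = (real k - ?x) / real (Suc n)" by (simp add: node_def field_simps)
      then have "\<bar>node a n k - s\<bar> < 1 / real (Suc n)" using True by (simp add: abs_divide divide_strict_right_mono abs_minus_commute)
      then have "\<bar>v k - y\<bar> * ?t k \<le> e * ?t k" by (intro mult_right_mono assms(3)) auto
      then show ?thesis by (simp add: abs_mult)
    next
      case False
      then have "?t k = 0" by (simp add: max_def)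
      then show ?thesis by simp
    qed
  qed
  also have "\<dots> = e" unfolding sum_distrib_left[symmetric] one by simp
  finally show ?thesis .
qed

lemma interpolate_tendsto:
  assumes w: "continuous_on {a..} w"
  shows "(\<lambda>n. semipath_of a (interpolate a n (\<lambda>k. w (node a n k)))) \<longlonglongrightarrow> semipath_of a w"
proof (rule metric_LIMSEQ_I)
  fix r :: real assume "0 < r"
  define e where "e = r / 2"
  have e: "0 < e" "e < r" using \<open>0 < r\<close> by (auto simp: e_def)
  define L where "L = \<bar>a\<bar> + 2 / e"
  have L: "0 \<le> L" using e by (simp add: L_def)
  have "uniformly_continuous_on {a..a + L + 1} w"
    by (rule compact_uniformly_continuous) (auto intro: continuous_on_subset[OF w])
  then obtain d where d: "0 < d" "\<And>x y. x \<in> {a..a + L + 1} \<Longrightarrow> y \<in> {a..a + L + 1} \<Longrightarrow> dist x y < d \<Longrightarrow> dist (w x) (w y) < e"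
    unfolding uniformly_continuous_on_def using e(1) by metis
  obtain n0 :: nat where n0: "max L (1 / d) \<le> real n0" using real_arch_simple by blast
  have "dist (semipath_of a (interpolate a n (\<lambda>k. w (node a n k)))) (semipath_of a w) < r" if "n0 \<le> n" for n
  proof -
    have n: "L \<le> real n" "1 / d \<le> real n" using n0 that by auto
    have "1 / d < real (Suc n)" using n by simp
    then have nd: "1 / real (Suc n) < d" using d(1) by (simp add: field_simps)
    have le: "\<bar>interpolate a n (\<lambda>k. w (node a n k)) s - w s\<bar> \<le> e" if s: "a \<le> s" "s \<le> a + L" for s
    proof (rule interpolate_close)
      fix k assume k: "\<bar>node a n k - s\<bar> < 1 / real (Suc n)"
      have "1 / real (Suc n) \<le> 1" by simp
      then have "node a n k \<le> a + L + 1" using k s by linarith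
      moreover have "a \<le> node a n k" by (simp add: node_def)
      ultimately have "node a n k \<in> {a..a + L + 1}" by simp
      then show "\<bar>w (node a n k) - w s\<bar> \<le> e"
        using d(2)[of "node a n k" s] s k nd by (simp add: dist_real_def)
    qed (use s n e in auto)
    have "dist (semipath_of a (interpolate a n (\<lambda>k. w (node a n k)))) (semipath_of a w) \<le> e"
    proof (rule dist_semipath_of_le[OF continuous_interpolate w])
      show "\<bar>tanh (interpolate a n (\<lambda>k. w (node a n k)) a) - tanh (w a)\<bar> \<le> e"
        using tanh_diff_le le[of a] L order_trans by fastforce
      show "\<bar>tanh (interpolate a n (\<lambda>k. w (node a n k)) s) - tanh (w s)\<bar> \<le> e \<or> 2 \<le> e * (1 + \<bar>s\<bar>)" if "a \<le> s" for s
      proof (cases "s \<le> a + L")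
        case True
        then show ?thesis using tanh_diff_le[of "interpolate a n (\<lambda>k. w (node a n k)) s" "w s"] le[of s] that by linarith
      next
        case False
        then have "2 / e \<le> \<bar>s\<bar>" by (simp add: L_def)
        then have "2 \<le> e * \<bar>s\<bar>" using e(1) by (simp add: pos_divide_le_eq mult.commute)
        then show ?thesis using e(1) by (simp add: distrib_left)
      qed
    qed
    then show ?thesis using e by simp
  qed
  then show "\<exists>no. \<forall>n\<ge>no. dist (semipath_of a (interpolate a n (\<lambda>k. w (node a n k)))) (semipath_of a w) < r" by blast
qed

lemma dist_interpolate_le:
  "dist (semipath_of a (interpolate a n v)) (semipath_of a (interpolate a n v')) \<le> (\<Sum>k\<le>(Suc n)\<^sup>2. \<bar>v k - v' k\<bar>)"
proof -
  have "\<bar>tanh (interpolate a n v s) - tanh (interpolate a n v' s)\<bar> \<le> (\<Sum>k\<le>(Suc n)\<^sup>2. \<bar>v k - v' k\<bar>)" for s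
  proof -
    have "\<bar>tanh (interpolate a n v s) - tanh (interpolate a n v' s)\<bar> \<le> \<bar>interpolate a n v s - interpolate a n v' s\<bar>"
      by (rule tanh_diff_le)
    also have "\<dots> = \<bar>\<Sum>k\<le>(Suc n)\<^sup>2. (v k - v' k) * max 0 (1 - \<bar>real (Suc n) * (s - a) - real k\<bar>)\<bar>"
      by (simp add: interpolate_def left_diff_distrib sum_subtractf)
    also have "\<dots> \<le> (\<Sum>k\<le>(Suc n)\<^sup>2. \<bar>(v k - v' k) * max 0 (1 - \<bar>real (Suc n) * (s - a) - real k\<bar>)\<bar>)" by (rule sum_abs)
    also have "\<dots> \<le> (\<Sum>k\<le>(Suc n)\<^sup>2. \<bar>v k - v' k\<bar>)"
      by (intro sum_mono) (simp add: abs_mult mult_left_le)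
    finally show ?thesis .
  qed
  then show ?thesis by (intro dist_semipath_of_le continuous_interpolate disjI1)
qed

theorem path_functional:
  fixes a :: "'i \<Rightarrow> real"
  assumes J: "countable J" and h: "continuous_map (product_topology (\<lambda>_. euclidean :: semipath topology) J) euclideanreal h"
  shows "\<exists>H\<in>borel_measurable (PiM (SIGMA i:J. {a i..}) (\<lambda>_. borel)). \<forall>z. (\<forall>i\<in>J. continuous_on {a i..} (z i)) \<longrightarrow>
    H (\<lambda>x\<in>(SIGMA i:J. {a i..}). z (fst x) (snd x)) = h (\<lambda>i\<in>J. semipath_of (a i) (z i))"
proof -
  let ?K = "SIGMA i:J. {a i..}" and ?T = "product_topology (\<lambda>_. euclidean :: semipath topology) J"
  define c where "c i k = prod_encode (to_nat_on J i, k)" for i and k :: nat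
  define \<Psi> where "\<Psi> n v = (\<lambda>i\<in>J. semipath_of (a i) (interpolate (a i) n (\<lambda>k. v (c i k))))" for n and v :: "nat \<Rightarrow> real"
  have cont: "continuous_on UNIV (\<lambda>v :: nat \<Rightarrow> real. semipath_of b (interpolate b n (\<lambda>k. v (l k))))" for b n l
    unfolding continuous_on_def
  proof
    fix v0 :: "nat \<Rightarrow> real"
    have "continuous_on UNIV (\<lambda>v :: nat \<Rightarrow> real. \<Sum>k\<le>(Suc n)\<^sup>2. \<bar>v (l k) - v0 (l k)\<bar>)"
      by (intro continuous_intros continuous_on_product_coordinates)
    then have "((\<lambda>v :: nat \<Rightarrow> real. \<Sum>k\<le>(Suc n)\<^sup>2. \<bar>v (l k) - v0 (l k)\<bar>) \<longlongrightarrow> (\<Sum>k\<le>(Suc n)\<^sup>2. \<bar>v0 (l k) - v0 (l k)\<bar>)) (at v0 within UNIV)"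
      unfolding continuous_on_def by blast
    then have lim: "((\<lambda>v :: nat \<Rightarrow> real. \<Sum>k\<le>(Suc n)\<^sup>2. \<bar>v (l k) - v0 (l k)\<bar>) \<longlongrightarrow> 0) (at v0 within UNIV)" by simp
    show "((\<lambda>v. semipath_of b (interpolate b n (\<lambda>k. v (l k)))) \<longlongrightarrow> semipath_of b (interpolate b n (\<lambda>k. v0 (l k)))) (at v0 within UNIV)"
      by (rule tendsto_dist_iff[THEN iffD2], rule Lim_null_comparison[OF _ lim], rule always_eventually) (simp add: dist_interpolate_le del: sum.atMost_Suc)
  qed
  have c\<Psi>: "continuous_map euclidean ?T (\<Psi> n)" for n
    unfolding continuous_map_componentwise
  proof (intro conjI ballI)
    show "\<Psi> n ` topspace euclidean \<subseteq> extensional J" by (auto simp: \<Psi>_def)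
    fix i assume i: "i \<in> J"
    show "continuous_map euclidean euclidean (\<lambda>v. \<Psi> n v i)" using cont[of "a i" n "c i"] i by (simp add: \<Psi>_def)
  qed
  have mG: "(\<lambda>v. h (\<Psi> n v)) \<in> borel_measurable (PiM UNIV (\<lambda>_. borel))" for n
  proof -
    have "continuous_on UNIV (\<lambda>v. h (\<Psi> n v))"
      using continuous_map_compose[OF c\<Psi>[of n] h] by (simp add: o_def)
    then have "(\<lambda>v. h (\<Psi> n v)) \<in> borel_measurable borel" by (rule borel_measurable_continuous_onI)
    then show ?thesis using measurable_cong_sets[OF sets_PiM_equal_borel refl] by blast
  qed
  define \<eta> where "\<eta> n x j = (let i = from_nat_into J (fst (prod_decode j)) in
      if i \<in> J then x (i, node (a i) n (snd (prod_decode j))) else (0::real))" for n x and j :: nat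
  have node_ge: "a i \<le> node (a i) n k" for i n k by (simp add: node_def)
  have m\<eta>: "\<eta> n \<in> PiM ?K (\<lambda>_. borel) \<rightarrow>\<^sub>M PiM UNIV (\<lambda>_. borel)" for n
  proof (rule measurable_PiM_single')
    fix j :: nat
    let ?i = "from_nat_into J (fst (prod_decode j))" and ?k = "snd (prod_decode j)"
    show "(\<lambda>x. \<eta> n x j) \<in> borel_measurable (PiM ?K (\<lambda>_. borel))"
    proof (cases "?i \<in> J")
      case True
      then have "(?i, node (a ?i) n ?k) \<in> ?K" using node_ge by simp
      from measurable_component_singleton[OF this, of "\<lambda>_. borel :: real measure"] show ?thesis using True by (simp add: \<eta>_def Let_def)
    qed (simp add: \<eta>_def Let_def)
  qed simp
  define H where "H x = lim (\<lambda>n. h (\<Psi> n (\<eta> n x)))" for x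
  have "H \<in> borel_measurable (PiM ?K (\<lambda>_. borel))"
    unfolding H_def by (intro borel_measurable_lim_metric measurable_compose[OF m\<eta> mG])
  moreover have "H (\<lambda>x\<in>?K. z (fst x) (snd x)) = h (\<lambda>i\<in>J. semipath_of (a i) (z i))"
    if z: "\<forall>i\<in>J. continuous_on {a i..} (z i)" for z
  proof -
    let ?x = "\<lambda>x\<in>?K. z (fst x) (snd x)"
    have "\<Psi> n (\<eta> n ?x) = (\<lambda>i\<in>J. semipath_of (a i) (interpolate (a i) n (\<lambda>k. z i (node (a i) n k))))" for n
    proof -
      have "\<eta> n ?x (c i k) = z i (node (a i) n k)" if i: "i \<in> J" for i k
        using i node_ge J by (simp add: \<eta>_def c_def Let_def)
      then show ?thesis unfolding \<Psi>_def by (intro restrict_ext) simp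
    qed
    moreover have "limitin ?T (\<lambda>n. \<lambda>i\<in>J. semipath_of (a i) (interpolate (a i) n (\<lambda>k. z i (node (a i) n k)))) (\<lambda>i\<in>J. semipath_of (a i) (z i)) sequentially"
      unfolding limitin_componentwise using z interpolate_tendsto by simp
    ultimately have "limitin euclideanreal (h \<circ> (\<lambda>n. \<Psi> n (\<eta> n ?x))) (h (\<lambda>i\<in>J. semipath_of (a i) (z i))) sequentially"
      by (intro continuous_map_limit[OF h]) simp
    then show ?thesis unfolding H_def by (intro limI) (simp add: o_def)
  qed
  ultimately show ?thesis by blast
qed

text \<open>Regularization by sup-convolution: if \<open>C\<close> is the graph of a relation along which \<open>g\<close> is continuous at \<open>u0\<close>, then
  \<open>h n u = sup {g k - n d(u', u) | C k u'}\<close> is \<open>n\<close>-Lipschitz and tends to \<open>g\<close> there. The element \<open>0\<close> is inserted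
  because \<open>Sup\<close> is not specified on the empty set.\<close>

lemma (in Metric_space) lipschitz_majorant:
  fixes g :: "'k \<Rightarrow> real"
  assumes g: "\<And>k. 0 \<le> g k" "\<And>k. g k \<le> 1"
  shows "\<exists>h :: nat \<Rightarrow> 'a \<Rightarrow> real. (\<forall>n. continuous_map mtopology euclideanreal (h n)) \<and> (\<forall>n u. 0 \<le> h n u \<and> h n u \<le> 1) \<and>
    (\<forall>n k u. C k u \<longrightarrow> u \<in> M \<longrightarrow> g k \<le> h n u) \<and>
    (\<forall>k0 u0. u0 \<in> M \<longrightarrow> C k0 u0 \<longrightarrow>
      (\<forall>k u. (\<forall>j. C (k j) (u j) \<and> u j \<in> M) \<longrightarrow> limitin mtopology u u0 sequentially \<longrightarrow> (\<lambda>j. g (k j)) \<longlonglongrightarrow> g k0) \<longrightarrow>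
      (\<lambda>n. h n u0) \<longlonglongrightarrow> g k0)"
proof -
  define S where "S n u = insert 0 {g k - real n * d u' u | k u'. C k u' \<and> u' \<in> M}" for n u
  define h where "h n u = Sup (S n u)" for n u
  have le1: "x \<le> 1" if "x \<in> S n u" for x n u
  proof -
    have "g k - real n * d u' u \<le> 1" for k u'
    proof -
      have "0 \<le> real n * d u' u" by (intro mult_nonneg_nonneg) auto
      then show ?thesis using g(2)[of k] by linarith
    qed
    then show ?thesis using that unfolding S_def by auto
  qed
  have bdd: "bdd_above (S n u)" for n u using le1 by (rule bdd_aboveI)
  have ne: "S n u \<noteq> {}" for n u by (simp add: S_def)
  have h01: "0 \<le> h n u" "h n u \<le> 1" for n u
    unfolding h_def by (rule cSup_upper[OF _ bdd], simp add: S_def) (rule cSup_least[OF ne le1])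
  have upper: "g k - real n * d u' u \<le> h n u" if "C k u'" "u' \<in> M" for n k u' u
    unfolding h_def by (rule cSup_upper[OF _ bdd]) (use that in \<open>auto simp: S_def\<close>)
  have maj: "g k \<le> h n u" if "C k u" "u \<in> M" for n k u using upper[OF that, of n u] that by simp
  have lip: "h n u \<le> h n v + real n * d u v" if uv: "u \<in> M" "v \<in> M" for n u v
    unfolding h_def[of n u]
  proof (rule cSup_least[OF ne])
    fix x assume "x \<in> S n u"
    then consider "x = 0" | k u' where "x = g k - real n * d u' u" "C k u'" "u' \<in> M" unfolding S_def by blast
    then show "x \<le> h n v + real n * d u v"
    proof cases
      case 1
      then show ?thesis using h01(1)[of n v] by simp
    next
      case 2
      have "real n * d u' v \<le> real n * (d u' u + d u v)" by (intro mult_left_mono triangle 2 uv) simp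
      then show ?thesis using upper[OF 2(2,3), of n v] 2(1) by (simp add: distrib_left)
    qed
  qed
  have "continuous_map mtopology euclideanreal (h n)" for n
    unfolding continuous_map_from_metric
  proof (intro conjI ballI allI impI)
    fix a U assume a: "a \<in> M" and "openin euclideanreal U \<and> h n a \<in> U"
    then obtain e where e: "0 < e" "\<And>y. dist y (h n a) < e \<Longrightarrow> y \<in> U" unfolding open_openin[symmetric] open_dist by blast
    have "h n x \<in> U" if x: "x \<in> M" "d a x < e / (real n + 1)" for x
    proof (rule e(2))
      have "\<bar>h n x - h n a\<bar> \<le> real n * d a x" using lip[OF a x(1), of n] lip[OF x(1) a, of n] by (simp add: commute abs_le_iff)
      also have "\<dots> \<le> (real n + 1) * d a x" by (intro mult_right_mono) auto
      also have "\<dots> < e" using x(2) by (simp add: pos_less_divide_eq mult.commute)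
      finally show "dist (h n x) (h n a) < e" by (simp add: dist_real_def)
    qed
    then show "\<exists>r>0. \<forall>x. x \<in> M \<and> d a x < r \<longrightarrow> h n x \<in> U" using e(1) by (intro exI[of _ "e / (real n + 1)"]) auto
  qed simp
  moreover have "(\<lambda>n. h n u0) \<longlonglongrightarrow> g k0" if u0: "u0 \<in> M" "C k0 u0"
    and lim: "\<forall>k u. (\<forall>j. C (k j) (u j) \<and> u j \<in> M) \<longrightarrow> limitin mtopology u u0 sequentially \<longrightarrow> (\<lambda>j. g (k j)) \<longlonglongrightarrow> g k0" for k0 u0
  proof (rule ccontr)
    assume "\<not> (\<lambda>n. h n u0) \<longlonglongrightarrow> g k0"
    then obtain e where e: "0 < e" "\<And>N. \<exists>n\<ge>N. e \<le> \<bar>h n u0 - g k0\<bar>"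
      unfolding lim_sequentially dist_real_def by (meson not_less)
    have "\<exists>k u. C k u \<and> u \<in> M \<and> d u u0 < 1 / real (Suc j) \<and> g k0 + e / 2 < g k" for j
    proof -
      obtain n where n: "Suc j \<le> n" "e \<le> \<bar>h n u0 - g k0\<bar>" using e(2) by blast
      then have "g k0 + e / 2 < Sup (S n u0)" using maj[OF u0(2,1), of n] e(1) unfolding h_def[symmetric] by linarith
      then obtain x where x: "x \<in> S n u0" "g k0 + e / 2 < x" using less_cSup_iff[OF ne bdd] by blast
      then have "x \<noteq> 0" using g(1)[of k0] e(1) by auto
      then obtain k u where ku: "x = g k - real n * d u u0" "C k u" "u \<in> M" using x(1) unfolding S_def by blast
      have "0 < x" using x(2) g(1)[of k0] e(1) by linarith
      then have "real n * d u u0 < 1" using ku(1) g(2)[of k] by linarith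
      moreover have "real (Suc j) * d u u0 \<le> real n * d u u0" using n(1) by (intro mult_right_mono) auto
      ultimately have "d u u0 < 1 / real (Suc j)" by (simp add: pos_less_divide_eq mult.commute del: of_nat_Suc)
      moreover have "0 \<le> real n * d u u0" by (intro mult_nonneg_nonneg) auto
      then have "g k0 + e / 2 < g k" using x(2) ku(1) by linarith
      ultimately show ?thesis using ku(2,3) by blast
    qed
    then obtain k u where ku: "\<And>j. C (k j) (u j)" "\<And>j. u j \<in> M" "\<And>j. d (u j) u0 < 1 / real (Suc j)" "\<And>j. g k0 + e / 2 < g (k j)"
      by metis
    have "limitin mtopology u u0 sequentially"
      unfolding limitin_metric_dist_null
    proof (intro conjI u0(1) always_eventually allI ku(2))
      show "(\<lambda>j. d (u j) u0) \<longlonglongrightarrow> 0"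
        by (rule Lim_null_comparison[OF _ LIMSEQ_Suc[OF lim_1_over_n]]) (use ku(3) in \<open>auto intro!: always_eventually less_imp_le\<close>)
    qed
    then have "(\<lambda>j. g (k j)) \<longlonglongrightarrow> g k0" using lim ku(1,2) by blast
    then have "g k0 + e / 2 \<le> g k0" by (rule LIMSEQ_le_const) (use ku(4) in \<open>auto intro: less_imp_le\<close>)
    then show False using e(1) by simp
  qed
  ultimately show ?thesis using h01 maj by (intro exI[of _ h]) blast
qed

section \<open>Limits of compact sets of paths\<close>

lemma continuous_map_measurable:
  assumes "continuous_map T euclideanreal f"
  shows "f \<in> borel_measurable (borel_of T)"
proof (rule borel_measurableI)
  have sub: "{U. openin T U} \<subseteq> Pow (topspace T)" using openin_subset by blast
  fix S :: "real set" assume "open S"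
  then have "openin T {x\<in>topspace T. f x \<in> S}" using assms by (simp add: continuous_map_def)
  moreover have "f -` S \<inter> space (borel_of T) = {x\<in>topspace T. f x \<in> S}"
    unfolding borel_of_def space_measure_of[OF sub] by auto
  ultimately show "f -` S \<inter> space (borel_of T) \<in> sets (borel_of T)"
    unfolding borel_of_def sets_measure_of[OF sub] by (auto intro: sigma_sets.Basic)
qed

abbreviation semipath_product :: "'i set \<Rightarrow> ('i \<Rightarrow> semipath) topology" where
  "semipath_product J \<equiv> product_topology (\<lambda>_. euclidean) J"

context brownian_source
begin

lemma semipath_transfer:
  fixes N :: "'n measure"
  assumes N: "prob_space N" and W: "coalescing_brownian_motions N D W" and D: "countable D"
    and r: "inj_on r D''" "D \<subseteq> D''"
    and J: "countable J" and \<sigma>: "\<And>p. p \<in> J \<Longrightarrow> \<sigma> p \<in> D" "\<And>p. p \<in> J \<Longrightarrow> snd (\<sigma> p) \<le> snd p"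
    and h: "continuous_map (semipath_product J) euclideanreal h"
  shows "\<exists>F\<in>borel_measurable N. (AE \<omega> in N. F \<omega> = h (\<lambda>p\<in>J. semipath_of (snd p) (W (\<sigma> p) \<omega>))) \<and>
      (\<integral>\<omega>. F \<omega> \<partial>N) = (\<integral>\<omega>. h (\<lambda>p\<in>J. semipath_of (snd p) (web D'' r (\<sigma> p) \<omega>)) \<partial>\<Omega>)"
    and "(\<lambda>\<omega>. h (\<lambda>p\<in>J. semipath_of (snd p) (web D'' r (\<sigma> p) \<omega>))) \<in> borel_measurable \<Omega>"
proof -
  let ?K = "SIGMA p:J. {snd p..}" and ?L = "SIGMA p:D. {snd p..}"
  obtain H where H: "H \<in> borel_measurable (PiM ?K (\<lambda>_. borel))"
    and Heq: "\<forall>z. (\<forall>p\<in>J. continuous_on {snd p..} (z p)) \<longrightarrow> H (\<lambda>x\<in>?K. z (fst x) (snd x)) = h (\<lambda>p\<in>J. semipath_of (snd p) (z p))"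
    using path_functional[OF J h, of snd] by blast
  define F where "F x = H (\<lambda>i\<in>?K. x (\<sigma> (fst i), snd i))" for x
  have KL: "(\<sigma> (fst i), snd i) \<in> ?L" if "i \<in> ?K" for i
    using \<sigma>[of "fst i"] that by (intro SigmaI) (auto intro: order_trans)
  have mF: "F \<in> borel_measurable (PiM ?L (\<lambda>_. borel))"
    unfolding F_def
  proof (rule measurable_compose[OF _ H])
    show "(\<lambda>x. \<lambda>i\<in>?K. x (\<sigma> (fst i), snd i)) \<in> PiM ?L (\<lambda>_. borel) \<rightarrow>\<^sub>M PiM ?K (\<lambda>_. borel)"
      by (rule measurable_restrict) (rule measurable_component_singleton, rule KL)
  qed
  have Feq: "F (\<lambda>i\<in>?L. z (fst i) (snd i)) = h (\<lambda>p\<in>J. semipath_of (snd p) (z (\<sigma> p)))"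
    if z: "\<forall>p\<in>D. continuous_on {snd p..} (z p)" for z
  proof -
    have "(\<lambda>i\<in>?K. (\<lambda>i\<in>?L. z (fst i) (snd i)) (\<sigma> (fst i), snd i)) = (\<lambda>i\<in>?K. z (\<sigma> (fst i)) (snd i))"
      by (rule restrict_ext) (simp only: restrict_apply KL if_True fst_conv snd_conv)
    moreover have "continuous_on {snd p..} (z (\<sigma> p))" if "p \<in> J" for p
      by (rule continuous_on_subset[OF z[rule_format, OF \<sigma>(1)[OF that]]]) (use \<sigma>(2)[OF that] in auto)
    ultimately show ?thesis unfolding F_def using Heq[rule_format, of "\<lambda>p. z (\<sigma> p)"] by simp
  qed
  have mN: "(\<lambda>\<omega>. W (fst i) \<omega> (snd i)) \<in> borel_measurable N" if "i \<in> ?L" for i by (rule measurable_random_path[OF W that])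
  have mO: "(\<lambda>\<omega>. web D'' r (fst i) \<omega> (snd i)) \<in> borel_measurable \<Omega>" if "i \<in> ?L" for i
  proof (rule measurable_web[OF r(1)])
    show "fst i \<in> D''" "snd (fst i) \<le> snd i" using that r(2) by auto
  qed
  have eqO: "F (\<lambda>i\<in>?L. web D'' r (fst i) \<omega> (snd i)) = h (\<lambda>p\<in>J. semipath_of (snd p) (web D'' r (\<sigma> p) \<omega>))" for \<omega>
    by (rule Feq[of "\<lambda>p. web D'' r p \<omega>"]) (use web_continuous[OF r(1)] r(2) in blast)
  show "(\<lambda>\<omega>. h (\<lambda>p\<in>J. semipath_of (snd p) (web D'' r (\<sigma> p) \<omega>))) \<in> borel_measurable \<Omega>"
    unfolding eqO[symmetric] by (rule measurable_compose[OF measurable_law_map mF]) (rule mO)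
  show "\<exists>F\<in>borel_measurable N. (AE \<omega> in N. F \<omega> = h (\<lambda>p\<in>J. semipath_of (snd p) (W (\<sigma> p) \<omega>))) \<and>
      (\<integral>\<omega>. F \<omega> \<partial>N) = (\<integral>\<omega>. h (\<lambda>p\<in>J. semipath_of (snd p) (web D'' r (\<sigma> p) \<omega>)) \<partial>\<Omega>)"
  proof (intro bexI[of _ "\<lambda>\<omega>. F (\<lambda>i\<in>?L. W (fst i) \<omega> (snd i))"] conjI)
    show "(\<lambda>\<omega>. F (\<lambda>i\<in>?L. W (fst i) \<omega> (snd i))) \<in> borel_measurable N"
      by (rule measurable_compose[OF measurable_law_map mF]) (rule mN)
    show "AE \<omega> in N. F (\<lambda>i\<in>?L. W (fst i) \<omega> (snd i)) = h (\<lambda>p\<in>J. semipath_of (snd p) (W (\<sigma> p) \<omega>))"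
      using coalescing_AE_continuous[OF W D]
    proof eventually_elim
      case (elim \<omega>)
      show ?case by (rule Feq[of "\<lambda>p. W p \<omega>"]) (use elim in blast)
    qed
    have "(\<integral>\<omega>. F (\<lambda>i\<in>?L. W (fst i) \<omega> (snd i)) \<partial>N) = (\<integral>\<omega>. F (\<lambda>i\<in>?L. web D'' r (fst i) \<omega> (snd i)) \<partial>\<Omega>)"
      by (rule law_integral[OF coalescing_law[OF N W r] mN mO mF])
    then show "(\<integral>\<omega>. F (\<lambda>i\<in>?L. W (fst i) \<omega> (snd i)) \<partial>N) = (\<integral>\<omega>. h (\<lambda>p\<in>J. semipath_of (snd p) (web D'' r (\<sigma> p) \<omega>)) \<partial>\<Omega>)"
      unfolding eqO .
  qed
qed

end

lemma unit_integral_tendsto: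
  fixes f :: "nat \<Rightarrow> 'a \<Rightarrow> real"
  assumes "prob_space M" "\<And>n. f n \<in> borel_measurable M" "f' \<in> borel_measurable M"
    and "\<And>n. AE \<omega> in M. 0 \<le> f n \<omega> \<and> f n \<omega> \<le> 1" "AE \<omega> in M. (\<lambda>n. f n \<omega>) \<longlonglongrightarrow> f' \<omega>"
  shows "(\<lambda>n. \<integral>\<omega>. f n \<omega> \<partial>M) \<longlonglongrightarrow> (\<integral>\<omega>. f' \<omega> \<partial>M)"
proof (rule integral_dominated_convergence[where w = "\<lambda>_. 1"])
  interpret prob_space M by fact
  show "integrable M (\<lambda>_. 1 :: real)" by simp
  show "AE \<omega> in M. norm (f n \<omega>) \<le> 1" for n using assms(4)[of n] by eventually_elim simp
qed (fact assms)+

definition compatible :: "(real \<times> real) set \<Rightarrow> path_compact \<Rightarrow> (real \<times> real \<Rightarrow> semipath) \<Rightarrow> bool" where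
  "compatible D K u \<longleftrightarrow> noncrossing (paths_of K) \<and> (\<forall>p\<in>D. \<exists>f\<in>paths_of K. semipath_from (snd p) f = u p)"

theorem integral_upper_bound:
  fixes M :: "nat \<Rightarrow> 'a measure" and X :: "nat \<Rightarrow> 'a \<Rightarrow> path_compact"
    and D D' :: "(real \<times> real) set" and \<theta> :: "nat \<Rightarrow> real \<times> real \<Rightarrow> 'a \<Rightarrow> full_path"
    and N :: "'b measure" and W :: "real \<times> real \<Rightarrow> 'b \<Rightarrow> real \<Rightarrow> real"
    and P :: "'c measure" and Y :: "'c \<Rightarrow> path_compact"
  assumes M: "\<And>m. prob_space (M m)" and X: "\<And>m. X m \<in> borel_measurable (M m)"
    and nc: "\<And>m. AE \<omega> in M m. noncrossing (paths_of (X m \<omega>))"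
    and D: "countable D" "closure D = UNIV"
    and \<theta>: "\<And>m p. p \<in> D \<Longrightarrow> AE \<omega> in M m. \<theta> m p \<omega> \<in> paths_of (X m \<omega>)"
    and N: "prob_space N" "coalescing_brownian_motions N D W"
    and conv: "converges_in_distribution (semipath_product D)
           M (\<lambda>m \<omega>. \<lambda>p\<in>D. semipath_from (snd p) (\<theta> m p \<omega>))
           N (\<lambda>\<omega>. \<lambda>p\<in>D. semipath_of (snd p) (W p \<omega>))"
    and P: "prob_space P" "Y \<in> borel_measurable P" and D': "countable D'" "D' \<noteq> {}"
    and W': "coalescing_brownian_motions P D' W'"
    and Y: "AE \<omega> in P. coalescing_family D' (\<lambda>p. W' p \<omega>) \<and> compatible D' (Y \<omega>) (\<lambda>p. semipath_of (snd p) (W' p \<omega>))"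
    and g: "continuous_on UNIV g" "\<And>K. 0 \<le> g K" "\<And>K. g K \<le> (1 :: real)" and e: "0 < e"
  shows "\<forall>\<^sub>F m in sequentially. (\<integral>\<omega>. g (X m \<omega>) \<partial>M m) < (\<integral>\<omega>. g (Y \<omega>) \<partial>P) + e"
proof -
  obtain M1 :: "(real \<times> real \<Rightarrow> real \<Rightarrow> real) measure" and p0 B where "brownian_source M1 p0 B"
    using coalescing_source[OF W' D'(2)] .
  then interpret brownian_source M1 p0 B .
  interpret P: prob_space P by (fact P(1))
  define D'' where "D'' = D \<union> D'"
  have sub: "D \<subseteq> D''" "D' \<subseteq> D''" by (auto simp: D''_def)
  have "countable D''" using D(1) D'(1) by (simp add: D''_def)
  then obtain r :: "real \<times> real \<Rightarrow> nat" where r: "inj_on r D''" unfolding countable_def by blast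
  have "metrizable_space (semipath_product D')"
  proof (rule metrizable_topology_D)
    show "countable {i \<in> D'. \<nexists>a. topspace (euclidean :: semipath topology) \<subseteq> {a}}"
      by (rule countable_subset[OF _ D'(1)]) blast
    show "topspace (semipath_product D') \<noteq> {}" by (simp add: PiE_eq_empty_iff)
  qed (rule metrizable_space_euclidean)
  then obtain S d where "Metric_space S d" and T: "semipath_product D' = Metric_space.mtopology S d"
    unfolding metrizable_space_def by blast
  then interpret S: Metric_space S d by simp
  have S: "S = topspace (semipath_product D')" unfolding T by simp
  have inS: "u \<in> S" if "u \<in> extensional D'" for u using that by (simp add: S PiE_def)
  obtain h :: "nat \<Rightarrow> (real \<times> real \<Rightarrow> semipath) \<Rightarrow> real"
    where h: "\<forall>n. continuous_map (semipath_product D') euclideanreal (h n)" and h01: "\<forall>n u. 0 \<le> h n u \<and> h n u \<le> 1"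
    and maj: "\<forall>n K u. compatible D' K u \<longrightarrow> u \<in> S \<longrightarrow> g K \<le> h n u"
    and hlim: "\<forall>K0 u0. u0 \<in> S \<longrightarrow> compatible D' K0 u0 \<longrightarrow>
      (\<forall>K u. (\<forall>j. compatible D' (K j) (u j) \<and> u j \<in> S) \<longrightarrow> limitin (semipath_product D') u u0 sequentially \<longrightarrow> (\<lambda>j. g (K j)) \<longlonglongrightarrow> g K0) \<longrightarrow>
      (\<lambda>n. h n u0) \<longlonglongrightarrow> g K0"
    using S.lipschitz_majorant[of g "compatible D'", OF g(2,3)] unfolding T[symmetric] by (elim exE conjE)
  have hn: "continuous_map (semipath_product D') euclideanreal (h n)" for n using h by blast
  define V' where "V' \<omega> = (\<lambda>p\<in>D'. semipath_of (snd p) (W' p \<omega>))" for \<omega>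
  define U where "U \<sigma> \<omega> = (\<lambda>p\<in>D'. semipath_of (snd p) (web D'' r (\<sigma> p) \<omega>))" for \<sigma> \<omega>
  have h_conv: "AE \<omega> in P. (\<lambda>n. h n (V' \<omega>)) \<longlonglongrightarrow> g (Y \<omega>)"
    using Y
  proof eventually_elim
    case (elim \<omega>)
    then interpret coalescing_family D' "\<lambda>p. W' p \<omega>" by blast
    have comp: "compatible D' (Y \<omega>) (\<lambda>p. semipath_of (snd p) (W' p \<omega>))" using elim by blast
    show ?case
    proof (rule hlim[THEN spec, THEN spec, THEN mp, THEN mp, THEN mp], goal_cases)
      case 1
      show ?case by (rule inS) (simp add: V'_def)
    next
      case 2
      show ?case using comp by (simp add: compatible_def V'_def)
    next
      case 3
      show ?case
      proof (intro allI impI)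
        fix K u assume ku: "\<forall>j. compatible D' (K j) (u j) \<and> u j \<in> S" and lim: "limitin (semipath_product D') u (V' \<omega>) sequentially"
        have "K \<longlonglongrightarrow> Y \<omega>"
        proof (rule compatible_tendsto[where u = u])
          show "noncrossing (paths_of (Y \<omega>))" using comp by (simp add: compatible_def)
          show "noncrossing (paths_of (K n))" for n using ku by (simp add: compatible_def)
          show "\<exists>f\<in>paths_of (Y \<omega>). semipath_from (snd p) f = semipath_of (snd p) (W' p \<omega>)" if "p \<in> D'" for p
            using comp that by (simp add: compatible_def)
          show "\<exists>f\<in>paths_of (K n). semipath_from (snd p) f = u n p" if "p \<in> D'" for n p
            using ku that by (simp add: compatible_def)
          show "(\<lambda>n. u n p) \<longlonglongrightarrow> semipath_of (snd p) (W' p \<omega>)" if "p \<in> D'" for p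
            using lim that unfolding limitin_componentwise by (auto simp: V'_def)
        qed
        moreover have "isCont g (Y \<omega>)" using g(1) by (simp add: continuous_on_eq_continuous_at)
        ultimately show "(\<lambda>j. g (K j)) \<longlonglongrightarrow> g (Y \<omega>)" by (rule isCont_tendsto_compose[rotated])
      qed
    qed
  qed
  have mg: "g \<in> borel_measurable borel" using g(1) by (rule borel_measurable_continuous_onI)
  have "\<forall>n. \<exists>F\<in>borel_measurable P. (AE \<omega> in P. F \<omega> = h n (V' \<omega>)) \<and> (\<integral>\<omega>. F \<omega> \<partial>P) = (\<integral>\<omega>. h n (U (\<lambda>p. p) \<omega>) \<partial>\<Omega>)"
    unfolding V'_def U_def by (rule allI, rule semipath_transfer(1)[OF P(1) W' D'(1) r sub(2) D'(1) _ _ hn]) auto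
  then obtain F where F: "\<And>n. F n \<in> borel_measurable P" "\<And>n. AE \<omega> in P. F n \<omega> = h n (V' \<omega>)"
    "\<And>n. (\<integral>\<omega>. F n \<omega> \<partial>P) = (\<integral>\<omega>. h n (U (\<lambda>p. p) \<omega>) \<partial>\<Omega>)" by metis
  have "(\<lambda>n. \<integral>\<omega>. F n \<omega> \<partial>P) \<longlonglongrightarrow> (\<integral>\<omega>. g (Y \<omega>) \<partial>P)"
  proof (rule unit_integral_tendsto[OF P(1) F(1)])
    show "(\<lambda>\<omega>. g (Y \<omega>)) \<in> borel_measurable P" by (rule measurable_compose[OF P(2) mg])
    show "AE \<omega> in P. 0 \<le> F n \<omega> \<and> F n \<omega> \<le> 1" for n using F(2)[of n] by eventually_elim (simp add: h01)
    have "AE \<omega> in P. \<forall>n. F n \<omega> = h n (V' \<omega>)" unfolding AE_all_countable using F(2) by blast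
    with h_conv show "AE \<omega> in P. (\<lambda>n. F n \<omega>) \<longlonglongrightarrow> g (Y \<omega>)" by eventually_elim simp
  qed
  then have "\<forall>\<^sub>F n in sequentially. (\<integral>\<omega>. h n (U (\<lambda>p. p) \<omega>) \<partial>\<Omega>) < (\<integral>\<omega>. g (Y \<omega>) \<partial>P) + e / 3"
    unfolding F(3) using e by (intro order_tendstoD) auto
  then obtain n where n: "(\<integral>\<omega>. h n (U (\<lambda>p. p) \<omega>) \<partial>\<Omega>) < (\<integral>\<omega>. g (Y \<omega>) \<partial>P) + e / 3"
    unfolding eventually_sequentially by blast
  obtain ap where ap: "\<forall>j. \<forall>q\<in>D'. ap j q \<in> D \<and> snd (ap j q) \<le> snd q"
    and ap_lim: "AE \<omega> in \<Omega>. \<forall>q\<in>D'. (\<lambda>j. semipath_of (snd q) (web D'' r (ap j q) \<omega>)) \<longlonglongrightarrow> semipath_of (snd q) (web D'' r q \<omega>)"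
    using approximants[OF D(2) D'(1) sub r] by blast
  have apD: "ap j q \<in> D" "snd (ap j q) \<le> snd q" if "q \<in> D'" for j q using ap that by blast+
  have "(\<lambda>j. \<integral>\<omega>. h n (U (ap j) \<omega>) \<partial>\<Omega>) \<longlonglongrightarrow> (\<integral>\<omega>. h n (U (\<lambda>p. p) \<omega>) \<partial>\<Omega>)"
  proof (rule unit_integral_tendsto[OF \<Omega>.prob_space_axioms])
    show "(\<lambda>\<omega>. h n (U (ap j) \<omega>)) \<in> borel_measurable \<Omega>" for j
      unfolding U_def by (rule semipath_transfer(2)[OF N D(1) r sub(1) D'(1) apD hn])
    show "(\<lambda>\<omega>. h n (U (\<lambda>p. p) \<omega>)) \<in> borel_measurable \<Omega>"
      unfolding U_def by (rule semipath_transfer(2)[OF P(1) W' D'(1) r sub(2) D'(1) _ _ hn]) auto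
    show "AE \<omega> in \<Omega>. 0 \<le> h n (U (ap j) \<omega>) \<and> h n (U (ap j) \<omega>) \<le> 1" for j by (simp add: h01)
    show "AE \<omega> in \<Omega>. (\<lambda>j. h n (U (ap j) \<omega>)) \<longlonglongrightarrow> h n (U (\<lambda>p. p) \<omega>)"
      using ap_lim
    proof eventually_elim
      case (elim \<omega>)
      have "limitin (semipath_product D') (\<lambda>j. U (ap j) \<omega>) (U (\<lambda>p. p) \<omega>) sequentially"
        unfolding limitin_componentwise U_def using elim by simp
      from continuous_map_limit[OF hn this] show ?case by (simp add: o_def)
    qed
  qed
  then have "\<forall>\<^sub>F j in sequentially. (\<integral>\<omega>. h n (U (ap j) \<omega>) \<partial>\<Omega>) < (\<integral>\<omega>. g (Y \<omega>) \<partial>P) + e / 3 + e / 3"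
    using n e by (intro order_tendstoD) auto
  then obtain j where j: "(\<integral>\<omega>. h n (U (ap j) \<omega>) \<partial>\<Omega>) < (\<integral>\<omega>. g (Y \<omega>) \<partial>P) + e / 3 + e / 3"
    unfolding eventually_sequentially by blast
  define R where "R v = (\<lambda>q\<in>D'. semipath_restrict (snd q) (v (ap j q)))" for v
  have R: "continuous_map (semipath_product D) (semipath_product D') R"
    unfolding continuous_map_componentwise
  proof (intro conjI ballI)
    fix q assume q: "q \<in> D'"
    have "continuous_map (semipath_product D) euclidean (\<lambda>v. v (ap j q))"
      by (rule continuous_map_product_projection[OF apD(1)[OF q]])
    from continuous_map_compose[OF this, of euclidean "semipath_restrict (snd q)"]
    show "continuous_map (semipath_product D) euclidean (\<lambda>v. R v q)"
      using q continuous_semipath_restrict by (simp add: R_def o_def)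
  qed (auto simp: R_def)
  have hR: "continuous_map (semipath_product D) euclideanreal (\<lambda>v. h n (R v))"
    using continuous_map_compose[OF R hn] by (simp add: o_def)
  define V where "V m \<omega> = (\<lambda>p\<in>D. semipath_from (snd p) (\<theta> m p \<omega>))" for m \<omega>
  define VN where "VN \<omega> = (\<lambda>p\<in>D. semipath_of (snd p) (W p \<omega>))" for \<omega>
  have bd: "bounded ((\<lambda>v. h n (R v)) ` topspace (semipath_product D))"
    unfolding bounded_iff using h01 by (intro exI[of _ 1]) auto
  have mV: "V m \<in> M m \<rightarrow>\<^sub>M borel_of (semipath_product D)" and mVN: "VN \<in> N \<rightarrow>\<^sub>M borel_of (semipath_product D)"
    and lim: "(\<lambda>m. \<integral>\<omega>. h n (R (V m \<omega>)) \<partial>M m) \<longlonglongrightarrow> (\<integral>\<omega>. h n (R (VN \<omega>)) \<partial>N)" for m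
    using conv hR bd unfolding converges_in_distribution_def V_def[abs_def] VN_def[abs_def] by blast+
  obtain G where G: "G \<in> borel_measurable N" "AE \<omega> in N. G \<omega> = h n (\<lambda>p\<in>D'. semipath_of (snd p) (W (ap j p) \<omega>))"
    "(\<integral>\<omega>. G \<omega> \<partial>N) = (\<integral>\<omega>. h n (U (ap j) \<omega>) \<partial>\<Omega>)"
    using semipath_transfer(1)[OF N D(1) r sub(1) D'(1) apD[of _ j] hn[of n]] unfolding U_def by blast
  have "(\<integral>\<omega>. h n (R (VN \<omega>)) \<partial>N) = (\<integral>\<omega>. G \<omega> \<partial>N)"
  proof (rule integral_cong_AE[OF _ G(1)])
    show "(\<lambda>\<omega>. h n (R (VN \<omega>))) \<in> borel_measurable N"
      by (rule measurable_compose[OF mVN continuous_map_measurable[OF hR]])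
    show "AE \<omega> in N. h n (R (VN \<omega>)) = G \<omega>"
      using G(2) coalescing_AE_continuous[OF N(2) D(1)]
    proof eventually_elim
      case (elim \<omega>)
      have "R (VN \<omega>) = (\<lambda>p\<in>D'. semipath_of (snd p) (W (ap j p) \<omega>))"
        unfolding R_def
      proof (rule restrict_ext)
        fix q assume q: "q \<in> D'"
        have "continuous_on {snd (ap j q)..} (W (ap j q) \<omega>)" using elim(2) apD(1)[OF q] by blast
        then show "semipath_restrict (snd q) (VN \<omega> (ap j q)) = semipath_of (snd q) (W (ap j q) \<omega>)"
          using semipath_restrict_of[OF apD(2)[OF q]] apD(1)[OF q] by (simp add: VN_def)
      qed
      then show ?case using elim(1) by simp
    qed
  qed
  then have "(\<integral>\<omega>. h n (R (VN \<omega>)) \<partial>N) < (\<integral>\<omega>. g (Y \<omega>) \<partial>P) + e" using G(3) j e by simp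
  then have "\<forall>\<^sub>F m in sequentially. (\<integral>\<omega>. h n (R (V m \<omega>)) \<partial>M m) < (\<integral>\<omega>. g (Y \<omega>) \<partial>P) + e"
    by (rule order_tendstoD(2)[OF lim])
  then show ?thesis
  proof eventually_elim
    case (elim m)
    interpret Mm: prob_space "M m" by (rule M)
    have "(\<integral>\<omega>. g (X m \<omega>) \<partial>M m) \<le> (\<integral>\<omega>. h n (R (V m \<omega>)) \<partial>M m)"
    proof (rule integral_mono_AE)
      show "integrable (M m) (\<lambda>\<omega>. g (X m \<omega>))"
        by (rule Mm.integrable_const_bound[where B = 1]) (use g in \<open>auto intro: measurable_compose[OF X mg]\<close>)
      show "integrable (M m) (\<lambda>\<omega>. h n (R (V m \<omega>)))"
        by (rule Mm.integrable_const_bound[where B = 1])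
          (use h01 in \<open>auto intro: measurable_compose[OF mV continuous_map_measurable[OF hR]]\<close>)
      have "AE \<omega> in M m. \<forall>p\<in>D. \<theta> m p \<omega> \<in> paths_of (X m \<omega>)"
        unfolding AE_ball_countable[OF D(1)] using \<theta> by blast
      with nc[of m] show "AE \<omega> in M m. g (X m \<omega>) \<le> h n (R (V m \<omega>))"
      proof eventually_elim
        case (elim \<omega>)
        have "R (V m \<omega>) q = semipath_from (snd q) (\<theta> m (ap j q) \<omega>)" if q: "q \<in> D'" for q
          using q apD[OF q] semipath_restrict_from[OF apD(2)[OF q]] by (simp add: R_def V_def)
        then have "compatible D' (X m \<omega>) (R (V m \<omega>))"
          unfolding compatible_def using elim apD(1) by (intro conjI ballI) auto
        then show ?case using maj inS[of "R (V m \<omega>)"] by (simp add: R_def)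
      qed
    qed
    with elim show ?case by simp
  qed
qed

section \<open>The skeleton of the full Brownian web\<close>

lemma noncrossing_closure:
  assumes S: "noncrossing S"
  shows "noncrossing (closure S)"
  unfolding noncrossing_def
proof (intro ballI notI)
  fix f g assume fg: "f \<in> closure S" "g \<in> closure S" and "paths_cross UNIV (path_at f) (path_at g)"
  then obtain s t where st: "tv g s < tv f s" "tv f t < tv g t" unfolding paths_cross_tv by blast
  have near: "\<exists>d>0. \<forall>f'. dist f' f < d \<longrightarrow> \<bar>tv f' u - tv f u\<bar> < e" if "0 < e" for e u f
  proof (intro exI[of _ "e / (1 + \<bar>u\<bar>)"] conjI allI impI)
    show "0 < e / (1 + \<bar>u\<bar>)" using that by (simp add: add_pos_nonneg)
    fix f' assume "dist f' f < e / (1 + \<bar>u\<bar>)"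
    then have "(1 + \<bar>u\<bar>) * dist f' f < e" by (simp add: pos_less_divide_eq add_pos_nonneg mult.commute)
    then show "\<bar>tv f' u - tv f u\<bar> < e" using tv_dist[of f' u f] by linarith
  qed
  define e where "e = min (tv f s - tv g s) (tv g t - tv f t) / 2"
  have e: "0 < e" using st by (simp add: e_def)
  have approx: "\<exists>f'\<in>S. \<bar>tv f' s - tv f s\<bar> < e \<and> \<bar>tv f' t - tv f t\<bar> < e" if f: "f \<in> closure S" for f
  proof -
    obtain d1 where d1: "d1 > 0" "\<forall>f'. dist f' f < d1 \<longrightarrow> \<bar>tv f' s - tv f s\<bar> < e" using near[OF e] by blast
    obtain d2 where d2: "d2 > 0" "\<forall>f'. dist f' f < d2 \<longrightarrow> \<bar>tv f' t - tv f t\<bar> < e" using near[OF e] by blast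
    obtain f' where "f' \<in> S" "dist f' f < min d1 d2"
      using f d1(1) d2(1) unfolding closure_approachable by (meson min_less_iff_conj)
    then show ?thesis using d1(2) d2(2) by auto
  qed
  obtain f' where f': "f' \<in> S" "\<bar>tv f' s - tv f s\<bar> < e" "\<bar>tv f' t - tv f t\<bar> < e" using approx[OF fg(1)] by blast
  obtain g' where g': "g' \<in> S" "\<bar>tv g' s - tv g s\<bar> < e" "\<bar>tv g' t - tv g t\<bar> < e" using approx[OF fg(2)] by blast
  have "2 * e \<le> tv f s - tv g s" "2 * e \<le> tv g t - tv f t" by (simp_all add: e_def)
  then have "tv g' s < tv f' s" "tv f' t < tv g' t" using f'(2,3) g'(2,3) by linarith+
  then have "paths_cross UNIV (path_at f') (path_at g')" unfolding paths_cross_tv by blast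
  then show False using S f'(1) g'(1) unfolding noncrossing_def by blast
qed

lemma IVT_crossing:
  fixes f g :: "real \<Rightarrow> real"
  assumes "continuous_on {u..v} f" "continuous_on {u..v} g" "u \<le> v" "(f u \<le> g u \<and> g v \<le> f v) \<or> (g u \<le> f u \<and> f v \<le> g v)"
  shows "\<exists>s\<in>{u..v}. f s = g s"
proof -
  have c: "connected ((\<lambda>s. f s - g s) ` {u..v})"
    by (intro connected_continuous_image continuous_intros assms) auto
  have m: "f u - g u \<in> (\<lambda>s. f s - g s) ` {u..v}" "f v - g v \<in> (\<lambda>s. f s - g s) ` {u..v}" using assms(3) by auto
  have "0 \<in> (\<lambda>s. f s - g s) ` {u..v}"
    using assms(4) connectedD_interval[OF c m, of 0] connectedD_interval[OF c m(2,1), of 0] by auto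
  then show ?thesis by auto
qed

abbreviation concat_paths :: "real \<Rightarrow> (real \<Rightarrow> real) \<Rightarrow> (real \<Rightarrow> real) \<Rightarrow> real \<Rightarrow> real" where
  "concat_paths a v w \<equiv> \<lambda>t. if t \<le> a then v t else w t"

lemma continuous_concat:
  assumes "continuous_on {..a} v" "continuous_on {a..} w" "v a = w a"
  shows "continuous_on UNIV (concat_paths a v w)"
proof -
  have "continuous_on ({..a} \<union> {a..}) (concat_paths a v w)"
    by (rule continuous_on_If) (use assms in auto)
  moreover have "{..a} \<union> {a..} = UNIV" by auto
  ultimately show ?thesis by simp
qed

text \<open>Between the starting times a forward path is compared with a backward path; outside, paths
  of the same kind are compared, which can change their order only by meeting, after which they coincide.\<close>

lemma concat_le:
  fixes w1 w2 v1 v2 :: "real \<Rightarrow> real"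
  assumes ab: "a \<le> b"
    and c: "continuous_on {a..} w1" "continuous_on {b..} w2" "continuous_on {..a} v1" "continuous_on {..b} v2"
    and fwd: "\<And>u t. b \<le> u \<Longrightarrow> u \<le> t \<Longrightarrow> w1 u = w2 u \<Longrightarrow> w1 t = w2 t"
    and bwd: "\<And>u t. u \<le> a \<Longrightarrow> t \<le> u \<Longrightarrow> v1 u = v2 u \<Longrightarrow> v1 t = v2 t"
    and nc: "\<not> paths_cross {a..b} w1 v2"
    and join: "w1 a = v1 a" "w2 b = v2 b" "w1 a \<noteq> v2 a"
    and less: "w1 b < w2 b"
  shows "concat_paths a v1 w1 t \<le> concat_paths b v2 w2 t"
proof -
  have mid: "w1 s \<le> v2 s" if "a \<le> s" "s \<le> b" for s
  proof (rule ccontr)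
    assume "\<not> w1 s \<le> v2 s"
    then have "v2 s < w1 s" by simp
    moreover have "w1 b < v2 b" using less join by simp
    ultimately show False using nc that ab unfolding paths_cross_def by (meson atLeastAtMost_iff order_refl)
  qed
  consider "t \<le> a" | "a < t" "t \<le> b" | "b < t" by linarith
  then show ?thesis
  proof cases
    case 1
    have "v1 t \<le> v2 t"
    proof (rule ccontr)
      assume n: "\<not> v1 t \<le> v2 t"
      have "\<exists>s\<in>{t..a}. v1 s = v2 s"
      proof (rule IVT_crossing)
        show "continuous_on {t..a} v1" "continuous_on {t..a} v2"
          using ab by (auto intro: continuous_on_subset[OF c(3)] continuous_on_subset[OF c(4)])
        show "(v1 t \<le> v2 t \<and> v2 a \<le> v1 a) \<or> (v2 t \<le> v1 t \<and> v1 a \<le> v2 a)"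
          using n mid[OF order_refl ab] join by simp
      qed fact
      then show False using bwd[of _ t] n by auto
    qed
    then show ?thesis using 1 ab by simp
  next
    case 2
    then show ?thesis using mid[of t] by simp
  next
    case 3
    have "w1 t \<le> w2 t"
    proof (rule ccontr)
      assume n: "\<not> w1 t \<le> w2 t"
      have "\<exists>s\<in>{b..t}. w1 s = w2 s"
      proof (rule IVT_crossing)
        show "continuous_on {b..t} w1" "continuous_on {b..t} w2"
          using ab by (auto intro: continuous_on_subset[OF c(1)] continuous_on_subset[OF c(2)])
        show "(w1 b \<le> w2 b \<and> w2 t \<le> w1 t) \<or> (w2 b \<le> w1 b \<and> w1 t \<le> w2 t)"
          using n less by simp
      qed (use 3 in simp)
      then show False using fwd[of _ t] n by auto
    qed
    then show ?thesis using 3 ab by simp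
  qed
qed

lemma concat_comparable:
  fixes w1 w2 v1 v2 :: "real \<Rightarrow> real"
  assumes ab: "a \<le> b"
    and c: "continuous_on {a..} w1" "continuous_on {b..} w2" "continuous_on {..a} v1" "continuous_on {..b} v2"
    and fwd: "\<And>u t. b \<le> u \<Longrightarrow> u \<le> t \<Longrightarrow> w1 u = w2 u \<Longrightarrow> w1 t = w2 t"
    and bwd: "\<And>u t. u \<le> a \<Longrightarrow> t \<le> u \<Longrightarrow> v1 u = v2 u \<Longrightarrow> v1 t = v2 t"
    and nc: "\<not> paths_cross {a..b} w1 v2"
    and join: "w1 a = v1 a" "w2 b = v2 b" "w1 a \<noteq> v2 a" "w1 b \<noteq> w2 b"
  shows "(\<forall>t. concat_paths a v1 w1 t \<le> concat_paths b v2 w2 t) \<or> (\<forall>t. concat_paths b v2 w2 t \<le> concat_paths a v1 w1 t)"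
proof (cases "w1 b < w2 b")
  case True
  have "concat_paths a v1 w1 t \<le> concat_paths b v2 w2 t" for t
    by (rule concat_le[OF ab c _ _ nc join(1-3) True]) (fact fwd bwd)+
  then show ?thesis by blast
next
  case False
  have "concat_paths a (\<lambda>t. - v1 t) (\<lambda>t. - w1 t) t \<le> concat_paths b (\<lambda>t. - v2 t) (\<lambda>t. - w2 t) t" for t
  proof (rule concat_le[OF ab])
    show "\<not> paths_cross {a..b} (\<lambda>t. - w1 t) (\<lambda>t. - v2 t)" using nc unfolding paths_cross_def by auto
  qed (use c fwd bwd join False in \<open>auto intro!: continuous_on_minus\<close>)
  then have "concat_paths b v2 w2 t \<le> concat_paths a v1 w1 t" for t
    by (smt (verit))
  then show ?thesis by blast
qed

lemma dual_paths:
  fixes P :: "'c measure"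
  assumes P: "prob_space P" and Wb: "backward_coalescing_brownian_motions P D Wb" and D: "countable D" "D \<noteq> {}"
  shows "AE \<omega> in P. (\<forall>p\<in>D. Wb p \<omega> (snd p) = fst p \<and> continuous_on {..snd p} (Wb p \<omega>)) \<and>
    (\<forall>p\<in>D. \<forall>q\<in>D. \<forall>u t. u \<le> snd p \<longrightarrow> u \<le> snd q \<longrightarrow> Wb p \<omega> u = Wb q \<omega> u \<longrightarrow> t \<le> u \<longrightarrow> Wb p \<omega> t = Wb q \<omega> t) \<and>
    (\<forall>p\<in>D. \<forall>q\<in>D. snd q < snd p \<longrightarrow> Wb p \<omega> (snd q) \<noteq> fst q)"
proof -
  define \<rho> where "\<rho> = (\<lambda>(x :: real, t :: real). (x, - t))"
  define V where "V = (\<lambda>(x, t) \<omega> u. Wb (x, - t) \<omega> (- u))"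
  have V: "coalescing_brownian_motions P (\<rho> ` D) V"
    using Wb unfolding backward_coalescing_brownian_motions_def \<rho>_def V_def .
  have \<rho>: "snd (\<rho> p) = - snd p" "fst (\<rho> p) = fst p" "V (\<rho> p) \<omega> u = Wb p \<omega> (- u)" for p \<omega> u
    by (simp_all add: \<rho>_def V_def case_prod_beta)
  obtain M1 :: "(real \<times> real \<Rightarrow> real \<Rightarrow> real) measure" and p0 B where "brownian_source M1 p0 B"
    using coalescing_source[OF V] D(2) by blast
  then interpret brownian_source M1 p0 B .
  have cD: "countable (\<rho> ` D)" using D(1) by simp
  have "AE \<omega> in P. V (\<rho> p) \<omega> (- snd q) \<noteq> fst q" if "p \<in> D" "snd q < snd p" for p q
    using that by (intro coalescing_AE_avoid[OF P V cD]) (auto simp: \<rho>)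
  then have "AE \<omega> in P. \<forall>p\<in>D. \<forall>q\<in>D. snd q < snd p \<longrightarrow> V (\<rho> p) \<omega> (- snd q) \<noteq> fst q"
    by (subst AE_ball_countable[OF D(1)], intro ballI, subst AE_ball_countable[OF D(1)]) auto
  with coalescing_AE_continuous[OF V cD] coalescing_AE_meet[OF P V cD] show ?thesis
  proof eventually_elim
    case (elim \<omega>)
    have 1: "Wb p \<omega> (snd p) = fst p \<and> continuous_on {..snd p} (Wb p \<omega>)" if p: "p \<in> D" for p
    proof
      have e: "V (\<rho> p) \<omega> (snd (\<rho> p)) = fst (\<rho> p)" "continuous_on {snd (\<rho> p)..} (V (\<rho> p) \<omega>)" using elim(1) p by blast+
      show "Wb p \<omega> (snd p) = fst p" using e(1) by (simp add: \<rho>)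
      have "continuous_on {..snd p} (\<lambda>t. V (\<rho> p) \<omega> (- t))"
        by (rule continuous_on_compose2[OF e(2)]) (auto intro!: continuous_intros simp: \<rho>)
      then show "continuous_on {..snd p} (Wb p \<omega>)" by (simp add: \<rho>)
    qed
    have 2: "Wb p \<omega> t = Wb q \<omega> t" if p: "p \<in> D" "q \<in> D" and u: "u \<le> snd p" "u \<le> snd q" "Wb p \<omega> u = Wb q \<omega> u" "t \<le> u" for p q u t
    proof -
      have "V (\<rho> p) \<omega> (- t) = V (\<rho> q) \<omega> (- t)"
        using elim(2)[THEN bspec, OF imageI[OF p(1)], THEN bspec, OF imageI[OF p(2)], THEN spec, THEN spec, of "- u" "- t"] u by (simp add: \<rho>)
      then show ?thesis by (simp add: \<rho>)
    qed
    have 3: "Wb p \<omega> (snd q) \<noteq> fst q" if "p \<in> D" "q \<in> D" "snd q < snd p" for p q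
      using elim(3) that by (simp add: \<rho>)
    have "\<forall>p\<in>D. Wb p \<omega> (snd p) = fst p \<and> continuous_on {..snd p} (Wb p \<omega>)" by (rule ballI) (rule 1)
    moreover have "\<forall>p\<in>D. \<forall>q\<in>D. \<forall>u t. u \<le> snd p \<longrightarrow> u \<le> snd q \<longrightarrow> Wb p \<omega> u = Wb q \<omega> u \<longrightarrow> t \<le> u \<longrightarrow> Wb p \<omega> t = Wb q \<omega> t"
      by (intro ballI allI impI) (rule 2)
    moreover have "\<forall>p\<in>D. \<forall>q\<in>D. snd q < snd p \<longrightarrow> Wb p \<omega> (snd q) \<noteq> fst q"
      by (intro ballI impI) (rule 3)
    ultimately show ?case by (intro conjI)
  qed
qed

theorem skeleton_compatible:
  fixes P :: "'c measure"
  assumes P: "prob_space P" and D: "countable D" "closure D = UNIV" and skel: "double_web_skeleton P D W Wb"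
    and Y: "AE \<omega> in P. paths_of (Y \<omega>) = closure ((\<lambda>p. full_path_of (\<lambda>t. if t \<le> snd p then Wb p \<omega> t else W p \<omega> t)) ` D)"
  shows "AE \<omega> in P. coalescing_family D (\<lambda>p. W p \<omega>) \<and> compatible D (Y \<omega>) (\<lambda>p. semipath_of (snd p) (W p \<omega>))"
proof -
  have W: "coalescing_brownian_motions P D W" and Wb: "backward_coalescing_brownian_motions P D Wb"
    and nc: "AE \<omega> in P. \<forall>p\<in>D. \<forall>q\<in>D. \<not> paths_cross {snd p..snd q} (W p \<omega>) (Wb q \<omega>)"
    using skel unfolding double_web_skeleton_def by blast+
  have ne: "D \<noteq> {}" using D(2) by auto
  obtain M1 :: "(real \<times> real \<Rightarrow> real \<Rightarrow> real) measure" and p0 B where "brownian_source M1 p0 B"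
    using coalescing_source[OF W ne] .
  then interpret brownian_source M1 p0 B .
  have "AE \<omega> in P. W p \<omega> (snd q) \<noteq> fst q" if "p \<in> D" "snd p < snd q" for p q
    using coalescing_AE_avoid[OF P W D(1) that] .
  then have avoid: "AE \<omega> in P. \<forall>p\<in>D. \<forall>q\<in>D. snd p < snd q \<longrightarrow> W p \<omega> (snd q) \<noteq> fst q"
    by (subst AE_ball_countable[OF D(1)], intro ballI, subst AE_ball_countable[OF D(1)]) auto
  from coalescing_AE_continuous[OF W D(1)] coalescing_AE_meet[OF P W D(1)] avoid dual_paths[OF P Wb D(1) ne] nc Y
  show ?thesis
  proof eventually_elim
    case (elim \<omega>)
    have c: "W p \<omega> (snd p) = fst p" "continuous_on {snd p..} (W p \<omega>)" if "p \<in> D" for p using elim(1) that by blast+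
    have cb: "Wb p \<omega> (snd p) = fst p" "continuous_on {..snd p} (Wb p \<omega>)" if "p \<in> D" for p using elim(4) that by blast+
    have meet: "W p \<omega> t = W q \<omega> t" if "p \<in> D" "q \<in> D" "snd p \<le> u" "snd q \<le> u" "W p \<omega> u = W q \<omega> u" "u \<le> t" for p q u t
      using elim(2) that by blast
    have meetb: "Wb p \<omega> t = Wb q \<omega> t" if "p \<in> D" "q \<in> D" "u \<le> snd p" "u \<le> snd q" "Wb p \<omega> u = Wb q \<omega> u" "t \<le> u" for p q u t
      using elim(4) that by blast
    have avoid: "W p \<omega> (snd q) \<noteq> fst q" if "p \<in> D" "q \<in> D" "p \<noteq> q" "snd p \<le> snd q" for p q
    proof (cases "snd p = snd q")
      case True
      then have "fst p \<noteq> fst q" using that(3) by (simp add: prod_eq_iff)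
      then show ?thesis using c(1)[OF that(1)] True by simp
    next
      case False
      then show ?thesis using elim(3) that by (meson order_le_imp_less_or_eq)
    qed
    have avoidb: "Wb q \<omega> (snd p) \<noteq> fst p" if "p \<in> D" "q \<in> D" "p \<noteq> q" "snd p \<le> snd q" for p q
    proof (cases "snd p = snd q")
      case True
      then have "fst p \<noteq> fst q" using that(3) by (simp add: prod_eq_iff)
      then show ?thesis using cb(1)[OF that(2)] True by simp
    next
      case False
      then show ?thesis using elim(4) that by (meson order_le_imp_less_or_eq)
    qed
    have fam: "coalescing_family D (\<lambda>p. W p \<omega>)"
      by unfold_locales (fact D(2) | rule c meet avoid; assumption)+
    let ?F = "\<lambda>p t. if t \<le> snd p then Wb p \<omega> t else W p \<omega> t"
    have cF: "continuous_on UNIV (?F p)" if p: "p \<in> D" for p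
      by (rule continuous_concat) (use c[OF p] cb[OF p] in simp_all)
    have tvF: "tv (full_path_of (?F p)) t = tanh (?F p t)" if p: "p \<in> D" for p t
      unfolding tv_def path_at_full_path_of[OF cF[OF p]] by simp
    have comparable: "(\<forall>t. ?F p t \<le> ?F q t) \<or> (\<forall>t. ?F q t \<le> ?F p t)"
      if pq: "p \<in> D" "q \<in> D" "snd p \<le> snd q" for p q
    proof (cases "p = q")
      case False
      show ?thesis
      proof (rule concat_comparable[OF pq(3) c(2)[OF pq(1)] c(2)[OF pq(2)] cb(2)[OF pq(1)] cb(2)[OF pq(2)]])
        show "W p \<omega> t = W q \<omega> t" if "snd q \<le> u" "u \<le> t" "W p \<omega> u = W q \<omega> u" for u t
          by (rule meet[OF pq(1,2) _ that(1,3,2)]) (use pq(3) that(1) in simp)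
        show "Wb p \<omega> t = Wb q \<omega> t" if "u \<le> snd p" "t \<le> u" "Wb p \<omega> u = Wb q \<omega> u" for u t
          by (rule meetb[OF pq(1,2) that(1) _ that(3,2)]) (use pq(3) that(1) in simp)
        show "\<not> paths_cross {snd p..snd q} (W p \<omega>) (Wb q \<omega>)" using elim(5) pq by blast
        show "W p \<omega> (snd p) = Wb p \<omega> (snd p)" "W q \<omega> (snd q) = Wb q \<omega> (snd q)" using c(1) cb(1) pq by simp_all
        show "W p \<omega> (snd p) \<noteq> Wb q \<omega> (snd p)" using avoidb[OF pq(1,2) False pq(3)] c(1)[OF pq(1)] by simp
        show "W p \<omega> (snd q) \<noteq> W q \<omega> (snd q)" using avoid[OF pq(1,2) False pq(3)] c(1)[OF pq(2)] by simp
      qed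
    qed simp
    have "noncrossing ((\<lambda>p. full_path_of (?F p)) ` D)"
      unfolding noncrossing_def
    proof (intro ballI)
      fix f g assume "f \<in> (\<lambda>p. full_path_of (?F p)) ` D" "g \<in> (\<lambda>p. full_path_of (?F p)) ` D"
      then obtain p q where f: "f = full_path_of (?F p)" "p \<in> D" and g: "g = full_path_of (?F q)" "q \<in> D" by blast
      have "(\<forall>t. ?F p t \<le> ?F q t) \<or> (\<forall>t. ?F q t \<le> ?F p t)"
        using comparable[OF f(2) g(2)] comparable[OF g(2) f(2)] by (meson linear)
      then have "(\<forall>t. tv f t \<le> tv g t) \<or> (\<forall>t. tv g t \<le> tv f t)"
        unfolding f(1) g(1) tvF[OF f(2)] tvF[OF g(2)] tanh_real_le_iff .
      then show "\<not> paths_cross UNIV (path_at f) (path_at g)" unfolding paths_cross_tv by (meson not_less)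
    qed
    then have nc: "noncrossing (paths_of (Y \<omega>))" unfolding elim(6) by (rule noncrossing_closure)
    have "\<exists>f\<in>paths_of (Y \<omega>). semipath_from (snd p) f = semipath_of (snd p) (W p \<omega>)" if p: "p \<in> D" for p
    proof (rule bexI)
      show "semipath_from (snd p) (full_path_of (?F p)) = semipath_of (snd p) (W p \<omega>)"
        by (rule semipath_from_eq_of[OF c(2)[OF p]]) (use c(1)[OF p] cb(1)[OF p] in \<open>auto simp: tvF[OF p]\<close>)
      show "full_path_of (?F p) \<in> paths_of (Y \<omega>)"
        unfolding elim(6) by (rule subsetD[OF closure_subset imageI[OF p]])
    qed
    then show ?case using fam nc unfolding compatible_def by blast
  qed
qed

theorem theorem4p1:
  fixes M :: "nat \<Rightarrow> 'a measure" and X :: "nat \<Rightarrow> 'a \<Rightarrow> path_compact"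
    and D :: "(real \<times> real) set" and \<theta> :: "nat \<Rightarrow> real \<times> real \<Rightarrow> 'a \<Rightarrow> full_path"
    and N :: "'b measure" and W :: "real \<times> real \<Rightarrow> 'b \<Rightarrow> real \<Rightarrow> real"
    and P :: "'c measure" and Y :: "'c \<Rightarrow> path_compact"
  assumes "\<And>m. prob_space (M m)"
    and "\<And>m. X m \<in> borel_measurable (M m)"
    and a: "\<And>m. AE \<omega> in M m. noncrossing (paths_of (X m \<omega>))"
    and "countable D" and "closure D = UNIV"
    and b: "\<And>m p. p \<in> D \<Longrightarrow> AE \<omega> in M m. \<theta> m p \<omega> \<in> paths_of (X m \<omega>)"
    and "prob_space N" and "coalescing_brownian_motions N D W"
    and b': "converges_in_distribution (product_topology (\<lambda>_. euclidean) D)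
           M (\<lambda>m \<omega>. \<lambda>p\<in>D. semipath_from (snd p) (\<theta> m p \<omega>))
           N (\<lambda>\<omega>. \<lambda>p\<in>D. semipath_of (snd p) (W p \<omega>))"
    and "full_brownian_web P Y"
  shows "converges_in_distribution euclidean M X P Y"
proof -
  obtain D' W' Wb where P: "prob_space P" "Y \<in> borel_measurable P" and D': "countable D'" "closure D' = UNIV"
    and skel: "double_web_skeleton P D' W' Wb"
    and Y: "AE \<omega> in P. paths_of (Y \<omega>) = closure ((\<lambda>p. full_path_of (\<lambda>t. if t \<le> snd p then Wb p \<omega> t else W' p \<omega> t)) ` D')"
    using assms(10) unfolding full_brownian_web_def by blast
  have ne: "D' \<noteq> {}" using D'(2) by auto
  have W': "coalescing_brownian_motions P D' W'" using skel unfolding double_web_skeleton_def by blast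
  interpret P: prob_space P by (fact P(1))
  have upper: "\<forall>\<^sub>F m in sequentially. (\<integral>\<omega>. g (X m \<omega>) \<partial>M m) < (\<integral>\<omega>. g (Y \<omega>) \<partial>P) + e"
    if g: "continuous_on UNIV g" "\<And>K. 0 \<le> g K" "\<And>K. g K \<le> (1 :: real)" and "0 < e" for g e
    by (rule integral_upper_bound[where D = D and N = N and W = W and \<theta> = \<theta> and D' = D' and W' = W'])
      (fact assms P D' ne W' that skeleton_compatible[OF P(1) D' skel Y])+
  have int: "integrable (M m) (\<lambda>\<omega>. g (X m \<omega>))" "integrable P (\<lambda>\<omega>. g (Y \<omega>))"
    if g: "continuous_on UNIV g" "\<And>K. \<bar>g K\<bar> \<le> c" for g :: "path_compact \<Rightarrow> real" and c m
  proof -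
    interpret Mm: prob_space "M m" by (rule assms(1))
    note mg = borel_measurable_continuous_onI[OF g(1)]
    show "integrable (M m) (\<lambda>\<omega>. g (X m \<omega>))"
      by (rule Mm.integrable_const_bound[where B = c]) (use g(2) in \<open>auto intro: measurable_compose[OF assms(2) mg]\<close>)
    show "integrable P (\<lambda>\<omega>. g (Y \<omega>))"
      by (rule P.integrable_const_bound[where B = c]) (use g(2) in \<open>auto intro: measurable_compose[OF P(2) mg]\<close>)
  qed
  have unit: "(\<lambda>m. \<integral>\<omega>. g (X m \<omega>) \<partial>M m) \<longlonglongrightarrow> (\<integral>\<omega>. g (Y \<omega>) \<partial>P)"
    if g: "continuous_on UNIV g" "\<And>K. 0 \<le> g K" "\<And>K. g K \<le> (1 :: real)" for g
  proof (rule order_tendstoI)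
    have g': "\<bar>g K\<bar> \<le> 1" for K using g(2,3)[of K] by simp
    fix y
    {
      assume "(\<integral>\<omega>. g (Y \<omega>) \<partial>P) < y"
      then show "\<forall>\<^sub>F m in sequentially. (\<integral>\<omega>. g (X m \<omega>) \<partial>M m) < y"
        using upper[OF g, of "y - (\<integral>\<omega>. g (Y \<omega>) \<partial>P)"] by simp
    next
      assume y: "y < (\<integral>\<omega>. g (Y \<omega>) \<partial>P)"
      have "(\<integral>\<omega>. 1 - g (X m \<omega>) \<partial>M m) = 1 - (\<integral>\<omega>. g (X m \<omega>) \<partial>M m)" for m
      proof -
        interpret Mm: prob_space "M m" by (rule assms(1))
        show ?thesis using int(1)[OF g(1) g'] by (simp add: Mm.prob_space)
      qed
      moreover have "(\<integral>\<omega>. 1 - g (Y \<omega>) \<partial>P) = 1 - (\<integral>\<omega>. g (Y \<omega>) \<partial>P)"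
        using int(2)[OF g(1) g'] by (simp add: P.prob_space)
      moreover have "continuous_on UNIV (\<lambda>K. 1 - g K)" by (intro continuous_intros g(1))
      ultimately show "\<forall>\<^sub>F m in sequentially. y < (\<integral>\<omega>. g (X m \<omega>) \<partial>M m)"
        using upper[of "\<lambda>K. 1 - g K" "(\<integral>\<omega>. g (Y \<omega>) \<partial>P) - y"] g(2,3) y by simp
    }
  qed
  show ?thesis
    unfolding converges_in_distribution_def borel_of_euclidean
  proof (intro conjI allI impI assms(2) P(2))
    fix g assume "continuous_map euclidean euclideanreal g \<and> bounded (g ` topspace (euclidean :: path_compact topology))"
    then have g: "continuous_on UNIV g" and "bounded (range g)" by auto
    then obtain c where c: "0 < c" "\<And>K. \<bar>g K\<bar> \<le> c" unfolding bounded_pos by auto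
    have bd: "0 \<le> (g K + c) / (2 * c)" "(g K + c) / (2 * c) \<le> 1" for K
      using c(1) c(2)[of K] by (auto simp: abs_le_iff)
    have lim: "(\<lambda>m. \<integral>\<omega>. (g (X m \<omega>) + c) / (2 * c) \<partial>M m) \<longlonglongrightarrow> (\<integral>\<omega>. (g (Y \<omega>) + c) / (2 * c) \<partial>P)"
      by (rule unit[OF _ bd]) (use c(1) in \<open>intro continuous_intros g, simp\<close>)
    have eM: "(\<integral>\<omega>. (g (X m \<omega>) + c) / (2 * c) \<partial>M m) = ((\<integral>\<omega>. g (X m \<omega>) \<partial>M m) + c) / (2 * c)" for m
    proof -
      interpret Mm: prob_space "M m" by (rule assms(1))
      show ?thesis using int(1)[OF g c(2)] by (simp add: Mm.prob_space)
    qed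
    have eP: "(\<integral>\<omega>. (g (Y \<omega>) + c) / (2 * c) \<partial>P) = ((\<integral>\<omega>. g (Y \<omega>) \<partial>P) + c) / (2 * c)"
      using int(2)[OF g c(2)] by (simp add: P.prob_space)
    have "(\<lambda>m. ((\<integral>\<omega>. g (X m \<omega>) \<partial>M m) + c) / (2 * c) * (2 * c) - c) \<longlonglongrightarrow> ((\<integral>\<omega>. g (Y \<omega>) \<partial>P) + c) / (2 * c) * (2 * c) - c"
      using lim unfolding eM eP by (rule tendsto_diff[OF tendsto_mult_right tendsto_const])
    then show "(\<lambda>m. \<integral>\<omega>. g (X m \<omega>) \<partial>M m) \<longlonglongrightarrow> (\<integral>\<omega>. g (Y \<omega>) \<partial>P)" using c(1) by simp
  qed
qed

end
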